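(* Let $1\le q\le n-1$, $d\ge 0$, with $n\ge 3$ if $q=1$ and $n\ge 4$ if $q\ge 2$, and let $\mathcal C$ be an irreducible component of $\mathscr F_q(n,d)$. Suppose that the generic element $\mathcal G=[\omega]$ of $\mathcal C$ has split tangent sheaf, i.e. $T\mathcal G\cong\bigoplus_{j=1}^{n-q}\mathcal O_{\mathbb P^n}(e_j)$ for some integers $e_j$, and satisfies $\operatorname{codim}\operatorname{sing}(d\omega)\ge 3$ (if $q=1$) or $\operatorname{codim}\operatorname{sing}(\omega)\ge 3$ (if $q\ge 2$). Then for every integer $m\ge 1$ there exists an irreducible component of $\mathscr F_q(n+m,d)$ whose generic element is the pull-back, under a generic linear projection $\mathbb P^{n+m}\dashrightarrow\mathbb P^n$, of a generic element of $\mathcal C$.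
   Context: $\mathrm H^0(\mathbb P^n,\Omega^q_{\mathbb P^n}(d+q+1))$ is identified with the space of $q$-forms on $\mathbb C^{n+1}$ with homogeneous polynomial coefficients of degree $d+1$ annihilated by contraction with the radial vector field $R=\sum_{i=0}^n x_i\frac{\partial}{\partial x_i}$. The space of codimension $q$ foliations of degree $d$ on $\mathbb P^n$ is the quasi-projective variety $\mathscr F_q(n,d)\subset\mathbb P\mathrm H^0(\mathbb P^n,\Omega^q_{\mathbb P^n}(d+q+1))$ of classes $[\omega]$ with $(i_v\omega)\wedge\omega=0$ and $(i_v\omega)\wedge d\omega=0$ for all $v\in\bigwedge^{q-1}\mathbb C^{n+1}$ and $\operatorname{codim}\operatorname{sing}(\omega)\ge 2$, where $\operatorname{sing}$ of a form is its zero set ($\operatorname{sing}(d\omega)$ is taken in $\mathbb C^{n+1}$; the empty set counts as having codimension $\ge 3$). The tangent sheaf of $\mathcal G=[\omega]$ is the kernel of $T\mathbb P^n\to\Omega^{q-1}_{\mathbb P^n}(d+q+1)$, $v\mapsto i_v\omega$. The pull-back of $[\omega]$ under a linear projection $\pi:\mathbb P^{n+m}\dashrightarrow\mathbb P^n$ (induced by a surjective linear map $\mathbb C^{n+m+1}\to\mathbb C^{n+1}$) is $[\pi^*\omega]$. "Generic element" means every element of a nonempty Zariski-open subset of the component in question. *)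

theory Defs
  imports
    "HOL-Analysis.Analysis"
    "HOL-Library.Function_Algebras"
    "HOL-Library.Extended_Nat"
    "HOL-Combinatorics.Permutations"
begin

section \<open>Polynomial functions and Zariski topologies on complex vector spaces\<close>

text \<open>
  A complex vector space is given by its scalar multiplication \<open>s\<close>.  Polynomials are treated as
  polynomial functions (the base field is infinite), generated by the linear functionals, so no
  coordinates are chosen.  The same notions are used for \<open>\<complex>\<^sup>N\<close>, for spaces of differential forms and
  for spaces of linear maps.
\<close>

inductive hom_poly :: "(complex \<Rightarrow> 'v::ab_group_add \<Rightarrow> 'v) \<Rightarrow> nat \<Rightarrow> ('v \<Rightarrow> complex) \<Rightarrow> bool"
  for s where
  const: "hom_poly s 0 (\<lambda>_. c)"
| linear: "Vector_Spaces.linear s (*) l \<Longrightarrow> hom_poly s 1 l"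
| add: "hom_poly s k p \<Longrightarrow> hom_poly s k q \<Longrightarrow> hom_poly s k (\<lambda>x. p x + q x)"
| mult: "hom_poly s j p \<Longrightarrow> hom_poly s k q \<Longrightarrow> hom_poly s (j + k) (\<lambda>x. p x * q x)"

inductive poly_fun :: "(complex \<Rightarrow> 'v::ab_group_add \<Rightarrow> 'v) \<Rightarrow> ('v \<Rightarrow> complex) \<Rightarrow> bool"
  for s where
  const: "poly_fun s (\<lambda>_. c)"
| linear: "Vector_Spaces.linear s (*) l \<Longrightarrow> poly_fun s l"
| add: "poly_fun s p \<Longrightarrow> poly_fun s q \<Longrightarrow> poly_fun s (\<lambda>x. p x + q x)"
| mult: "poly_fun s p \<Longrightarrow> poly_fun s q \<Longrightarrow> poly_fun s (\<lambda>x. p x * q x)"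

definition affine_zariski :: "(complex \<Rightarrow> 'v::ab_group_add \<Rightarrow> 'v) \<Rightarrow> 'v topology" where
  "affine_zariski s =
     topology (\<lambda>U. \<exists>S. (\<forall>p\<in>S. poly_fun s p) \<and> - U = {x. \<forall>p\<in>S. p x = 0})"

text \<open>The point \<open>[x]\<close> of projective space, as the punctured line through \<open>x\<close>.\<close>

definition proj_point :: "(complex \<Rightarrow> 'v \<Rightarrow> 'v) \<Rightarrow> 'v \<Rightarrow> 'v set" where
  "proj_point s x = {s c x | c. c \<noteq> 0}"

definition proj_space :: "(complex \<Rightarrow> 'v::zero \<Rightarrow> 'v) \<Rightarrow> 'v set \<Rightarrow> 'v set set" where
  "proj_space s W = proj_point s ` (W - {0})"

text \<open>
  The Zariski topology of \<open>\<P>(W)\<close> for a linear subspace \<open>W\<close>: linear functionals on \<open>W\<close> are exactly the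
  restrictions of linear functionals on the ambient space, so the polynomials on the ambient space
  may be used.
\<close>

definition proj_zariski :: "(complex \<Rightarrow> 'v::ab_group_add \<Rightarrow> 'v) \<Rightarrow> 'v set \<Rightarrow> 'v set topology" where
  "proj_zariski s W =
     topology (\<lambda>U. U \<subseteq> proj_space s W \<and>
       (\<exists>S. (\<forall>p\<in>S. \<exists>k. hom_poly s k p) \<and>
            proj_space s W - U = {g \<in> proj_space s W. \<forall>p\<in>S. \<forall>x\<in>g. p x = 0}))"

lemma hom_poly_scale:
  assumes "hom_poly s k p"
  shows "p (s c x) = c ^ k * p x"
  using assms
proof induction
  case (linear l)
  then interpret l: Vector_Spaces.linear s "(*)" l .
  show ?case by (simp add: l.scale)
qed (auto simp: algebra_simps power_add)

lemma istopology_of_zero_sets: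
  assumes one: "\<exists>p. P p \<and> (\<forall>g\<in>X. \<not> Z p g)"
    and mult: "\<And>p q. P p \<Longrightarrow> P q \<Longrightarrow> \<exists>r. P r \<and> (\<forall>g\<in>X. Z r g \<longleftrightarrow> Z p g \<or> Z q g)"
  shows "istopology (\<lambda>U. U \<subseteq> X \<and> (\<exists>S. (\<forall>p\<in>S. P p) \<and> X - U = {g \<in> X. \<forall>p\<in>S. Z p g}))"
  unfolding istopology_def
proof (intro conjI allI impI)
  fix U V
  assume U: "U \<subseteq> X \<and> (\<exists>S. (\<forall>p\<in>S. P p) \<and> X - U = {g \<in> X. \<forall>p\<in>S. Z p g})"
    and V: "V \<subseteq> X \<and> (\<exists>S. (\<forall>p\<in>S. P p) \<and> X - V = {g \<in> X. \<forall>p\<in>S. Z p g})"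
  show "U \<inter> V \<subseteq> X" using U by blast
  from U obtain S where S: "\<forall>p\<in>S. P p" "X - U = {g \<in> X. \<forall>p\<in>S. Z p g}" by blast
  from V obtain T where T: "\<forall>p\<in>T. P p" "X - V = {g \<in> X. \<forall>p\<in>T. Z p g}" by blast
  have "\<forall>p\<in>S. \<forall>q\<in>T. \<exists>r. P r \<and> (\<forall>g\<in>X. Z r g \<longleftrightarrow> Z p g \<or> Z q g)"
    using mult S(1) T(1) by blast
  then obtain r where r: "\<And>p q. p \<in> S \<Longrightarrow> q \<in> T \<Longrightarrow> P (r p q)"
      "\<And>p q g. p \<in> S \<Longrightarrow> q \<in> T \<Longrightarrow> g \<in> X \<Longrightarrow> Z (r p q) g \<longleftrightarrow> Z p g \<or> Z q g"
    by metis
  let ?R = "{r p q | p q. p \<in> S \<and> q \<in> T}"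
  have "X - U \<inter> V = (X - U) \<union> (X - V)" by blast
  also have "\<dots> = {g \<in> X. \<forall>p\<in>?R. Z p g}"
    unfolding S(2) T(2) using r(2) by blast
  finally have "X - U \<inter> V = {g \<in> X. \<forall>p\<in>?R. Z p g}" .
  moreover have "\<forall>p\<in>?R. P p" using r(1) by blast
  ultimately show "\<exists>S. (\<forall>p\<in>S. P p) \<and> X - U \<inter> V = {g \<in> X. \<forall>p\<in>S. Z p g}" by blast
next
  fix K
  assume K: "\<forall>U\<in>K. U \<subseteq> X \<and> (\<exists>S. (\<forall>p\<in>S. P p) \<and> X - U = {g \<in> X. \<forall>p\<in>S. Z p g})"
  show "\<Union>K \<subseteq> X" using K by blast
  from K obtain S where S: "\<And>U. U \<in> K \<Longrightarrow> \<forall>p\<in>S U. P p"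
      "\<And>U. U \<in> K \<Longrightarrow> X - U = {g \<in> X. \<forall>p\<in>S U. Z p g}" by metis
  have "X - \<Union>K = {g \<in> X. \<forall>p\<in>\<Union>(S ` K). Z p g}"
    using S(2) by blast
  moreover have "\<forall>p\<in>\<Union>(S ` K). P p" using S(1) by blast
  ultimately show "\<exists>S. (\<forall>p\<in>S. P p) \<and> X - \<Union>K = {g \<in> X. \<forall>p\<in>S. Z p g}" by blast
qed

lemma openin_affine_zariski:
  "openin (affine_zariski s) U \<longleftrightarrow> (\<exists>S. (\<forall>p\<in>S. poly_fun s p) \<and> - U = {x. \<forall>p\<in>S. p x = 0})"
proof -
  have "istopology (\<lambda>U. U \<subseteq> UNIV \<and>
      (\<exists>S. (\<forall>p\<in>S. poly_fun s p) \<and> UNIV - U = {x \<in> UNIV. \<forall>p\<in>S. p x = 0}))"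
  proof (rule istopology_of_zero_sets)
    show "\<exists>p. poly_fun s p \<and> (\<forall>g\<in>UNIV. p g \<noteq> 0)"
      using poly_fun.const[of s 1] by (intro exI[of _ "\<lambda>_. 1"]) auto
  next
    fix p q assume "poly_fun s p" "poly_fun s q"
    then show "\<exists>r. poly_fun s r \<and> (\<forall>g\<in>UNIV. r g = 0 \<longleftrightarrow> p g = 0 \<or> q g = 0)"
      using poly_fun.mult[of s p q] by (intro exI[of _ "\<lambda>x. p x * q x"]) auto
  qed
  then show ?thesis
    unfolding affine_zariski_def by (simp add: Compl_eq_Diff_UNIV)
qed

lemma openin_proj_zariski:
  "openin (proj_zariski s W) U \<longleftrightarrow> U \<subseteq> proj_space s W \<and>
     (\<exists>S. (\<forall>p\<in>S. \<exists>k. hom_poly s k p) \<and>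
          proj_space s W - U = {g \<in> proj_space s W. \<forall>p\<in>S. \<forall>x\<in>g. p x = 0})"
proof -
  have "istopology (\<lambda>U. U \<subseteq> proj_space s W \<and>
     (\<exists>S. (\<forall>p\<in>S. \<exists>k. hom_poly s k p) \<and>
          proj_space s W - U = {g \<in> proj_space s W. \<forall>p\<in>S. \<forall>x\<in>g. p x = 0}))"
  proof (rule istopology_of_zero_sets)
    have "proj_point s x \<noteq> {}" for x
      unfolding proj_point_def by (auto intro!: exI[of _ "1::complex"])
    then show "\<exists>p. (\<exists>k. hom_poly s k p) \<and> (\<forall>g\<in>proj_space s W. \<not> (\<forall>x\<in>g. p x = 0))"
      using hom_poly.const[of s 1]
      by (intro exI[of _ "\<lambda>_. 1"]) (auto simp: proj_space_def)
  next
    fix p q assume "\<exists>k. hom_poly s k p" "\<exists>k. hom_poly s k q"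
    then obtain j k where p: "hom_poly s j p" and q: "hom_poly s k q" by blast
    have "(\<forall>x\<in>g. p x * q x = 0) \<longleftrightarrow> (\<forall>x\<in>g. p x = 0) \<or> (\<forall>x\<in>g. q x = 0)"
      if "g \<in> proj_space s W" for g
    proof -
      from that obtain y where "g = proj_point s y" by (auto simp: proj_space_def)
      then show ?thesis
        using zero_neq_one[where ?'a = complex]
        by (auto simp: proj_point_def hom_poly_scale[OF p] hom_poly_scale[OF q])
    qed
    then show "\<exists>r. (\<exists>k. hom_poly s k r) \<and> (\<forall>g\<in>proj_space s W.
        (\<forall>x\<in>g. r x = 0) \<longleftrightarrow> (\<forall>x\<in>g. p x = 0) \<or> (\<forall>x\<in>g. q x = 0))"
      using hom_poly.mult[OF p q] by (intro exI[of _ "\<lambda>x. p x * q x"]) auto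
  qed
  then show ?thesis
    unfolding proj_zariski_def by simp
qed


section \<open>Irreducibility, codimension, genericity\<close>

definition irreducible_set :: "'a topology \<Rightarrow> 'a set \<Rightarrow> bool" where
  "irreducible_set X S \<longleftrightarrow> S \<subseteq> topspace X \<and> S \<noteq> {} \<and>
     (\<forall>A B. closedin X A \<and> closedin X B \<and> S \<subseteq> A \<union> B \<longrightarrow> S \<subseteq> A \<or> S \<subseteq> B)"

definition irreducible_component :: "'a topology \<Rightarrow> 'a set \<Rightarrow> bool" where
  "irreducible_component X C \<longleftrightarrow> irreducible_set X C \<and>
     (\<forall>D. irreducible_set X D \<and> C \<subseteq> D \<longrightarrow> D = C)"

definition irreducible_chain :: "'a topology \<Rightarrow> nat \<Rightarrow> (nat \<Rightarrow> 'a set) \<Rightarrow> bool" where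
  "irreducible_chain X c K \<longleftrightarrow>
     (\<forall>i\<le>c. closedin X (K i) \<and> irreducible_set X (K i)) \<and> (\<forall>i<c. K i \<subset> K (Suc i))"

text \<open>The codimension of a closed set; it is \<open>\<infinity>\<close> for the empty set.\<close>

definition codim :: "'a topology \<Rightarrow> 'a set \<Rightarrow> enat" where
  "codim X Z = (INF Y \<in> {Y. closedin X Y \<and> irreducible_set X Y \<and> Y \<subseteq> Z}.
                  SUP c \<in> {c. \<exists>K. irreducible_chain X c K \<and> K 0 = Y}. enat c)"

definition generic_in :: "'a topology \<Rightarrow> 'a set \<Rightarrow> ('a \<Rightarrow> bool) \<Rightarrow> bool" where
  "generic_in X C P \<longleftrightarrow> (\<exists>U. openin (subtopology X C) U \<and> U \<noteq> {} \<and> (\<forall>u\<in>U. P u))"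


section \<open>Differential forms with polynomial coefficients on \<open>\<complex>\<^sup>N\<close>\<close>

text \<open>
  A \<open>q\<close>-form takes a point and a list of \<open>q\<close> vectors; on lists of any other length it is \<open>0\<close>.
  Throughout, \<open>\<complex>\<^sup>N\<close> is \<^typ>\<open>complex^'n\<close> with \<open>N = CARD('n)\<close>.
\<close>

type_synonym 'n form = "complex^'n \<Rightarrow> (complex^'n) list \<Rightarrow> complex"

definition hom_form :: "nat \<Rightarrow> nat \<Rightarrow> 'n::finite form \<Rightarrow> bool" where
  "hom_form q k \<omega> \<longleftrightarrow>
     (\<forall>x vs. length vs \<noteq> q \<longrightarrow> \<omega> x vs = 0) \<and>
     (\<forall>x vs i. length vs = q \<and> i < q \<longrightarrow>
        Vector_Spaces.linear (*s) (*) (\<lambda>v. \<omega> x (vs[i := v]))) \<and>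
     (\<forall>x vs i j. length vs = q \<and> i < j \<and> j < q \<and> vs ! i = vs ! j \<longrightarrow> \<omega> x vs = 0) \<and>
     (\<forall>vs. length vs = q \<longrightarrow> hom_poly (*s) k (\<lambda>x. \<omega> x vs))"

definition form_scale :: "complex \<Rightarrow> 'n::finite form \<Rightarrow> 'n form" where
  "form_scale c \<omega> = (\<lambda>x vs. c * \<omega> x vs)"

definition wedge :: "nat \<Rightarrow> nat \<Rightarrow> 'n::finite form \<Rightarrow> 'n form \<Rightarrow> 'n form" where
  "wedge p q \<alpha> \<beta> = (\<lambda>x vs. if length vs = p + q then
      (\<Sum>\<sigma> | \<sigma> permutes {..<p + q}. of_int (sign \<sigma>) *
          \<alpha> x (map (\<lambda>i. vs ! \<sigma> i) [0..<p]) * \<beta> x (map (\<lambda>i. vs ! \<sigma> i) [p..<p + q]))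
        / (fact p * fact q)
    else 0)"

definition ext_deriv :: "'n::finite form \<Rightarrow> 'n form" where
  "ext_deriv \<omega> = (\<lambda>x vs. \<Sum>i<length vs.
      (-1) ^ i * deriv (\<lambda>t. \<omega> (x + t *s (vs ! i)) (take i vs @ drop (Suc i) vs)) 0)"

text \<open>
  Contraction with the constant multivector \<open>\<Sum>\<^sub>I v\<^sub>I e\<^sub>i\<^sub>1 \<and> \<dots> \<and> e\<^sub>i\<^sub>k\<close>, the sum being over all index
  lists \<open>I = [i\<^sub>1, \<dots>, i\<^sub>k]\<close>.  Every element of \<open>\<Lambda>\<^sup>k \<complex>\<^sup>N\<close> has this shape (not uniquely, as \<open>v\<close> is
  not required to be antisymmetric).
\<close>

definition contract :: "nat \<Rightarrow> ('n list \<Rightarrow> complex) \<Rightarrow> 'n::finite form \<Rightarrow> 'n form" where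
  "contract k v \<omega> = (\<lambda>x ws. \<Sum>I | length I = k. v I * \<omega> x (map (\<lambda>i. axis i 1) I @ ws))"

definition pullback :: "(complex^'k \<Rightarrow> complex^'n) \<Rightarrow> 'n::finite form \<Rightarrow> 'k::finite form" where
  "pullback \<pi> \<omega> = (\<lambda>x vs. \<omega> (\<pi> x) (map \<pi> vs))"


section \<open>Foliations on projective space\<close>

abbreviation projective_zariski :: "(complex^'n::finite) set topology" where
  "projective_zariski \<equiv> proj_zariski (*s) UNIV"

text \<open>
  \<open>H\<^sup>0(\<P>\<^sup>n, \<Omega>\<^sup>q(d+q+1))\<close> for \<open>n = CARD('n) - 1\<close>; the second condition is \<open>i\<^sub>R \<omega> = 0\<close>, as the value
  of the radial vector field at \<open>x\<close> is \<open>x\<close>.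
\<close>

definition twisted_forms :: "nat \<Rightarrow> nat \<Rightarrow> 'n::finite form set" where
  "twisted_forms q d = {\<omega>. hom_form q (d + 1) \<omega> \<and> (\<forall>x ws. \<omega> x (x # ws) = 0)}"

definition affine_sing :: "'n::finite form \<Rightarrow> (complex^'n) set" where
  "affine_sing \<omega> = {x. \<forall>vs. \<omega> x vs = 0}"

definition proj_sing :: "'n::finite form \<Rightarrow> (complex^'n) set set" where
  "proj_sing \<omega> = {g \<in> proj_space (*s) UNIV. g \<subseteq> affine_sing \<omega>}"

definition foliations :: "nat \<Rightarrow> nat \<Rightarrow> 'n::finite form set set" where
  "foliations q d = {proj_point form_scale \<omega> | \<omega>.
     \<omega> \<in> twisted_forms q d \<and> \<omega> \<noteq> 0 \<and>
     (\<forall>v. wedge 1 q (contract (q - 1) v \<omega>) \<omega> = 0 \<and>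
          wedge 1 (q + 1) (contract (q - 1) v \<omega>) (ext_deriv \<omega>) = 0) \<and>
     codim projective_zariski (proj_sing \<omega>) \<ge> 2}"

text \<open>\<open>\<F>\<^sub>q(n,d)\<close> as a topological space.\<close>

definition foliation_space :: "nat \<Rightarrow> nat \<Rightarrow> 'n::finite form set topology" where
  "foliation_space q d = subtopology (proj_zariski form_scale (twisted_forms q d)) (foliations q d)"

text \<open>The linear projections \<open>\<P>\<^sup>n\<^sup>+\<^sup>m \<dashrightarrow> \<P>\<^sup>n\<close>, an open subset of \<open>\<P>(Hom(\<complex>\<^sup>n\<^sup>+\<^sup>m\<^sup>+\<^sup>1, \<complex>\<^sup>n\<^sup>+\<^sup>1))\<close>.\<close>

definition map_scale :: "complex \<Rightarrow> (complex^'k \<Rightarrow> complex^'n) \<Rightarrow> complex^'k \<Rightarrow> complex^'n" where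
  "map_scale c \<pi> = (\<lambda>x. c *s \<pi> x)"

definition linear_projections :: "(complex^'k::finite \<Rightarrow> complex^'n::finite) set topology" where
  "linear_projections = subtopology
     (proj_zariski map_scale {\<pi>. Vector_Spaces.linear (*s) (*s) \<pi>})
     (proj_point map_scale ` {\<pi>. Vector_Spaces.linear (*s) (*s) \<pi> \<and> surj \<pi>})"

lemma vector_space_form_scale: "vector_space (form_scale :: complex \<Rightarrow> 'n::finite form \<Rightarrow> _)"
  by standard (auto simp: form_scale_def fun_eq_iff algebra_simps)

lemma vector_space_map_scale:
  "vector_space (map_scale :: complex \<Rightarrow> (complex^'k::finite \<Rightarrow> complex^'n::finite) \<Rightarrow> _)"
  by standard (auto simp: map_scale_def fun_eq_iff vec_eq_iff algebra_simps)


section \<open>Sheaves of modules on \<open>\<P>\<^sup>n\<close>\<close>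

text \<open>
  Sections over a Zariski-open \<open>U \<subseteq> \<P>\<^sup>n\<close> are functions on the punctured cone \<open>\<Union>U \<subseteq> \<complex>\<^sup>n\<^sup>+\<^sup>1 - 0\<close>,
  extended by a fixed value to all of \<open>\<complex>\<^sup>n\<^sup>+\<^sup>1\<close>.  The sections of \<open>\<O>(e)\<close> are the functions that are
  locally quotients of homogeneous polynomials with degrees differing by \<open>e\<close>.
\<close>

definition twist_sections :: "int \<Rightarrow> (complex^'n::finite) set set \<Rightarrow> (complex^'n \<Rightarrow> complex) set" where
  "twist_sections e U = {f. (\<forall>x. x \<notin> \<Union>U \<longrightarrow> f x = 0) \<and>
     (\<forall>g\<in>U. \<exists>V a b F G. openin projective_zariski V \<and> g \<in> V \<and> V \<subseteq> U \<and>
        hom_poly (*s) a F \<and> hom_poly (*s) b G \<and> int a - int b = e \<and>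
        (\<forall>x\<in>\<Union>V. G x \<noteq> 0 \<and> f x = F x / G x))}"

text \<open>
  By the Euler sequence \<open>0 \<rightarrow> \<O> \<rightarrow> \<O>(1)\<^sup>n\<^sup>+\<^sup>1 \<rightarrow> T\<P>\<^sup>n \<rightarrow> 0\<close>, a vector field over \<open>U\<close> is locally given by an
  \<open>(n+1)\<close>-tuple of sections of \<open>\<O>(1)\<close> modulo multiples of the radial field.  It is encoded by its
  value at each \<open>x\<close> of the cone, a coset in \<open>\<complex>\<^sup>n\<^sup>+\<^sup>1 / \<complex>x\<close>.
\<close>

definition radial_coset :: "complex^'n \<Rightarrow> complex^'n \<Rightarrow> (complex^'n) set" where
  "radial_coset x v = {v + t *s x | t. True}"

definition vector_field_sections ::
    "(complex^'n::finite) set set \<Rightarrow> (complex^'n \<Rightarrow> (complex^'n) set) set" where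
  "vector_field_sections U = {\<xi>. (\<forall>x. x \<notin> \<Union>U \<longrightarrow> \<xi> x = {}) \<and>
     (\<forall>g\<in>U. \<exists>V a. openin projective_zariski V \<and> g \<in> V \<and> V \<subseteq> U \<and>
        (\<forall>i. a i \<in> twist_sections 1 V) \<and>
        (\<forall>x\<in>\<Union>V. \<xi> x = radial_coset x (\<chi> i. a i x)))}"

record ('n, 'a) module_sheaf =
  sections :: "(complex^'n) set set \<Rightarrow> 'a set"
  plus_section :: "'a \<Rightarrow> 'a \<Rightarrow> 'a"
  smult_section :: "(complex^'n \<Rightarrow> complex) \<Rightarrow> 'a \<Rightarrow> 'a"
  restrict_section :: "(complex^'n) set set \<Rightarrow> 'a \<Rightarrow> 'a"

definition sheaf_iso ::
    "('n::finite, 'a) module_sheaf \<Rightarrow> ('n, 'b) module_sheaf \<Rightarrow> bool" where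
  "sheaf_iso \<A> \<B> \<longleftrightarrow> (\<exists>\<phi>.
     (\<forall>U. openin projective_zariski U \<longrightarrow>
        bij_betw (\<phi> U) (sections \<A> U) (sections \<B> U) \<and>
        (\<forall>\<xi>\<in>sections \<A> U. \<forall>\<eta>\<in>sections \<A> U.
           \<phi> U (plus_section \<A> \<xi> \<eta>) = plus_section \<B> (\<phi> U \<xi>) (\<phi> U \<eta>)) \<and>
        (\<forall>f\<in>twist_sections 0 U. \<forall>\<xi>\<in>sections \<A> U.
           \<phi> U (smult_section \<A> f \<xi>) = smult_section \<B> f (\<phi> U \<xi>)) \<and>
        (\<forall>V. openin projective_zariski V \<and> V \<subseteq> U \<longrightarrow> (\<forall>\<xi>\<in>sections \<A> U.
           \<phi> V (restrict_section \<A> V \<xi>) = restrict_section \<B> V (\<phi> U \<xi>)))))"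

text \<open>
  The kernel of \<open>T\<P>\<^sup>n \<rightarrow> \<Omega>\<^sup>q\<^sup>-\<^sup>1(d+q+1)\<close>, \<open>v \<mapsto> i\<^sub>v \<omega>\<close>; for a form \<open>\<omega>\<close> with \<open>i\<^sub>R \<omega> = 0\<close> the contraction
  does not depend on the representative of a coset.
\<close>

definition tangent_sheaf ::
    "'n::finite form \<Rightarrow> ('n, complex^'n \<Rightarrow> (complex^'n) set) module_sheaf" where
  "tangent_sheaf \<omega> = \<lparr>
     sections = (\<lambda>U. {\<xi> \<in> vector_field_sections U. \<forall>x. \<forall>v\<in>\<xi> x. \<forall>ws. \<omega> x (v # ws) = 0}),
     plus_section = (\<lambda>\<xi> \<eta> x. {v + w | v w. v \<in> \<xi> x \<and> w \<in> \<eta> x}),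
     smult_section = (\<lambda>f \<xi> x. {f x *s v + t *s x | v t. v \<in> \<xi> x}),
     restrict_section = (\<lambda>V \<xi> x. if x \<in> \<Union>V then \<xi> x else {}) \<rparr>"

text \<open>\<open>\<O>(e 0) \<oplus> \<dots> \<oplus> \<O>(e (r-1))\<close>, with sections extended by \<open>0\<close> to indices \<open>j \<ge> r\<close>.\<close>

definition split_sheaf ::
    "nat \<Rightarrow> (nat \<Rightarrow> int) \<Rightarrow> ('n::finite, nat \<Rightarrow> complex^'n \<Rightarrow> complex) module_sheaf" where
  "split_sheaf r e = \<lparr>
     sections = (\<lambda>U. {h. (\<forall>j<r. h j \<in> twist_sections (e j) U) \<and> (\<forall>j\<ge>r. h j = (\<lambda>_. 0))}),
     plus_section = (\<lambda>h k j x. h j x + k j x),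
     smult_section = (\<lambda>f h j x. f x * h j x),
     restrict_section = (\<lambda>V h j x. if x \<in> \<Union>V then h j x else 0) \<rparr>"

definition split_tangent_sheaf :: "nat \<Rightarrow> 'n::finite form \<Rightarrow> bool" where
  "split_tangent_sheaf q \<omega> \<longleftrightarrow>
     (\<exists>e. sheaf_iso (tangent_sheaf \<omega>) (split_sheaf (CARD('n) - 1 - q) e))"

end

theory Submission
  imports Defs "HOL-Computational_Algebra.Fundamental_Theorem_Algebra"
begin

text \<open>
  The idea is that the kernel of a pulled back foliation does not become smaller under deformation.
  A splitting of the tangent sheaf yields polynomial vector fields generating the module of fields
  annihilated by \<open>\<omega>\<close> (for \<open>q = 1\<close>: by \<open>d\<omega>\<close>).  As the singular set has codimension at least three, three
  of the coefficients form a regular sequence, and a Koszul argument shows that every family of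
  coefficients satisfying the linear relations fulfilled by the contractions of \<open>\<omega>\<close> is itself a contraction
  of \<open>\<omega>\<close> with a polynomial field.  For the pull-back \<open>\<omega>\<^sub>0 = \<pi>\<^sup>*\<omega>\<close> and coefficient families of the degree
  of \<open>\<omega>\<close>, the field is a constant vector.  Thus the two-term complex formed by \<open>v \<mapsto> i\<^sub>v\<omega>'\<close> and these
  relations is exact at \<open>\<omega>' = \<omega>\<^sub>0\<close>, and by semicontinuity the rank of \<open>v \<mapsto> i\<^sub>v\<omega>'\<close> is constant for
  foliations \<open>\<omega>'\<close> near \<open>\<omega>\<^sub>0\<close>.  Integrability shows that \<open>\<omega>'\<close> is invariant under translation by the
  constant vectors in its kernel, so \<open>\<omega>'\<close> is a linear pull-back of its restriction to a fixed linear
  subspace; the projection depends polynomially on \<open>\<omega>'\<close> by Cramer's rule.  The pull-backs of the members of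
  \<open>C\<close> form an irreducible set, and on the component containing it restriction to the subspace lands in
  \<open>C\<close> by maximality of \<open>C\<close>.
\<close>

text \<open>Codimension is read through polynomials: codimension two (three) supplies, for every
  direction (every independent pair), a non-zero polynomial constant along it and vanishing on the
  set. Such a polynomial does not involve the chosen coordinates, so coprimality and regular
  sequences come down to Euclidean division by polynomials monic in one coordinate; the link with
  chains of irreducible sets is a count of algebraically independent elements. For
  \<open>q = 1\<close> the form d\<omega> has to replace \<omega>: the linear relations on
  contractions of a one-form are vacuous, since a contraction is a single function, whereas
  d\<omega> is a decomposable two-form whose contraction with the radial field is
  \<open>d + 2\<close> times \<omega>. The tangent sheaf determines vector fields only modulo the
  radial field. Wedging with the position vector removes the ambiguity, and Koszul exactness for
  three coordinates recovers polynomial fields. Semicontinuity takes the form of one explicit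
  polynomial \<Delta> on the space of forms, and irreducibility spreads what holds near one
  pull-back over an open subset of the whole component.\<close>

abbreviation pf :: "(complex^'n => complex) => bool" where "pf \<equiv> poly_fun (*s)"
abbreviation hp :: "nat => (complex^'n => complex) => bool" where "hp \<equiv> hom_poly (*s)"
abbreviation lin :: "(complex^'n => complex) => bool" where "lin \<equiv> Vector_Spaces.linear (*s) (*)"

abbreviation zopen :: "(complex^'n::finite) set set => bool" where "zopen \<equiv> openin projective_zariski"

section \<open>Polynomial functions on complex coordinate space\<close>

lemma pf_const [simp, intro]: "pf (\<lambda>_. c)" by (rule poly_fun.const)
lemma pf_0 [simp, intro]: "pf 0" using poly_fun.const[of "(*s)" 0] by (simp add: zero_fun_def)
lemma pf_1 [simp, intro]: "pf 1" using poly_fun.const[of "(*s)" 1] by (simp add: one_fun_def)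
lemma pf_add [intro]: "pf p ==> pf q ==> pf (p + q)"
 using poly_fun.add[of "(*s)" p q] by (simp add: plus_fun_def)
lemma pf_mult [intro]: "pf p ==> pf q ==> pf (p * q)"
 using poly_fun.mult[of "(*s)" p q] by (simp add: times_fun_def)
lemma pf_uminus [intro]: "pf p ==> pf (- p)"
 using poly_fun.mult[of "(*s)" "\<lambda>_. -1" p] by (auto simp: fun_Compl_def poly_fun.const)
lemma pf_diff [intro]: "pf p ==> pf q ==> pf (p - q)"
 using pf_add[of p "- q"] pf_uminus[of q] by simp
lemma pf_sum [intro]: "(\<And>i. i \<in> A ==> pf (f i)) ==> pf (sum f A)"
 by (induction A rule: infinite_finite_induct) auto
lemma pf_power [intro]: "pf p ==> pf (p ^ n)"
 by (induction n) auto
lemma pf_prod [intro]: "(\<And>i. i \<in> A ==> pf (f i)) ==> pf (prod f A)"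
 by (induction A rule: infinite_finite_induct) auto

lemma fun_sum_apply: "(sum f A) x = (\<Sum>i\<in>A. f i x)"
 for f :: "'i => 'x => 'b::comm_monoid_add"
 by (induction A rule: infinite_finite_induct) auto
lemma fun_prod_apply: "(prod f A) x = (\<Prod>i\<in>A. f i x)"
 for f :: "'i => 'x => 'b::comm_monoid_mult"
 by (induction A rule: infinite_finite_induct) auto
lemma fun_power_apply: "(p ^ n) x = p x ^ n" for p :: "'x => 'b::comm_monoid_mult"
 by (induction n) auto

lemma pf_sum' [intro]: "(\<And>i. i \<in> A ==> pf (f i)) ==> pf (\<lambda>x. \<Sum>i\<in>A. f i x)"
 using pf_sum[of A f] by (simp add: fun_sum_apply[abs_def])

lemma pf_pointwise [intro]:
 "pf p ==> pf q ==> pf (\<lambda>x. p x + q x)" "pf p ==> pf q ==> pf (\<lambda>x. p x * q x)"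
 "pf p ==> pf q ==> pf (\<lambda>x. p x - q x)" "pf p ==> pf (\<lambda>x. p x ^ n)"
 using pf_add[of p q] pf_mult[of p q] pf_diff[of p q] pf_power[of p n]
 by (simp_all add: plus_fun_def times_fun_def fun_diff_def fun_power_apply[abs_def])

lemma lin_component: "lin (\<lambda>x. x $ i)"
 by unfold_locales (auto simp: algebra_simps)
lemma pf_component [simp, intro]: "pf (\<lambda>x. x $ i)"
 by (rule poly_fun.linear[OF lin_component])
lemma hp_component: "hp 1 (\<lambda>x. x $ i)"
 by (rule hom_poly.linear[OF lin_component])

lemma lin_add: "lin l ==> l (x + y) = l x + l y" by (simp add: Vector_Spaces.linear_iff)
lemma lin_scale: "lin l ==> l (c *s x) = c * l x" by (simp add: Vector_Spaces.linear_iff)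
lemma lin_zero: "lin l ==> l 0 = 0" using lin_scale[of l 0 0] by simp
lemma linI: "(\<And>x y. l (x + y) = l x + l y) ==> (\<And>c x. l (c *s x) = c * l x) ==> lin l"
 by unfold_locales auto

lemma hp_imp_pf: "hp k p ==> pf p"
 by (induction rule: hom_poly.induct) (auto intro: poly_fun.intros)

lemma hp_zero: "hp k (\<lambda>_. 0)"
proof (induction k)
 case (Suc k)
 have "lin (\<lambda>_. 0)" by (rule linI) auto
 from hom_poly.mult[OF hom_poly.linear[OF this] Suc] show ?case by simp
qed (rule hom_poly.const)

lemma hp_scale: "hp k p ==> hp k (\<lambda>x. c * p x)"
 using hom_poly.mult[OF hom_poly.const[of "(*s)" c], of k p] by simp

lemma hp_sum: "(\<And>i. i \<in> A ==> hp k (f i)) ==> hp k (\<lambda>x. \<Sum>i\<in>A. f i x)"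
 by (induction A rule: infinite_finite_induct) (auto intro: hp_zero hom_poly.add)

lemma hp_power: "hp k p ==> hp (k * n) (p ^ n)"
proof (induction n)
 case 0 then show ?case using hom_poly.const[of "(*s)" 1] by (simp add: one_fun_def)
next
 case (Suc n) then show ?case
  using hom_poly.mult[OF Suc.prems Suc.IH[OF Suc.prems]] by (simp add: times_fun_def)
qed

text \<open>Lines are the test objects throughout: a statement on polynomial functions is restricted
  to a line, where only finitely many parameters can be roots.\<close>

lemma pf_line: "pf p ==> \<exists>P. \<forall>t. p (x + t *s v) = poly P t"
proof (induction rule: poly_fun.induct)
 case (const c) show ?case by (rule exI[of _ "[:c:]"]) simp
next
 case (linear l) show ?case
  by (rule exI[of _ "[:l x, l v:]"]) (simp add: lin_add[OF linear] lin_scale[OF linear])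
next
 case (add p q) then obtain P Q where "\<forall>t. p (x + t *s v) = poly P t" "\<forall>t. q (x + t *s v) = poly Q t" by blast
 then show ?case by (intro exI[of _ "P + Q"]) simp
next
 case (mult p q) then obtain P Q where "\<forall>t. p (x + t *s v) = poly P t" "\<forall>t. q (x + t *s v) = poly Q t" by blast
 then show ?case by (intro exI[of _ "P * Q"]) simp
qed

text \<open>On the line joining a point where \<open>p\<close> is non-zero to one where
  \<open>q\<close> is non-zero, both restrict to non-zero univariate polynomials, whose product
  cannot vanish.\<close>

lemma pf_no_zero_divisors:
 assumes "pf p" "pf q" "p * q = 0" shows "p = 0 \<or> q = 0"
proof (rule ccontr)
 assume "\<not> ?thesis"
 then obtain x y where xy: "p x \<noteq> 0" "q y \<noteq> 0" by (auto simp: fun_eq_iff)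
 obtain P Q where P: "\<And>t. p (x + t *s (y - x)) = poly P t" and Q: "\<And>t. q (x + t *s (y - x)) = poly Q t"
  using pf_line[OF assms(1)] pf_line[OF assms(2)] by metis
 have "poly (P * Q) t = 0" for t
  using fun_cong[OF assms(3), of "x + t *s (y - x)"] P[of t] Q[of t] by simp
 then have "P * Q = 0" using poly_all_0_iff_0 by blast
 moreover have "P \<noteq> 0" using xy P[of 0] by auto
 moreover have "Q \<noteq> 0" using xy Q[of 1] by auto
 ultimately show False by simp
qed

lemma pf_mult_cancel: "pf p ==> pf q ==> pf r ==> p \<noteq> 0 ==> p * q = p * r ==> q = r"
 using pf_no_zero_divisors[of p "q - r"] by (auto simp: algebra_simps)

lemma pf_power_nonzero: "pf p ==> p \<noteq> 0 ==> p ^ n \<noteq> 0"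
proof (induction n)
 case (Suc n) then show ?case using pf_no_zero_divisors[of p "p ^ n"] pf_power[of p n] by (metis power_Suc)
qed simp

section \<open>Division along a direction\<close>

text \<open>For non-zero \<open>v\<close> these are the polynomials on the quotient by the line
  through \<open>v\<close>; they form the coefficient ring for division along
  \<open>v\<close>.\<close>

definition inv_dir :: "complex^'n => (complex^'n => complex) set" where
 "inv_dir v = {p. pf p \<and> (\<forall>x t. p (x + t *s v) = p x)}"

lemma inv_dir_pf: "p \<in> inv_dir v ==> pf p" by (simp add: inv_dir_def)
lemma inv_dir_apply: "p \<in> inv_dir v ==> p (x + t *s v) = p x" by (simp add: inv_dir_def)
lemma inv_dir_const [simp]: "(\<lambda>_. c) \<in> inv_dir v" by (simp add: inv_dir_def)
lemma inv_dir_0 [simp]: "0 \<in> inv_dir v" by (simp add: inv_dir_def)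
lemma inv_dir_1 [simp]: "1 \<in> inv_dir v" by (simp add: inv_dir_def)
lemma inv_dir_add: "p \<in> inv_dir v ==> q \<in> inv_dir v ==> p + q \<in> inv_dir v" by (auto simp: inv_dir_def)
lemma inv_dir_diff: "p \<in> inv_dir v ==> q \<in> inv_dir v ==> p - q \<in> inv_dir v" by (auto simp: inv_dir_def)
lemma inv_dir_mult: "p \<in> inv_dir v ==> q \<in> inv_dir v ==> p * q \<in> inv_dir v" by (auto simp: inv_dir_def)
lemma inv_dir_sum: "(\<And>i. i \<in> A ==> f i \<in> inv_dir v) ==> sum f A \<in> inv_dir v"
 by (induction A rule: infinite_finite_induct) (auto simp: inv_dir_add)

text \<open>Expanding in a coordinate along \<open>v\<close> turns division of polynomials into division of univariate
 polynomials over the ring of functions.\<close>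

definition inv_coeffs :: "complex^'n => (complex^'n => complex) poly => bool" where
 "inv_coeffs v P \<longleftrightarrow> (\<forall>j. coeff P j \<in> inv_dir v)"

lemma inv_coeffsD: "inv_coeffs v P ==> coeff P j \<in> inv_dir v" by (simp add: inv_coeffs_def)
lemma inv_coeffs_0 [simp]: "inv_coeffs v 0" by (simp add: inv_coeffs_def)
lemma inv_coeffs_add: "inv_coeffs v P ==> inv_coeffs v Q ==> inv_coeffs v (P + Q)"
 by (simp add: inv_coeffs_def inv_dir_add)
lemma inv_coeffs_diff: "inv_coeffs v P ==> inv_coeffs v Q ==> inv_coeffs v (P - Q)"
 by (simp add: inv_coeffs_def inv_dir_diff)
lemma inv_coeffs_mult: "inv_coeffs v P ==> inv_coeffs v Q ==> inv_coeffs v (P * Q)"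
 unfolding inv_coeffs_def coeff_mult by (blast intro: inv_dir_sum inv_dir_mult)
lemma inv_coeffs_smult: "g \<in> inv_dir v ==> inv_coeffs v P ==> inv_coeffs v (smult g P)"
 by (simp add: inv_coeffs_def inv_dir_mult)
lemma inv_coeffs_monom: "g \<in> inv_dir v ==> inv_coeffs v (monom g n)"
 by (simp add: inv_coeffs_def)

lemma pf_poly:
 assumes "\<And>j. pf (coeff P j)" "pf l" shows "pf (poly P l)"
 unfolding poly_altdef using assms by (intro pf_sum pf_mult pf_power) auto

lemma inv_coeffs_pf_poly: "inv_coeffs v P ==> lin l ==> pf (poly P l)"
 by (rule pf_poly) (auto simp: inv_coeffs_def inv_dir_def poly_fun.linear)

lemma poly_fun_apply: "poly P l x = poly (map_poly (\<lambda>c. c x) P) (l x)"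
 by (induction P) (auto simp: map_poly_pCons)

text \<open>Moving along \<open>v\<close> leaves the coefficients alone and lets \<open>l\<close>
  take every value, so at each point the coefficients form a univariate polynomial that vanishes
  everywhere.\<close>

lemma inv_coeffs_unique:
 assumes "inv_coeffs v P" "lin l" "l v = 1" "poly P l = 0" shows "P = 0"
proof (rule poly_eqI)
 fix j
 have "coeff P j x = 0" for x
 proof -
  have "poly (map_poly (\<lambda>c. c x) P) t = 0" for t
  proof -
   \<comment> \<open>\<open>y\<close> is the point of the line through \<open>x\<close> in direction
     \<open>v\<close> at which \<open>l\<close> equals \<open>t\<close>.\<close>
   define y where "y = x + (t - l x) *s v"
   have "map_poly (\<lambda>c. c y) P = map_poly (\<lambda>c. c x) P"
    unfolding y_def by (intro poly_eqI)
     (simp add: coeff_map_poly inv_dir_apply[OF inv_coeffsD[OF assms(1)]] del: vector_sub_rdistrib)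
   moreover have "l y = t" by (simp add: y_def lin_add[OF assms(2)] lin_scale[OF assms(2)] assms(3) del: vector_sub_rdistrib)
   ultimately show ?thesis using fun_cong[OF assms(4), of y] by (simp add: poly_fun_apply)
  qed
  then have "map_poly (\<lambda>c. c x) P = 0" using poly_all_0_iff_0 by blast
  then have "coeff (map_poly (\<lambda>c. c x) P) j = 0" by simp
  then show ?thesis by (simp add: coeff_map_poly)
 qed
 then show "coeff P j = coeff 0 j" by (simp add: fun_eq_iff)
qed

lemma inv_coeffs_expand:
 assumes "pf p" "lin l" "l v = 1"
 obtains P where "inv_coeffs v P" "p = poly P l"
proof -
 from assms(1) have "\<exists>P. inv_coeffs v P \<and> p = poly P l"
 proof (induction rule: poly_fun.induct)
  case (const c) show ?case
   by (rule exI[of _ "monom (\<lambda>_. c) 0"]) (simp add: inv_coeffs_monom poly_monom fun_eq_iff)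
 next
  case (linear k)
  have "(\<lambda>x. k x - k v * l x) \<in> inv_dir v"
   unfolding inv_dir_def using assms(2,3) linear
    pf_pointwise(3)[OF poly_fun.linear[OF linear] pf_pointwise(2)[OF pf_const poly_fun.linear[OF assms(2)]]]
   by (auto simp: lin_add lin_scale algebra_simps)
  then show ?case
   by (intro exI[of _ "monom (\<lambda>x. k x - k v * l x) 0 + monom (\<lambda>_. k v) 1"])
    (auto intro!: inv_coeffs_add inv_coeffs_monom simp: poly_monom fun_eq_iff)
 next
  case (add p q) then obtain P Q where "inv_coeffs v P \<and> p = poly P l" "inv_coeffs v Q \<and> q = poly Q l" by blast
  then show ?case by (intro exI[of _ "P + Q"]) (auto simp: inv_coeffs_add fun_eq_iff)
 next
  case (mult p q) then obtain P Q where "inv_coeffs v P \<and> p = poly P l" "inv_coeffs v Q \<and> q = poly Q l" by blast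
  then show ?case by (intro exI[of _ "P * Q"]) (auto simp: inv_coeffs_mult fun_eq_iff)
 qed
 then show ?thesis using that by blast
qed

text \<open>By homogeneity the coefficient of the top power along \<open>v\<close> is the number
  \<open>p v\<close>. If it is non-zero, \<open>p\<close> is monic along \<open>v\<close> up to a
  unit, which is what Euclidean division requires.\<close>

lemma inv_coeffs_expand_hom:
 assumes "hp k p" "lin l" "l v = 1"
 obtains P where "inv_coeffs v P" "p = poly P l" "degree P \<le> k" "coeff P k = (\<lambda>_. p v)"
proof -
 from assms(1) have "\<exists>P. inv_coeffs v P \<and> p = poly P l \<and> degree P \<le> k \<and> coeff P k = (\<lambda>_. p v)"
 proof (induction rule: hom_poly.induct)
  case (const c) show ?case
   by (rule exI[of _ "monom (\<lambda>_. c) 0"]) (use degree_monom_le[of "\<lambda>_. c" 0] in \<open>simp add: inv_coeffs_monom poly_monom fun_eq_iff\<close>)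
 next
  case (linear k)
  have "(\<lambda>x. k x - k v * l x) \<in> inv_dir v"
   unfolding inv_dir_def using assms(2,3) linear
    pf_pointwise(3)[OF poly_fun.linear[OF linear] pf_pointwise(2)[OF pf_const poly_fun.linear[OF assms(2)]]]
   by (auto simp: lin_add lin_scale algebra_simps)
  then show ?case
   by (intro exI[of _ "monom (\<lambda>x. k x - k v * l x) 0 + monom (\<lambda>_. k v) 1"])
    (use degree_add_le[of "monom (\<lambda>x. k x - k v * l x) 0" 1 "monom (\<lambda>_. k v) 1"]
      degree_monom_le[of "\<lambda>x. k x - k v * l x" 0] degree_monom_le[of "\<lambda>_. k v" 1] in
      \<open>auto intro!: inv_coeffs_add inv_coeffs_monom simp: poly_monom fun_eq_iff\<close>)
 next
  case (add k p q)
  then obtain P Q where "inv_coeffs v P \<and> p = poly P l \<and> degree P \<le> k \<and> coeff P k = (\<lambda>_. p v)"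
   "inv_coeffs v Q \<and> q = poly Q l \<and> degree Q \<le> k \<and> coeff Q k = (\<lambda>_. q v)" by blast
  then show ?case by (intro exI[of _ "P + Q"]) (auto simp: inv_coeffs_add fun_eq_iff degree_add_le)
 next
  case (mult j p k q)
  then obtain P Q where PQ: "inv_coeffs v P \<and> p = poly P l \<and> degree P \<le> j \<and> coeff P j = (\<lambda>_. p v)"
   "inv_coeffs v Q \<and> q = poly Q l \<and> degree Q \<le> k \<and> coeff Q k = (\<lambda>_. q v)" by blast
  \<comment> \<open>\<open>j\<close> and \<open>k\<close> only bound the degrees; when one bound is
    not attained, both sides vanish.\<close>
  have "coeff (P * Q) (j + k) = coeff P j * coeff Q k"
  proof (cases "degree P = j \<and> degree Q = k")
   case True then show ?thesis using coeff_mult_degree_sum[of P Q] by simp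
  next
   case False
   then have "degree (P * Q) < j + k" using PQ degree_mult_le[of P Q] by linarith
   moreover have "coeff P j = 0 \<or> coeff Q k = 0" using False PQ by (metis coeff_eq_0 le_neq_implies_less)
   ultimately show ?thesis using coeff_eq_0 by auto
  qed
  then show ?case using PQ degree_mult_le[of P Q]
   by (intro exI[of _ "P * Q"]) (auto simp: inv_coeffs_mult fun_eq_iff)
 qed
 then show ?thesis using that by blast
qed

text \<open>The remainder is described by vanishing coefficients from \<open>d\<close> on rather
  than by its degree, so that \<open>d = 0\<close> forces it to be zero.\<close>

lemma inv_coeffs_division:
 assumes F: "inv_coeffs v F" "degree F \<le> d" "coeff F d = (\<lambda>_. c)" "c \<noteq> 0"
 shows "inv_coeffs v P ==> \<exists>B R. inv_coeffs v B \<and> inv_coeffs v R \<and> P = F * B + R \<and> (\<forall>j\<ge>d. coeff R j = 0)"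
proof (induction "degree P" arbitrary: P rule: less_induct)
 case less
 show ?case
 proof (cases "\<forall>j\<ge>d. coeff P j = 0")
  case True then show ?thesis using less.prems by (intro exI[of _ 0] exI[of _ P]) auto
 next
  case False
  define m where "m = degree P"
  from False obtain j where "j \<ge> d" "coeff P j \<noteq> 0" by blast
  then have md: "m \<ge> d" using le_degree[of P j] unfolding m_def by simp
  define G where "G = monom (coeff P m * (\<lambda>_. inverse c)) (m - d)"
  have Gi: "inv_coeffs v G" unfolding G_def
   by (intro inv_coeffs_monom inv_dir_mult inv_coeffsD[OF less.prems]) auto
  define P' where "P' = P - F * G"
  have P'i: "inv_coeffs v P'" unfolding P'_def by (rule inv_coeffs_diff[OF less.prems inv_coeffs_mult[OF F(1) Gi]])
  have cFG: "coeff (F * G) j = (if j < m - d then 0 else (coeff P m * (\<lambda>_. inverse c)) * coeff F (j - (m - d)))" for j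
   unfolding G_def mult.commute[of F] coeff_monom_mult by simp
  have "coeff P' m = 0" using md F(4) by (simp add: P'_def cFG F(3) fun_eq_iff)
  moreover have "coeff P' j = 0" if "j > m" for j
  proof -
   have "coeff P j = 0" using that coeff_eq_0 m_def by blast
   moreover have "coeff F (j - (m - d)) = 0" using that md F(2) by (intro coeff_eq_0) auto
   ultimately show ?thesis by (simp add: P'_def cFG)
  qed
  ultimately have P'0: "coeff P' j = 0" if "j \<ge> m" for j using that by (cases "j = m") auto
  have "\<exists>B R. inv_coeffs v B \<and> inv_coeffs v R \<and> P' = F * B + R \<and> (\<forall>j\<ge>d. coeff R j = 0)"
  proof (cases "P' = 0")
   case True then show ?thesis by (intro exI[of _ 0]) auto
  next
   case False
   then have "degree P' < m" using P'0 by (metis leading_coeff_neq_0 not_le)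
   then show ?thesis using less.hyps[OF _ P'i] m_def by simp
  qed
  then obtain B R where "inv_coeffs v B" "inv_coeffs v R" "P' = F * B + R" "\<forall>j\<ge>d. coeff R j = 0" by blast
  then have "P = F * (B + G) + R" "inv_coeffs v (B + G)"
   using Gi by (simp_all add: P'_def inv_coeffs_add distrib_left diff_eq_eq)
  then show ?thesis using \<open>inv_coeffs v R\<close> \<open>\<forall>j\<ge>d. coeff R j = 0\<close> by blast
 qed
qed

text \<open>A homogeneous polynomial in Weierstrass position: with \<open>l\<close> as the variable
  along \<open>v\<close>, \<open>f\<close> is a non-zero constant times a monic polynomial of degree
  \<open>k\<close>.\<close>

locale monic_along =
 fixes f :: "complex^'n => complex" and v k l
 assumes hp: "hp k f" and fv: "f v \<noteq> 0" and lin: "lin l" and lv: "l v = 1"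
begin

lemma pf: "pf f" using hp_imp_pf[OF hp] .

lemma division:
 assumes "pf a"
 obtains b R where "pf b" "inv_coeffs v R" "a = f * b + poly R l" "\<forall>j\<ge>k. coeff R j = 0"
proof -
 obtain F where F: "inv_coeffs v F" "f = poly F l" "degree F \<le> k" "coeff F k = (\<lambda>_. f v)"
  using inv_coeffs_expand_hom[OF hp lin lv] .
 obtain P where P: "inv_coeffs v P" "a = poly P l" using inv_coeffs_expand[OF assms lin lv] .
 obtain B R where "inv_coeffs v B" "inv_coeffs v R" "P = F * B + R" "\<forall>j\<ge>k. coeff R j = 0"
  using inv_coeffs_division[OF F(1,3,4) fv P(1)] by blast
 then show thesis using P F inv_coeffs_pf_poly[OF _ lin] by (intro that[of "poly B l" R]) auto
qed

text \<open>A non-zero multiple of \<open>f\<close> has degree at least \<open>k\<close> in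
  \<open>l\<close>: the leading coefficient of \<open>f\<close> is a non-zero constant and kills
  nothing.\<close>

lemma remainder_unique:
 assumes "pf b" "inv_coeffs v R" "\<forall>j\<ge>k. coeff R j = 0" "f * b = poly R l"
 shows "R = 0"
proof -
 obtain F where F: "inv_coeffs v F" "f = poly F l" "degree F \<le> k" "coeff F k = (\<lambda>_. f v)"
  using inv_coeffs_expand_hom[OF hp lin lv] .
 obtain B where B: "inv_coeffs v B" "b = poly B l" using inv_coeffs_expand[OF assms(1) lin lv] .
 have "poly (F * B - R) l = 0"
  by (simp only: poly_diff poly_mult F(2)[symmetric] B(2)[symmetric] assms(4) diff_self)
 then have FB: "F * B - R = 0"
  by (rule inv_coeffs_unique[OF inv_coeffs_diff[OF inv_coeffs_mult[OF F(1) B(1)] assms(2)] lin lv])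
 have dF: "degree F = k" using F(3,4) fv le_degree[of F k] by (auto simp: fun_eq_iff)
 have "B = 0"
 proof (rule ccontr)
  assume "B \<noteq> 0"
  then obtain x where x: "coeff B (degree B) x \<noteq> 0" by (metis leading_coeff_neq_0 ext zero_fun_apply)
  have "coeff (F * B) (k + degree B) = coeff F k * coeff B (degree B)"
   using coeff_mult_degree_sum[of F B] dF by simp
  moreover have "coeff (F * B) (k + degree B) = 0" using FB assms(3) by simp
  ultimately have "(coeff F k * coeff B (degree B)) x = 0" by simp
  then show False using x fv F(4) by simp
 qed
 then show ?thesis using FB by simp
qed

text \<open>\<open>f\<close> is monic in \<open>l\<close> and \<open>g\<close> does not involve
  \<open>l\<close>, so the two are coprime. Concretely, \<open>g\<close> times the remainder of
  \<open>a\<close> is again a remainder and a multiple of \<open>f\<close>, hence zero.\<close>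

lemma dvd_cancel:
 assumes g: "g \<in> inv_dir v" "g \<noteq> 0" and "pf a" "pf b" "g * a = f * b"
 obtains c where "pf c" "a = f * c"
proof -
 obtain b' R where R: "pf b'" "inv_coeffs v R" "a = f * b' + poly R l" "\<forall>j\<ge>k. coeff R j = 0"
  using division[OF assms(3)] .
 have "f * (b - g * b') = poly (smult g R) l" using assms(5) R(3) by (simp add: algebra_simps)
 then have sR: "smult g R = 0"
  by (rule remainder_unique[OF pf_diff[OF assms(4) pf_mult[OF inv_dir_pf[OF g(1)] R(1)]]
    inv_coeffs_smult[OF g(1) R(2)], rotated]) (simp add: R(4))
 have "R = 0"
 proof (rule poly_eqI)
  fix j have "g * coeff R j = 0" using sR by (metis coeff_smult coeff_0)
  then show "coeff R j = coeff 0 j"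
   using pf_no_zero_divisors[of g "coeff R j"] g R(2) by (auto simp: inv_coeffs_def inv_dir_def)
 qed
 then show thesis using R that by simp
qed

text \<open>With \<open>g\<close> and \<open>h\<close> invariant along \<open>v\<close>, and \<open>h\<close> also along \<open>w\<close>, the triple \<open>f, g, h\<close> is a
 regular sequence.\<close>

lemma ideal_cancel:
 assumes g: "monic_along g w k' l'" "g \<in> inv_dir v"
  and h: "h \<in> inv_dir v" "h \<in> inv_dir w" "h \<noteq> 0"
  and pf: "pf a" "pf b" "pf b'" and eq: "h * a = f * b + g * b'"
 obtains \<alpha> \<beta> where "pf \<alpha>" "pf \<beta>" "a = f * \<alpha> + g * \<beta>"
proof -
 interpret g: monic_along g w k' l' by fact
 obtain \<alpha> R where R: "pf \<alpha>" "inv_coeffs v R" "a = f * \<alpha> + poly R l" "\<forall>j\<ge>k. coeff R j = 0"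
  using division[OF pf(1)] .
 obtain \<gamma> P where P: "pf \<gamma>" "inv_coeffs v P" "b' = f * \<gamma> + poly P l" "\<forall>j\<ge>k. coeff P j = 0"
  using division[OF pf(3)] .
 \<comment> \<open>Both \<open>a\<close> and \<open>b'\<close> are reduced modulo \<open>f\<close>.
   As \<open>g\<close> and \<open>h\<close> do not involve \<open>l\<close>, the combination on the
   right is still a remainder, so it vanishes coefficient by coefficient.\<close>
 have "f * (b + g * \<gamma> - h * \<alpha>) = poly (smult h R - smult g P) l"
  using eq R(3) P(3) by (simp add: algebra_simps)
 then have 0: "smult h R - smult g P = 0"
  by (rule remainder_unique[OF pf_diff[OF pf_add[OF pf(2) pf_mult[OF g.pf P(1)]]
     pf_mult[OF inv_dir_pf[OF h(1)] R(1)]]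
    inv_coeffs_diff[OF inv_coeffs_smult[OF h(1) R(2)] inv_coeffs_smult[OF g(2) P(2)]], rotated])
   (simp add: R(4) P(4))
 have "\<exists>c. pf c \<and> coeff R j = g * c" for j
 proof -
  \<comment> \<open>The roles shift by one: now \<open>g\<close> is monic along \<open>w\<close>,
    and \<open>h\<close> does not involve that coordinate.\<close>
  have "h * coeff R j = g * coeff P j" using arg_cong[OF 0, of "\<lambda>p. coeff p j"] by simp
  then obtain c where "pf c" "coeff R j = g * c"
   by (rule g.dvd_cancel[OF h(2,3) inv_dir_pf[OF inv_coeffsD[OF R(2)]] inv_dir_pf[OF inv_coeffsD[OF P(2)]]])
  then show ?thesis by (intro exI[of _ c] conjI)
 qed
 then have "\<exists>c. \<forall>j. pf (c j) \<and> coeff R j = g * c j" by (intro choice allI)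
 then obtain c where c: "\<And>j. pf (c j)" "\<And>j. coeff R j = g * c j" by blast
 define s where "s = (\<Sum>i\<le>degree R. c i * l ^ i)"
 have "pf s" unfolding s_def by (rule pf_sum[OF pf_mult[OF c(1) pf_power[OF poly_fun.linear[OF lin]]]])
 moreover have "poly R l = g * s"
  unfolding poly_altdef s_def sum_distrib_left by (intro sum.cong refl) (simp only: c(2) mult.assoc)
 ultimately show thesis using R(3) by (intro that[OF R(1), of s]) (simp_all only:)
qed

end

section \<open>Finite-dimensionality and algebraic independence\<close>

definition fsc :: "complex => ('x => complex) => 'x => complex" where
 "fsc c f = (\<lambda>x. c * f x)"

lemma fsc_apply [simp]: "fsc c f x = c * f x" by (simp add: fsc_def)

interpretation fs: vector_space fsc
 by unfold_locales (auto simp: fun_eq_iff algebra_simps)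

lemma fsc_mult: "fsc c f * g = fsc c (f * g)" "f * fsc c g = fsc c (f * g)"
 by (auto simp: fun_eq_iff algebra_simps)

lemma fsc_const: "fsc c f = (\<lambda>_. c) * f" by (auto simp: fun_eq_iff)

lemma pf_fsc [intro]: "pf p ==> pf (fsc c p)"
 unfolding fsc_const by auto

text \<open>Indexed by \<open>I\<close> instead of a set of vectors: the functions to which this is
  applied may coincide, and a coincidence is itself a relation.\<close>

lemma (in vector_space) family_dependent:
 assumes "finite I" "finite T" "card T < card I" "\<And>i. i \<in> I ==> F i \<in> span T"
 obtains c where "\<exists>i\<in>I. c i \<noteq> 0" "(\<Sum>i\<in>I. scale (c i) (F i)) = 0"
proof (cases "inj_on F I")
 case True
 have "dependent (F ` I)"
 proof (rule ccontr)
  assume "independent (F ` I)"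
  from independent_span_bound[OF assms(2) this] assms show False
   by (auto simp: card_image[OF True] image_subset_iff)
 qed
 then obtain u where "\<exists>v\<in>F ` I. u v \<noteq> 0" "(\<Sum>v\<in>F ` I. scale (u v) v) = 0"
  using dependent_finite[of "F ` I"] assms(1) by auto
 then show ?thesis using that[of "u \<circ> F"] True by (simp add: sum.reindex)
next
 case False
 then obtain i j where ij: "i \<in> I" "j \<in> I" "i \<noteq> j" "F i = F j" by (auto simp: inj_on_def)
 let ?c = "\<lambda>k. if k = i then 1 else if k = j then - 1 else 0 :: 'a"
 have "(\<Sum>k\<in>I. scale (?c k) (F k)) = (\<Sum>k\<in>{i,j}. scale (?c k) (F k))"
  using ij assms(1) by (intro sum.mono_neutral_right) auto
 also have "\<dots> = 0" using ij by simp
 finally have "(\<Sum>k\<in>I. scale (?c k) (F k)) = 0" .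
 moreover have "\<exists>k\<in>I. ?c k \<noteq> 0" by (rule bexI[OF _ ij(1)]) simp
 ultimately show ?thesis by (rule that[rotated])
qed

definition monom_fun :: "('n => nat) => complex^'n => complex" where
 "monom_fun \<alpha> = (\<lambda>x. \<Prod>i\<in>UNIV. x $ i ^ \<alpha> i)"

text \<open>Each exponent is bounded separately, not the total degree: the number of monomials is
  then at most a pure power, and the bounds still add under products.\<close>

definition monoms_le :: "nat => (complex^'n => complex) set" where
 "monoms_le s = monom_fun ` {\<alpha>. \<forall>i. \<alpha> i \<le> s}"

definition pdeg :: "nat => (complex^'n => complex) => bool" where
 "pdeg s p \<longleftrightarrow> p \<in> fs.span (monoms_le s)"

lemma finite_exponents: "finite {\<alpha> :: 'n::finite => nat. \<forall>i. \<alpha> i \<le> s}"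
 and card_exponents: "card {\<alpha> :: 'n::finite => nat. \<forall>i. \<alpha> i \<le> s} = (s + 1) ^ CARD('n)"
proof -
 have eq: "{\<alpha> :: 'n => nat. \<forall>i. \<alpha> i \<le> s} = (UNIV \<rightarrow>\<^sub>E {..s})" by (auto simp: PiE_def Pi_def)
 show "finite {\<alpha> :: 'n => nat. \<forall>i. \<alpha> i \<le> s}" unfolding eq by (intro finite_PiE) auto
 show "card {\<alpha> :: 'n => nat. \<forall>i. \<alpha> i \<le> s} = (s + 1) ^ CARD('n)" unfolding eq by (simp add: card_PiE)
qed

lemma finite_monoms_le: "finite (monoms_le s)" unfolding monoms_le_def using finite_exponents by auto
lemma card_monoms_le: "card (monoms_le s :: (complex^'n => complex) set) \<le> (s + 1) ^ CARD('n)"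
 unfolding monoms_le_def card_exponents[symmetric] by (rule card_image_le[OF finite_exponents])

lemma pdeg_mono: "s \<le> t ==> pdeg s p ==> pdeg t p"
 unfolding pdeg_def monoms_le_def
 by (erule rev_subsetD) (intro fs.span_mono image_mono Collect_mono impI allI, meson order_trans)

lemma pdeg_add: "pdeg s p ==> pdeg s q ==> pdeg s (p + q)" by (simp add: pdeg_def fs.span_add)
lemma pdeg_fsc: "pdeg s p ==> pdeg s (fsc c p)" by (simp add: pdeg_def fs.span_scale)
lemma pdeg_sum: "(\<And>i. i \<in> A ==> pdeg s (f i)) ==> pdeg s (sum f A)" by (simp add: pdeg_def fs.span_sum)

lemma pdeg_1: "pdeg 0 1"
proof -
 have "monom_fun (\<lambda>_. 0) = (1 :: complex^'n => complex)" by (simp add: monom_fun_def fun_eq_iff)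
 then have "(1 :: complex^'n => complex) \<in> monoms_le 0" unfolding monoms_le_def by (auto intro!: image_eqI[of _ monom_fun "\<lambda>_. 0"])
 then show ?thesis unfolding pdeg_def by (rule fs.span_base)
qed

lemma pdeg_component: "pdeg 1 (\<lambda>x::complex^'n. x $ i)"
proof -
 have "monom_fun (\<lambda>j. if j = i then 1 else 0) x = x $ i" for x :: "complex^'n"
 proof -
  have "monom_fun (\<lambda>j. if j = i then 1 else 0) x = (\<Prod>j\<in>UNIV. if j = i then x $ j else 1)"
   unfolding monom_fun_def by (intro prod.cong) auto
  then show ?thesis by simp
 qed
 then show ?thesis unfolding pdeg_def monoms_le_def
  by (intro fs.span_base image_eqI[of _ monom_fun "\<lambda>j. if j = i then 1 else 0"]) (auto simp: fun_eq_iff)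
qed

lemma pdeg_mult: assumes "pdeg s p" "pdeg t q" shows "pdeg (s + t) (p * q)"
proof -
 have *: "p * monom_fun \<beta> \<in> fs.span (monoms_le (s + t))" if "\<forall>i. \<beta> i \<le> t" for \<beta>
  using assms(1) unfolding pdeg_def
 proof (induction rule: fs.span_induct_alt)
  case (step c m p)
  then obtain \<alpha> where \<alpha>: "m = monom_fun \<alpha>" "\<forall>i. \<alpha> i \<le> s" by (auto simp: monoms_le_def)
  have "m * monom_fun \<beta> = monom_fun (\<lambda>i. \<alpha> i + \<beta> i)"
   by (simp add: \<alpha> monom_fun_def fun_eq_iff power_add prod.distrib)
  then have "m * monom_fun \<beta> \<in> monoms_le (s + t)" unfolding monoms_le_def using \<alpha> that by (auto intro!: imageI add_mono)
  from fs.span_add[OF fs.span_scale[OF fs.span_base[OF this]] step.IH]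
  show ?case by (simp only: distrib_right fsc_mult)
 qed (simp only: mult_zero_left fs.span_zero)
 have "p * q \<in> fs.span (monoms_le (s + t))"
  using assms(2) unfolding pdeg_def
 proof (induction rule: fs.span_induct_alt)
  case (step c m q)
  then obtain \<beta> where "m = monom_fun \<beta>" "\<forall>i. \<beta> i \<le> t" by (auto simp: monoms_le_def)
  then have "p * m \<in> fs.span (monoms_le (s + t))" using * by blast
  from fs.span_add[OF fs.span_scale[OF this] step.IH]
  show ?case by (simp only: distrib_left fsc_mult)
 qed (simp only: mult_zero_right fs.span_zero)
 then show ?thesis by (simp add: pdeg_def)
qed

lemma pdeg_power: "pdeg s p ==> pdeg (s * n) (p ^ n)"
 by (induction n) (auto simp: pdeg_1 intro: pdeg_mult)

lemma lin_expand: assumes "lin l" shows "l x = (\<Sum>i\<in>UNIV. x $ i * l (axis i 1))"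
proof -
 interpret l: Vector_Spaces.linear "(*s)" "(*)" l by fact
 have "l x = l (\<Sum>i\<in>UNIV. x $ i *s axis i 1)" by (simp add: basis_expansion)
 also have "\<dots> = (\<Sum>i\<in>UNIV. x $ i * l (axis i 1))" by (simp only: l.sum l.scale)
 finally show ?thesis .
qed

lemma pf_pdeg: "pf p ==> \<exists>s. pdeg s p"
proof (induction rule: poly_fun.induct)
 case (const c)
 have "(\<lambda>_. c) = fsc c 1" by (simp add: fun_eq_iff)
 then show ?case using pdeg_fsc[OF pdeg_1] by metis
next
 case (linear l)
 have "l = (\<Sum>i\<in>UNIV. fsc (l (axis i 1)) (\<lambda>x. x $ i))"
  by (rule ext) (subst lin_expand[OF linear], simp add: fun_sum_apply mult.commute)
 moreover have "pdeg 1 (\<Sum>i\<in>UNIV. fsc (l (axis i 1)) (\<lambda>x. x $ i))"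
  by (rule pdeg_sum[OF pdeg_fsc[OF pdeg_component]])
 ultimately show ?case by metis
next
 case (add p q) then obtain s t where "pdeg s p" "pdeg t q" by blast
 then have "pdeg (max s t) (p + q)"
  by (meson pdeg_add pdeg_mono max.cobounded1 max.cobounded2)
 then show ?case by (auto simp: plus_fun_def)
next
 case (mult p q) then obtain s t where "pdeg s p" "pdeg t q" by blast
 then show ?case using pdeg_mult[of s p t q] by (auto simp: times_fun_def)
qed

lemma pf_pdeg_list: assumes "\<forall>f\<in>set fs. pf f" obtains D where "\<forall>f\<in>set fs. pdeg D f"
 using assms
proof (induction fs arbitrary: thesis)
 case (Cons f fs)
 obtain D where D: "\<forall>f\<in>set fs. pdeg D f" using Cons by auto
 obtain s where "pdeg s f" using Cons.prems(2) pf_pdeg[of f] by auto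
 then have "\<forall>g\<in>set (f # fs). pdeg (max D s) g"
  using D pdeg_mono[of D "max D s"] pdeg_mono[of s "max D s"] by auto
 then show ?case using Cons.prems(1) by blast
qed simp

section \<open>Monomials in a list of polynomials and algebraic independence\<close>

definition lists_le :: "nat => nat => nat list set" where
 "lists_le k s = {l. set l \<subseteq> {..s} \<and> length l = k}"

lemma finite_lists_le: "finite (lists_le k s)" unfolding lists_le_def by (rule finite_lists_length_eq) auto
lemma card_lists_le: "card (lists_le k s) = (s + 1) ^ k" unfolding lists_le_def by (simp add: card_lists_length_eq)

lemma sum_lists_le_Suc: "(\<Sum>l\<in>lists_le (Suc k) s. g l) = (\<Sum>j\<le>s. \<Sum>l\<in>lists_le k s. g (j # l))"
proof -
 have "lists_le (Suc k) s = (\<lambda>(j, l). j # l) ` ({..s} \<times> lists_le k s)"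
  unfolding lists_le_def by (auto simp: length_Suc_conv image_iff)
 then have "(\<Sum>l\<in>lists_le (Suc k) s. g l) = (\<Sum>jl\<in>{..s} \<times> lists_le k s. g ((\<lambda>(j, l). j # l) jl))"
  by (simp add: sum.reindex inj_on_def)
 then show ?thesis by (simp add: sum.cartesian_product split_def)
qed

fun monl :: "('x => complex) list => nat list => 'x => complex" where
 "monl (f # fs) (j # l) = f ^ j * monl fs l"
| "monl _ _ = 1"

definition lcomb :: "('x => complex) list => nat => (nat list => complex) => 'x => complex" where
 "lcomb fs s c = (\<Sum>l\<in>lists_le (length fs) s. fsc (c l) (monl fs l))"

text \<open>For a prime ideal \<open>Q\<close> this says that the classes of \<open>fs\<close> are
  algebraically independent in the quotient by \<open>Q\<close>; for \<open>Q = {0}\<close> it is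
  ordinary algebraic independence.\<close>

definition alg_indep :: "(complex^'n => complex) set => (complex^'n => complex) list => bool" where
 "alg_indep Q fs \<longleftrightarrow> (\<forall>f\<in>set fs. pf f) \<and>
  (\<forall>s c. lcomb fs s c \<in> Q --> (\<forall>l\<in>lists_le (length fs) s. c l = 0))"

lemma lcomb_Cons: "lcomb (f # fs) s c = (\<Sum>j\<le>s. f ^ j * lcomb fs s (\<lambda>l. c (j # l)))"
 by (simp add: lcomb_def sum_lists_le_Suc sum_distrib_left fsc_mult)

lemma pdeg_monl: "\<forall>f\<in>set fs. pdeg D f ==> set l \<subseteq> {..s} ==> pdeg (D * s * length fs) (monl fs l)"
proof (induction fs l rule: monl.induct)
 case (1 f fs j l)
 then have "pdeg (D * j) (f ^ j)" using pdeg_power[of D f j] by simp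
 moreover have "D * j \<le> D * s" using 1 by auto
 ultimately have "pdeg (D * s) (f ^ j)" by (rule pdeg_mono[rotated])
 moreover have "pdeg (D * s * length fs) (monl fs l)" using 1 by simp
 moreover have "D * s * length (f # fs) = D * s + D * s * length fs" by simp
 ultimately show ?case using pdeg_mult by (metis monl.simps(1))
qed (auto intro: pdeg_mono[OF _ pdeg_1])

lemma pf_monl: "\<forall>f\<in>set fs. pf f ==> pf (monl fs l)"
 by (induction fs l rule: monl.induct) auto

lemma pf_lcomb: "\<forall>f\<in>set fs. pf f ==> pf (lcomb fs s c)"
 unfolding lcomb_def by (intro pf_sum pf_fsc pf_monl)

text \<open>A dimension count: the \<open>(s + 1) ^ length fs\<close> monomials in \<open>fs\<close>
  lie in a space whose dimension grows only like \<open>s ^ CARD('n)\<close>, so more than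
  \<open>CARD('n)\<close> polynomials are dependent once \<open>s\<close> is large.\<close>

lemma alg_indep_length:
 assumes "alg_indep {0} (fs :: (complex^'n => complex) list)"
 shows "length fs \<le> CARD('n)"
proof (rule ccontr)
 assume "\<not> ?thesis"
 then have len: "length fs \<ge> CARD('n) + 1" by simp
 obtain D where D: "\<forall>f\<in>set fs. pdeg D f" using assms pf_pdeg_list unfolding alg_indep_def by blast
 \<comment> \<open>With \<open>s = E ^ CARD('n)\<close> the dimension bound
   \<open>(E * (s + 1)) ^ CARD('n)\<close> equals \<open>s * (s + 1) ^ CARD('n)\<close>, just below
   the next power of \<open>s + 1\<close>.\<close>
 define E where "E = D * length fs + 1"
 define s where "s = E ^ CARD('n)"
 let ?I = "lists_le (length fs) s"
 have "card (monoms_le (D * s * length fs) :: (complex^'n => complex) set) \<le> (D * s * length fs + 1) ^ CARD('n)"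
  by (rule card_monoms_le)
 also have "\<dots> \<le> (E * (s + 1)) ^ CARD('n)" by (intro power_mono) (auto simp: E_def algebra_simps)
 also have "\<dots> = s * (s + 1) ^ CARD('n)" by (simp only: power_mult_distrib s_def)
 also have "\<dots> < (s + 1) ^ (CARD('n) + 1)" by simp
 also have "\<dots> \<le> (s + 1) ^ length fs" using len by (intro power_increasing) auto
 also have "\<dots> = card ?I" by (simp add: card_lists_le)
 finally have lt: "card (monoms_le (D * s * length fs) :: (complex^'n => complex) set) < card ?I" .
 obtain c where c: "\<exists>l\<in>?I. c l \<noteq> 0" "(\<Sum>l\<in>?I. fsc (c l) (monl fs l)) = 0"
  by (rule fs.family_dependent[OF finite_lists_le finite_monoms_le lt, of "monl fs"])
   (use pdeg_monl[OF D] in \<open>auto simp: lists_le_def pdeg_def\<close>)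
 then show False using assms unfolding alg_indep_def lcomb_def by blast
qed

section \<open>Ideals of polynomial functions and the Nullstellensatz\<close>

definition pideal :: "(complex^'n => complex) set => bool" where
 "pideal J \<longleftrightarrow> (\<forall>a\<in>J. pf a) \<and> 0 \<in> J \<and> (\<forall>a\<in>J. \<forall>b\<in>J. a + b \<in> J) \<and> (\<forall>a\<in>J. \<forall>b. pf b --> b * a \<in> J)"

definition pprime :: "(complex^'n => complex) set => bool" where
 "pprime J \<longleftrightarrow> pideal J \<and> 1 \<notin> J \<and> (\<forall>a b. pf a --> pf b --> a * b \<in> J --> a \<in> J \<or> b \<in> J)"

lemma pidealD:
 assumes "pideal J"
 shows "a \<in> J ==> pf a" "0 \<in> J" "a \<in> J ==> b \<in> J ==> a + b \<in> J"
  "a \<in> J ==> pf b ==> b * a \<in> J" "a \<in> J ==> pf b ==> a * b \<in> J" "a \<in> J ==> fsc c a \<in> J"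
  "a \<in> J ==> - a \<in> J" "a \<in> J ==> b \<in> J ==> a - b \<in> J"
proof -
 show *: "a \<in> J ==> pf a" "0 \<in> J" "a \<in> J ==> b \<in> J ==> a + b \<in> J" for a b
  using assms by (auto simp: pideal_def)
 show **: "a \<in> J ==> pf b ==> b * a \<in> J" for a b using assms by (auto simp: pideal_def)
 then show "a \<in> J ==> pf b ==> a * b \<in> J" by (simp add: mult.commute)
 show "a \<in> J ==> fsc c a \<in> J" unfolding fsc_const using ** by auto
 show m: "a \<in> J ==> - a \<in> J" for a using **[of a "- 1"] by auto
 show "a \<in> J ==> b \<in> J ==> a - b \<in> J" using *(3)[of a "- b"] m by auto
qed

lemma pideal_sum: "pideal J ==> (\<And>i. i \<in> A ==> f i \<in> J) ==> sum f A \<in> J"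
 by (induction A rule: infinite_finite_induct) (auto intro: pidealD)

lemma pprime_pideal: "pprime J ==> pideal J" by (simp add: pprime_def)
lemma pprimeD: "pprime J ==> pf a ==> pf b ==> a * b \<in> J ==> a \<in> J \<or> b \<in> J" by (auto simp: pprime_def)
lemma pprime_const: assumes "pprime J" "(\<lambda>_. c) \<in> J" shows "c = 0"
proof (rule ccontr)
 assume "c \<noteq> 0"
 then have "fsc (inverse c) (\<lambda>_. c) = (1 :: complex^'a => complex)" by (auto simp: fun_eq_iff)
 then show False using pidealD(6)[OF pprime_pideal[OF assms(1)] assms(2), of "inverse c"] assms(1)
  by (simp add: pprime_def)
qed
lemma pprime_power: "pprime J ==> pf a ==> a ^ n \<in> J ==> a \<in> J"
proof (induction n)
 case (Suc n) then show ?case using pprimeD[of J a "a ^ n"] by (metis pf_power power_Suc)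
qed (auto simp: pprime_def)

text \<open>Krull's argument: an ideal maximal among those disjoint from a multiplicative set is
  prime. The last conclusion keeps the maximality: modulo \<open>P\<close>, every polynomial outside
  \<open>P\<close> divides an element of \<open>S\<close>.\<close>

lemma prime_avoiding:
 fixes J :: "(complex^'n => complex) set"
 assumes J: "pideal J" and S: "1 \<in> S" "\<And>a b. a \<in> S ==> b \<in> S ==> a * b \<in> S" and disj: "J \<inter> S = {}"
 obtains P where "pprime P" "J \<subseteq> P" "P \<inter> S = {}"
  "\<And>p. pf p ==> p \<notin> P ==> \<exists>b. pf b \<and> (\<exists>c\<in>P. c + b * p \<in> S)"
proof -
 let ?A = "{I. pideal I \<and> J \<subseteq> I \<and> I \<inter> S = {}}"
 have "\<exists>M\<in>?A. \<forall>X\<in>?A. M \<subseteq> X --> X = M"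
 proof (rule subset_Zorn_nonempty)
  show "?A \<noteq> {}" using J disj by auto
  fix C assume C: "C \<noteq> {}" "subset.chain ?A C"
  then have CA: "\<And>I. I \<in> C ==> pideal I \<and> J \<subseteq> I \<and> I \<inter> S = {}" by (auto simp: subset.chain_def)
  have "pideal (\<Union>C)" unfolding pideal_def
  proof (intro conjI ballI allI impI)
   fix a b assume "a \<in> \<Union>C" "b \<in> \<Union>C"
   then obtain I K where IK: "I \<in> C" "K \<in> C" "a \<in> I" "b \<in> K" by blast
   have "\<forall>X\<in>C. \<forall>Y\<in>C. X \<subseteq> Y \<or> Y \<subseteq> X" using C(2) by (simp add: subset_chain_def)
   then have "I \<subseteq> K \<or> K \<subseteq> I" using IK by blast
   then have "\<exists>L\<in>C. a \<in> L \<and> b \<in> L" using IK by blast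
   then show "a + b \<in> \<Union>C" using CA pidealD(3) by blast
  next
   show "0 \<in> \<Union>C" using C(1) CA pidealD(2) by blast
  qed (use CA pidealD in blast)+
  then show "\<Union>C \<in> ?A" using CA C(1) by blast
 qed
 then obtain P where P0: "P \<in> ?A" and max0: "\<forall>X\<in>?A. P \<subseteq> X --> X = P" by (rule bexE) (rule that)
 from P0 have P: "pideal P" "J \<subseteq> P" "P \<inter> S = {}" by simp_all
 from max0 have max: "\<And>X. pideal X ==> J \<subseteq> X ==> X \<inter> S = {} ==> P \<subseteq> X ==> X = P" by simp
 have ext: "\<exists>b. pf b \<and> (\<exists>c\<in>P. c + b * p \<in> S)" if p: "pf p" "p \<notin> P" for p
 proof (rule ccontr)
  assume no: "\<not> ?thesis"
  let ?X = "{c + b * p | c b. c \<in> P \<and> pf b}"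
  have "pideal ?X" unfolding pideal_def
  proof (intro conjI ballI allI impI)
   fix a assume "a \<in> ?X" then show "pf a" using p pidealD(1)[OF P(1)] by auto
  next
   fix a b :: "complex^'n => complex" assume "a \<in> ?X" and b: "pf b"
   then obtain c d where "a = c + d * p" "c \<in> P" "pf d" by blast
   then have "b * a = b * c + (b * d) * p" "b * c \<in> P" "pf (b * d)"
    using b pidealD(4)[OF P(1)] by (auto simp: distrib_left mult.assoc)
   then show "b * a \<in> ?X" by blast
  next
   have "(0 :: complex^'n => complex) = 0 + 0 * p" by simp
   then show "0 \<in> ?X" using pidealD(2)[OF P(1)] pf_0 by blast
  next
   fix a b assume "a \<in> ?X" "b \<in> ?X"
   then obtain c d c' d' where "a = c + d * p" "b = c' + d' * p" "c \<in> P" "c' \<in> P" "pf d" "pf d'" by blast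
   then have "a + b = (c + c') + (d + d') * p" "c + c' \<in> P" "pf (d + d')"
    using pidealD(3)[OF P(1)] by (auto simp: algebra_simps)
   then show "a + b \<in> ?X" by blast
  qed
  moreover have sub: "P \<subseteq> ?X"
  proof
   fix c assume "c \<in> P"
   moreover have "c = c + 0 * p" by simp
   ultimately show "c \<in> ?X" using pf_0 by blast
  qed
  moreover have "?X \<inter> S = {}" using no by blast
  ultimately have "?X = P" using max P(2) by blast
  moreover have "p = 0 + 1 * p" by simp
  then have "p \<in> ?X" using pidealD(2)[OF P(1)] pf_1 by blast
  ultimately show False using p by blast
 qed
 have "pprime P" unfolding pprime_def
 proof (intro conjI allI impI)
  show "pideal P" by fact
  show "1 \<notin> P" using P(3) S(1) by blast
  fix a b assume ab: "pf a" "pf b" "a * b \<in> P"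
  show "a \<in> P \<or> b \<in> P"
  proof (rule ccontr)
   assume "\<not> ?thesis"
   then obtain u c v d where u: "pf u" "c \<in> P" "c + u * a \<in> S" "pf v" "d \<in> P" "d + v * b \<in> S"
    using ext ab by meson
   have "(c + u * a) * (d + v * b) = c * (d + v * b) + u * a * d + u * v * (a * b)"
    by (simp add: algebra_simps)
   also have "\<dots> \<in> P"
    by (intro pidealD(3)[OF P(1)] pidealD(5)[OF P(1) u(2)] pidealD(4)[OF P(1) u(5)]
      pidealD(4)[OF P(1) ab(3)] pf_add pf_mult pidealD(1)[OF P(1) u(5)] ab(1,2) u(1,4))
   finally show False using S(2)[OF u(3,6)] P(3) by blast
  qed
 qed
 then show ?thesis using that P ext by blast
qed

definition common_zeros :: "(complex^'n => complex) set => (complex^'n) set" where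
 "common_zeros J = {x. \<forall>p\<in>J. p x = 0}"

text \<open>A polynomial in one coordinate splits into linear factors over the complex numbers, and
  a prime ideal containing the product contains a factor.\<close>

lemma pprime_root:
 assumes "pprime P" "q \<noteq> 0" "(\<lambda>x. poly q (x $ i)) \<in> P" shows "\<exists>\<mu>. (\<lambda>x. x $ i - \<mu>) \<in> P"
 using assms(2,3)
proof (induction "degree q" arbitrary: q)
 case 0
 then obtain c where "q = [:c:]" using degree_eq_zeroE by metis
 then show ?case using 0 pprime_const[OF assms(1)] by auto
next
 case (Suc n)
 have "\<not> constant (poly q)" using Suc.hyps(2) by (simp add: constant_degree)
 then obtain \<mu> where "poly q \<mu> = 0" using fundamental_theorem_of_algebra by blast
 then obtain r where r: "q = [:- \<mu>, 1:] * r" by (metis poly_eq_0_iff_dvd dvdE)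
 have "degree q = Suc (degree r)" using r Suc.prems(1) by (simp add: degree_mult_eq del: mult_pCons_left)
 moreover have "(\<lambda>x. x $ i - \<mu>) * (\<lambda>x. poly r (x $ i)) \<in> P"
  using Suc.prems(2) by (simp add: r times_fun_def algebra_simps)
 moreover have "pf (\<lambda>x. poly r (x $ i))" unfolding poly_altdef by (intro pf_sum' pf_pointwise) auto
 moreover have "pf (\<lambda>x. x $ i - \<mu>)" by (intro pf_pointwise) auto
 ultimately have "(\<lambda>x. x $ i - \<mu>) \<in> P \<or> (\<lambda>x. poly r (x $ i)) \<in> P" "n = degree r" "r \<noteq> 0"
  using pprimeD[OF assms(1)] Suc.hyps(2) Suc.prems(1) r by auto
 then show ?case using Suc.hyps(1) by blast
qed

text \<open>Uncountably many arguments are spread over countably many fibres. It serves to fix an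
  exponent and a degree bound for infinitely many \<mu> at once.\<close>

lemma infinite_fibre:
 fixes h :: "complex => 'b::countable"
 obtains z where "infinite {\<mu>. h \<mu> = z}"
proof -
 have "\<exists>z. infinite {\<mu>. h \<mu> = z}"
 proof (rule ccontr)
  assume "\<not> ?thesis"
  then have "countable (\<Union>z. {\<mu>. h \<mu> = z})" by (intro countable_UN) (auto intro: countable_finite)
  moreover have "(\<Union>z. {\<mu>. h \<mu> = z}) = UNIV" by auto
  ultimately have "countable (UNIV :: complex set)" by metis
  then show False using uncountable_UNIV_complex by blast
 qed
 then show thesis using that by blast
qed

text \<open>The field \<open>\<complex>\<close> is uncountable while the polynomials have countable dimension; this yields
 the Nullstellensatz without any elimination theory.\<close>

theorem nullstellensatz:
 fixes J :: "(complex^'n => complex) set"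
 assumes J: "pideal J" and a: "pf a" and van: "\<And>x. x \<in> common_zeros J ==> a x = 0"
 obtains s where "a ^ s \<in> J"
proof -
 have "\<exists>s. a ^ s \<in> J"
 proof (rule ccontr)
  assume "\<not> ?thesis"
  then have disj: "J \<inter> range (\<lambda>s. a ^ s) = {}" by blast
  obtain P where P: "pprime P" "J \<subseteq> P" "P \<inter> range (\<lambda>s. a ^ s) = {}"
   and ext: "\<And>p. pf p ==> p \<notin> P ==> \<exists>b. pf b \<and> (\<exists>c\<in>P. c + b * p \<in> range (\<lambda>s. a ^ s))"
   by (rule prime_avoiding[OF J _ _ disj]) (auto simp: power_add[symmetric] intro: range_eqI[of _ _ 0])
  note PI = pprime_pideal[OF P(1)]
  have aP: "a ^ s \<notin> P" for s using P(3) by blast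
  have "\<exists>\<mu>. (\<lambda>x. x $ i - \<mu>) \<in> P" for i
  proof (rule ccontr)
   assume no: "\<not> ?thesis"
   \<comment> \<open>If no \<open>x $ i - \<mu>\<close> lies in \<open>P\<close>, each of them is
     invertible modulo \<open>P\<close> up to a power of \<open>a\<close>.\<close>
   have "\<exists>b s e. pf b \<and> pdeg e b \<and> b * (\<lambda>x. x $ i - \<mu>) - a ^ s \<in> P" for \<mu>
   proof -
    have "pf (\<lambda>x. x $ i - \<mu>)" by (intro pf_pointwise) auto
    then obtain b c s where b: "pf b" "c \<in> P" "c + b * (\<lambda>x. x $ i - \<mu>) = a ^ s"
     using ext no by blast
    then have "b * (\<lambda>x. x $ i - \<mu>) - a ^ s = - c" by (simp add: algebra_simps flip: b(3))
    then show ?thesis using b pf_pdeg pidealD(7)[OF PI] by metis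
   qed
   then obtain b s e where b: "\<And>\<mu>. pf (b \<mu>)" "\<And>\<mu>. pdeg (e \<mu>) (b \<mu>)"
    "\<And>\<mu>. b \<mu> * (\<lambda>x. x $ i - \<mu>) - a ^ s \<mu> \<in> P" by metis
   obtain z where z: "infinite {\<mu>. (s \<mu>, e \<mu>) = z}" using infinite_fibre[of "\<lambda>\<mu>. (s \<mu>, e \<mu>)"] .
   obtain k d where kd: "z = (k, d)" by fastforce
   obtain T where T: "finite T" "card T = (d + 1) ^ CARD('n) + 1" "T \<subseteq> {\<mu>. (s \<mu>, e \<mu>) = z}"
    using infinite_arbitrarily_large[OF z] by blast
   then have se: "s \<mu> = k" "e \<mu> = d" if "\<mu> \<in> T" for \<mu> using that kd by auto
   have "card (monoms_le d :: (complex^'n => complex) set) < card T"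
    by (rule le_less_trans[OF card_monoms_le]) (simp add: T(2))
   then obtain c where c: "\<exists>\<mu>\<in>T. c \<mu> \<noteq> 0" "(\<Sum>\<mu>\<in>T. fsc (c \<mu>) (b \<mu>)) = 0"
    using fs.family_dependent[OF T(1) finite_monoms_le, of d b] b(2) se(2) unfolding pdeg_def by metis
   define L where "L \<mu> = (\<lambda>x::complex^'n. x $ i - \<mu>)" for \<mu>
   have L: "pf (L \<mu>)" for \<mu> unfolding L_def by (intro pf_pointwise) auto
   \<comment> \<open>Multiplying a relation between the inverses by all factors
     \<open>L \<nu>\<close> clears denominators: \<open>R \<mu>\<close> is the product without its
     own factor, as in Lagrange interpolation.\<close>
   define R where "R \<mu> = (\<Prod>\<nu>\<in>T - {\<mu>}. L \<nu>)" for \<mu>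
   have R: "pf (R \<mu>)" for \<mu> unfolding R_def using L by auto
   have LR: "L \<mu> * R \<mu> = prod L T" if "\<mu> \<in> T" for \<mu>
    unfolding R_def using that T(1) by (simp add: prod.remove)
   define G where "G = (\<Sum>\<mu>\<in>T. fsc (c \<mu>) (R \<mu>))"
   have G: "pf G" unfolding G_def using R by auto
   have "(\<Sum>\<mu>\<in>T. fsc (c \<mu>) (R \<mu> * (b \<mu> * L \<mu> - a ^ k))) \<in> P"
    using b(3) se R unfolding L_def by (intro pideal_sum[OF PI] pidealD(6)[OF PI] pidealD(4)[OF PI]) auto
   also have "(\<Sum>\<mu>\<in>T. fsc (c \<mu>) (R \<mu> * (b \<mu> * L \<mu> - a ^ k)))
     = (\<Sum>\<mu>\<in>T. prod L T * fsc (c \<mu>) (b \<mu>)) - (\<Sum>\<mu>\<in>T. a ^ k * fsc (c \<mu>) (R \<mu>))"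
    unfolding sum_subtractf[symmetric]
   proof (rule sum.cong[OF refl])
    fix \<mu> assume "\<mu> \<in> T"
    have "fsc (c \<mu>) (R \<mu> * (b \<mu> * L \<mu> - a ^ k)) = (L \<mu> * R \<mu>) * fsc (c \<mu>) (b \<mu>) - a ^ k * fsc (c \<mu>) (R \<mu>)"
     by (simp add: fun_eq_iff algebra_simps)
    then show "fsc (c \<mu>) (R \<mu> * (b \<mu> * L \<mu> - a ^ k)) = prod L T * fsc (c \<mu>) (b \<mu>) - a ^ k * fsc (c \<mu>) (R \<mu>)"
     unfolding LR[OF \<open>\<mu> \<in> T\<close>] .
   qed
   also have "\<dots> = - (a ^ k * G)"
    unfolding G_def sum_distrib_left[symmetric] c(2) by simp
   finally have "- (a ^ k * G) \<in> P" .
   from pidealD(7)[OF PI this] have "a ^ k * G \<in> P" by (simp only: minus_minus)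
   then have GP: "G \<in> P" using pprimeD[OF P(1) pf_power[OF a] G] aP by blast
   define q where "q = (\<Sum>\<mu>\<in>T. smult (c \<mu>) (\<Prod>\<nu>\<in>T - {\<mu>}. [:- \<nu>, 1:]))"
   have "G = (\<lambda>x. poly q (x $ i))"
    unfolding G_def q_def R_def L_def by (simp add: fun_eq_iff fun_sum_apply fun_prod_apply poly_sum poly_prod)
   moreover have "q \<noteq> 0"
   proof -
    obtain \<mu> where \<mu>: "\<mu> \<in> T" "c \<mu> \<noteq> 0" using c(1) by blast
    \<comment> \<open>At a node \<mu> with non-zero coefficient all other Lagrange terms vanish, so
      \<open>q\<close> is not zero.\<close>
    have "poly q \<mu> = (\<Sum>\<kappa>\<in>T. c \<kappa> * (\<Prod>\<nu>\<in>T - {\<kappa>}. \<mu> - \<nu>))"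
     by (simp add: q_def poly_sum poly_prod)
    also have "\<dots> = (\<Sum>\<kappa>\<in>{\<mu>}. c \<kappa> * (\<Prod>\<nu>\<in>T - {\<kappa>}. \<mu> - \<nu>))"
     using \<mu> T(1) by (intro sum.mono_neutral_right) (auto intro!: prod_zero)
    also have "\<dots> \<noteq> 0" using \<mu> T(1) by auto
    finally show ?thesis by auto
   qed
   ultimately have "\<exists>\<mu>. (\<lambda>x. x $ i - \<mu>) \<in> P" using pprime_root[OF P(1)] GP by metis
   then show False using no by blast
  qed
  then obtain m where m: "\<And>i. (\<lambda>x. x $ i - m i) \<in> P" by metis
  define z where "z = (\<chi> i. m i)"
  \<comment> \<open>Modulo \<open>P\<close> every coordinate is a constant, so reduction modulo
    \<open>P\<close> is evaluation at \<open>z\<close>. This point lies on the zero set of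
    \<open>J\<close>, although \<open>a\<close> is not in \<open>P\<close>.\<close>
  have mod: "p - (\<lambda>_. p z) \<in> P" if "pf p" for p
   using that
  proof (induction rule: poly_fun.induct)
   case (const c) show ?case using pidealD(2)[OF PI] by (simp add: fun_diff_def zero_fun_def)
  next
   case (linear l)
   have "l x - l z = (\<Sum>i\<in>UNIV. l (axis i 1) * (x $ i - m i))" for x
    by (simp only: lin_expand[OF linear, of x] lin_expand[OF linear, of z])
     (simp add: z_def algebra_simps sum_subtractf)
   then have "l - (\<lambda>_. l z) = (\<Sum>i\<in>UNIV. fsc (l (axis i 1)) (\<lambda>x. x $ i - m i))"
    by (simp add: fun_eq_iff fun_sum_apply)
   also have "\<dots> \<in> P" by (intro pideal_sum[OF PI] pidealD(6)[OF PI] m)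
   finally show ?case .
  next
   case (add p q)
   from pidealD(3)[OF PI add.IH] show ?case by (simp add: plus_fun_def fun_diff_def algebra_simps)
  next
   case (mult p q)
   have "(\<lambda>x. p x * q x) - (\<lambda>_. p z * q z) = q * (p - (\<lambda>_. p z)) + fsc (p z) (q - (\<lambda>_. q z))"
    by (simp add: fun_eq_iff algebra_simps)
   also have "\<dots> \<in> P" using mult by (intro pidealD(3)[OF PI] pidealD(4)[OF PI] pidealD(6)[OF PI])
   finally show ?case .
  qed
  have "p z = 0" if "p \<in> J" for p
  proof -
   have "p - (p - (\<lambda>_. p z)) \<in> P"
    by (rule pidealD(8)[OF PI subsetD[OF P(2) that] mod[OF pidealD(1)[OF J that]]])
   then show ?thesis using pprime_const[OF P(1)] by simp
  qed
  then have "a z = 0" using van by (simp add: common_zeros_def)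
  then have "a ^ 1 \<in> P" using mod[OF a] by (simp add: fun_diff_def)
  then show False using aP by blast
 qed
 then show thesis using that by blast
qed

section \<open>Prime chains and codimension\<close>

interpretation fsp: vector_space_pair fsc "(*) :: complex => complex => complex" ..

text \<open>Used contrapositively: an element outside a subspace is detected by one scalar, which
  turns membership questions into questions on univariate polynomials.\<close>

lemma separating_functional:
 assumes "fs.subspace P" "p \<notin> P"
 obtains \<Lambda> where "Vector_Spaces.linear fsc (*) \<Lambda>" "\<And>q. q \<in> P ==> \<Lambda> q = 0" "\<Lambda> p = 1"
proof -
 obtain B where B: "B \<subseteq> P" "fs.independent B" "P \<subseteq> fs.span B"
  using fs.maximal_independent_subset by blast
 have sp: "fs.span B \<subseteq> P" using B(1) assms(1) by (rule fs.span_minimal)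
 then have "p \<notin> fs.span B" using assms(2) by blast
 then have ind: "fs.independent (insert p B)" using B(2) by (rule fs.independent_insertI)
 obtain \<Lambda> where L: "Vector_Spaces.linear fsc (*) \<Lambda>" "\<forall>x\<in>insert p B. \<Lambda> x = (if x = p then 1 else 0)"
  using fsp.linear_independent_extend[OF ind, of "\<lambda>x. if x = p then 1 else 0"] by blast
 interpret L: Vector_Spaces.linear fsc "(*)" \<Lambda> by fact
 have B0: "\<Lambda> b = 0" if "b \<in> B" for b
  using L(2) that \<open>p \<notin> fs.span B\<close> fs.span_base[OF that] by auto
 have "\<Lambda> q = 0" if "q \<in> P" for q
  using L.eq_0_on_span[OF B0, of B q] that B(3) by blast
 moreover have "\<Lambda> p = 1" using L(2) by simp
 ultimately show ?thesis using that L(1) by blast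
qed

definition van :: "(complex^'n) set => (complex^'n => complex) set" where
 "van K = {p. pf p \<and> (\<forall>x\<in>K. p x = 0)}"

lemma pideal_van: "pideal (van K)"
 unfolding pideal_def van_def by auto

lemma van_common_zeros: assumes "pprime P" shows "van (common_zeros P) = P"
proof
 show "P \<subseteq> van (common_zeros P)"
  using pidealD(1)[OF pprime_pideal[OF assms]] by (auto simp: van_def common_zeros_def)
 show "van (common_zeros P) \<subseteq> P"
 proof
  fix p assume p: "p \<in> van (common_zeros P)"
  then obtain s where "p ^ s \<in> P"
   using nullstellensatz[OF pprime_pideal[OF assms], of p] by (auto simp: van_def)
  then show "p \<in> P" using pprime_power[OF assms] p by (auto simp: van_def)
 qed
qed

definition inv_dirs :: "(complex^'n) set => (complex^'n => complex) set" where
 "inv_dirs D = {p. pf p \<and> (\<forall>v\<in>D. p \<in> inv_dir v)}"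

lemma inv_dirsI: "pf p ==> (\<And>v x t. v \<in> D ==> p (x + t *s v) = p x) ==> p \<in> inv_dirs D"
 by (auto simp: inv_dirs_def inv_dir_def)
lemma inv_dirs_pf: "p \<in> inv_dirs D ==> pf p" by (auto simp: inv_dirs_def)
lemma inv_dirs_mult: "p \<in> inv_dirs D ==> q \<in> inv_dirs D ==> p * q \<in> inv_dirs D"
 by (auto simp: inv_dirs_def inv_dir_mult)

lemma alg_indep_weaken: "alg_indep Q fs ==> 0 \<in> Q ==> alg_indep {0} fs"
 unfolding alg_indep_def by (metis singletonD)

text \<open>Induction on the list: along the basis vector \<open>b\<close> only the coordinate of
  \<open>b\<close> varies, so a relation restricted to such a line is a univariate polynomial whose
  coefficients are the shorter combinations.\<close>

lemma alg_indep_coordinates: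
 fixes B :: "(complex^'n) set"
 assumes B: "vec.independent B" "vec.span B = UNIV"
 shows "distinct bs ==> set bs \<subseteq> B ==> alg_indep {0} (map (\<lambda>b x. vec.representation B x b) bs)"
proof (induction bs)
 case Nil
 have "lists_le 0 s = {[]}" for s by (auto simp: lists_le_def)
 then have lc: "lcomb [] s c = (\<lambda>_ :: complex^'n. c [])" for s and c :: "nat list => complex"
  by (simp add: lcomb_def fun_eq_iff)
 moreover have "c = 0" if "(\<lambda>_ :: complex^'n. c) = 0" for c :: complex using fun_cong[OF that] by simp
 ultimately have "c [] = 0" if h: "lcomb [] s c \<in> {0 :: complex^'n => complex}" for s and c :: "nat list => complex"
 proof -
  have "(\<lambda>_ :: complex^'n. c []) = 0"
   using singletonD[OF h] lc[of s c] by (simp only:)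
  from fun_cong[OF this] show ?thesis by simp
 qed
 then show ?case unfolding alg_indep_def using \<open>\<And>s. lists_le 0 s = {[]}\<close> by auto
next
 case (Cons b bs)
 let ?\<tau> = "\<lambda>b x. vec.representation B x b"
 have radd: "?\<tau> b' (x + t *s b) = ?\<tau> b' x + t * (if b' = b then 1 else 0)" for b' x t
  using Cons.prems(2) B by (simp add: vec.representation_add vec.representation_scale vec.representation_basis)
 have rlin: "lin (?\<tau> b')" for b'
  by (rule linI) (simp_all add: B vec.representation_add vec.representation_scale)
 have mono: "monl (map ?\<tau> bs) l (x + t *s b) = monl (map ?\<tau> bs) l x" for l x t
  using Cons.prems(1)
 proof (induction bs arbitrary: l)
  case (Cons a as) then show ?case by (cases l) (auto simp: radd fun_power_apply)
 qed simp
 have IH: "alg_indep {0} (map ?\<tau> bs)" by (rule Cons.IH) (use Cons.prems in auto)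
 show ?case unfolding alg_indep_def
 proof (intro conjI allI impI ballI)
  fix f assume "f \<in> set (map ?\<tau> (b # bs))" then show "pf f" using rlin by (auto intro: poly_fun.linear)
 next
  fix s c l assume 0: "lcomb (map ?\<tau> (b # bs)) s c \<in> {0}" and l: "l \<in> lists_le (length (map ?\<tau> (b # bs))) s"
  define G where "G j = lcomb (map ?\<tau> bs) s (\<lambda>l. c (j # l))" for j
  have Ginv: "G j (x + t *s b) = G j x" for j x t
   unfolding G_def lcomb_def by (simp add: fun_sum_apply mono)
  have "G j x = 0" if "j \<le> s" for j x
  proof -
   define p where "p = (\<Sum>i\<le>s. monom (G i x) i)"
   have "poly p u = 0" for u
   proof -
    define y where "y = x + (u - ?\<tau> b x) *s b"
    have "lcomb (map ?\<tau> (b # bs)) s c y = (\<Sum>i\<le>s. ?\<tau> b y ^ i * G i y)"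
     by (simp only: list.map lcomb_Cons G_def fun_sum_apply times_fun_apply fun_power_apply)
    moreover have "?\<tau> b y = u" unfolding y_def radd by simp
    moreover have "G i y = G i x" for i unfolding y_def by (rule Ginv)
    ultimately show ?thesis using 0 by (simp add: p_def poly_sum poly_monom mult.commute)
   qed
   then have "p = 0" using poly_all_0_iff_0 by blast
   then have "coeff p j = 0" by simp
   then show ?thesis using that by (simp add: p_def coeff_sum)
  qed
  then have G0: "G j \<in> {0}" if "j \<le> s" for j using that by (auto simp: fun_eq_iff)
  obtain j l' where jl: "l = j # l'" "j \<le> s" "l' \<in> lists_le (length (map ?\<tau> bs)) s"
   using l by (cases l) (auto simp: lists_le_def)
  show "c l = 0" using IH G0[OF jl(2)] jl(3) unfolding alg_indep_def G_def jl(1) by blast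
 qed
qed

text \<open>Extend \<open>D\<close> to a basis; the coordinates belonging to the new basis vectors
  are coordinates on the quotient by the span of \<open>D\<close>.\<close>

lemma directions_coordinates:
 fixes D :: "(complex^'n) set"
 assumes "vec.independent D"
 obtains fs where "length fs = CARD('n) - card D" "alg_indep {0} fs"
  "\<And>s c. lcomb fs s c \<in> inv_dirs D" "\<And>f. f \<in> set fs ==> lin f \<and> f \<in> inv_dirs D \<and> f \<noteq> 0"
proof -
 obtain B where B: "D \<subseteq> B" "vec.independent B" "vec.span B = UNIV"
  using vec.maximal_independent_subset_extend[of D UNIV] assms by (metis subset_UNIV top.extremum_uniqueI)
 have fB: "finite B" using B(2) by (rule vec.finiteI_independent)
 have cB: "card B = CARD('n)"
  using vec.dim_eq_card_independent[OF B(2)] vec.dim_span[of B] B(3) vec_dim_card[where 'n='n and 'a=complex]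
  by metis
 obtain bs where bs: "set bs = B - D" "distinct bs" using finite_distinct_list[of "B - D"] fB by blast
 let ?\<tau> = "\<lambda>b x. vec.representation B x b"
 have rlin: "lin (?\<tau> b)" for b
  by (rule linI) (simp_all add: B vec.representation_add vec.representation_scale)
 have rinv: "?\<tau> b (x + t *s v) = ?\<tau> b x" if "v \<in> D" "b \<notin> D" for v b x t
 proof -
  have "v \<in> B" "b \<noteq> v" using that B(1) by auto
  then show ?thesis using B by (simp add: vec.representation_add vec.representation_scale vec.representation_basis)
 qed
 have m: "monl (map ?\<tau> cs) l (x + t *s v) = monl (map ?\<tau> cs) l x" if "v \<in> D" "set cs \<inter> D = {}" for cs l x t v
  using that(2)
 proof (induction cs arbitrary: l)
  case (Cons a as) then show ?case by (cases l) (simp_all add: rinv[OF that(1)] fun_power_apply)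
 qed simp
 show ?thesis
 proof (rule that[of "map ?\<tau> bs"])
  show "length (map ?\<tau> bs) = CARD('n) - card D"
   using bs distinct_card[OF bs(2)] card_Diff_subset[of D B] B(1) fB cB finite_subset by auto
  show "alg_indep {0} (map ?\<tau> bs)" using alg_indep_coordinates[OF B(2,3) bs(2)] bs(1) by blast
  show "lcomb (map ?\<tau> bs) s c \<in> inv_dirs D" for s c
  proof (rule inv_dirsI)
   show "pf (lcomb (map ?\<tau> bs) s c)" by (rule pf_lcomb) (use rlin in \<open>auto intro: poly_fun.linear\<close>)
   show "lcomb (map ?\<tau> bs) s c (x + t *s v) = lcomb (map ?\<tau> bs) s c x" if "v \<in> D" for v x t
   proof -
    have "set bs \<inter> D = {}" using bs by auto
    then show ?thesis unfolding lcomb_def fun_sum_apply fsc_apply using m[OF that] by simp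
   qed
  qed
  show "lin f \<and> f \<in> inv_dirs D \<and> f \<noteq> 0" if f: "f \<in> set (map ?\<tau> bs)" for f
  proof -
   obtain b where b: "f = ?\<tau> b" "b \<in> B" "b \<notin> D" using f unfolding set_map bs(1) by blast
   have "f b = 1" using b B by (simp add: vec.representation_basis)
   then have "f \<noteq> 0" by auto
   moreover have "f \<in> inv_dirs D" unfolding b(1)
    by (rule inv_dirsI[OF poly_fun.linear[OF rlin]]) (use rinv b(3) in auto)
   ultimately show ?thesis using rlin b(1) by blast
  qed
 qed
qed

text \<open>Going down from \<open>P\<close> to a smaller prime \<open>Q\<close> gains one
  independent element, any \<open>f\<close> in the difference. In a relation modulo \<open>Q\<close>
  the lowest power of \<open>f\<close> can be divided off, since \<open>f\<close> is not in
  \<open>Q\<close>; reading the rest modulo \<open>P\<close> kills the terms with \<open>f\<close>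
  and leaves a relation among \<open>fs\<close>.\<close>

lemma alg_indep_step:
 assumes P: "pideal P" "alg_indep P fs" and Q: "pprime Q" "Q \<subseteq> P" and f: "f \<in> P" "f \<notin> Q"
 shows "alg_indep Q (f # fs)"
 unfolding alg_indep_def
proof (intro conjI allI impI ballI)
 fix g assume "g \<in> set (f # fs)"
 then show "pf g" using P(2) pidealD(1)[OF P(1) f(1)] by (auto simp: alg_indep_def)
next
 fix s c l assume comb: "lcomb (f # fs) s c \<in> Q" and l: "l \<in> lists_le (length (f # fs)) s"
 define G where "G j = lcomb fs s (\<lambda>l. c (j # l))" for j
 have pfG: "pf (G j)" for j unfolding G_def using P(2) by (intro pf_lcomb) (auto simp: alg_indep_def)
 have pff: "pf f" using pidealD(1)[OF P(1) f(1)] .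
 have main: "j \<le> s ==> \<forall>l\<in>lists_le (length fs) s. c (j # l) = 0" for j
 proof (induction j rule: less_induct)
  case (less j)
  have G0: "G i = 0" if "i < j" for i
   unfolding G_def lcomb_def using less that by (intro sum.neutral) (auto simp: fun_eq_iff)
  define H where "H = (\<Sum>i\<in>{j<..s}. f ^ (i - j - 1) * G i)"
  have "lcomb (f # fs) s c = (\<Sum>i\<le>s. f ^ i * G i)" unfolding lcomb_Cons G_def ..
  also have "\<dots> = (\<Sum>i\<in>{j..s}. f ^ i * G i)"
   by (rule sum.mono_neutral_right) (auto simp: G0 not_le simp del: times_fun_apply)
  also have "\<dots> = f ^ j * G j + (\<Sum>i\<in>{j<..s}. f ^ i * G i)"
   using less.prems by (subst sum.head) auto
  also have "(\<Sum>i\<in>{j<..s}. f ^ i * G i) = f ^ j * (f * H)"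
   unfolding H_def sum_distrib_left
  proof (rule sum.cong[OF refl])
   fix i assume "i \<in> {j<..s}"
   then have "i = j + (1 + (i - j - 1))" by auto
   then have "f ^ i = f ^ j * (f * f ^ (i - j - 1))" by (metis power_add power_one_right)
   then show "f ^ i * G i = f ^ j * (f * (f ^ (i - j - 1) * G i))" by (simp only: mult.assoc)
  qed
  finally have "f ^ j * (G j + f * H) \<in> Q" using comb by (simp only: distrib_left)
  moreover have pfH: "pf H" unfolding H_def using pfG pff by auto
  moreover have "f ^ j \<notin> Q" using pprime_power[OF Q(1) pff] f(2) by blast
  ultimately have "G j + f * H \<in> Q"
   using pprimeD[OF Q(1) pf_power[OF pff] pf_add[OF pfG pf_mult[OF pff pfH]]] by blast
  then have "G j + f * H - f * H \<in> P"
   using Q(2) pidealD(5)[OF P(1) f(1) pfH] by (intro pidealD(8)[OF P(1)]) auto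
  then have "G j \<in> P" by (simp only: add_diff_cancel_right')
  then show ?case using P(2) unfolding alg_indep_def G_def by blast
 qed
 obtain j l' where "l = j # l'" "j \<le> s" "l' \<in> lists_le (length fs) s"
  using l by (cases l) (auto simp: lists_le_def)
 then show "c l = 0" using main by blast
qed

lemma alg_indep_chain:
 assumes "\<And>i. i \<le> c ==> pprime (P i)" "\<And>i. i < c ==> P (Suc i) \<subset> P i" "alg_indep (P 0) fs"
 shows "\<exists>gs. length gs = c + length fs \<and> alg_indep (P c) gs"
 using assms(1,2)
proof (induction c)
 case 0 then show ?case using assms(3) by auto
next
 case (Suc c)
 then obtain gs where gs: "length gs = c + length fs" "alg_indep (P c) gs" by auto
 obtain f where "f \<in> P c" "f \<notin> P (Suc c)" using Suc.prems(2)[of c] by blast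
 then have "alg_indep (P (Suc c)) (f # gs)"
  using alg_indep_step[OF pprime_pideal gs(2)] Suc.prems by (meson le_SucI lessI less_imp_le order_refl)
 then show ?case using gs(1) by (intro exI[of _ "f # gs"]) auto
qed

text \<open>The hypothesis on \<open>P 0\<close> keeps the \<open>CARD('n) - card D\<close>
  coordinates of the quotient independent modulo \<open>P 0\<close>. Each step down the chain adds
  one element, and \<open>card D + 1\<close> steps give one more than
  \<open>CARD('n)\<close>.\<close>

lemma prime_chain_bound:
 fixes P :: "nat => (complex^'n => complex) set"
 assumes "\<And>i. i \<le> c ==> pprime (P i)" "\<And>i. i < c ==> P (Suc i) \<subset> P i"
  and D: "vec.independent D" "c = Suc (card D)" and 0: "P 0 \<inter> inv_dirs D \<subseteq> {0}"
 shows False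
proof -
 obtain fs where fs: "length fs = CARD('n) - card D" "alg_indep {0} fs" "\<And>s c. lcomb fs s c \<in> inv_dirs D"
  using directions_coordinates[OF D(1)] by metis
 have "alg_indep (P 0) fs" using fs(2,3) 0 unfolding alg_indep_def by blast
 from alg_indep_chain[OF assms(1,2) this] obtain gs
  where gs: "length gs = c + length fs" "alg_indep (P c) gs" by blast
 have "alg_indep {0} gs"
  using gs(2) pidealD(2)[OF pprime_pideal[OF assms(1)[of c]]] by (auto intro: alg_indep_weaken)
 from alg_indep_length[OF this] gs(1) fs(1) D(2) show False by linarith
qed

lemma irreducible_chain_prefix: "irreducible_chain X c K ==> b \<le> c ==> irreducible_chain X b K"
 by (auto simp: irreducible_chain_def)

lemma codim_chain:
 assumes "codim X Z \<ge> enat c" "closedin X Y" "irreducible_set X Y" "Y \<subseteq> Z"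
 obtains K where "irreducible_chain X c K" "K 0 = Y"
proof -
 let ?C = "{c. \<exists>K. irreducible_chain X c K \<and> K 0 = Y}"
 have "\<exists>b\<in>?C. c \<le> b"
 proof (rule ccontr)
  assume no: "\<not> ?thesis"
  \<comment> \<open>The chain of length zero shows \<open>c > 0\<close>; only then is
    \<open>c - 1\<close> below a smaller bound.\<close>
  have "irreducible_chain X 0 (\<lambda>_. Y)" using assms by (simp add: irreducible_chain_def)
  then have "0 \<in> ?C" by auto
  with no have "c > 0" by auto
  have "codim X Z \<le> (SUP c\<in>?C. enat c)" unfolding codim_def using assms by (intro INF_lower) auto
  also have "\<dots> \<le> enat (c - 1)" using no by (intro SUP_least) (auto simp: not_le)
  finally have "enat c \<le> enat (c - 1)" using assms(1) by (rule order_trans[rotated])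
  then show False using \<open>c > 0\<close> by simp
 qed
 then show thesis using that irreducible_chain_prefix by blast
qed

section \<open>Affine and projective closed sets\<close>

lemma affine_topspace: "topspace (affine_zariski (*s) :: (complex^'n) topology) = UNIV"
proof -
 have "openin (affine_zariski (*s) :: (complex^'n) topology) UNIV"
  unfolding openin_affine_zariski by (intro exI[of _ "{\<lambda>_. 1}"]) auto
 then show ?thesis using openin_subset by blast
qed

lemma closedin_affine:
 "closedin (affine_zariski (*s)) Y \<longleftrightarrow> (\<exists>S. (\<forall>p\<in>S. pf p) \<and> Y = common_zeros S)"
 unfolding closedin_def affine_topspace openin_affine_zariski common_zeros_def Compl_eq_Diff_UNIV[symmetric]
 by simp

lemma affine_irreducible_prime:
 assumes "irreducible_set (affine_zariski (*s)) Y" shows "pprime (van Y)"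
 unfolding pprime_def
proof (intro conjI allI impI pideal_van)
 show "1 \<notin> van Y" using assms by (auto simp: irreducible_set_def van_def)
 fix a b assume ab: "pf a" "pf b" "a * b \<in> van Y"
 have "Y \<subseteq> common_zeros {a} \<union> common_zeros {b}" using ab(3) by (auto simp: van_def common_zeros_def)
 moreover have "closedin (affine_zariski (*s)) (common_zeros {a})" "closedin (affine_zariski (*s)) (common_zeros {b})"
  using ab unfolding closedin_affine by auto
 ultimately have "Y \<subseteq> common_zeros {a} \<or> Y \<subseteq> common_zeros {b}"
  using assms unfolding irreducible_set_def by blast
 then show "a \<in> van Y \<or> b \<in> van Y" using ab by (auto simp: van_def common_zeros_def)
qed

lemma affine_prime_irreducible:
 assumes "pprime (van Y)" shows "irreducible_set (affine_zariski (*s)) Y"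
 unfolding irreducible_set_def affine_topspace
proof (intro conjI allI impI)
 show "Y \<noteq> {}" using assms by (auto simp: pprime_def van_def)
 fix A B assume "closedin (affine_zariski (*s)) A \<and> closedin (affine_zariski (*s)) B \<and> Y \<subseteq> A \<union> B"
 then obtain S T where ST: "\<forall>p\<in>S. pf p" "A = common_zeros S" "\<forall>p\<in>T. pf p" "B = common_zeros T" "Y \<subseteq> A \<union> B"
  unfolding closedin_affine by blast
 show "Y \<subseteq> A \<or> Y \<subseteq> B"
 proof (rule ccontr)
  assume "\<not> ?thesis"
  then obtain p q x y where *: "p \<in> S" "x \<in> Y" "p x \<noteq> 0" "q \<in> T" "y \<in> Y" "q y \<noteq> 0"
   unfolding ST common_zeros_def by blast
  have "p * q \<in> van Y" using ST * by (auto simp: van_def common_zeros_def)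
  then have "p \<in> van Y \<or> q \<in> van Y" using pprimeD[OF assms] ST * by blast
  then show False using * by (auto simp: van_def)
 qed
qed simp

lemma affine_closed_zeros: "closedin (affine_zariski (*s)) Y ==> common_zeros (van Y) = Y"
 unfolding closedin_affine by (auto simp: common_zeros_def van_def)

text \<open>The dimension count behind the next lemmas: a prime \<open>P\<close> maximal among those not meeting the
 ring of polynomials invariant under \<open>D\<close> defines an irreducible set of codimension at most \<open>card D\<close>.\<close>

theorem affine_codim_direction:
 fixes Z :: "(complex^'n) set"
 assumes Z: "closedin (affine_zariski (*s)) Z" and cod: "codim (affine_zariski (*s)) Z \<ge> enat (Suc (card D))"
  and D: "vec.independent D"
 obtains g where "g \<in> inv_dirs D" "g \<noteq> 0" "\<And>x. x \<in> Z ==> g x = 0"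
proof -
 have "\<exists>g\<in>inv_dirs D - {0}. g \<in> van Z"
 proof (rule ccontr)
  assume "\<not> ?thesis"
  then have disj: "van Z \<inter> (inv_dirs D - {0}) = {}" by blast
  have m: "a * b \<in> inv_dirs D - {0}" if "a \<in> inv_dirs D - {0}" "b \<in> inv_dirs D - {0}" for a b
   using that inv_dirs_mult pf_no_zero_divisors inv_dirs_pf by (metis DiffD1 DiffD2 DiffI singletonD singletonI)
  have "1 \<in> inv_dirs D - {0}" by (auto simp: inv_dirs_def)
  then obtain P where P: "pprime P" "van Z \<subseteq> P" "P \<inter> (inv_dirs D - {0}) = {}"
   using prime_avoiding[OF pideal_van _ m disj] by metis
  let ?X = "affine_zariski (*s) :: (complex^'n) topology"
  define Y where "Y = common_zeros P"
  have vY: "van Y = P" unfolding Y_def by (rule van_common_zeros[OF P(1)])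
  have cl: "closedin ?X Y" unfolding Y_def closedin_affine using pidealD(1)[OF pprime_pideal[OF P(1)]] by blast
  have irr: "irreducible_set ?X Y" by (rule affine_prime_irreducible) (simp add: vY P)
  have "Y \<subseteq> common_zeros (van Z)" using P(2) unfolding Y_def common_zeros_def by blast
  then have "Y \<subseteq> Z" using affine_closed_zeros[OF Z] by simp
  from codim_chain[OF cod cl irr this] obtain K where K: "irreducible_chain ?X (Suc (card D)) K" "K 0 = Y" .
  show False
  proof (rule prime_chain_bound[of "Suc (card D)" "\<lambda>i. van (K i)" D])
   show "pprime (van (K i))" if "i \<le> Suc (card D)" for i
    using K(1) that by (intro affine_irreducible_prime) (auto simp: irreducible_chain_def)
   show "van (K (Suc i)) \<subset> van (K i)" if i: "i < Suc (card D)" for i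
   proof -
    have *: "K i \<subset> K (Suc i)" "common_zeros (van (K i)) = K i" "common_zeros (van (K (Suc i))) = K (Suc i)"
     using K(1) i by (auto simp: irreducible_chain_def intro!: affine_closed_zeros)
    then have "van (K (Suc i)) \<noteq> van (K i)" by auto
    then show ?thesis using *(1) unfolding van_def by blast
   qed
   show "van (K 0) \<inter> inv_dirs D \<subseteq> {0}" using P(3) vY K(2) by auto
  qed (use D in auto)
 qed
 then show thesis using that by (auto simp: van_def)
qed

subsection \<open>Homogeneous components\<close>

lemma hom_components:
 fixes p :: "complex^'n => complex"
 assumes "pf p" obtains n P where "\<And>i. hp i (P i)" "\<And>x. p x = (\<Sum>i\<le>n. P i x)"
proof -
 \<comment> \<open>The induction also carries that \<open>P i\<close> vanishes beyond
   \<open>n\<close>: sums of different lengths and the convolution in the product case rely on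
   it.\<close>
 from assms have "\<exists>n P. (\<forall>i. hp i (P i)) \<and> (\<forall>x. p x = (\<Sum>i\<le>n. P i x)) \<and> (\<forall>i>n. P i = (\<lambda>_. 0))"
 proof (induction rule: poly_fun.induct)
  case (const c)
  have "hp i (if i = 0 then \<lambda>_::complex^'n. c else (\<lambda>_. 0))" for i using hom_poly.const hp_zero by auto
  then show ?case by (intro exI[of _ "0::nat"] exI[of _ "\<lambda>i. if i = 0 then \<lambda>_. c else (\<lambda>_. 0)"]) auto
 next
  case (linear l)
  have "hp i (if i = 1 then l else (\<lambda>_. 0))" for i using hom_poly.linear[OF linear] hp_zero by auto
  then show ?case by (intro exI[of _ "1::nat"] exI[of _ "\<lambda>i. if i = 1 then l else (\<lambda>_. 0)"]) auto
 next
  case (add p q)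
  then obtain n P m Q where PQ: "\<forall>i. hp i (P i)" "\<forall>x. p x = (\<Sum>i\<le>n. P i x)" "\<forall>i>n. P i = (\<lambda>_. 0)"
   "\<forall>i. hp i (Q i)" "\<forall>x. q x = (\<Sum>i\<le>m. Q i x)" "\<forall>i>m. Q i = (\<lambda>_. 0)" by blast
  have "(\<Sum>i\<le>n. P i x) = (\<Sum>i\<le>max n m. P i x)" "(\<Sum>i\<le>m. Q i x) = (\<Sum>i\<le>max n m. Q i x)" for x
   using PQ(3,6) by (auto intro!: sum.mono_neutral_left) (metis not_le)+
  then show ?case using PQ
   by (intro exI[of _ "max n m"] exI[of _ "\<lambda>i x. P i x + Q i x"]) (auto simp: sum.distrib intro: hom_poly.add)
 next
  case (mult p q)
  then obtain n P m Q where PQ: "\<forall>i. hp i (P i)" "\<forall>x. p x = (\<Sum>i\<le>n. P i x)" "\<forall>i>n. P i = (\<lambda>_. 0)"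
   "\<forall>i. hp i (Q i)" "\<forall>x. q x = (\<Sum>i\<le>m. Q i x)" "\<forall>i>m. Q i = (\<lambda>_. 0)" by blast
  define R where "R k = (\<lambda>x. \<Sum>i\<le>k. P i x * Q (k - i) x)" for k
  have "hp k (R k)" for k unfolding R_def
  proof (rule hp_sum)
   fix i assume "i \<in> {..k}"
   then show "hp k (\<lambda>x. P i x * Q (k - i) x)"
    using hom_poly.mult[of "(*s)" i "P i" "k - i" "Q (k - i)"] PQ by simp
  qed
  moreover have "R k = (\<lambda>_. 0)" if "k > n + m" for k
  proof -
   have "P i = (\<lambda>_. 0) \<or> Q (k - i) = (\<lambda>_. 0)" for i
    using PQ(3,6) that by (cases "i > n") auto
   then show ?thesis unfolding R_def by (auto intro!: sum.neutral ext) (metis)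
  qed
  moreover have "p x * q x = (\<Sum>k\<le>n + m. R k x)" for x
  proof -
   have "p x * q x = (\<Sum>i\<le>n. \<Sum>j\<le>m. P i x * Q j x)" using PQ by (simp add: sum_product)
   \<comment> \<open>The double sum is regrouped by total degree by reading it as a product of
     univariate polynomials evaluated at 1.\<close>
   also have "\<dots> = poly ((\<Sum>i\<le>n. monom (P i x) i) * (\<Sum>j\<le>m. monom (Q j x) j)) 1"
    by (simp add: poly_sum poly_monom sum_product)
   also have "\<dots> = (\<Sum>k\<le>n + m. coeff ((\<Sum>i\<le>n. monom (P i x) i) * (\<Sum>j\<le>m. monom (Q j x) j)) k)"
   proof -
    have d: "degree (\<Sum>i\<le>n. monom (c i) i) \<le> n" for c :: "nat => complex" and n
     by (rule degree_le) (simp add: coeff_sum)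
    have "degree ((\<Sum>i\<le>n. monom (P i x) i) * (\<Sum>j\<le>m. monom (Q j x) j)) \<le> n + m" (is "degree ?r \<le> _")
     using degree_mult_le add_mono[OF d d] by (rule order_trans)
    then have "poly ?r 1 = (\<Sum>k\<le>n + m. coeff ?r k)"
     unfolding poly_altdef by (auto intro!: sum.mono_neutral_left le_degree)
    then show ?thesis .
   qed
   also have "\<dots> = (\<Sum>k\<le>n + m. R k x)"
   proof (intro sum.cong refl)
    have c: "coeff (\<Sum>i\<le>n. monom (P i x) i) j = P j x" "coeff (\<Sum>i\<le>m. monom (Q i x) i) j = Q j x" for j
     using PQ(3,6) by (auto simp: coeff_sum not_le)
    show "coeff ((\<Sum>i\<le>n. monom (P i x) i) * (\<Sum>j\<le>m. monom (Q j x) j)) k = R k x" for k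
     unfolding coeff_mult c R_def ..
   qed
   finally show ?thesis .
  qed
  ultimately show ?case by (intro exI[of _ "n + m"] exI[of _ R]) auto
 qed
 then show thesis using that by blast
qed

definition dil :: "complex => (complex^'n => complex) => complex^'n => complex" where
 "dil t p = (\<lambda>x. p (t *s x))"

lemma pf_dil: "pf p ==> pf (dil t p)"
proof (induction rule: poly_fun.induct)
 case (linear l)
 have "lin (\<lambda>x. t * l x)" by (rule linI) (simp_all add: lin_add[OF linear] lin_scale[OF linear] algebra_simps)
 then show ?case unfolding dil_def lin_scale[OF linear] by (rule poly_fun.linear)
qed (auto simp: dil_def intro: pf_pointwise)

lemma dil_components:
 assumes "\<And>i. hp i (P i)" "\<And>x. p x = (\<Sum>i\<le>n. P i x)"
 shows "dil t p = (\<Sum>i\<le>n. fsc (t ^ i) (P i))"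
 by (rule ext) (simp add: dil_def assms(2) fun_sum_apply hom_poly_scale[OF assms(1)])

text \<open>A Vandermonde argument: a functional vanishing on \<open>J\<close> turns the family into
  a univariate polynomial with infinitely many roots, so all its coefficients vanish.\<close>

lemma components_mem:
 assumes J: "fs.subspace J" and T: "infinite T" and mem: "\<And>t. t \<in> T ==> (\<Sum>i\<le>n. fsc (t ^ i) (P i)) \<in> J"
  and i: "i \<le> n"
 shows "P i \<in> J"
proof (rule ccontr)
 assume "P i \<notin> J"
 then obtain \<Lambda> where L: "Vector_Spaces.linear fsc (*) \<Lambda>" "\<And>q. q \<in> J ==> \<Lambda> q = 0" "\<Lambda> (P i) = 1"
  using separating_functional[OF J] by metis
 interpret L: Vector_Spaces.linear fsc "(*)" \<Lambda> by fact
 define p where "p = (\<Sum>i\<le>n. monom (\<Lambda> (P i)) i)"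
 have "poly p t = 0" if "t \<in> T" for t
 proof -
  have "poly p t = (\<Sum>i\<le>n. t ^ i * \<Lambda> (P i))" by (simp add: p_def poly_sum poly_monom mult.commute)
  also have "\<dots> = \<Lambda> (\<Sum>i\<le>n. fsc (t ^ i) (P i))" by (simp only: L.sum L.scale)
  finally show ?thesis using L(2) mem[OF that] by simp
 qed
 then have "infinite {t. poly p t = 0}" using T by (metis (mono_tags, lifting) finite_subset mem_Collect_eq subsetI)
 then have "p = 0" using poly_roots_finite by blast
 then have "coeff p i = 0" by simp
 then show False using i L(3) by (simp add: p_def coeff_sum)
qed

lemma pideal_subspace: "pideal J ==> fs.subspace J"
 by (auto simp: fs.subspace_def intro: pidealD)

lemma infinite_nonzero: "infinite (- {0 :: complex})"
 using infinite_UNIV_char_0 by (simp add: Compl_eq_Diff_UNIV)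

lemma component_zero:
 assumes "\<And>i. hp i (P i)" "\<And>x. p x = (\<Sum>i\<le>n. P i x)" "infinite T" "\<And>t. t \<in> T ==> p (t *s x) = 0" "i \<le> n"
 shows "P i x = 0"
proof -
 have sub: "fs.subspace (van {x})" by (rule pideal_subspace[OF pideal_van])
 have "P i \<in> van {x}"
 proof (rule components_mem[OF sub assms(3) _ assms(5)])
  fix t assume t: "t \<in> T"
  have "(\<Sum>i\<le>n. fsc (t ^ i) (P i)) x = 0"
   using fun_cong[OF dil_components[OF assms(1,2), of t], of x] assms(4)[OF t] by (simp add: dil_def)
  then show "(\<Sum>i\<le>n. fsc (t ^ i) (P i)) \<in> van {x}"
   using hp_imp_pf[OF assms(1)] by (auto simp: van_def intro!: pf_sum pf_fsc)
 qed
 then show ?thesis by (simp add: van_def)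
qed

subsection \<open>Projective closed sets and their cones\<close>

abbreviation PP :: "(complex^'n) set set" where "PP \<equiv> proj_space (*s) UNIV"

lemma in_PP_E:
 assumes "g \<in> PP" obtains x where "x \<noteq> 0" "g = {c *s x | c. c \<noteq> 0}"
 using assms by (auto simp: proj_space_def proj_point_def)

lemma PP_mem_nonzero: "g \<in> PP ==> x \<in> g ==> x \<noteq> 0"
 by (auto elim!: in_PP_E)

lemma PP_scale: "g \<in> PP ==> x \<in> g ==> t \<noteq> 0 ==> t *s x \<in> g"
 by (auto elim!: in_PP_E)

lemma PP_rep: assumes "g \<in> PP" "x \<in> g" shows "g = proj_point (*s) x"
proof -
 obtain y where y: "y \<noteq> 0" "g = {c *s y | c. c \<noteq> 0}" using in_PP_E[OF assms(1)] .
 obtain c where c: "c \<noteq> 0" "x = c *s y" using assms(2) y(2) by blast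
 show ?thesis unfolding y(2) proj_point_def c(2)
 proof (intro set_eqI iffI)
  fix z assume "z \<in> {d *s y | d. d \<noteq> 0}"
  then obtain d where "d \<noteq> 0" "z = d *s y" by blast
  then show "z \<in> {d *s (c *s y) | d. d \<noteq> 0}" using c(1) by (intro CollectI exI[of _ "d / c"]) auto
 qed (use c(1) in auto)
qed

lemma proj_point_self: "x \<in> proj_point (*s) x" for x :: "complex^'n"
 by (auto simp: proj_point_def intro!: exI[of _ 1])

lemma proj_point_PP: "x \<noteq> 0 ==> proj_point (*s) x \<in> PP"
 by (auto simp: proj_space_def)

lemma proj_topspace: "topspace projective_zariski = (PP :: (complex^'n) set set)"
proof
 have "zopen (PP :: (complex^'n) set set)"
  unfolding openin_proj_zariski
 proof (intro conjI exI[of _ "{\<lambda>_::complex^'n. 1}"] ballI)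
  show "\<exists>k. hp k p" if "p \<in> {\<lambda>_. 1}" for p :: "complex^'n => complex" using that hom_poly.const by auto
  show "PP - PP = {g \<in> PP. \<forall>p\<in>{\<lambda>_::complex^'n. 1::complex}. \<forall>x\<in>g. p x = 0}"
   by (auto elim!: in_PP_E intro!: exI[of _ "1::complex"])
 qed simp
 then show "(PP :: (complex^'n) set set) \<subseteq> topspace projective_zariski" by (rule openin_subset)
 have "zopen (topspace projective_zariski :: (complex^'n) set set)" by simp
 then show "topspace projective_zariski \<subseteq> (PP :: (complex^'n) set set)"
  unfolding openin_proj_zariski by blast
qed

lemma closedin_proj:
 "closedin projective_zariski \<K> \<longleftrightarrow>
  (\<exists>S. (\<forall>p\<in>S. \<exists>k. hp k p) \<and> \<K> = {g \<in> PP. \<forall>p\<in>S. \<forall>x\<in>g. p x = 0})"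
 unfolding closedin_def proj_topspace openin_proj_zariski
 by (auto simp: double_diff)

lemma hp_zero_line: "hp k p ==> g \<in> PP ==> x \<in> g ==> p x = 0 ==> y \<in> g ==> p y = 0"
 by (auto elim!: in_PP_E simp: hom_poly_scale)

text \<open>A closed set is recovered from the ideal of its cone. Strict inclusions of closed sets
  therefore become strict inclusions of ideals.\<close>

lemma proj_closed_eq:
 assumes "closedin projective_zariski \<K>"
 shows "\<K> = {g \<in> PP. \<forall>p\<in>van (\<Union>\<K>). \<forall>x\<in>g. p x = 0}"
proof -
 obtain S where S: "\<forall>p\<in>S. \<exists>k. hp k p" "\<K> = {g \<in> PP. \<forall>p\<in>S. \<forall>x\<in>g. p x = 0}"
  using assms unfolding closedin_proj by blast
 have "S \<subseteq> van (\<Union>\<K>)" using S by (auto simp: van_def intro: hp_imp_pf)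
 moreover have "\<K> \<subseteq> PP" using S(2) by blast
 ultimately show ?thesis
 proof (intro set_eqI iffI)
  fix g assume "S \<subseteq> van (\<Union>\<K>)" "g \<in> {g \<in> PP. \<forall>p\<in>van (\<Union>\<K>). \<forall>x\<in>g. p x = 0}"
  then show "g \<in> \<K>" by (subst S(2)) blast
 qed (auto simp: van_def)
qed

lemma proj_prime_irreducible:
 assumes "pprime (van (\<Union>\<K>))" "\<K> \<subseteq> PP" shows "irreducible_set projective_zariski \<K>"
 unfolding irreducible_set_def proj_topspace
proof (intro conjI allI impI assms(2))
 show "\<K> \<noteq> {}" using assms(1) by (auto simp: pprime_def van_def)
 fix A B assume "closedin projective_zariski A \<and> closedin projective_zariski B \<and> \<K> \<subseteq> A \<union> B"
 then obtain S T where ST: "\<forall>p\<in>S. \<exists>k. hp k p" "A = {g \<in> PP. \<forall>p\<in>S. \<forall>x\<in>g. p x = 0}"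
  "\<forall>p\<in>T. \<exists>k. hp k p" "B = {g \<in> PP. \<forall>p\<in>T. \<forall>x\<in>g. p x = 0}" "\<K> \<subseteq> A \<union> B"
  unfolding closedin_proj by blast
 show "\<K> \<subseteq> A \<or> \<K> \<subseteq> B"
 proof (rule ccontr)
  assume "\<not> ?thesis"
  then obtain g h where gh: "g \<in> \<K>" "g \<notin> A" "h \<in> \<K>" "h \<notin> B" by blast
  obtain p x where p: "p \<in> S" "x \<in> g" "p x \<noteq> 0" using gh(1,2) assms(2) unfolding ST(2) by blast
  obtain q y where q: "q \<in> T" "y \<in> h" "q y \<noteq> 0" using gh(3,4) assms(2) unfolding ST(4) by blast
  have "p z = 0 \<or> q z = 0" if "z \<in> \<Union>\<K>" for z
   using that ST(5) p(1) q(1) unfolding ST(2,4) by blast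
  moreover have "pf p" "pf q" using ST(1,3) p(1) q(1) hp_imp_pf by blast+
  ultimately have "p * q \<in> van (\<Union>\<K>)" by (auto simp: van_def)
  then have "p \<in> van (\<Union>\<K>) \<or> q \<in> van (\<Union>\<K>)"
   using pprimeD[OF assms(1)] ST(1,3) p(1) q(1) hp_imp_pf by blast
  then show False using p q gh by (auto simp: van_def)
 qed
qed

text \<open>For a polynomial that is not homogeneous, the closed set to use consists of the lines on
  which it vanishes identically. On a single line a product vanishes only if a factor does, since
  both restrict to univariate polynomials.\<close>

lemma proj_irreducible_prime:
 fixes \<K> :: "(complex^'n) set set"
 assumes irr: "irreducible_set projective_zariski \<K>" shows "pprime (van (\<Union>\<K>))"
 unfolding pprime_def
proof (intro conjI allI impI pideal_van)
 have sub: "\<K> \<subseteq> PP" and ne: "\<K> \<noteq> {}" using irr by (auto simp: irreducible_set_def proj_topspace)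
 then obtain g where g: "g \<in> \<K>" "g \<in> PP" by blast
 obtain x where "x \<noteq> 0" "g = {c *s x | c. c \<noteq> 0}" using in_PP_E[OF g(2)] .
 then have "x \<in> g" using proj_point_self[of x] by (simp add: proj_point_def)
 then show "1 \<notin> van (\<Union>\<K>)" using g by (auto simp: van_def)
 have closed: "closedin projective_zariski {g \<in> PP. \<forall>x\<in>g. p x = 0}" if p: "pf p" for p :: "complex^'n => complex"
 proof -
  obtain n P where P: "\<And>i. hp i (P i)" "\<And>x. p x = (\<Sum>i\<le>n. P i x)" using hom_components[OF p] by metis
  have "{g \<in> PP. \<forall>x\<in>g. p x = 0} = {g \<in> PP. \<forall>q\<in>P ` {..n}. \<forall>x\<in>g. q x = 0}"
  proof (intro set_eqI iffI; clarify)
   fix g x i assume g: "g \<in> PP" "\<forall>x\<in>g. p x = 0" "i \<le> n" "x \<in> g"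
   show "P i x = 0"
    by (rule component_zero[OF P infinite_nonzero _ g(3)]) (use PP_scale[OF g(1,4)] g(2) in auto)
  qed (simp add: P(2))
  moreover have "\<forall>q\<in>P ` {..n}. \<exists>k. hp k q" using P(1) by blast
  ultimately show ?thesis unfolding closedin_proj by blast
 qed
 fix a b :: "complex^'n => complex" assume ab: "pf a" "pf b" "a * b \<in> van (\<Union>\<K>)"
 let ?Z = "\<lambda>p. {g \<in> PP. \<forall>x\<in>g. p x = 0}"
 have "\<K> \<subseteq> ?Z a \<union> ?Z b"
 proof
  fix g assume g: "g \<in> \<K>"
  then have gP: "g \<in> PP" using sub by blast
  show "g \<in> ?Z a \<union> ?Z b"
  proof (rule ccontr)
   assume "\<not> ?thesis"
   then obtain x y where xy: "x \<in> g" "a x \<noteq> 0" "y \<in> g" "b y \<noteq> 0" using gP by auto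
   obtain A where A: "\<And>t. a (0 + t *s x) = poly A t" using pf_line[OF ab(1)] by metis
   obtain B where B: "\<And>t. b (0 + t *s x) = poly B t" using pf_line[OF ab(2)] by metis
   have AB: "poly (A * B) t = 0" if "t \<noteq> 0" for t
   proof -
    have "(a * b) (t *s x) = 0" using ab(3) PP_scale[OF gP xy(1) that] g unfolding van_def by blast
    then show ?thesis using A[of t] B[of t] by simp
   qed
   have "A * B = 0"
   proof (rule ccontr)
    assume "A * B \<noteq> 0"
    from poly_roots_finite[OF this] infinite_nonzero show False
     using AB by (metis (mono_tags, lifting) ComplD finite_subset mem_Collect_eq singletonI subsetI)
   qed
   moreover have "A \<noteq> 0" using A[of 1] xy(2) by auto
   moreover have "B \<noteq> 0"
   proof -
    obtain c where "y = c *s x" using xy(3) PP_rep[OF gP xy(1)] by (auto simp: proj_point_def)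
    then show ?thesis using B[of c] xy(4) by auto
   qed
   ultimately show False by simp
  qed
 qed
 then have "\<K> \<subseteq> ?Z a \<or> \<K> \<subseteq> ?Z b" using irr closed[OF ab(1)] closed[OF ab(2)] unfolding irreducible_set_def by blast
 then show "a \<in> van (\<Union>\<K>) \<or> b \<in> van (\<Union>\<K>)" using ab by (auto simp: van_def)
qed

text \<open>The largest homogeneous ideal inside an ideal \<open>P\<close>: over an infinite field,
  containing all dilates amounts to containing all homogeneous components.\<close>

definition hsat :: "(complex^'n => complex) set => (complex^'n => complex) set" where
 "hsat P = {p. pf p \<and> (\<forall>t. t \<noteq> 0 --> dil t p \<in> P)}"

lemma hsat_subset: "hsat P \<subseteq> P"
proof
 fix p assume "p \<in> hsat P"
 then have "dil 1 p \<in> P" by (simp add: hsat_def)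
 then show "p \<in> P" by (simp add: dil_def)
qed

lemma dil_dil: "dil s (dil t p) = dil (t * s) p" by (simp add: dil_def mult.commute)
lemma dil_add: "dil t (p + q) = dil t p + dil t q" by (simp add: dil_def fun_eq_iff)
lemma dil_mult: "dil t (p * q) = dil t p * dil t q" by (simp add: dil_def fun_eq_iff)

lemma hsat_component:
 assumes P: "pideal P" and c: "\<And>i. hp i (Q i)" "\<And>x. p x = (\<Sum>i\<le>n. Q i x)"
  and T: "infinite T" "\<And>t. t \<in> T ==> dil t p \<in> P" and i: "i \<le> n"
 shows "Q i \<in> P"
 by (rule components_mem[OF pideal_subspace[OF P] T(1) _ i])
  (use T(2) in \<open>simp only: dil_components[OF c, symmetric]\<close>)

lemma hsat_infinite:
 assumes P: "pideal P" and p: "pf p" and T: "infinite T" "\<And>t. t \<in> T ==> dil t p \<in> P"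
 shows "p \<in> hsat P"
proof -
 obtain n Q where c: "\<And>i. hp i (Q i)" "\<And>x. p x = (\<Sum>i\<le>n. Q i x)" using hom_components[OF p] by metis
 have "dil t p \<in> P" for t
  unfolding dil_components[OF c]
  using hsat_component[OF P c T] by (intro pideal_sum[OF P] pidealD(6)[OF P]) auto
 then show ?thesis using p by (simp add: hsat_def)
qed

text \<open>If \<open>a * b\<close> is in the saturation, every non-zero \<open>t\<close> puts
  \<open>dil t a\<close> or \<open>dil t b\<close> into \<open>P\<close>. One alternative holds for
  infinitely many \<open>t\<close>, and that forces all homogeneous components into
  \<open>P\<close>.\<close>

lemma pprime_hsat:
 fixes P :: "(complex^'n => complex) set"
 assumes P: "pprime P" shows "pprime (hsat P)"
proof -
 note PI = pprime_pideal[OF P]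
 have "pideal (hsat P)"
  unfolding pideal_def
 proof (intro conjI ballI allI impI)
  have "dil t 0 = (0 :: complex^'n => complex)" for t by (simp add: dil_def fun_eq_iff)
  note d0 = this
  show "0 \<in> hsat P" unfolding hsat_def
   by (intro CollectI conjI allI impI pf_0) (subst d0, rule pidealD(2)[OF PI])
 next
  fix a b assume "a \<in> hsat P" "b \<in> hsat P"
  then show "a + b \<in> hsat P" unfolding hsat_def mem_Collect_eq dil_add using pidealD(3)[OF PI] by blast
 next
  fix a b :: "complex^'n => complex" assume "a \<in> hsat P" "pf b"
  then show "b * a \<in> hsat P" unfolding hsat_def mem_Collect_eq dil_mult using pidealD(4)[OF PI] pf_dil by blast
 qed (simp add: hsat_def)
 moreover have "1 \<notin> hsat P" using P hsat_subset by (auto simp: pprime_def)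
 moreover have "a \<in> hsat P \<or> b \<in> hsat P" if ab: "pf a" "pf b" "a * b \<in> hsat P" for a b
 proof -
  let ?T = "\<lambda>p. {t. t \<noteq> 0 \<and> dil t p \<in> P}"
  have "- {0} \<subseteq> ?T a \<union> ?T b"
  proof
   fix t :: complex assume "t \<in> - {0}"
   moreover have "\<forall>t. t \<noteq> 0 --> dil t (a * b) \<in> P" using ab(3) unfolding hsat_def by blast
   ultimately have "dil t a * dil t b \<in> P" unfolding dil_mult by blast
   then show "t \<in> ?T a \<union> ?T b" using pprimeD[OF P pf_dil[OF ab(1)] pf_dil[OF ab(2)]] \<open>t \<in> - {0}\<close> by blast
  qed
  then have "infinite (?T a) \<or> infinite (?T b)" using infinite_nonzero finite_subset by blast
  then show ?thesis using hsat_infinite[OF PI] ab(1,2) by blast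
 qed
 ultimately show ?thesis unfolding pprime_def by blast
qed

text \<open>The linear form outside \<open>P\<close> excludes the irrelevant ideal. Multiplying by
  \<open>l\<close> makes a polynomial vanish at the origin, the one point of the affine zero set
  that lies on no line; primality removes the factor again.\<close>

lemma hsat_cone:
 assumes P: "pprime P" and l: "lin l" "l \<notin> P"
 defines "\<K> \<equiv> {g \<in> PP. g \<subseteq> common_zeros (hsat P)}"
 shows "van (\<Union>\<K>) = hsat P" "closedin projective_zariski \<K>" "irreducible_set projective_zariski \<K>"
proof -
 note H = pprime_hsat[OF P] and PI = pprime_pideal[OF P]
 have sub: "\<K> \<subseteq> PP" by (auto simp: \<K>_def)
 show van: "van (\<Union>\<K>) = hsat P"
 proof
  show "hsat P \<subseteq> van (\<Union>\<K>)" by (auto simp: van_def \<K>_def common_zeros_def hsat_def)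
  show "van (\<Union>\<K>) \<subseteq> hsat P"
  proof
   fix p assume p: "p \<in> van (\<Union>\<K>)"
   then have pfp: "pf p" by (simp add: van_def)
   have "l * p \<in> van (common_zeros (hsat P))" unfolding van_def
   proof (intro CollectI conjI ballI)
    show "pf (l * p)" using poly_fun.linear[OF l(1)] pfp by (rule pf_mult)
    fix x assume x: "x \<in> common_zeros (hsat P)"
    show "(l * p) x = 0"
    proof (cases "x = 0")
     case False
     have "proj_point (*s) x \<subseteq> common_zeros (hsat P)"
     proof
      fix y assume "y \<in> proj_point (*s) x"
      then obtain t where t: "t \<noteq> 0" "y = t *s x" by (auto simp: proj_point_def)
      have "dil t q \<in> hsat P" if "q \<in> hsat P" for q
       using that t(1) pf_dil by (auto simp: hsat_def dil_dil)
      then show "y \<in> common_zeros (hsat P)" using x t(2) by (auto simp: common_zeros_def dil_def)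
     qed
     then have "proj_point (*s) x \<in> \<K>" using proj_point_PP[OF False] by (simp add: \<K>_def)
     then show ?thesis using p proj_point_self[of x] by (auto simp: van_def)
    qed (simp add: lin_zero[OF l(1)])
   qed
   then have "l * p \<in> hsat P" using van_common_zeros[OF H] by simp
   moreover have "l \<notin> hsat P" using l(2) hsat_subset by blast
   ultimately show "p \<in> hsat P" using pprimeD[OF H poly_fun.linear[OF l(1)] pfp] by blast
  qed
 qed
 show "irreducible_set projective_zariski \<K>" by (rule proj_prime_irreducible[OF _ sub]) (simp add: van H)
 show "closedin projective_zariski \<K>" unfolding closedin_proj
 proof (intro exI[of _ "{q \<in> hsat P. \<exists>k. hp k q}"] conjI)
  show "\<K> = {g \<in> PP. \<forall>q\<in>{q \<in> hsat P. \<exists>k. hp k q}. \<forall>x\<in>g. q x = 0}"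
  proof (intro set_eqI iffI)
   fix g assume g: "g \<in> {g \<in> PP. \<forall>q\<in>{q \<in> hsat P. \<exists>k. hp k q}. \<forall>x\<in>g. q x = 0}"
   have "p x = 0" if p: "p \<in> hsat P" and x: "x \<in> g" for p x
   proof -
    have "pf p" using p unfolding hsat_def by blast
    then obtain n Q where c: "\<And>i. hp i (Q i)" "\<And>x. p x = (\<Sum>i\<le>n. Q i x)"
     by (rule hom_components) (rule that)
    have "Q i \<in> hsat P" if "i \<le> n" for i
    proof -
     have "Q i \<in> P" using hsat_component[OF PI c infinite_nonzero _ that] p by (auto simp: hsat_def)
     moreover have "dil t (Q i) = fsc (t ^ i) (Q i)" for t
      by (simp add: dil_def fun_eq_iff hom_poly_scale[OF c(1)])
     ultimately show ?thesis using pidealD(6)[OF PI] hp_imp_pf[OF c(1)] by (simp add: hsat_def)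
    qed
    then show ?thesis unfolding c(2) using g x c(1) by (intro sum.neutral) blast
   qed
   then show "g \<in> \<K>" using g by (auto simp: \<K>_def common_zeros_def)
  qed (auto simp: \<K>_def common_zeros_def)
 qed auto
qed

section \<open>Codimension of homogeneous cones in terms of directions\<close>

locale hom_cone =
 fixes S :: "(complex^'n => complex) set"
 assumes hom: "\<And>p. p \<in> S ==> \<exists>k. hp k p"
begin

definition "lines = {g \<in> PP. g \<subseteq> common_zeros S}"

lemma scale_mem: "x \<in> common_zeros S ==> t *s x \<in> common_zeros S"
 using hom hom_poly_scale by (fastforce simp: common_zeros_def)

lemma van_component:
 assumes "\<And>i. hp i (P i)" "\<And>x. p x = (\<Sum>i\<le>n. P i x)" "p \<in> van (common_zeros S)" "i \<le> n"
 shows "P i \<in> van (common_zeros S)"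
 using component_zero[OF assms(1,2) infinite_nonzero _ assms(4)] scale_mem assms(3) hp_imp_pf[OF assms(1)]
 by (auto simp: van_def)

text \<open>The affine dimension count, applied to the homogeneous part of \<open>P\<close>. As
  \<open>card D < CARD('n)\<close>, there is a non-zero linear form invariant under
  \<open>D\<close>: it keeps \<open>P\<close> away from the irrelevant ideal and, as a factor of the
  witness, restores vanishing at the origin, which \<open>?Z\<close> leaves out.\<close>

theorem proj_codim_direction:
 assumes cod: "codim projective_zariski lines \<ge> enat (Suc (card D))"
  and D: "vec.independent D" "card D < CARD('n)"
 obtains g where "g \<in> inv_dirs D" "g \<noteq> 0" "\<And>x. x \<in> common_zeros S ==> g x = 0"
proof -
 obtain fs where fs: "length fs = CARD('n) - card D" "\<And>f. f \<in> set fs ==> lin f \<and> f \<in> inv_dirs D \<and> f \<noteq> 0"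
  using directions_coordinates[OF D(1)] by metis
 have "hd fs \<in> set fs" using fs(1) D(2) by (cases fs) auto
 then obtain l where l: "lin l" "l \<in> inv_dirs D" "l \<noteq> 0" using fs(2) by blast
 let ?Z = "common_zeros S - {0}"
 have "\<exists>g\<in>inv_dirs D - {0}. g \<in> van ?Z"
 proof (rule ccontr)
  assume "\<not> ?thesis"
  then have disj: "van ?Z \<inter> (inv_dirs D - {0}) = {}" by blast
  have m: "a * b \<in> inv_dirs D - {0}" if "a \<in> inv_dirs D - {0}" "b \<in> inv_dirs D - {0}" for a b
   using that inv_dirs_mult pf_no_zero_divisors inv_dirs_pf by (metis DiffD1 DiffD2 DiffI singletonD singletonI)
  have "1 \<in> inv_dirs D - {0}" by (auto simp: inv_dirs_def)
  then obtain P where P: "pprime P" "van ?Z \<subseteq> P" "P \<inter> (inv_dirs D - {0}) = {}"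
   using prime_avoiding[OF pideal_van _ m disj] by metis
  have lP: "l \<notin> P" using l P(3) by blast
  define \<K> where "\<K> = {g \<in> PP. g \<subseteq> common_zeros (hsat P)}"
  note K = hsat_cone[OF P(1) l(1) lP, folded \<K>_def]
  have "\<K> \<subseteq> lines"
  proof
   fix g assume g: "g \<in> \<K>"
   have "p x = 0" if p: "p \<in> S" "x \<in> g" for p x
   proof -
    obtain k where k: "hp k p" using hom[OF p(1)] by blast
    have "p \<in> van ?Z" using p(1) hp_imp_pf[OF k] by (auto simp: van_def common_zeros_def)
    then have "p \<in> P" using P(2) by blast
    moreover have "dil t p = fsc (t ^ k) p" for t by (simp add: dil_def fun_eq_iff hom_poly_scale[OF k])
    ultimately have "p \<in> hsat P"
     using pidealD(6)[OF pprime_pideal[OF P(1)]] hp_imp_pf[OF k] by (simp add: hsat_def)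
    then show ?thesis using g p(2) by (auto simp: \<K>_def common_zeros_def)
   qed
   then show "g \<in> lines" using g by (auto simp: lines_def \<K>_def common_zeros_def)
  qed
  from codim_chain[OF cod K(2,3) this] obtain C
   where C: "irreducible_chain projective_zariski (Suc (card D)) C" "C 0 = \<K>" .
  show False
  proof (rule prime_chain_bound[of "Suc (card D)" "\<lambda>i. van (\<Union>(C i))" D])
   show "pprime (van (\<Union>(C i)))" if "i \<le> Suc (card D)" for i
    using C(1) that by (intro proj_irreducible_prime) (auto simp: irreducible_chain_def)
   show "van (\<Union>(C (Suc i))) \<subset> van (\<Union>(C i))" if i: "i < Suc (card D)" for i
   proof -
    have *: "C i \<subset> C (Suc i)" "closedin projective_zariski (C i)" "closedin projective_zariski (C (Suc i))"
     using C(1) i by (auto simp: irreducible_chain_def)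
    have "van (\<Union>(C (Suc i))) \<noteq> van (\<Union>(C i))"
    proof
     assume "van (\<Union>(C (Suc i))) = van (\<Union>(C i))"
     then have "C (Suc i) = C i" using proj_closed_eq[OF *(2)] proj_closed_eq[OF *(3)] by simp
     then show False using *(1) by simp
    qed
    then show ?thesis using *(1) unfolding van_def by blast
   qed
   show "van (\<Union>(C 0)) \<inter> inv_dirs D \<subseteq> {0}" using P(3) K(1) C(2) hsat_subset[of P] by auto
  qed (use D in auto)
 qed
 then obtain g where g: "g \<in> inv_dirs D" "g \<noteq> 0" "g \<in> van ?Z" by blast
 show thesis
 proof (rule that[of "l * g"])
  show "l * g \<in> inv_dirs D" using inv_dirs_mult[OF l(2) g(1)] .
  show "l * g \<noteq> 0" using pf_no_zero_divisors[OF inv_dirs_pf[OF l(2)] inv_dirs_pf[OF g(1)]] l(3) g(2) by blast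
  show "(l * g) x = 0" if "x \<in> common_zeros S" for x
   using that g(3) lin_zero[OF l(1)] by (cases "x = 0") (auto simp: van_def)
 qed
qed

text \<open>An irreducible \<open>Y\<close> in the cone is enlarged to a proper irreducible closed
  \<open>\<K>\<close>. A homogeneous \<open>f\<close> vanishing on \<open>Y\<close> and monic along
  \<open>w\<close> lies in a prime that contains no non-zero polynomial invariant along
  \<open>w\<close>; since some such polynomial \<open>g\<close> vanishes on \<open>Y\<close>, the
  zero set of the prime is strictly larger than \<open>Y\<close>.\<close>

theorem proj_codim_ge_2:
 assumes card: "CARD('n) \<ge> 2"
  and dir: "\<And>v. v \<noteq> 0 ==> \<exists>g\<in>inv_dir v. g \<noteq> 0 \<and> (\<forall>x\<in>common_zeros S. g x = 0)"
 shows "codim projective_zariski lines \<ge> 2"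
proof -
 have chain: "\<exists>K. irreducible_chain projective_zariski 2 K \<and> K 0 = Y"
  if Y: "closedin projective_zariski Y" "irreducible_set projective_zariski Y" "Y \<subseteq> lines" for Y
 proof -
  define Q where "Q = van (\<Union>Y)"
  have Q: "pprime Q" unfolding Q_def by (rule proj_irreducible_prime[OF Y(2)])
  have sub: "Y \<subseteq> PP" "Y \<noteq> {}" using Y(2) by (auto simp: irreducible_set_def proj_topspace)
  have SQ: "g \<in> Q" if "pf g" "\<forall>x\<in>common_zeros S. g x = 0" for g
   using that Y(3) by (auto simp: Q_def van_def lines_def)
  obtain v0 :: "complex^'n" where "v0 \<noteq> 0" by (metis axis_eq_0_iff one_neq_zero)
  obtain g0 where g0: "g0 \<in> inv_dir v0" "g0 \<noteq> 0" "\<forall>x\<in>common_zeros S. g0 x = 0" using dir[OF \<open>v0 \<noteq> 0\<close>] by blast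
  obtain n P0 where P0: "\<And>i. hp i (P0 i)" "\<And>x. g0 x = (\<Sum>i\<le>n. P0 i x)"
   using hom_components[OF inv_dir_pf[OF g0(1)]] by metis
  obtain w where "g0 w \<noteq> 0" using g0(2) by (auto simp: fun_eq_iff)
  then obtain k where k: "k \<le> n" "P0 k w \<noteq> 0" unfolding P0(2) by (meson atMost_iff sum.not_neutral_contains_not_neutral)
  define f where "f = P0 k"
  have f: "hp k f" "f w \<noteq> 0" using P0 k by (auto simp: f_def)
  have "f \<in> van (common_zeros S)" unfolding f_def
   by (rule van_component[OF P0 _ k(1)]) (use g0 in \<open>auto simp: van_def inv_dir_pf\<close>)
  then have fQ: "f \<in> Q" using SQ by (auto simp: van_def)
  have w0: "w \<noteq> 0"
  proof
   assume "w = 0"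
   have "k = 0"
   proof (rule ccontr)
    assume "k \<noteq> 0" then show False using hom_poly_scale[OF f(1), of 0 0] f(2) \<open>w = 0\<close> by (simp add: power_0_left)
   qed
   then have "f x = f w" for x using hom_poly_scale[OF f(1), of 0 x] \<open>w = 0\<close> by simp
   then have "f = (\<lambda>_. f w)" by auto
   then show False using pprime_const[OF Q, of "f w"] fQ f(2) by simp
  qed
  obtain l where l: "lin l" "l w = 1"
  proof -
   obtain i where "w $ i \<noteq> 0" using w0 by (auto simp: vec_eq_iff)
   moreover have "lin (\<lambda>x. x $ i / w $ i)" by (rule linI) (auto simp: add_divide_distrib)
   ultimately show thesis using that by force
  qed
  interpret f: monic_along f w k l by (rule monic_along.intro[OF f l])
  obtain g where g: "g \<in> inv_dir w" "g \<noteq> 0" "\<forall>x\<in>common_zeros S. g x = 0" using dir[OF w0] by blast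
  have gQ: "g \<in> Q" using SQ g inv_dir_pf by blast
  \<comment> \<open>Avoiding this set does two things: with \<open>a = 1\<close> it keeps
    \<open>P\<close> inside \<open>Q\<close>, and with \<open>s = 1\<close> it excludes the
    invariants along \<open>w\<close>.\<close>
  let ?\<Sigma> = "{a * s | a s. a \<in> inv_dir w \<and> a \<noteq> 0 \<and> pf s \<and> s \<notin> Q}"
  let ?J = "{f * b | b. pf b}"
  have J: "pideal ?J" unfolding pideal_def
  proof (intro conjI ballI allI impI)
   fix a assume "a \<in> ?J" then show "pf a" using f.pf by auto
  next
   have "0 = f * 0" by simp then show "0 \<in> ?J" using pf_0 by blast
  next
   fix a b assume "a \<in> ?J" "b \<in> ?J"
   then obtain c d where "a = f * c" "b = f * d" "pf c" "pf d" by blast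
   then have "a + b = f * (c + d)" "pf (c + d)" by (auto simp: algebra_simps)
   then show "a + b \<in> ?J" by blast
  next
   fix a b :: "complex^'n => complex" assume "a \<in> ?J" "pf b"
   then obtain c where "a = f * c" "pf c" by blast
   then have "b * a = f * (b * c)" "pf (b * c)" using \<open>pf b\<close> by (auto simp: mult.left_commute)
   then show "b * a \<in> ?J" by blast
  qed
  have 1: "1 \<in> ?\<Sigma>"
  proof -
   have "1 = 1 * (1 :: complex^'n => complex)" by simp
   moreover have "1 \<notin> Q" using Q by (simp add: pprime_def)
   ultimately show ?thesis using inv_dir_1 pf_1 one_neq_zero by blast
  qed
  have m: "a * b \<in> ?\<Sigma>" if ab: "a \<in> ?\<Sigma>" "b \<in> ?\<Sigma>" for a b
  proof -
   obtain c s d t where *: "a = c * s" "b = d * t" "c \<in> inv_dir w" "c \<noteq> 0" "d \<in> inv_dir w" "d \<noteq> 0"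
    "pf s" "s \<notin> Q" "pf t" "t \<notin> Q" using ab by blast
   have "a * b = (c * d) * (s * t)" unfolding * by (simp add: mult.assoc mult.left_commute)
   moreover have "c * d \<noteq> 0" using pf_no_zero_divisors * inv_dir_pf by metis
   moreover have "s * t \<notin> Q" using pprimeD[OF Q] * by metis
   ultimately show ?thesis using inv_dir_mult[OF *(3,5)] pf_mult[OF *(7,9)] by blast
  qed
  \<comment> \<open>An element of both sets would make \<open>f\<close> divide \<open>s\<close>,
    since \<open>a\<close> is free of the coordinate in which \<open>f\<close> is monic; but
    \<open>f\<close> is in \<open>Q\<close> and \<open>s\<close> is not.\<close>
  have disj: "?J \<inter> ?\<Sigma> = {}"
  proof (rule ccontr)
   assume "\<not> ?thesis"
   then obtain b a s where *: "f * b = a * s" "pf b" "a \<in> inv_dir w" "a \<noteq> 0" "pf s" "s \<notin> Q" by auto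
   obtain c where "pf c" "s = f * c" using f.dvd_cancel[OF *(3,4,5,2) *(1)[symmetric]] .
   then show False using *(6) pidealD(5)[OF pprime_pideal[OF Q] fQ] by blast
  qed
  obtain P where P: "pprime P" "?J \<subseteq> P" "P \<inter> ?\<Sigma> = {}"
   by (rule prime_avoiding[OF J 1 _ disj], rule m, assumption, assumption, rule that)
  have PQ: "P \<subseteq> Q"
  proof
   fix p assume p: "p \<in> P"
   show "p \<in> Q"
   proof (rule ccontr)
    assume "p \<notin> Q"
    then have "1 * p \<in> ?\<Sigma>" using inv_dir_1 one_neq_zero pidealD(1)[OF pprime_pideal[OF P(1)] p] by blast
    then show False using p P(3) by (simp only: mult_1) blast
   qed
  qed
  have Pinv: "a \<notin> P" if "a \<in> inv_dir w" "a \<noteq> 0" for a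
  proof -
   have "a * 1 \<in> ?\<Sigma>" using that pf_1 Q unfolding pprime_def by blast
   then show ?thesis using P(3) by (simp only: mult_1_right) blast
  qed
  obtain \<tau> where \<tau>: "lin \<tau>" "\<tau> \<in> inv_dir w" "\<tau> \<noteq> 0"
  proof -
   have ind: "vec.independent {w}" using w0 by simp
   obtain fs where fs: "length fs = CARD('n) - card {w}" "\<And>f. f \<in> set fs ==> lin f \<and> f \<in> inv_dirs {w} \<and> f \<noteq> 0"
    using directions_coordinates[OF ind] by metis
   have "hd fs \<in> set fs" using fs(1) card by (cases fs) auto
   then show thesis using fs(2)[of "hd fs"] that by (auto simp: inv_dirs_def)
  qed
  define \<K> where "\<K> = {g \<in> PP. g \<subseteq> common_zeros (hsat P)}"
  note K = hsat_cone[OF P(1) \<tau>(1) Pinv[OF \<tau>(2,3)], folded \<K>_def]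
  have fH: "f \<in> hsat P"
  proof -
   have "f * 1 \<in> P" using P(2) pf_1 by blast
   then have "f \<in> P" by (simp only: mult_1_right)
   moreover have "dil t f = fsc (t ^ k) f" for t by (simp add: dil_def fun_eq_iff hom_poly_scale[OF f(1)])
   ultimately show ?thesis using pidealD(6)[OF pprime_pideal[OF P(1)]] f.pf by (simp add: hsat_def)
  qed
  have YK: "Y \<subset> \<K>"
  proof
   show "Y \<subseteq> \<K>" using hsat_subset[of P] PQ sub by (auto simp: \<K>_def common_zeros_def Q_def van_def)
   have "g \<notin> van (\<Union>\<K>)" using K(1) hsat_subset Pinv[OF g(1,2)] by blast
   then show "Y \<noteq> \<K>" using gQ by (auto simp: Q_def)
  qed
  have top: "van (\<Union>PP) = ({0} :: (complex^'n => complex) set)"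
  proof (rule set_eqI)
   fix p :: "complex^'n => complex"
   have "p = 0" if p: "p \<in> van (\<Union>PP)"
   proof -
    have "\<tau> * p = 0"
    proof
     fix x show "(\<tau> * p) x = 0 x"
      using lin_zero[OF \<tau>(1)] p proj_point_PP[of x] proj_point_self[of x]
      by (cases "x = 0") (auto simp: van_def)
    qed
    then show ?thesis using pf_no_zero_divisors[OF poly_fun.linear[OF \<tau>(1)]] p \<tau>(3) by (auto simp: van_def)
   qed
   then show "p \<in> van (\<Union>PP) \<longleftrightarrow> p \<in> {0}" using pidealD(2)[OF pideal_van] by blast
  qed
  have "pprime ({0} :: (complex^'n => complex) set)"
   unfolding pprime_def
  proof (intro conjI allI impI)
   show "pideal ({0} :: (complex^'n => complex) set)" using pideal_van[of "\<Union>(PP :: (complex^'n) set set)"] unfolding top .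
  qed (metis singletonD zero_neq_one, metis pf_no_zero_divisors singletonD singletonI)
  then have topirr: "irreducible_set projective_zariski (PP :: (complex^'n) set set)"
   by (intro proj_prime_irreducible) (simp_all only: top order_refl)
  have KP: "\<K> \<subset> PP"
  proof
   have "proj_point (*s) w \<notin> \<K>"
    using fH f(2) proj_point_self[of w] by (auto simp: \<K>_def common_zeros_def)
   then show "\<K> \<noteq> PP" using proj_point_PP[OF w0] by blast
  qed (auto simp: \<K>_def)
  have "closedin projective_zariski (PP :: (complex^'n) set set)"
   using closedin_topspace[of "projective_zariski :: (complex^'n) set topology"] by (simp only: proj_topspace)
  then have "irreducible_chain projective_zariski 2 (\<lambda>i. if i = 0 then Y else if i = 1 then \<K> else PP)"
   using Y(1,2) K(2,3) topirr YK KP by (auto simp: irreducible_chain_def less_2_cases_iff)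
  then show ?thesis by (intro exI[of _ "\<lambda>i. if i = 0 then Y else if i = 1 then \<K> else PP"]) simp
 qed
 have "2 \<le> (SUP c \<in> {c. \<exists>K. irreducible_chain projective_zariski c K \<and> K 0 = Y}. enat c)"
  if "closedin projective_zariski Y \<and> irreducible_set projective_zariski Y \<and> Y \<subseteq> lines" for Y
  using that chain[of Y] by (intro SUP_upper2[of 2]) (auto simp: numeral_eq_enat)
 then show ?thesis unfolding codim_def by (intro INF_greatest) auto
qed

end

section \<open>Alternating multilinear functions of lists of vectors\<close>

abbreviation ax :: "'n => complex^'n" where "ax i \<equiv> axis i 1"

definition multilin :: "nat => ((complex^'n) list => complex) => bool" where
 "multilin q F \<longleftrightarrow> (\<forall>vs i. length vs = q \<and> i < q --> lin (\<lambda>v. F (vs[i := v])))"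

definition alt :: "nat => ((complex^'n) list => complex) => bool" where
 "alt q F \<longleftrightarrow> multilin q F \<and>
  (\<forall>vs i j. length vs = q \<and> i < j \<and> j < q \<and> vs ! i = vs ! j --> F vs = 0)"

lemma multilin_lin: "multilin q F ==> length vs = q ==> i < q ==> lin (\<lambda>v. F (vs[i := v]))"
 by (simp add: multilin_def)

lemma multilin_add: "multilin q F ==> length vs = q ==> i < q ==>
  F (vs[i := v + w]) = F (vs[i := v]) + F (vs[i := w])"
 using lin_add[OF multilin_lin] by blast

lemma multilin_scale: "multilin q F ==> length vs = q ==> i < q ==> F (vs[i := c *s v]) = c * F (vs[i := v])"
 using lin_scale[OF multilin_lin] by blast

lemma multilin_Cons_lin: "multilin (Suc q) F ==> length vs = q ==> lin (\<lambda>v. F (v # vs))"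
 using multilin_lin[of "Suc q" F "0 # vs" 0] by simp

lemma multilin_Cons: "multilin (Suc q) F ==> multilin q (\<lambda>vs. F (v # vs))"
 for F :: "(complex^'n) list => complex"
 unfolding multilin_def
proof (intro allI impI)
 fix vs :: "(complex^'n) list" and i assume *: "\<forall>vs i. length vs = Suc q \<and> i < Suc q --> lin (\<lambda>v. F (vs[i := v]))" "length vs = q \<and> i < q"
 then show "lin (\<lambda>w. F (v # vs[i := w]))" using *(1)[rule_format, of "v # vs" "Suc i"] by simp
qed

lemma finite_index_lists: "finite {I :: 'n::finite list. length I = q}"
 using finite_lists_length_eq[of "UNIV :: 'n set" q] by simp

lemma sum_index_lists_Suc:
 "(\<Sum>I | length I = Suc q. g I) = (\<Sum>i\<in>UNIV. \<Sum>I | length I = q. g (i # I))" for g :: "'n::finite list => 'b::comm_monoid_add"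
proof -
 have "{I :: 'n list. length I = Suc q} = (\<lambda>(i, I). i # I) ` (UNIV \<times> {I. length I = q})"
  by (auto simp: length_Suc_conv image_iff)
 then have "(\<Sum>I | length I = Suc q. g I) = (\<Sum>x\<in>UNIV \<times> {I. length I = q}. g ((\<lambda>(i, I). i # I) x))"
  by (simp add: sum.reindex inj_on_def)
 then show ?thesis by (simp add: sum.cartesian_product split_def)
qed

fun coord_prod :: "(complex^'n) list => 'n list => complex" where
 "coord_prod (v # vs) (i # I) = v $ i * coord_prod vs I"
| "coord_prod _ _ = 1"

lemma multilin_expand:
 assumes "multilin q F" "length vs = q"
 shows "F vs = (\<Sum>I | length I = q. coord_prod vs I * F (map ax I))"
 using assms
proof (induction q arbitrary: F vs)
 case 0 then show ?case by simp
next
 case (Suc q)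
 obtain v ws where vs: "vs = v # ws" "length ws = q" using Suc.prems(2) by (cases vs) auto
 have "F vs = (\<Sum>i\<in>UNIV. v $ i * F (ax i # ws))"
  unfolding vs by (rule lin_expand[OF multilin_Cons_lin[OF Suc.prems(1) vs(2)]])
 also have "\<dots> = (\<Sum>i\<in>UNIV. v $ i * (\<Sum>I | length I = q. coord_prod ws I * F (ax i # map ax I)))"
  using Suc.IH[OF multilin_Cons[OF Suc.prems(1)] vs(2)] by simp
 also have "\<dots> = (\<Sum>I | length I = Suc q. coord_prod vs I * F (map ax I))"
  by (simp add: sum_index_lists_Suc vs sum_distrib_left mult.assoc)
 finally show ?case .
qed

lemma multilin_zero_basis:
 assumes "multilin q F" "\<And>I. length I = q ==> F (map ax I) = 0" "length vs = q"
 shows "F vs = 0"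
 using multilin_expand[OF assms(1,3)] assms(2) by simp

lemma alt_multilin: "alt q F ==> multilin q F" by (simp add: alt_def)
lemma alt_equal: "alt q F ==> length vs = q ==> i < q ==> j < q ==> i \<noteq> j ==> vs ! i = vs ! j ==> F vs = 0"
 unfolding alt_def by (metis linorder_neqE_nat)

lemma swap_of_diag:
 assumes "multilin q F" "length vs = q" "i < q" "j < q" "i \<noteq> j"
  and "\<And>v. F (vs[i := v, j := v]) = 0"
 shows "F (vs[i := w, j := v]) = - F (vs[i := v, j := w])"
proof -
 have upd: "vs[i := x, j := y] = vs[j := y, i := x]" for x y by (rule list_update_swap[OF assms(5)])
 have "0 = F (vs[i := v + w, j := v + w])" using assms(6) by simp
 also have "\<dots> = F (vs[i := v + w, j := v]) + F (vs[i := v + w, j := w])"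
  using assms by (intro multilin_add) auto
 also have "\<dots> = (F (vs[i := v, j := v]) + F (vs[i := w, j := v])) + (F (vs[i := v, j := w]) + F (vs[i := w, j := w]))"
  unfolding upd using assms by (simp add: multilin_add)
 finally show ?thesis using assms(6) by (simp add: add_eq_0_iff)
qed

lemma alt_swap:
 assumes "alt q F" "length vs = q" "i < q" "j < q" "i \<noteq> j"
 shows "F (vs[i := w, j := v]) = - F (vs[i := v, j := w])"
 by (rule swap_of_diag[OF alt_multilin[OF assms(1)] assms(2-5)])
  (rule alt_equal[OF assms(1), of _ i j], use assms in auto)

text \<open>Equal entries are moved together by adjacent swaps. The adjacent case is the one that
  can be checked directly on the exterior derivative.\<close>

lemma altI_adjacent:
 assumes "multilin q F" "\<And>vs i. length vs = q ==> Suc i < q ==> vs ! i = vs ! Suc i ==> F vs = 0"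
 shows "alt q F"
proof -
 have "F vs = 0" if "length vs = q" "i + Suc k < q" "vs ! i = vs ! (i + Suc k)" for vs i k
  using that
 proof (induction k arbitrary: vs)
  case 0 then show ?case using assms(2) by simp
 next
  case (Suc k)
  let ?j = "i + Suc k"
  have "F (vs[?j := vs ! Suc ?j, Suc ?j := vs ! ?j]) = - F (vs[?j := vs ! ?j, Suc ?j := vs ! Suc ?j])"
   by (rule swap_of_diag[OF assms(1) Suc.prems(1)]) (use Suc.prems assms(2)[of _ ?j] in auto)
  moreover have "F (vs[?j := vs ! Suc ?j, Suc ?j := vs ! ?j]) = 0"
   by (rule Suc.IH) (use Suc.prems in auto)
  ultimately show ?case by simp
 qed
 then have "F vs = 0" if "length vs = q" "i < j" "j < q" "vs ! i = vs ! j" for vs i j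
  using that less_imp_Suc_add[OF that(2)] by fastforce
 then show ?thesis using assms(1) unfolding alt_def by blast
qed

text \<open>The positions start at 1 because position 0 is the slot of the one-form in the wedge
  product below.\<close>

lemma alt_permute:
 assumes F: "alt q F" and p: "\<rho> permutes {1..<Suc q}"
 shows "F (map (\<lambda>i. g (\<rho> i)) [1..<Suc q]) = of_int (sign \<rho>) * F (map g [1..<Suc q])"
 using p finite_atLeastLessThan[of 1 "Suc q"]
proof (induction arbitrary: g rule: permutes_induct)
 case id then show ?case by simp
next
 case (swap a b p)
 let ?t = "Transposition.transpose a b"
 have "F (map (\<lambda>i. g ((?t \<circ> p) i)) [1..<Suc q]) = of_int (sign p) * F (map (\<lambda>i. g (?t i)) [1..<Suc q])"
  using swap.IH[of "\<lambda>i. g (?t i)"] by simp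
 also have "map (\<lambda>i. g (?t i)) [1..<Suc q] = (map g [1..<Suc q])[a - 1 := g b, b - 1 := g a]"
  using swap(1-3) by (intro nth_equalityI) (auto simp: nth_list_update transpose_def nth_append simp del: upt_Suc)
 also have "F \<dots> = - F ((map g [1..<Suc q])[a - 1 := g a, b - 1 := g b])"
  by (rule alt_swap[OF F]) (use swap(1-3) in auto)
 also have "(map g [1..<Suc q])[a - 1 := g a, b - 1 := g b] = map g [1..<Suc q]"
  using swap(1-3) by (intro nth_equalityI) (auto simp: nth_list_update simp del: upt_Suc)
 also have "of_int (sign p) * - F (map g [1..<Suc q]) = of_int (- sign p) * F (map g [1..<Suc q])" by simp
 also have "- sign p = sign (?t \<circ> p)"
  using sign_compose[OF permutation_swap_id[of a b] permutes_imp_permutation[OF finite_atLeastLessThan \<open>p permutes {1..<Suc q}\<close>]]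
   swap(3) by (simp only: sign_swap_id if_False mult_minus_left mult_1)
 finally show ?case .
qed

lemma alt_head:
 assumes F: "alt q F" and us: "length us = q" "a < q"
 shows "F (us[a := v]) = (-1) ^ a * F (v # take a us @ drop (Suc a) us)"
 using us
proof (induction a arbitrary: us)
 case 0 then show ?case by (cases us) auto
next
 case (Suc a)
 have "us[Suc a := v] = (us[a := us ! a])[Suc a := v]" by simp
 then have "F (us[Suc a := v]) = - F (us[a := v, Suc a := us ! a])"
  using alt_swap[OF F Suc.prems(1), of a "Suc a" "us ! a" v] Suc.prems by simp
 also have "us[a := v, Suc a := us ! a] = (us[Suc a := us ! a])[a := v]" by (rule list_update_swap) simp
 also have "F \<dots> = (-1) ^ a * F (v # take a us @ us ! a # drop (Suc (Suc a)) us)"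
  using Suc by (subst Suc.IH) (auto simp: drop_update_cancel Cons_nth_drop_Suc[symmetric] simp del: Cons_nth_drop_Suc)
 also have "take a us @ us ! a # drop (Suc (Suc a)) us = take (Suc a) us @ drop (Suc (Suc a)) us"
  using Suc.prems by (simp add: take_Suc_conv_app_nth)
 finally show ?case by simp
qed

text \<open>Sort the permutations by the vector that goes to the one-form: each is a transposition
  of 0 and \<open>b\<close> after a permutation fixing 0. The latter only produce signs that cancel,
  so they contribute \<open>fact q\<close> equal terms, which the normalisation of
  \<open>wedge\<close> removes.\<close>

lemma wedge_1_Cons:
 assumes B: "alt q (\<beta> x)" and us: "length us = q"
 shows "wedge 1 q \<alpha> \<beta> x (v # us) = \<alpha> x [v] * \<beta> x us - (\<Sum>a<q. \<beta> x (us[a := v]) * \<alpha> x [us ! a])"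
proof -
 let ?vs = "v # us" and ?t = "Transposition.transpose (0::nat)"
 let ?f = "\<lambda>\<sigma>. of_int (sign \<sigma>) * \<alpha> x [?vs ! \<sigma> 0] * \<beta> x (map (\<lambda>i. ?vs ! \<sigma> i) [1..<Suc q])"
 have ins: "{..<1 + q} = insert 0 {1..<Suc q}" by auto
 have tm: "?f (?t b \<circ> \<rho>) = (if b = 0 then \<alpha> x [v] * \<beta> x us else - (\<alpha> x [us ! (b - 1)] * \<beta> x (us[b - 1 := v])))"
  if b: "b \<in> insert 0 {1..<Suc q}" and \<rho>: "\<rho> permutes {1..<Suc q}" for b \<rho>
 proof -
  have "\<rho> 0 = 0" using \<rho> by (auto simp: permutes_def)
  have "\<beta> x (map (\<lambda>i. ?vs ! (?t b \<circ> \<rho>) i) [1..<Suc q]) = of_int (sign \<rho>) * \<beta> x (map (\<lambda>i. ?vs ! ?t b i) [1..<Suc q])"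
   using alt_permute[OF B \<rho>, of "\<lambda>i. ?vs ! ?t b i"] by simp
  moreover have "sign (?t b \<circ> \<rho>) = (if b = 0 then 1 else - 1) * sign \<rho>"
   using sign_compose[OF permutation_swap_id permutes_imp_permutation[OF finite_atLeastLessThan \<rho>], of 0 b]
   unfolding sign_swap_id by auto
  moreover have "of_int (sign \<rho>) * (of_int (sign \<rho>) * z) = z" for z :: complex
   unfolding mult.assoc[symmetric] of_int_mult[symmetric] by simp
  moreover have "map (\<lambda>i. ?vs ! ?t b i) [1..<Suc q] = (if b = 0 then us else us[b - 1 := v])"
   using b us by (intro nth_equalityI) (auto simp: transpose_def nth_list_update nth_Cons' simp del: upt_Suc)
  ultimately show ?thesis using \<open>\<rho> 0 = 0\<close> b by (auto simp: mult.left_commute)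
 qed
 have "wedge 1 q \<alpha> \<beta> x (v # us) * fact q = (\<Sum>\<sigma> | \<sigma> permutes {..<1 + q}. ?f \<sigma>)"
  using us by (simp add: wedge_def upt_rec[of 0 "Suc 0"] del: upt_Suc)
 also have "\<dots> = (\<Sum>b\<in>insert 0 {1..<Suc q}. \<Sum>\<rho> | \<rho> permutes {1..<Suc q}. ?f (?t b \<circ> \<rho>))"
  unfolding ins by (rule sum_over_permutations_insert) auto
 also have "\<dots> = (\<Sum>b\<in>insert 0 {1..<Suc q}. \<Sum>\<rho> | \<rho> permutes {1..<Suc q}.
   if b = 0 then \<alpha> x [v] * \<beta> x us else - (\<alpha> x [us ! (b - 1)] * \<beta> x (us[b - 1 := v])))"
  using tm by (intro sum.cong refl) blast
 also have "\<dots> = fact q * (\<Sum>b\<in>insert 0 {1..<Suc q}.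
   if b = 0 then \<alpha> x [v] * \<beta> x us else - (\<alpha> x [us ! (b - 1)] * \<beta> x (us[b - 1 := v])))"
  by (simp only: sum_constant card_permutations[of "{1..<Suc q}" q] card_atLeastLessThan diff_Suc_1
    finite_atLeastLessThan of_nat_fact sum_distrib_left)
 also have "(\<Sum>b\<in>insert 0 {1..<Suc q}. if b = 0 then \<alpha> x [v] * \<beta> x us else - (\<alpha> x [us ! (b - 1)] * \<beta> x (us[b - 1 := v])))
   = \<alpha> x [v] * \<beta> x us - (\<Sum>b\<in>{1..<Suc q}. \<alpha> x [us ! (b - 1)] * \<beta> x (us[b - 1 := v]))"
  by (simp add: sum_negf)
 also have "(\<Sum>b\<in>{1..<Suc q}. \<alpha> x [us ! (b - 1)] * \<beta> x (us[b - 1 := v])) = (\<Sum>a<q. \<alpha> x [us ! a] * \<beta> x (us[a := v]))"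
  by (rule sum.reindex_bij_witness[of _ Suc "\<lambda>b. b - 1"]) auto
 finally show ?thesis by (simp add: mult.commute)
qed

lemma wedge_1_eq_0:
 assumes B: "alt q (\<beta> x)" and w: "wedge 1 q \<alpha> \<beta> x (v # us) = 0" and us: "length us = q"
 shows "\<alpha> x [v] * \<beta> x us = (\<Sum>a<q. \<beta> x (us[a := v]) * \<alpha> x [us ! a])"
 using w unfolding wedge_1_Cons[where \<beta>=\<beta> and x=x, OF B us] by simp

section \<open>Forms with polynomial coefficients and their derivatives\<close>

lemma hom_formD:
 assumes "hom_form q k \<omega>"
 shows hom_form_alt: "alt q (\<omega> x)" and hom_form_multilin: "multilin q (\<omega> x)"
  and hom_form_length: "length vs \<noteq> q ==> \<omega> x vs = 0" and hom_form_hp: "length vs = q ==> hp k (\<lambda>x. \<omega> x vs)"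
 using assms unfolding hom_form_def alt_def multilin_def by blast+

lemma hom_formI:
 assumes "\<And>x. alt q (\<omega> x)" "\<And>x vs. length vs \<noteq> q ==> \<omega> x vs = 0" "\<And>vs. length vs = q ==> hp k (\<lambda>x. \<omega> x vs)"
 shows "hom_form q k \<omega>"
 using assms unfolding hom_form_def alt_def multilin_def by blast

text \<open>The clause for \<open>k = 0\<close> compensates for truncated subtraction: in the
  product rule a factor of degree 0 must contribute no derivative term, or the degree
  \<open>j + k - 1\<close> would be wrong.\<close>

lemma hp_gradient:
 assumes "hp k p"
 shows "\<exists>G. (\<forall>i. hp (k - 1) (G i)) \<and> (\<forall>i. k = 0 --> G i = (\<lambda>_. 0)) \<and>
  (\<forall>x v. ((\<lambda>t. p (x + t *s v)) has_field_derivative (\<Sum>i\<in>UNIV. v $ i * G i x)) (at 0))"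
 using assms
proof (induction rule: hom_poly.induct)
  case (const c) show ?case by (intro exI[of _ "\<lambda>_ _. 0"]) (auto simp: hp_zero)
 next
  case (linear l)
  have "((\<lambda>t. l (x + t *s v)) has_field_derivative (\<Sum>i\<in>UNIV. v $ i * l (ax i))) (at 0)" for x v
   unfolding lin_add[OF linear] lin_scale[OF linear] lin_expand[OF linear, of v, symmetric]
   by (auto intro!: derivative_eq_intros)
  then show ?case by (intro exI[of _ "\<lambda>i _. l (ax i)"]) (auto intro: hom_poly.const)
 next
  case (add k p q)
  then obtain G H where *: "\<forall>i. hp (k - 1) (G i)" "\<forall>i. k = 0 --> G i = (\<lambda>_. 0)"
   "\<forall>x v. ((\<lambda>t. p (x + t *s v)) has_field_derivative (\<Sum>i\<in>UNIV. v $ i * G i x)) (at 0)"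
   "\<forall>i. hp (k - 1) (H i)" "\<forall>i. k = 0 --> H i = (\<lambda>_. 0)"
   "\<forall>x v. ((\<lambda>t. q (x + t *s v)) has_field_derivative (\<Sum>i\<in>UNIV. v $ i * H i x)) (at 0)" by blast
  have "((\<lambda>t. p (x + t *s v) + q (x + t *s v)) has_field_derivative (\<Sum>i\<in>UNIV. v $ i * (G i x + H i x))) (at 0)" for x v
   using DERIV_add[OF *(3)[rule_format, of x v] *(6)[rule_format, of x v]] by (simp add: distrib_left sum.distrib)
  then show ?case using * by (intro exI[of _ "\<lambda>i x. G i x + H i x"]) (auto intro: hom_poly.add)
 next
  case (mult j p k q)
  then obtain G H where *: "\<forall>i. hp (j - 1) (G i)" "\<forall>i. j = 0 --> G i = (\<lambda>_. 0)"
   "\<forall>x v. ((\<lambda>t. p (x + t *s v)) has_field_derivative (\<Sum>i\<in>UNIV. v $ i * G i x)) (at 0)"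
   "\<forall>i. hp (k - 1) (H i)" "\<forall>i. k = 0 --> H i = (\<lambda>_. 0)"
   "\<forall>x v. ((\<lambda>t. q (x + t *s v)) has_field_derivative (\<Sum>i\<in>UNIV. v $ i * H i x)) (at 0)" by blast
  let ?K = "\<lambda>i x. G i x * q x + p x * H i x"
  have "((\<lambda>t. p (x + t *s v) * q (x + t *s v)) has_field_derivative (\<Sum>i\<in>UNIV. v $ i * ?K i x)) (at 0)" for x v
   using DERIV_mult[OF *(3)[rule_format, of x v] *(6)[rule_format, of x v]]
   by (simp add: algebra_simps sum.distrib sum_distrib_left)
  moreover have "hp (j + k - 1) (\<lambda>x. G i x * q x)" for i
  proof (cases "j = 0")
   case True then show ?thesis using *(2) by (simp add: hp_zero)
  next
   case False then show ?thesis using hom_poly.mult[OF *(1)[rule_format, of i] mult.hyps(2)] by simp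
  qed
  moreover have "hp (j + k - 1) (\<lambda>x. p x * H i x)" for i
  proof (cases "k = 0")
   case True then show ?thesis using *(5) by (simp add: hp_zero)
  next
   case False then show ?thesis using hom_poly.mult[OF mult.hyps(1) *(4)[rule_format, of i]] by simp
  qed
  ultimately show ?case using *(2,5) by (intro exI[of _ ?K]) (auto intro: hom_poly.add)
qed

definition dird :: "complex^'n => (complex^'n => complex) => complex^'n => complex" where
 "dird v p x = deriv (\<lambda>t. p (x + t *s v)) 0"

lemma dird_has_derivative:
 assumes "hp k p" shows "((\<lambda>t. p (x + t *s v)) has_field_derivative dird v p x) (at 0)"
proof -
 obtain G where "\<And>x v. ((\<lambda>t. p (x + t *s v)) has_field_derivative (\<Sum>i\<in>UNIV. v $ i * G i x)) (at 0)"
  using hp_gradient[OF assms] by blast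
 then show ?thesis unfolding dird_def using DERIV_imp_deriv by metis
qed

lemma dird_eqI: "((\<lambda>t. p (x + t *s v)) has_field_derivative D) (at 0) ==> dird v p x = D"
 unfolding dird_def by (rule DERIV_imp_deriv)

lemma lin_dird: assumes "hp k p" shows "lin (\<lambda>v. dird v p x)"
proof -
 obtain G where "\<And>x v. ((\<lambda>t. p (x + t *s v)) has_field_derivative (\<Sum>i\<in>UNIV. v $ i * G i x)) (at 0)"
  using hp_gradient[OF assms] by blast
 then have "dird v p x = (\<Sum>i\<in>UNIV. v $ i * G i x)" for v by (rule dird_eqI)
 then show ?thesis by (intro linI) (simp_all add: distrib_right sum.distrib sum_distrib_left mult.assoc)
qed

lemma hp_dird: assumes "hp (Suc k) p" shows "hp k (dird v p)"
proof -
 obtain G where G: "\<And>i. hp (Suc k - 1) (G i)"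
  "\<And>x v. ((\<lambda>t. p (x + t *s v)) has_field_derivative (\<Sum>i\<in>UNIV. v $ i * G i x)) (at 0)"
  using hp_gradient[OF assms] by blast
 then have "dird v p = (\<lambda>x. \<Sum>i\<in>UNIV. v $ i * G i x)" using dird_eqI by blast
 then show ?thesis using G(1) by (auto intro!: hp_sum hp_scale)
qed

lemma dird_add: "hp k p ==> hp k q ==> dird v (\<lambda>x. p x + q x) x = dird v p x + dird v q x"
 by (intro dird_eqI DERIV_add dird_has_derivative)
lemma dird_scale: "hp k p ==> dird v (\<lambda>x. c * p x) x = c * dird v p x"
 by (intro dird_eqI DERIV_cmult dird_has_derivative)
lemma dird_zero: "dird v (\<lambda>_. 0) x = 0"
 by (rule dird_eqI) simp
lemma lin_dird_p: "(\<And>v. hp k (P v)) ==> (\<And>x. lin (\<lambda>v. P v x)) ==> lin (\<lambda>w. dird v (P w) x)"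
proof (rule linI)
 assume P: "\<And>v. hp k (P v)" and l: "\<And>x. lin (\<lambda>v. P v x)"
 fix a b c
 have "P (a + b) = (\<lambda>x. P a x + P b x)" "P (c *s a) = (\<lambda>x. c * P a x)"
  by (auto simp: lin_add[OF l] lin_scale[OF l])
 then show "dird v (P (a + b)) x = dird v (P a) x + dird v (P b) x" "dird v (P (c *s a)) x = c * dird v (P a) x"
  using dird_add[OF P P] dird_scale[OF P] by simp_all
qed

lemma euler: assumes "hp k p" shows "dird x p x = of_nat k * p x"
proof (rule dird_eqI)
 have "(\<lambda>t. p (x + t *s x)) = (\<lambda>t. (1 + t) ^ k * p x)"
 proof
  fix t
  have "x + t *s x = (1 + t) *s x" by (simp add: vec_eq_iff algebra_simps)
  then show "p (x + t *s x) = (1 + t) ^ k * p x" using hom_poly_scale[OF assms] by metis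
 qed
 then show "((\<lambda>t. p (x + t *s x)) has_field_derivative of_nat k * p x) (at 0)"
  by (auto intro!: derivative_eq_intros)
qed

lemma dird_zero_const:
 assumes "hp k p" "\<And>x. dird v p x = 0" shows "p (x + t *s v) = p x"
proof -
 have "((\<lambda>t. p (x + t *s v)) has_field_derivative 0) (at t)" for t
 proof -
  have "((\<lambda>s. p ((x + t *s v) + s *s v)) has_field_derivative 0) (at 0)"
   using dird_has_derivative[OF assms(1)] assms(2) by metis
  moreover have "(x + t *s v) + s *s v = x + (s + t) *s v" for s by (simp add: vec_eq_iff algebra_simps)
  ultimately have "((\<lambda>s. p (x + (s + t) *s v)) has_field_derivative 0) (at 0)" by (simp only:)
  then show ?thesis using DERIV_shift[of "\<lambda>s. p (x + s *s v)" 0 0 t] by simp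
 qed
 then obtain c where "\<And>t. p (x + t *s v) = c"
  using has_field_derivative_zero_constant[of UNIV "\<lambda>t. p (x + t *s v)"] by auto
 from this[of t] this[of 0] show ?thesis by simp
qed

lemma ext_deriv_eq:
 "ext_deriv \<omega> x vs = (\<Sum>i<length vs. (-1) ^ i * dird (vs ! i) (\<lambda>x. \<omega> x (take i vs @ drop (Suc i) vs)) x)"
 by (simp add: ext_deriv_def dird_def)

lemma take_drop_update:
 assumes "i < length vs" "j < length vs"
 shows "take i (vs[j := v]) @ drop (Suc i) (vs[j := v]) =
  (if j < i then (take i vs @ drop (Suc i) vs)[j := v]
  else if j = i then take i vs @ drop (Suc i) vs
  else (take i vs @ drop (Suc i) vs)[j - 1 := v])"
 using assms by (auto intro!: nth_equalityI simp: nth_append nth_list_update min_def)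

text \<open>For alternation, take two equal adjacent vectors: omitting any other vector leaves a
  repeated argument, and omitting either of the two leaves the same list with opposite
  signs.\<close>

lemma hom_form_ext_deriv:
 assumes \<omega>: "hom_form q (Suc k) \<omega>" shows "hom_form (Suc q) k (ext_deriv \<omega>)"
proof (rule hom_formI)
 note hpw = hom_form_hp[OF \<omega>]
 show "ext_deriv \<omega> x vs = 0" if "length vs \<noteq> Suc q" for x vs
  unfolding ext_deriv_eq
 proof (rule sum.neutral, rule ballI)
  fix i assume "i \<in> {..<length vs}"
  then have "length (take i vs @ drop (Suc i) vs) \<noteq> q" using that by auto
  then show "(-1) ^ i * dird (vs ! i) (\<lambda>x. \<omega> x (take i vs @ drop (Suc i) vs)) x = 0"
   using hom_form_length[OF \<omega>] by (simp add: dird_zero)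
 qed
 show "hp k (\<lambda>x. ext_deriv \<omega> x vs)" if "length vs = Suc q" for vs
  unfolding ext_deriv_eq
 proof (rule hp_sum, rule hp_scale)
  fix i assume "i \<in> {..<length vs}"
  then have "length (take i vs @ drop (Suc i) vs) = q" using that by auto
  then show "hp k (\<lambda>x. dird (vs ! i) (\<lambda>x. \<omega> x (take i vs @ drop (Suc i) vs)) x)" using hp_dird[OF hpw] by simp
 qed
 fix x
 show "alt (Suc q) (ext_deriv \<omega> x)"
 proof (rule altI_adjacent)
  show "multilin (Suc q) (ext_deriv \<omega> x)"
   unfolding multilin_def
  proof (intro allI impI)
   fix vs :: "(complex^'a) list" and j assume *: "length vs = Suc q \<and> j < Suc q"
   have l: "lin (\<lambda>v. dird (vs[j := v] ! i) (\<lambda>x. \<omega> x (take i (vs[j := v]) @ drop (Suc i) (vs[j := v]))) x)"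
    if i: "i < Suc q" for i
   proof -
    have len: "length (take i vs @ drop (Suc i) vs) = q" using i * by auto
    show ?thesis
    proof (cases "j = i")
     case True
     then show ?thesis using * i lin_dird[OF hpw[OF len]] by (simp add: take_drop_update)
    next
     case False
     let ?j = "if j < i then j else j - 1"
     have "?j < q" using False i * by auto
     then have "lin (\<lambda>v. \<omega> y ((take i vs @ drop (Suc i) vs)[?j := v]))" for y
      using multilin_lin[OF hom_form_multilin[OF \<omega>] len] by blast
     then have "lin (\<lambda>v. dird (vs ! i) (\<lambda>x. \<omega> x ((take i vs @ drop (Suc i) vs)[?j := v])) x)"
      using hpw len by (intro lin_dird_p[of "Suc k"]) auto
     moreover have "take i (vs[j := v]) @ drop (Suc i) (vs[j := v]) = (take i vs @ drop (Suc i) vs)[?j := v]" for v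
      using False i * by (simp add: take_drop_update)
     ultimately show ?thesis using False by simp
    qed
   qed
   show "lin (\<lambda>v. ext_deriv \<omega> x (vs[j := v]))"
    using lin_add[OF l] lin_scale[OF l] *
    by (intro linI) (simp_all add: ext_deriv_eq sum.distrib sum_distrib_left algebra_simps)
  qed
  fix vs :: "(complex^'a) list" and a assume *: "length vs = Suc q" "Suc a < Suc q" "vs ! a = vs ! Suc a"
  let ?T = "\<lambda>i. (-1) ^ i * dird (vs ! i) (\<lambda>x. \<omega> x (take i vs @ drop (Suc i) vs)) x"
  have z: "?T i = 0" if "i < Suc q" "i \<noteq> a" "i \<noteq> Suc a" for i
  proof -
   let ?ws = "take i vs @ drop (Suc i) vs"
   have "\<omega> y ?ws = 0" for y
   proof (cases "i < a")
    case True
    show ?thesis by (rule alt_equal[OF hom_form_alt[OF \<omega>], of ?ws "a - 1" a])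
     (use * that True in \<open>auto simp: nth_append min_def\<close>)
   next
    case False
    show ?thesis by (rule alt_equal[OF hom_form_alt[OF \<omega>], of ?ws a "Suc a"])
     (use * that False in \<open>auto simp: nth_append min_def\<close>)
   qed
   then show ?thesis by (simp add: dird_zero)
  qed
  have "ext_deriv \<omega> x vs = (\<Sum>i\<in>{a, Suc a}. ?T i)"
   unfolding ext_deriv_eq using * z by (intro sum.mono_neutral_right) auto
  also have "\<dots> = ?T a + ?T (Suc a)" by simp
  also have "take a vs @ drop (Suc a) vs = take (Suc a) vs @ drop (Suc (Suc a)) vs"
   using * by (metis Cons_nth_drop_Suc Suc_lessD append.assoc append_Cons append_Nil take_Suc_conv_app_nth)
  finally show "ext_deriv \<omega> x vs = 0" using *(3) by simp
 qed
qed

section \<open>Decomposability and integrability\<close>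

text \<open>The Pluecker relations \<open>(i\<^sub>u \<omega>) \<and> \<omega> = 0\<close> in exchange form.\<close>

definition exchange :: "nat => nat => 'n::finite form => 'n form => bool" where
 "exchange q p \<omega> \<eta> \<longleftrightarrow> (\<forall>x v us js. length us = p \<and> Suc (length js) = q -->
  \<omega> x (v # js) * \<eta> x us = (\<Sum>a<p. \<eta> x (us[a := v]) * \<omega> x (us ! a # js)))"

lemma exchangeD: "exchange q p \<omega> \<eta> ==> length us = p ==> Suc (length js) = q ==>
  \<omega> x (v # js) * \<eta> x us = (\<Sum>a<p. \<eta> x (us[a := v]) * \<omega> x (us ! a # js))"
 by (simp add: exchange_def)

lemma alt_last_head: "alt q F ==> Suc (length js) = q ==> F (js @ [u]) = (-1) ^ length js * F (u # js)"
 using alt_head[of q F "js @ [0]" "length js" u] by simp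

lemma multilin_comb:
 fixes G :: "'i => (complex^'n) list => complex"
 assumes "\<And>i. i \<in> A ==> multilin q (G i)"
 shows "multilin q (\<lambda>vs. \<Sum>i\<in>A. c i * G i vs)"
 unfolding multilin_def
proof (intro allI impI linI)
 fix vs :: "(complex^'n) list" and j v w c'
 assume *: "length vs = q \<and> j < q"
 have "c i * G i (vs[j := v + w]) = c i * G i (vs[j := v]) + c i * G i (vs[j := w])"
  "c i * G i (vs[j := c' *s v]) = c' * (c i * G i (vs[j := v]))" if "i \<in> A" for i
  using * multilin_add[OF assms[OF that]] multilin_scale[OF assms[OF that]] by (simp_all add: distrib_left)
 then show "(\<Sum>i\<in>A. c i * G i (vs[j := v + w])) = (\<Sum>i\<in>A. c i * G i (vs[j := v])) + (\<Sum>i\<in>A. c i * G i (vs[j := w]))"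
  "(\<Sum>i\<in>A. c i * G i (vs[j := c' *s v])) = c' * (\<Sum>i\<in>A. c i * G i (vs[j := v]))"
  unfolding sum.distrib[symmetric] sum_distrib_left by (auto intro: sum.cong)
qed

lemma multilin_diff:
 fixes F G :: "(complex^'n) list => complex"
 assumes "multilin q F" "multilin q G" shows "multilin q (\<lambda>vs. c * F vs - G vs)"
 unfolding multilin_def
proof (intro allI impI linI)
 fix vs :: "(complex^'n) list" and j v w c'
 assume "length vs = q \<and> j < q"
 then show "c * F (vs[j := v + w]) - G (vs[j := v + w]) = (c * F (vs[j := v]) - G (vs[j := v])) + (c * F (vs[j := w]) - G (vs[j := w]))"
  "c * F (vs[j := c' *s v]) - G (vs[j := c' *s v]) = c' * (c * F (vs[j := v]) - G (vs[j := v]))"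
  using assms by (simp_all add: multilin_add multilin_scale algebra_simps)
qed

lemma contract_basis:
 assumes "length J = k"
 shows "contract k (\<lambda>I. if I = J then 1 else 0) \<omega> x ws = \<omega> x (map ax J @ ws)"
proof -
 have "contract k (\<lambda>I. if I = J then 1 else 0) \<omega> x ws = (\<Sum>I\<in>{J}. \<omega> x (map ax I @ ws))"
  unfolding contract_def by (rule sum.mono_neutral_cong_right) (use assms finite_index_lists in auto)
 then show ?thesis by simp
qed

text \<open>Contraction with basis multivectors yields the relation for basis vectors in
  \<open>js\<close>, and multilinearity extends it. The multivector fills the first slots, so the
  free slot is the last one; the sign \<open>(-1) ^ (q - 1)\<close> from moving it to the front
  occurs on both sides.\<close>

lemma exchangeI_wedge:
 fixes \<omega> \<eta> :: "'n::finite form"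
 assumes \<omega>: "hom_form q k \<omega>" and q: "q \<ge> 1" and \<eta>: "hom_form p l \<eta>"
  and w: "\<And>v. wedge 1 p (contract (q - 1) v \<omega>) \<eta> = 0"
 shows "exchange q p \<omega> \<eta>"
 unfolding exchange_def
proof (intro allI impI)
 fix x v and us js :: "(complex^'n) list" assume *: "length us = p \<and> Suc (length js) = q"
 have alt: "alt q (\<omega> x)" using hom_form_alt[OF \<omega>] .
 define G where "G js = \<eta> x us * \<omega> x (v # js) - (\<Sum>a<p. \<eta> x (us[a := v]) * \<omega> x (us ! a # js))" for js
 have mlin: "multilin (q - 1) (\<lambda>js. \<omega> x (u # js))" for u
  using multilin_Cons[of "q - 1" "\<omega> x"] alt_multilin[OF alt] q by simp
 have "multilin (q - 1) G"
  unfolding G_def by (intro multilin_diff multilin_comb mlin)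
 moreover have "G (map ax J) = 0" if J: "length J = q - 1" for J
 proof -
  let ?\<alpha> = "contract (q - 1) (\<lambda>I. if I = J then 1 else 0) \<omega>"
  have \<alpha>: "?\<alpha> x [u] = (-1) ^ (q - 1) * \<omega> x (u # map ax J)" for u
   using contract_basis[OF J] alt_last_head[OF alt, of "map ax J" u] J q by simp
  have "wedge 1 p ?\<alpha> \<eta> x (v # us) = 0" using fun_cong[OF fun_cong[OF w]] by simp
  from wedge_1_eq_0[OF hom_form_alt[OF \<eta>] this] *
  have "(-1) ^ (q - 1) * (\<omega> x (v # map ax J) * \<eta> x us) =
    (-1) ^ (q - 1) * (\<Sum>a<p. \<eta> x (us[a := v]) * \<omega> x (us ! a # map ax J))"
   unfolding \<alpha> by (simp add: sum_distrib_left algebra_simps)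
  then show ?thesis by (simp add: G_def mult.commute)
 qed
 ultimately have "G js = 0" by (rule multilin_zero_basis) (use * in auto)
 then show "\<omega> x (v # js) * \<eta> x us = (\<Sum>a<p. \<eta> x (us[a := v]) * \<omega> x (us ! a # js))"
  by (simp add: G_def mult.commute)
qed

lemma wedge_eq_0I_exchange:
 fixes \<omega> \<eta> :: "'n::finite form"
 assumes \<omega>: "hom_form q k \<omega>" and q: "q \<ge> 1" and \<eta>: "hom_form p l \<eta>" and ex: "exchange q p \<omega> \<eta>"
 shows "wedge 1 p (contract (q - 1) v \<omega>) \<eta> = 0"
proof (intro ext)
 fix x and vs :: "(complex^'n) list"
 let ?\<alpha> = "contract (q - 1) v \<omega>"
 show "wedge 1 p ?\<alpha> \<eta> x vs = 0 x vs"
 proof (cases "length vs = Suc p")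
  case True
  then obtain w us where vs: "vs = w # us" "length us = p" by (cases vs) auto
  have \<alpha>: "?\<alpha> x [u] = (\<Sum>I | length I = q - 1. v I * ((-1) ^ (q - 1) * \<omega> x (u # map ax I)))" for u
   unfolding contract_def
  proof (intro sum.cong refl)
   fix I :: "'n list" assume "I \<in> {I. length I = q - 1}"
   then show "v I * \<omega> x (map ax I @ [u]) = v I * ((-1) ^ (q - 1) * \<omega> x (u # map ax I))"
    using alt_last_head[OF hom_form_alt[OF \<omega>], of "map ax I" x u] q by simp
  qed
  have "?\<alpha> x [w] * \<eta> x us = (\<Sum>I | length I = q - 1. v I * (-1) ^ (q - 1) * (\<omega> x (w # map ax I) * \<eta> x us))"
   unfolding \<alpha> by (simp add: sum_distrib_right mult.assoc)
  also have "\<dots> = (\<Sum>I | length I = q - 1. v I * (-1) ^ (q - 1) * (\<Sum>a<p. \<eta> x (us[a := w]) * \<omega> x (us ! a # map ax I)))"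
  proof (intro sum.cong refl)
   fix I :: "'n list" assume "I \<in> {I. length I = q - 1}"
   then have "Suc (length (map ax I)) = q" using q by simp
   from exchangeD[OF ex vs(2) this]
   show "v I * (-1) ^ (q - 1) * (\<omega> x (w # map ax I) * \<eta> x us) =
    v I * (-1) ^ (q - 1) * (\<Sum>a<p. \<eta> x (us[a := w]) * \<omega> x (us ! a # map ax I))" by simp
  qed
  also have "\<dots> = (\<Sum>a<p. \<eta> x (us[a := w]) * ?\<alpha> x [us ! a])"
   unfolding \<alpha> sum_distrib_left by (subst sum.swap) (simp add: mult_ac)
  finally show ?thesis
   unfolding vs(1) wedge_1_Cons[where \<beta>=\<eta> and x=x, OF hom_form_alt[OF \<eta>] vs(2)] by simp
 qed (simp add: wedge_def)
qed

lemma exchange_zero: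
 assumes \<gamma>: "alt q \<gamma>" and \<omega>: "alt q \<omega>"
  and ex: "\<And>v us js. length us = q ==> Suc (length js) = q ==>
   \<omega> (v # js) * \<gamma> us = (\<Sum>a<q. \<gamma> (us[a := v]) * \<omega> (us ! a # js))"
  and U: "length U = q" "\<omega> U \<noteq> 0" "\<gamma> U = 0" and us: "length us = q"
 shows "\<gamma> us = 0"
proof -
 have "m \<le> q ==> (\<forall>us. length us = q \<and> (\<forall>i<q - m. us ! i = U ! i) --> \<gamma> us = 0)" for m
 proof (induction m)
  case 0
  show ?case using U nth_equalityI[of _ U] by auto
 next
  case (Suc m)
  show ?case
  proof (intro allI impI)
   fix us assume us: "length us = q \<and> (\<forall>i<q - Suc m. us ! i = U ! i)"
   define k where "k = q - Suc m"
   have k: "k < q" "q - m = Suc k" using Suc.prems by (auto simp: k_def)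
   let ?js = "take k U @ drop (Suc k) U"
   have IH: "\<gamma> ws = 0" if "length ws = q" "\<forall>i\<le>k. ws ! i = U ! i" for ws
    using Suc that k by (auto simp: less_Suc_eq_le)
   have "\<omega> (U ! k # ?js) * \<gamma> us = (\<Sum>a<q. \<gamma> (us[a := U ! k]) * \<omega> (us ! a # ?js))"
    using us U(1) k by (intro ex) auto
   also have "\<dots> = 0"
   proof (rule sum.neutral, rule ballI)
    fix a assume "a \<in> {..<q}"
    then consider "a < k" | "a = k" | "a > k" "a < q" by fastforce
    then show "\<gamma> (us[a := U ! k]) * \<omega> (us ! a # ?js) = 0"
    proof cases
     case 1
     have "\<omega> (us ! a # ?js) = 0"
      by (rule alt_equal[OF \<omega>, of _ 0 "Suc a"]) (use 1 us k U in \<open>auto simp: nth_append k_def\<close>)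
     then show ?thesis by simp
    next
     case 2
     then have "\<gamma> (us[a := U ! k]) = 0" using us k
      by (intro IH) (auto simp: nth_list_update k_def)
     then show ?thesis by simp
    next
     case 3
     have "us[a := U ! k] = us[k := us ! k, a := U ! k]" by simp
     then have "\<gamma> (us[a := U ! k]) = - \<gamma> (us[k := U ! k, a := us ! k])"
      using alt_swap[OF \<gamma>, of us k a "us ! k" "U ! k"] us k 3 by simp
     also have "\<gamma> (us[k := U ! k, a := us ! k]) = 0"
      using us k 3 by (intro IH) (auto simp: nth_list_update k_def)
     finally show ?thesis by simp
    qed
   qed
   finally have "\<omega> (U ! k # ?js) * \<gamma> us = 0" .
   moreover have "\<omega> (U ! k # ?js) \<noteq> 0"
    using alt_head[OF \<omega> U(1) k(1), of "U ! k"] U(2) by auto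
   ultimately show "\<gamma> us = 0" by simp
  qed
 qed
 from this[of q] us show ?thesis by simp
qed

text \<open>The combination of \<eta> and \<omega> that is zero at \<open>U\<close> inherits the
  exchange relation from both, so \<open>exchange_zero\<close> applies to it. If
  \<open>\<omega> U = 0\<close>, the roles of \<open>U\<close> and \<open>us\<close> are
  exchanged.\<close>

lemma exchange_proportional:
 assumes \<eta>: "alt q \<eta>" and \<omega>: "alt q \<omega>"
  and ex: "\<And>v us js. length us = q ==> Suc (length js) = q ==>
   \<omega> (v # js) * \<eta> us = (\<Sum>a<q. \<eta> (us[a := v]) * \<omega> (us ! a # js))"
  and pl: "\<And>v us js. length us = q ==> Suc (length js) = q ==>
   \<omega> (v # js) * \<omega> us = (\<Sum>a<q. \<omega> (us[a := v]) * \<omega> (us ! a # js))"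
  and len: "length U = q" "length us = q"
 shows "\<omega> U * \<eta> us = \<eta> U * \<omega> us"
proof -
 have main: "\<omega> U * \<eta> us = \<eta> U * \<omega> us" if U: "\<omega> U \<noteq> 0" "length U = q" "length us = q" for U us
 proof -
  define \<gamma> where "\<gamma> us = \<omega> U * \<eta> us - \<eta> U * \<omega> us" for us
  have "alt q \<gamma>"
   unfolding alt_def
  proof (intro conjI allI impI)
   show "multilin q \<gamma>" unfolding \<gamma>_def multilin_def
    using alt_multilin[OF \<eta>] alt_multilin[OF \<omega>]
    by (intro allI impI linI) (simp_all add: multilin_add multilin_scale algebra_simps)
  next
   fix vs :: "(complex^'a) list" and i j assume "length vs = q \<and> i < j \<and> j < q \<and> vs ! i = vs ! j"
   then have "\<eta> vs = 0" "\<omega> vs = 0"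
    using alt_equal[OF \<eta>, of vs i j] alt_equal[OF \<omega>, of vs i j] by auto
   then show "\<gamma> vs = 0" by (simp add: \<gamma>_def)
  qed
  moreover have "\<omega> (v # js) * \<gamma> us = (\<Sum>a<q. \<gamma> (us[a := v]) * \<omega> (us ! a # js))"
   if "length us = q" "Suc (length js) = q" for v us js
  proof -
   have "\<omega> (v # js) * \<gamma> us = \<omega> U * (\<omega> (v # js) * \<eta> us) - \<eta> U * (\<omega> (v # js) * \<omega> us)"
    by (simp add: \<gamma>_def algebra_simps)
   also have "\<dots> = (\<Sum>a<q. \<gamma> (us[a := v]) * \<omega> (us ! a # js))"
    unfolding ex[OF that] pl[OF that] by (simp add: \<gamma>_def sum_distrib_left sum_subtractf algebra_simps)
   finally show ?thesis .
  qed
  moreover have "\<gamma> U = 0" by (simp add: \<gamma>_def)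
  ultimately have "\<gamma> us = 0" using exchange_zero[OF _ \<omega> _ U(2,1) _ U(3), of \<gamma>] by blast
  then show ?thesis by (simp add: \<gamma>_def)
 qed
 show ?thesis
 proof (cases "\<omega> U = 0")
  case True
  show ?thesis
  proof (cases "\<omega> us = 0")
   case False then show ?thesis using main[OF False len(2,1)] True by simp
  qed (simp add: True)
 qed (use main len in blast)
qed

lemma ext_deriv_2:
 "ext_deriv \<omega> x [a, b] = dird a (\<lambda>x. \<omega> x [b]) x - dird b (\<lambda>x. \<omega> x [a]) x"
 by (simp add: ext_deriv_eq numeral_2_eq_2)

text \<open>Cartan's formula for the radial field R: as i_R \<omega> = 0, contracting d\<omega> with
  R gives the Lie derivative, which multiplies \<omega> by the degree \<open>d + 1\<close> of its
  coefficients plus one. The additional one comes from differentiating i_R \<omega> = 0 along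
  \<open>v\<close>.\<close>

lemma ext_deriv_radial:
 assumes \<omega>: "hom_form 1 (Suc d) \<omega>" and R: "\<And>x ws. \<omega> x (x # ws) = 0"
 shows "ext_deriv \<omega> x [x, v] = of_nat (d + 2) * \<omega> x [v]"
proof -
 note hpw = hom_form_hp[OF \<omega>]
 have l1: "length [u] = 1" for u :: "complex^'a" by simp
 have 0: "((\<lambda>t. \<omega> (x + t *s v) [x] + t * \<omega> (x + t *s v) [v]) has_field_derivative
   (dird v (\<lambda>x. \<omega> x [x']) x + (1 * \<omega> (x + 0 *s v) [v] + dird v (\<lambda>x. \<omega> x [v]) x * 0))) (at 0)" if "x' = x" for x'
  unfolding that by (intro DERIV_add DERIV_mult dird_has_derivative[OF hpw[OF l1]] DERIV_ident)
 have "\<omega> (x + t *s v) [x] + t * \<omega> (x + t *s v) [v] = 0" for t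
 proof -
  have "lin (\<lambda>u. \<omega> (x + t *s v) [u])"
   using multilin_Cons_lin[of 0 "\<omega> (x + t *s v)" "[]"] hom_form_multilin[OF \<omega>] by simp
  note ll = this
  have "\<omega> (x + t *s v) [x + t *s v] = \<omega> (x + t *s v) [x] + t * \<omega> (x + t *s v) [v]"
   using lin_add[OF ll, of x "t *s v"] lin_scale[OF ll, of t v] by simp
  then show ?thesis using R by simp
 qed
 then have "((\<lambda>t. 0) has_field_derivative
   (dird v (\<lambda>y. \<omega> y [x]) x + (1 * \<omega> (x + 0 *s v) [v] + dird v (\<lambda>x. \<omega> x [v]) x * 0))) (at 0)"
  using 0[OF refl] by simp
 then have "dird v (\<lambda>y. \<omega> y [x]) x + \<omega> x [v] = 0"
  using DERIV_unique[OF _ DERIV_const] by fastforce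
 then have "dird v (\<lambda>y. \<omega> y [x]) x = - \<omega> x [v]" by (simp add: eq_neg_iff_add_eq_0)
 then show ?thesis using euler[OF hpw[OF l1[of v]], of x] by (simp add: ext_deriv_2 algebra_simps)
qed

text \<open>Integrability writes \<open>\<omega> x [u]\<close> times d\<omega> as a wedge of two
  one-forms. After multiplication by the square of \<open>\<omega> x [u]\<close> the Pluecker
  relation is a formal identity, and the factor cancels since polynomials have no zero
  divisors.\<close>

lemma pluecker_ext_deriv:
 assumes \<omega>: "hom_form 1 (Suc d) \<omega>" "\<omega> \<noteq> 0" and ex: "exchange 1 2 \<omega> (ext_deriv \<omega>)"
 shows "exchange 2 2 (ext_deriv \<omega>) (ext_deriv \<omega>)"
proof -
 let ?\<tau> = "ext_deriv \<omega>"
 have h\<tau>: "hom_form 2 d ?\<tau>" using hom_form_ext_deriv[OF \<omega>(1)] by (simp add: numeral_2_eq_2)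
 have anti: "?\<tau> x [b, a] = - ?\<tau> x [a, b]" for x a b
  using alt_swap[OF hom_form_alt[OF h\<tau>, of x], of "[a, a]" 0 1 b a] by simp
 have ex': "\<omega> x [u] * ?\<tau> x [a, b] = ?\<tau> x [u, b] * \<omega> x [a] - ?\<tau> x [u, a] * \<omega> x [b]" for x u a b
  using exchangeD[OF ex, of "[a, b]" "[]" x u] anti[of x u a] by (simp add: numeral_2_eq_2)
 obtain x0 vs0 where "\<omega> x0 vs0 \<noteq> 0" using \<omega>(2) by (auto simp: fun_eq_iff)
 then obtain u where u: "\<omega> x0 [u] \<noteq> 0"
  using hom_form_length[OF \<omega>(1)] by (cases vs0) (fastforce, metis length_Cons length_0_conv One_nat_def Suc_inject)
 have pfu: "pf (\<lambda>x. \<omega> x [u])" using hp_imp_pf[OF hom_form_hp[OF \<omega>(1), of "[u]"]] by simp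
 have pft: "pf (\<lambda>x. ?\<tau> x [a, b])" for a b using hp_imp_pf[OF hom_form_hp[OF h\<tau>, of "[a, b]"]] by simp
 have "?\<tau> x [a, b] * ?\<tau> x [v, w] = ?\<tau> x [v, b] * ?\<tau> x [a, w] + ?\<tau> x [a, v] * ?\<tau> x [b, w]" for x a b v w
 proof -
  define E where "E x = ?\<tau> x [a, b] * ?\<tau> x [v, w] - ?\<tau> x [v, b] * ?\<tau> x [a, w] - ?\<tau> x [a, v] * ?\<tau> x [b, w]" for x
  have pfE: "pf E" unfolding E_def by (intro pf_pointwise pft)
  have "\<omega> x [u] * (\<omega> x [u] * E x) = 0" for x
  proof -
   have "\<omega> x [u] * (\<omega> x [u] * E x) = (\<omega> x [u] * ?\<tau> x [a, b]) * (\<omega> x [u] * ?\<tau> x [v, w])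
    - (\<omega> x [u] * ?\<tau> x [v, b]) * (\<omega> x [u] * ?\<tau> x [a, w]) - (\<omega> x [u] * ?\<tau> x [a, v]) * (\<omega> x [u] * ?\<tau> x [b, w])"
    by (simp add: E_def algebra_simps)
   also have "\<dots> = 0" unfolding ex' by (simp add: algebra_simps)
   finally show ?thesis .
  qed
  then have "(\<lambda>x. \<omega> x [u]) * ((\<lambda>x. \<omega> x [u]) * E) = 0" by (simp add: fun_eq_iff)
  moreover have "(\<lambda>x. \<omega> x [u]) \<noteq> 0" using u by (auto simp: fun_eq_iff)
  ultimately have "E = 0" using pf_no_zero_divisors pfu pfE pf_mult by metis
  then have "E x = 0" by simp
  then show ?thesis unfolding E_def by (simp add: diff_eq_eq add.commute)
 qed
 note id = this
 show ?thesis unfolding exchange_def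
 proof (intro allI impI)
  fix x v and us js :: "(complex^'a) list" assume "length us = 2 \<and> Suc (length js) = (2::nat)"
  then obtain a b w where "us = [a, b]" "js = [w]" by (auto simp: numeral_2_eq_2 length_Suc_conv)
  then show "?\<tau> x (v # js) * ?\<tau> x us = (\<Sum>i<2. ?\<tau> x (us[i := v]) * ?\<tau> x (us ! i # js))"
   using id[of x a b v w] by (simp add: numeral_2_eq_2 mult.commute)
 qed
qed

section \<open>Division by a family without common divisors\<close>

lemma pideal_generated:
 fixes c :: "'i => complex^'n => complex"
 assumes "\<And>i. i \<in> T ==> pf (c i)"
 shows "pideal {p. \<exists>b. (\<forall>i. pf (b i)) \<and> p = (\<Sum>i\<in>T. b i * c i)}"
 unfolding pideal_def
proof (intro conjI ballI allI impI)
 fix p assume "p \<in> {p. \<exists>b. (\<forall>i. pf (b i)) \<and> p = (\<Sum>i\<in>T. b i * c i)}"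
 then show "pf p" using assms by auto
next
 show "0 \<in> {p. \<exists>b. (\<forall>i. pf (b i)) \<and> p = (\<Sum>i\<in>T. b i * c i)}"
  by (rule CollectI, rule exI[of _ "\<lambda>_. 0"]) simp
next
 fix p r assume "p \<in> {p. \<exists>b. (\<forall>i. pf (b i)) \<and> p = (\<Sum>i\<in>T. b i * c i)}"
  "r \<in> {p. \<exists>b. (\<forall>i. pf (b i)) \<and> p = (\<Sum>i\<in>T. b i * c i)}"
 then obtain b b' where "\<forall>i. pf (b i)" "p = (\<Sum>i\<in>T. b i * c i)" "\<forall>i. pf (b' i)" "r = (\<Sum>i\<in>T. b' i * c i)" by blast
 then have "(\<forall>i. pf (b i + b' i)) \<and> p + r = (\<Sum>i\<in>T. (b i + b' i) * c i)" by (auto simp: distrib_right sum.distrib)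
 then show "p + r \<in> {p. \<exists>b. (\<forall>i. pf (b i)) \<and> p = (\<Sum>i\<in>T. b i * c i)}" by (intro CollectI exI[of _ "\<lambda>i. b i + b' i"])
next
 fix p r :: "complex^'n => complex" assume "p \<in> {p. \<exists>b. (\<forall>i. pf (b i)) \<and> p = (\<Sum>i\<in>T. b i * c i)}" "pf r"
 then obtain b where "\<forall>i. pf (b i)" "p = (\<Sum>i\<in>T. b i * c i)" by blast
 then have "(\<forall>i. pf (r * b i)) \<and> r * p = (\<Sum>i\<in>T. (r * b i) * c i)"
  using \<open>pf r\<close> by (auto simp: sum_distrib_left mult.assoc)
 then show "r * p \<in> {p. \<exists>b. (\<forall>i. pf (b i)) \<and> p = (\<Sum>i\<in>T. b i * c i)}" by (intro CollectI exI[of _ "\<lambda>i. r * b i"])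
qed

lemma power_in_generated:
 fixes c :: "'i => complex^'n => complex"
 assumes "\<And>i. i \<in> T ==> pf (c i)" "pf g" "\<And>x. (\<forall>i\<in>T. c i x = 0) ==> g x = 0" "finite T"
 shows "\<exists>s b. (\<forall>i. pf (b i)) \<and> g ^ s = (\<Sum>i\<in>T. b i * c i)"
proof -
 let ?J = "{p. \<exists>b. (\<forall>i. pf (b i)) \<and> p = (\<Sum>i\<in>T. b i * c i)}"
 have c: "c i \<in> ?J" if "i \<in> T" for i
 proof -
  have "c i = (\<Sum>j\<in>T. (if j = i then 1 else 0) * c j)"
   using that assms(4) by (subst sum.remove[of _ i]) (auto intro!: sum.neutral)
  moreover have "\<forall>j. pf (if j = i then 1 else 0)" by auto
  ultimately show ?thesis by (intro CollectI exI[of _ "\<lambda>j. if j = i then 1 else 0"] conjI)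
 qed
 have van: "g x = 0" if "x \<in> common_zeros ?J" for x
  using that c assms(3)[of x] unfolding common_zeros_def by blast
 have "\<exists>s. g ^ s \<in> ?J"
  by (rule nullstellensatz[OF pideal_generated[where c=c and T=T] assms(2)]; (erule assms(1) | erule van | erule exI))
 then show ?thesis by simp
qed

text \<open>No projection along a line maps the set densely onto the quotient, so the set contains
  no hypersurface. This is codimension at least two in a form that passes through linear
  pull-backs.\<close>

definition no_common_divisor :: "(complex^'n) set => bool" where
 "no_common_divisor Z \<longleftrightarrow> (\<forall>v. v \<noteq> 0 --> (\<exists>g\<in>inv_dir v. g \<noteq> 0 \<and> (\<forall>x\<in>Z. g x = 0)))"

lemma exists_functional:
 assumes "v \<noteq> (0 :: complex^'n)" obtains l where "lin l" "l v = 1"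
proof -
 obtain i where "v $ i \<noteq> 0" using assms by (auto simp: vec_eq_iff)
 moreover have "lin (\<lambda>x. x $ i / v $ i)" by (rule linI) (auto simp: add_divide_distrib)
 ultimately show thesis using that[of "\<lambda>x. x $ i / v $ i"] by simp
qed

lemma hom_monic_along:
 assumes "hp k f" "f v \<noteq> 0" "v \<noteq> 0"
 obtains l where "monic_along f v k l"
 using exists_functional[OF assms(3)] monic_along.intro[OF assms(1,2)] by metis

lemma hom_nonzero_vector:
 fixes f :: "complex^'n => complex"
 assumes "hp k f" "f \<noteq> 0" obtains v where "f v \<noteq> 0" "v \<noteq> 0"
proof -
 obtain w where w: "f w \<noteq> 0" using assms(2) by (auto simp: fun_eq_iff)
 show thesis
 proof (cases "w = 0")
  case True
  have "k = 0"
  proof (rule ccontr)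
   assume "k \<noteq> 0" then show False using hom_poly_scale[OF assms(1), of 0 0] w True by (simp add: power_0_left)
  qed
  then have "f x = f w" for x using hom_poly_scale[OF assms(1), of 0 x] True by simp
  moreover obtain u :: "complex^'n" where "u \<noteq> 0" by (metis axis_eq_0_iff one_neq_zero)
  ultimately show thesis using that w by metis
 qed (use that w in blast)
qed

text \<open>The Nullstellensatz puts a power of a polynomial \<open>g\<close>, free of the
  coordinate in which \<open>c i0\<close> is monic, into the ideal of the \<open>c i\<close>. The
  cross relations then show that \<open>c i0\<close> divides \<open>g ^ s * a i0\<close>, hence
  \<open>a i0\<close>.\<close>

lemma proportional_division:
 fixes c a :: "'i => complex^'n => complex"
 assumes T: "finite T" and c: "\<And>i. i \<in> T ==> hp k (c i)" and a: "\<And>i. i \<in> T ==> pf (a i)"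
  and cross: "\<And>i j. i \<in> T ==> j \<in> T ==> c i * a j = a i * c j"
  and i0: "i0 \<in> T" "c i0 \<noteq> 0" and ncd: "no_common_divisor {x. \<forall>i\<in>T. c i x = 0}"
 obtains h where "pf h" "\<And>i. i \<in> T ==> a i = h * c i"
proof -
 have pfc: "pf (c i)" if "i \<in> T" for i using hp_imp_pf[OF c[OF that]] .
 obtain v where v: "c i0 v \<noteq> 0" "v \<noteq> 0" using hom_nonzero_vector[OF c[OF i0(1)] i0(2)] .
 obtain l where l: "monic_along (c i0) v k l" using hom_monic_along[OF c[OF i0(1)] v] .
 interpret f: monic_along "c i0" v k l by fact
 obtain g where g: "g \<in> inv_dir v" "g \<noteq> 0" "\<And>x. (\<forall>i\<in>T. c i x = 0) ==> g x = 0"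
  using ncd v(2) unfolding no_common_divisor_def by blast
 obtain s b where b: "\<And>i. pf (b i)" "g ^ s = (\<Sum>i\<in>T. b i * c i)"
 proof -
  have "\<exists>s b. (\<forall>i. pf (b i)) \<and> g ^ s = (\<Sum>i\<in>T. b i * c i)"
   by (rule power_in_generated[OF pfc inv_dir_pf[OF g(1)] g(3) T])
  then show thesis using that by blast
 qed
 have gs: "g ^ s \<in> inv_dir v"
  by (induction s) (simp_all only: power_0 power_Suc inv_dir_1 inv_dir_mult g(1))
 have "g ^ s * a i0 = c i0 * (\<Sum>i\<in>T. b i * a i)"
 proof -
  have "g ^ s * a i0 = (\<Sum>i\<in>T. b i * (c i * a i0))" by (simp only: b(2) sum_distrib_right mult.assoc)
  also have "\<dots> = (\<Sum>i\<in>T. b i * (a i * c i0))" using cross i0(1) by simp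
  also have "\<dots> = c i0 * (\<Sum>i\<in>T. b i * a i)" by (simp only: sum_distrib_left mult_ac)
  finally show ?thesis .
 qed
 note eq = this
 have "pf (\<Sum>i\<in>T. b i * a i)" by (intro pf_sum pf_mult b(1) a)
 from f.dvd_cancel[OF gs pf_power_nonzero[OF inv_dir_pf[OF g(1)] g(2)] a[OF i0(1)] this eq]
 obtain h where h: "pf h" "a i0 = c i0 * h" .
 have "a i = h * c i" if "i \<in> T" for i
 proof (rule pf_mult_cancel[OF pfc[OF i0(1)] a[OF that] pf_mult[OF h(1) pfc[OF that]] i0(2)])
  show "c i0 * a i = c i0 * (h * c i)" using cross[OF i0(1) that] h(2) by (simp only: mult.assoc)
 qed
 then show thesis using that h(1) by blast
qed

text \<open>Along the line through the origin and \<open>x\<close> the left side scales as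
  \<open>t ^ d\<close>, while the right side is divisible by \<open>t ^ Suc d\<close>.\<close>

lemma degree_drop_zero:
 assumes "hp d \<eta>" "hp (Suc d) c" "pf h" "\<eta> = h * c" shows "\<eta> x = 0"
proof -
 obtain H where H: "\<And>t. h (0 + t *s x) = poly H t" using pf_line[OF assms(3)] by metis
 define p where "p = [:\<eta> x:] - pCons 0 (smult (c x) H)"
 have "poly p t = 0" if "t \<in> - {0}" for t
 proof -
  have "\<eta> (t *s x) = h (t *s x) * c (t *s x)" by (simp add: assms(4))
  then have "t ^ d * \<eta> x = t ^ d * (t * (c x * poly H t))"
   using H[of t] hom_poly_scale[OF assms(1), of t x] hom_poly_scale[OF assms(2), of t x] by (simp add: mult_ac)
  then show ?thesis using that by (auto simp: p_def mult_ac)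
 qed
 then have "infinite {t. poly p t = 0}"
  using infinite_nonzero by (metis (mono_tags, lifting) finite_subset mem_Collect_eq subsetI)
 then have "p = 0" using poly_roots_finite by blast
 then have "poly p 0 = 0" by simp
 then show ?thesis by (simp add: p_def)
qed

section \<open>Foliations in terms of coefficients\<close>

definition folform :: "nat => nat => 'n::finite form => bool" where
 "folform q d \<omega> \<longleftrightarrow> \<omega> \<in> twisted_forms q d \<and> \<omega> \<noteq> 0 \<and> exchange q q \<omega> \<omega> \<and>
  exchange q (Suc q) \<omega> (ext_deriv \<omega>) \<and> no_common_divisor (affine_sing \<omega>)"

definition form_coeffs :: "nat => 'n::finite form => (complex^'n => complex) set" where
 "form_coeffs q \<omega> = (\<lambda>I x. \<omega> x (map ax I)) ` {I. length I = q}"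

lemma affine_sing_form_coeffs:
 assumes "hom_form q k \<omega>" shows "affine_sing \<omega> = common_zeros (form_coeffs q \<omega>)"
proof -
 have "\<omega> x vs = 0" if "\<And>I. length I = q ==> \<omega> x (map ax I) = 0" for x vs
  using multilin_zero_basis[OF hom_form_multilin[OF assms] that] hom_form_length[OF assms] by metis
 then show ?thesis unfolding affine_sing_def common_zeros_def form_coeffs_def by auto
qed

lemma hom_form_eq_0: "hom_form q k \<omega> ==> (\<And>I x. length I = q ==> \<omega> x (map ax I) = 0) ==> \<omega> = 0"
 using affine_sing_form_coeffs[of q k \<omega>] by (auto simp: affine_sing_def common_zeros_def form_coeffs_def fun_eq_iff)

lemma hom_form_nonzero:
 assumes "hom_form q k \<omega>" "\<omega> \<noteq> 0" shows "\<exists>I. length I = q \<and> (\<lambda>x. \<omega> x (map ax I)) \<noteq> 0"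
proof (rule ccontr)
 assume "\<not> ?thesis"
 then have "(\<lambda>x. \<omega> x (map ax I)) = 0" if "length I = q" for I using that by blast
 then have "\<omega> x (map ax I) = 0" if "length I = q" for I x using that by (simp add: fun_eq_iff)
 then show False using hom_form_eq_0[OF assms(1)] assms(2) by blast
qed

lemma hom_form_1_nonzero:
 assumes "hom_form 1 k \<omega>" "\<omega> \<noteq> 0" shows "\<exists>i. (\<lambda>x. \<omega> x [ax i]) \<noteq> 0"
proof -
 obtain I where I: "length I = 1" "(\<lambda>x. \<omega> x (map ax I)) \<noteq> 0" using hom_form_nonzero[OF assms] by blast
 then obtain i where "I = [i]" by (cases I) auto
 then show ?thesis using I(2) by (intro exI[of _ i]) simp
qed

lemma hom_cone_form_coeffs: "hom_form q k \<omega> ==> hom_cone (form_coeffs q \<omega>)"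
 by unfold_locales (auto simp: form_coeffs_def intro!: exI[of _ k] hom_form_hp)

lemma proj_sing_lines:
 assumes "hom_form q k \<omega>" shows "proj_sing \<omega> = hom_cone.lines (form_coeffs q \<omega>)"
 unfolding proj_sing_def hom_cone.lines_def[OF hom_cone_form_coeffs[OF assms]] affine_sing_form_coeffs[OF assms] ..

lemma codim_2_iff:
 fixes \<omega> :: "'n::finite form"
 assumes \<omega>: "hom_form q k \<omega>" and card: "CARD('n) \<ge> 2"
 shows "codim projective_zariski (proj_sing \<omega>) \<ge> 2 \<longleftrightarrow> no_common_divisor (affine_sing \<omega>)"
proof
 interpret hom_cone "form_coeffs q \<omega>" by (rule hom_cone_form_coeffs[OF \<omega>])
 show "no_common_divisor (affine_sing \<omega>)" if c: "codim projective_zariski (proj_sing \<omega>) \<ge> 2"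
  unfolding no_common_divisor_def
 proof (intro allI impI)
  fix v :: "complex^'n" assume "v \<noteq> 0"
  then have "vec.independent {v}" by simp
  moreover have "codim projective_zariski lines \<ge> enat (Suc (card {v}))"
   using c proj_sing_lines[OF \<omega>] by (simp add: numeral_eq_enat numeral_2_eq_2)
  moreover have "card {v} < CARD('n)" using card by simp
  ultimately obtain g where "g \<in> inv_dirs {v}" "g \<noteq> 0" "\<And>x. x \<in> common_zeros (form_coeffs q \<omega>) ==> g x = 0"
   by - (rule proj_codim_direction[of "{v}"]; blast)
  then show "\<exists>g\<in>inv_dir v. g \<noteq> 0 \<and> (\<forall>x\<in>affine_sing \<omega>. g x = 0)"
   unfolding affine_sing_form_coeffs[OF \<omega>] by (auto simp: inv_dirs_def)
 qed
 show "codim projective_zariski (proj_sing \<omega>) \<ge> 2" if "no_common_divisor (affine_sing \<omega>)"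
  using proj_codim_ge_2[OF card] that unfolding proj_sing_lines[OF \<omega>] no_common_divisor_def affine_sing_form_coeffs[OF \<omega>]
  by blast
qed

lemma twisted_hom_form: "\<omega> \<in> twisted_forms q d ==> hom_form q (Suc d) \<omega>"
 by (simp add: twisted_forms_def)

lemma foliations_folform:
 assumes q: "q \<ge> 1" and card: "CARD('n::finite) \<ge> 2"
 shows "foliations q d = {proj_point form_scale \<omega> | \<omega>::'n form. folform q d \<omega>}"
proof -
 have "folform q d \<omega> \<longleftrightarrow> \<omega> \<in> twisted_forms q d \<and> \<omega> \<noteq> 0 \<and>
  (\<forall>v. wedge 1 q (contract (q - 1) v \<omega>) \<omega> = 0 \<and>
     wedge 1 (q + 1) (contract (q - 1) v \<omega>) (ext_deriv \<omega>) = 0) \<and>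
  codim projective_zariski (proj_sing \<omega>) \<ge> 2" for \<omega> :: "'n form"
 proof (cases "\<omega> \<in> twisted_forms q d")
  case True
  note h = twisted_hom_form[OF True]
  have "exchange q q \<omega> \<omega> \<longleftrightarrow> (\<forall>v. wedge 1 q (contract (q - 1) v \<omega>) \<omega> = 0)"
   using exchangeI_wedge[OF h q h] wedge_eq_0I_exchange[OF h q h] by blast
  moreover have "exchange q (Suc q) \<omega> (ext_deriv \<omega>) \<longleftrightarrow> (\<forall>v. wedge 1 (q + 1) (contract (q - 1) v \<omega>) (ext_deriv \<omega>) = 0)"
   using exchangeI_wedge[OF h q hom_form_ext_deriv[OF h]] wedge_eq_0I_exchange[OF h q hom_form_ext_deriv[OF h]]
   by (auto simp only: Suc_eq_plus1)
  ultimately show ?thesis unfolding folform_def codim_2_iff[OF h card] by blast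
 qed (auto simp: folform_def)
 then show ?thesis unfolding foliations_def by (auto simp only:)
qed

text \<open>The projection of a cone along two directions is not dominant, in terms of polynomials.\<close>

definition codim3 :: "(complex^'n) set => bool" where
 "codim3 Z \<longleftrightarrow> (\<forall>v w. v \<noteq> w --> vec.independent {v, w} --> (\<exists>g\<in>inv_dir v \<inter> inv_dir w. g \<noteq> 0 \<and> (\<forall>x\<in>Z. g x = 0)))"

text \<open>Codimension three is only assumed, for the generic member, hence a single implication;
  codimension two must also be verified for pulled back and restricted forms, hence the equivalence
  in \<open>codim_2_iff\<close>.\<close>

lemma codim3_proj:
 fixes \<omega> :: "'n::finite form"
 assumes \<omega>: "hom_form q k \<omega>" and card: "CARD('n) \<ge> 3" and c: "codim projective_zariski (proj_sing \<omega>) \<ge> 3"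
 shows "codim3 (affine_sing \<omega>)"
 unfolding codim3_def
proof (intro allI impI)
 interpret hom_cone "form_coeffs q \<omega>" by (rule hom_cone_form_coeffs[OF \<omega>])
 fix v w :: "complex^'n" assume vw: "v \<noteq> w" "vec.independent {v, w}"
 have "codim projective_zariski lines \<ge> enat (Suc (card {v, w}))"
  using c proj_sing_lines[OF \<omega>] vw by (simp add: numeral_eq_enat numeral_3_eq_3)
 moreover have "card {v, w} < CARD('n)" using card vw by simp
 ultimately obtain g where "g \<in> inv_dirs {v, w}" "g \<noteq> 0" "\<And>x. x \<in> common_zeros (form_coeffs q \<omega>) ==> g x = 0"
  using vw(2) by - (rule proj_codim_direction[of "{v, w}"]; blast)
 then show "\<exists>g\<in>inv_dir v \<inter> inv_dir w. g \<noteq> 0 \<and> (\<forall>x\<in>affine_sing \<omega>. g x = 0)"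
  unfolding affine_sing_form_coeffs[OF \<omega>] by (auto simp: inv_dirs_def)
qed

lemma codim3_affine:
 fixes \<omega> :: "'n::finite form"
 assumes \<omega>: "hom_form q k \<omega>" and c: "codim (affine_zariski (*s)) (affine_sing \<omega>) \<ge> 3"
 shows "codim3 (affine_sing \<omega>)"
 unfolding codim3_def
proof (intro allI impI)
 fix v w :: "complex^'n" assume vw: "v \<noteq> w" "vec.independent {v, w}"
 have "closedin (affine_zariski (*s)) (affine_sing \<omega>)"
  unfolding closedin_affine affine_sing_form_coeffs[OF \<omega>]
  by (intro exI[of _ "form_coeffs q \<omega>"]) (auto simp: form_coeffs_def intro!: hp_imp_pf[OF hom_form_hp[OF \<omega>]])
 moreover have "codim (affine_zariski (*s)) (affine_sing \<omega>) \<ge> enat (Suc (card {v, w}))"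
  using c vw by (simp add: numeral_eq_enat numeral_3_eq_3)
 ultimately obtain g where "g \<in> inv_dirs {v, w}" "g \<noteq> 0" "\<And>x. x \<in> affine_sing \<omega> ==> g x = 0"
  using affine_codim_direction[OF _ _ vw(2)] by blast
 then show "\<exists>g\<in>inv_dir v \<inter> inv_dir w. g \<noteq> 0 \<and> (\<forall>x\<in>affine_sing \<omega>. g x = 0)"
  by (auto simp: inv_dirs_def)
qed

lemma hom_component_inv_dir:
 assumes P: "\<And>i. hp i (P i)" "\<And>x. p x = (\<Sum>i\<le>n. P i x)" and p: "p \<in> inv_dir v" and i: "i \<le> n"
 shows "P i \<in> inv_dir v"
proof -
 have "P i (x + s *s v) - P i x = 0" for x s
 proof -
  let ?Q = "\<lambda>i _ :: complex^'a. P i (x + s *s v) - P i x"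
  have sub: "fs.subspace ({0} :: (complex^'a => complex) set)" by (rule fs.subspace_single_0)
  have "?Q i \<in> {0}"
  proof (rule components_mem[OF sub infinite_nonzero _ i])
   fix t :: complex
   have "p (t *s (x + s *s v)) = p (t *s x)"
    using inv_dir_apply[OF p, of "t *s x" "t * s"] by (simp add: vector_add_ldistrib)
   then have "(\<Sum>i\<le>n. t ^ i * (P i (x + s *s v) - P i x)) = 0"
    by (simp only: P(2) hom_poly_scale[OF P(1)] right_diff_distrib sum_subtractf) simp
   then show "(\<Sum>i\<le>n. fsc (t ^ i) (?Q i)) \<in> {0}" by (simp add: fun_eq_iff fun_sum_apply)
  qed
  then show ?thesis by (auto dest: fun_cong)
 qed
 then show ?thesis using hp_imp_pf[OF P(1)] by (simp add: inv_dir_def)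
qed

lemma independent_pair:
 fixes v w :: "complex^'n"
 assumes "v \<noteq> 0" "\<And>c. w \<noteq> c *s v" shows "vec.independent {v, w}" "v \<noteq> w"
proof -
 show "v \<noteq> w" using assms(2)[of 1] by auto
 have "w \<notin> vec.span {v}" using assms(2) by (auto simp: vec.span_singleton)
 then have "vec.independent (insert w {v})" using vec.independent_insertI[of w "{v}"] assms(1) by simp
 then show "vec.independent {v, w}" by (simp add: insert_commute)
qed

lemma exists_not_parallel:
 assumes "CARD('n::finite) \<ge> 2" "v \<noteq> (0 :: complex^'n)" obtains w where "\<And>c. w \<noteq> c *s v"
proof -
 have "vec.span {v} \<noteq> (UNIV :: (complex^'n) set)"
 proof
  assume "vec.span {v} = (UNIV :: (complex^'n) set)"
  then have "vec.dim (UNIV :: (complex^'n) set) \<le> card {v}" by (metis vec.dim_le_card finite.emptyI finite_insert order_refl)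
  then show False using assms(1) vec_dim_card[where 'n='n and 'a=complex] by simp
 qed
 then obtain w where "w \<notin> vec.span {v}" by blast
 then show thesis using that by (auto simp: vec.span_singleton)
qed

text \<open>Coefficients of a form with singular set of codimension three generate an ideal containing
 a triangular regular sequence.\<close>

lemma triangular_triple:
 fixes \<theta> :: "'n::finite form"
 assumes \<theta>: "hom_form p k \<theta>" "\<theta> \<noteq> 0" and card: "CARD('n) \<ge> 2" and c3: "codim3 (affine_sing \<theta>)"
 obtains f g h v l w k' l' where "monic_along f v k l" "monic_along g w k' l'" "g \<in> inv_dir v"
  "h \<in> inv_dir v" "h \<in> inv_dir w" "h \<noteq> 0"
  "\<forall>\<phi>\<in>{f, g, h}. \<exists>b. (\<forall>I. pf (b I)) \<and> \<phi> = (\<Sum>I | length I = p. b I * (\<lambda>x. \<theta> x (map ax I)))"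
proof -
 let ?c = "\<lambda>I x. \<theta> x (map ax I)" and ?T = "{I :: 'n list. length I = p}"
 have hpc: "hp k (?c I)" if "I \<in> ?T" for I using hom_form_hp[OF \<theta>(1)] that by simp
 have pfc: "pf (?c I)" if "I \<in> ?T" for I using hp_imp_pf[OF hpc[OF that]] .
 have Z: "x \<in> affine_sing \<theta>" if "\<forall>I\<in>?T. ?c I x = 0" for x
  unfolding affine_sing_form_coeffs[OF \<theta>(1)] using that by (auto simp: common_zeros_def form_coeffs_def)
 obtain I0 x0 where I0: "length I0 = p" "?c I0 x0 \<noteq> 0" using hom_form_eq_0[OF \<theta>(1)] \<theta>(2) by blast
 then have "?c I0 \<noteq> 0" by (auto simp: fun_eq_iff)
 from hom_nonzero_vector[OF hom_form_hp[OF \<theta>(1)] this] I0(1)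
 obtain v where v: "?c I0 v \<noteq> 0" "v \<noteq> 0" by auto
 obtain l where l: "monic_along (?c I0) v k l" using hom_monic_along[OF hom_form_hp[OF \<theta>(1)] v] I0(1) by auto
 obtain w0 where w0: "\<And>c. w0 \<noteq> c *s v" using exists_not_parallel[OF card v(2)] by blast
 obtain g0 where g0: "g0 \<in> inv_dir v" "g0 \<noteq> 0" "\<And>x. x \<in> affine_sing \<theta> ==> g0 x = 0"
  using c3 independent_pair[OF v(2) w0] unfolding codim3_def by blast
 obtain n P where P: "\<And>i. hp i (P i)" "\<And>x. g0 x = (\<Sum>i\<le>n. P i x)" using hom_components[OF inv_dir_pf[OF g0(1)]] by metis
 obtain y where "g0 y \<noteq> 0" using g0(2) by (auto simp: fun_eq_iff)
 then obtain j where j: "j \<le> n" "P j y \<noteq> 0" unfolding P(2) by (meson atMost_iff sum.not_neutral_contains_not_neutral)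
 \<comment> \<open>A homogeneous component inherits invariance along \<open>v\<close> and vanishing
   on the cone, and it can be put into monic position.\<close>
 define g where "g = P j"
 have g: "hp j g" "g \<in> inv_dir v" "g \<noteq> 0" using P(1) hom_component_inv_dir[OF P g0(1) j(1)] j(2) by (auto simp: g_def)
 interpret cone: hom_cone "form_coeffs p \<theta>" by (rule hom_cone_form_coeffs[OF \<theta>(1)])
 have gZ: "g x = 0" if "x \<in> affine_sing \<theta>" for x
 proof -
  have "g0 \<in> van (common_zeros (form_coeffs p \<theta>))"
   using g0 inv_dir_pf unfolding affine_sing_form_coeffs[OF \<theta>(1)] van_def by blast
  from cone.van_component[OF P this j(1)] show ?thesis
   using that unfolding affine_sing_form_coeffs[OF \<theta>(1)] g_def van_def by blast
 qed
 \<comment> \<open>A direction not parallel to \<open>v\<close> with \<open>g w\<close> non-zero: if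
   \<open>g\<close> has positive degree, it vanishes on the line through \<open>v\<close>, being
   invariant along it and zero at the origin; if \<open>g\<close> is constant, any independent
   direction will do.\<close>
 obtain w where w: "g w \<noteq> 0" "\<And>c. w \<noteq> c *s v"
 proof (cases "j = 0")
  case True
  have "g w0 = g y" using hom_poly_scale[OF g(1), of 0 w0] hom_poly_scale[OF g(1), of 0 y] True by simp
  then show thesis using that[of w0] w0 j(2) by (simp add: g_def)
 next
  case False
  have "y \<noteq> c *s v" for c
  proof
   assume "y = c *s v"
   then have "g y = g 0" using inv_dir_apply[OF g(2), of 0 c] by simp
   also have "g 0 = 0" using hom_poly_scale[OF g(1), of 0 0] False by (simp add: power_0_left)
   finally show False using j(2) by (simp add: g_def)
  qed
  then show thesis using that[of y] j(2) by (simp add: g_def)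
 qed
 have w0': "w \<noteq> 0" using w(2)[of 0] by simp
 obtain h0 where h0: "h0 \<in> inv_dir v" "h0 \<in> inv_dir w" "h0 \<noteq> 0" "\<And>x. x \<in> affine_sing \<theta> ==> h0 x = 0"
  using c3 independent_pair[OF v(2) w(2)] unfolding codim3_def by blast
 \<comment> \<open>The Nullstellensatz gives only powers of \<open>g\<close> and \<open>h0\<close>
   in the ideal of the coefficients; powers keep the invariance and the monic position.\<close>
 obtain s b where b: "\<forall>I. pf (b I)" "g ^ s = (\<Sum>I\<in>?T. b I * ?c I)"
  using power_in_generated[of ?T ?c g, OF pfc inv_dir_pf[OF g(2)] gZ[OF Z] finite_index_lists] by auto
 obtain t b' where b': "\<forall>I. pf (b' I)" "h0 ^ t = (\<Sum>I\<in>?T. b' I * ?c I)"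
  using power_in_generated[of ?T ?c h0, OF pfc inv_dir_pf[OF h0(1)] h0(4)[OF Z] finite_index_lists] by auto
 have gs: "hp (j * s) (g ^ s)" "(g ^ s) w \<noteq> 0" using hp_power[OF g(1)] w(1) by (simp_all add: fun_power_apply)
 obtain l' where l': "monic_along (g ^ s) w (j * s) l'" using hom_monic_along[OF gs w0'] .
 have pw: "q ^ n \<in> inv_dir u" if "q \<in> inv_dir u" for q n and u :: "complex^'n"
  by (induction n) (simp_all only: power_0 power_Suc inv_dir_1 inv_dir_mult that)
 show thesis
 proof (rule that[OF l l' pw[OF g(2)] pw[OF h0(1)] pw[OF h0(2)] pf_power_nonzero[OF inv_dir_pf[OF h0(1)] h0(3)]])
  show "\<forall>\<phi>\<in>{?c I0, g ^ s, h0 ^ t}. \<exists>b. (\<forall>I. pf (b I)) \<and> \<phi> = (\<Sum>I\<in>?T. b I * ?c I)"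
  proof
  fix \<phi> assume "\<phi> \<in> {?c I0, g ^ s, h0 ^ t}"
  moreover have "?c I0 = (\<Sum>I\<in>?T. (if I = I0 then 1 else 0) * ?c I)"
  proof -
   have "(\<Sum>I\<in>?T. (if I = I0 then 1 else 0) * ?c I) = (\<Sum>I\<in>{I0}. (if I = I0 then 1 else 0) * ?c I)"
    by (rule sum.mono_neutral_right) (use I0(1) finite_index_lists in auto)
   also have "\<dots> = 1 * ?c I0" by (simp only: sum.insert sum.empty finite.emptyI empty_iff simp_thms if_True add_0_right)
   finally show ?thesis by (simp only: mult_1)
  qed
  moreover have "\<forall>I. pf (if I = I0 then 1 else 0)" by auto
  ultimately show "\<exists>b. (\<forall>I. pf (b I)) \<and> \<phi> = (\<Sum>I\<in>?T. b I * ?c I)"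
   using b b' by (elim insertE emptyE; hypsubst) (rule exI, rule conjI, assumption+)+
  qed
 qed
qed

section \<open>The kernel of a decomposable form\<close>

definition pvf :: "(complex^'n => complex^'n) => bool" where
 "pvf Y \<longleftrightarrow> (\<forall>i. pf (\<lambda>x. Y x $ i))"

lemma pvf_add: "pvf Y ==> pvf Z ==> pvf (\<lambda>x. Y x + Z x)" by (auto simp: pvf_def)
lemma pvf_diff: "pvf Y ==> pvf Z ==> pvf (\<lambda>x. Y x - Z x)" by (auto simp: pvf_def)
lemma pvf_scale: "pf f ==> pvf Y ==> pvf (\<lambda>x. f x *s Y x)" by (auto simp: pvf_def)
lemma pvf_const: "pvf (\<lambda>_. v)" by (auto simp: pvf_def)
lemma pvf_ident: "pvf (\<lambda>x. x)" by (auto simp: pvf_def)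
lemma pvf_sum: "(\<And>i. i \<in> A ==> pvf (Y i)) ==> pvf (\<lambda>x. \<Sum>i\<in>A. Y i x)"
 by (auto simp: pvf_def)

definition kernel_field :: "nat => 'n::finite form => (complex^'n => complex^'n) => bool" where
 "kernel_field p \<theta> Y \<longleftrightarrow> pvf Y \<and> (\<forall>x js. Suc (length js) = p --> \<theta> x (Y x # js) = 0)"

definition kernel_generators :: "nat => 'n::finite form => nat => (nat => complex^'n => complex^'n) => bool" where
 "kernel_generators p \<theta> r X \<longleftrightarrow> (\<forall>j<r. kernel_field p \<theta> (X j)) \<and>
  (\<forall>Y. kernel_field p \<theta> Y --> (\<exists>G. (\<forall>j. pf (G j)) \<and> (\<forall>x. Y x = (\<Sum>j<r. G j x *s X j x))))"

lemma pf_multilin: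
 assumes \<theta>: "hom_form p k \<theta>" and Y: "pvf Y" and js: "Suc (length js) = p"
 shows "pf (\<lambda>x. \<theta> x (Y x # js))"
proof -
 have "\<theta> x (Y x # js) = (\<Sum>i\<in>UNIV. Y x $ i * \<theta> x (ax i # js))" for x
  using lin_expand[OF multilin_Cons_lin[of "p - 1" "\<theta> x"]] hom_form_multilin[OF \<theta>] js by force
 then show ?thesis using Y hp_imp_pf[OF hom_form_hp[OF \<theta>]] js by (auto simp: pvf_def intro!: pf_sum' pf_pointwise)
qed

text \<open>At a point where \<theta> does not vanish its kernel has dimension
  \<open>CARD('n) - p = r\<close>. If one of the \<open>r\<close> generators were redundant there,
  the others and the \<open>p\<close> vectors \<open>ax i\<close> with \<open>i\<close> in
  \<open>I\<close> would span the whole space, which is one vector too few.\<close>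

lemma kernel_independent:
 fixes \<theta> :: "'n::finite form"
 assumes \<theta>: "hom_form p k \<theta>" "exchange p p \<theta> \<theta>" and p: "p \<ge> 1" and gen: "kernel_generators p \<theta> r X"
  and r: "r + p = CARD('n)" and x: "\<theta> x (map ax I) \<noteq> 0" "length I = p"
  and rel: "(\<Sum>j<r. a j *s X j x) = 0" and j0: "j0 < r"
 shows "a j0 = 0"
proof (rule ccontr)
 assume a0: "a j0 \<noteq> 0"
 define A where "A = (\<lambda>j. X j x) ` ({..<r} - {j0})"
 define B where "B = A \<union> ax ` set I"
 have Xj0: "X j0 x \<in> vec.span A"
 proof -
  have "a j0 *s X j0 x = - (\<Sum>j\<in>{..<r} - {j0}. a j *s X j x)"
   using rel j0 by (simp add: sum.remove[of _ j0] eq_neg_iff_add_eq_0)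
  also have "\<dots> \<in> vec.span A"
   by (intro vec.span_neg vec.span_sum vec.span_scale vec.span_base) (auto simp: A_def)
  finally have "inverse (a j0) *s (a j0 *s X j0 x) \<in> vec.span A" by (rule vec.span_scale)
  then show ?thesis using a0 by simp
 qed
 have XA: "X j x \<in> vec.span A" if "j < r" for j
  using Xj0 that vec.span_base[of "X j x" A] by (cases "j = j0") (auto simp: A_def)
 have "v \<in> vec.span B" for v
 proof -
  \<comment> \<open>The exchange relations make \<open>Y\<close> a polynomial kernel field: it is
    the projection of \<open>v\<close> to the kernel along the vectors \<open>ax (I ! b)\<close>,
    multiplied by its denominator.\<close>
  define Y where "Y y = \<theta> y (map ax I) *s v - (\<Sum>b<p. \<theta> y ((map ax I)[b := v]) *s ax (I ! b))" for y
  have "kernel_field p \<theta> Y" unfolding kernel_field_def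
  proof (intro conjI allI impI)
   have "pf (\<lambda>y. \<theta> y us)" if "length us = p" for us using hp_imp_pf[OF hom_form_hp[OF \<theta>(1) that]] .
   then show "pvf Y" unfolding Y_def using x(2)
    by (intro pvf_diff pvf_sum pvf_scale pvf_const) auto
   fix y and js :: "(complex^'n) list" assume js: "Suc (length js) = p"
   interpret l: Vector_Spaces.linear "(*s)" "(*)" "\<lambda>u. \<theta> y (u # js)"
    using multilin_Cons_lin[of "p - 1" "\<theta> y" js] hom_form_multilin[OF \<theta>(1)] js by auto
   have "\<theta> y (Y y # js) = \<theta> y (map ax I) * \<theta> y (v # js) - (\<Sum>b<p. \<theta> y ((map ax I)[b := v]) * \<theta> y (ax (I ! b) # js))"
    by (simp only: Y_def l.diff l.scale l.sum)
   also have "\<dots> = 0"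
    using exchangeD[OF \<theta>(2), of "map ax I" js y v] js x(2) by (simp add: mult.commute)
   finally show "\<theta> y (Y y # js) = 0" .
  qed
  then obtain G where "\<And>y. Y y = (\<Sum>j<r. G j y *s X j y)" using gen unfolding kernel_generators_def by blast
  then have "Y x \<in> vec.span A" using XA by (auto intro!: vec.span_sum vec.span_scale)
  then have Yx: "Y x \<in> vec.span B" using vec.span_mono[of A B] by (auto simp: B_def)
  have "\<theta> x (map ax I) *s v = Y x + (\<Sum>b<p. \<theta> x ((map ax I)[b := v]) *s ax (I ! b))" by (simp add: Y_def)
  also have "\<dots> \<in> vec.span B"
   using x(2) by (intro vec.span_add[OF Yx] vec.span_sum vec.span_scale vec.span_base) (auto simp: B_def)
  finally have "inverse (\<theta> x (map ax I)) *s (\<theta> x (map ax I) *s v) \<in> vec.span B" by (rule vec.span_scale)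
  then show ?thesis using x(1) by simp
 qed
 then have "CARD('n) \<le> card B"
  unfolding vec_dim_card[where 'n='n and 'a=complex, symmetric]
  by (intro vec.dim_le_card) (auto simp: B_def A_def)
 moreover have "card B \<le> card A + card (ax ` set I)" unfolding B_def by (rule card_Un_le)
 moreover have "card A \<le> r - 1" unfolding A_def using card_image_le[of "{..<r} - {j0}"] j0 by (metis card_Diff_singleton card_lessThan finite_Diff finite_lessThan lessThan_iff)
 moreover have "card (ax ` set I) \<le> p" using card_image_le[of "set I" ax] card_length[of I] x(2) by simp
 ultimately show False using r j0 by linarith
qed

text \<open>The relations say that each coefficient of \<theta> times \<open>e\<close> is a
  contraction of \<theta>, hence so is \<phi> times \<open>e\<close> for every \<phi> in the ideal
  of the coefficients, in particular for \<open>f\<close>, \<open>g\<close>, \<open>h\<close>. The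
  three fields agree after cross-multiplication up to kernel fields; regularity of the sequence
  makes the discrepancies coboundaries, and the corrected field for \<open>f\<close> is divisible by
  \<open>f\<close>.\<close>

theorem kernel_lifting:
 fixes \<theta> :: "'n::finite form"
 assumes \<theta>: "hom_form p k \<theta>" "\<theta> \<noteq> 0" "exchange p p \<theta> \<theta>" and p: "p \<ge> 1" and card: "CARD('n) \<ge> 2"
  and gen: "kernel_generators p \<theta> r X" and r: "r + p = CARD('n)" and c3: "codim3 (affine_sing \<theta>)"
  and e: "\<And>J. length J = p - 1 ==> pf (e J)"
  and rel: "\<And>I J x. length I = p ==> length J = p - 1 ==>
   \<theta> x (map ax I) * e J x = (\<Sum>a<p. (-1) ^ a * e (take a I @ drop (Suc a) I) x * \<theta> x (ax (I ! a) # map ax J))"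
 obtains w where "pvf w" "\<And>J x. length J = p - 1 ==> e J x = \<theta> x (w x # map ax J)"
proof -
 let ?c = "\<lambda>I x. \<theta> x (map ax I)" and ?T = "{I :: 'n list. length I = p}"
 obtain f g h v l v' k' l' where fv: "monic_along f v k l" and gv: "monic_along g v' k' l'" "g \<in> inv_dir v"
  and h: "h \<in> inv_dir v" "h \<in> inv_dir v'" "h \<noteq> 0"
  and ideal: "\<forall>\<phi>\<in>{f, g, h}. \<exists>b. (\<forall>I. pf (b I)) \<and> \<phi> = (\<Sum>I\<in>?T. b I * ?c I)"
  by (rule triangular_triple[OF \<theta>(1,2) card c3]) (rule that)
 interpret f: monic_along f v k l by fact
 interpret g: monic_along g v' k' l' by fact
 have lin\<theta>: "lin (\<lambda>u. \<theta> x (u # map ax J))" if "length J = p - 1" for x J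
  using multilin_Cons_lin[of "p - 1" "\<theta> x"] hom_form_multilin[OF \<theta>(1)] that p by simp
 have "\<exists>u. pvf u \<and> (\<forall>J x. length J = p - 1 --> \<phi> x * e J x = \<theta> x (u x # map ax J))"
  if \<phi>: "\<phi> \<in> {f, g, h}" for \<phi>
 proof -
  obtain b where b: "\<forall>I. pf (b I)" "\<phi> = (\<Sum>I\<in>?T. b I * ?c I)" using ideal \<phi> by blast
  define u where "u x = (\<Sum>I\<in>?T. b I x *s (\<Sum>a<p. ((-1) ^ a * e (take a I @ drop (Suc a) I) x) *s ax (I ! a)))" for x
  have "pvf u" unfolding u_def
   using b(1) e by (intro pvf_sum pvf_scale pvf_const pf_pointwise) auto
  moreover have "\<phi> x * e J x = \<theta> x (u x # map ax J)" if J: "length J = p - 1" for J x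
  proof -
   interpret L: Vector_Spaces.linear "(*s)" "(*)" "\<lambda>u. \<theta> x (u # map ax J)" by (rule lin\<theta>[OF J])
   have "\<theta> x (u x # map ax J) = (\<Sum>I\<in>?T. b I x * (\<Sum>a<p. (-1) ^ a * e (take a I @ drop (Suc a) I) x * \<theta> x (ax (I ! a) # map ax J)))"
    by (simp only: u_def L.sum L.scale)
   also have "\<dots> = (\<Sum>I\<in>?T. b I x * (?c I x * e J x))" using rel[OF _ J] by (intro sum.cong refl) simp
   also have "\<dots> = \<phi> x * e J x" unfolding b(2) fun_sum_apply times_fun_apply sum_distrib_right by (simp add: mult.assoc)
   finally show ?thesis by simp
  qed
  ultimately show ?thesis by blast
 qed
 note fields = this
 obtain uf where uf: "pvf uf" "\<And>J x. length J = p - 1 ==> f x * e J x = \<theta> x (uf x # map ax J)" using fields[of f] by blast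
 obtain ug where ug: "pvf ug" "\<And>J x. length J = p - 1 ==> g x * e J x = \<theta> x (ug x # map ax J)" using fields[of g] by blast
 obtain uh where uh: "pvf uh" "\<And>J x. length J = p - 1 ==> h x * e J x = \<theta> x (uh x # map ax J)" using fields[of h] by blast
 have pfh: "pf h" using inv_dir_pf[OF h(1)] .
 \<comment> \<open>Cross-multiplied fields contract to the same family, so their difference is a
   kernel field and expands in the generators.\<close>
 have pair: "\<exists>A. (\<forall>j. pf (A j)) \<and> (\<forall>x. \<psi> x *s u x - \<phi> x *s w x = (\<Sum>j<r. A j x *s X j x))"
  if u: "pvf u" "\<And>J x. length J = p - 1 ==> \<phi> x * e J x = \<theta> x (u x # map ax J)"
   and w: "pvf w" "\<And>J x. length J = p - 1 ==> \<psi> x * e J x = \<theta> x (w x # map ax J)"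
   and pf: "pf \<phi>" "pf \<psi>" for \<phi> \<psi> u w
 proof -
  have "kernel_field p \<theta> (\<lambda>x. \<psi> x *s u x - \<phi> x *s w x)" unfolding kernel_field_def
  proof (intro conjI allI impI)
   show "pvf (\<lambda>x. \<psi> x *s u x - \<phi> x *s w x)" using u(1) w(1) pf by (intro pvf_diff pvf_scale)
   fix x and js :: "(complex^'n) list" assume js: "Suc (length js) = p"
   show "\<theta> x ((\<psi> x *s u x - \<phi> x *s w x) # js) = 0"
   proof (rule multilin_zero_basis[of "p - 1" "\<lambda>js. \<theta> x ((\<psi> x *s u x - \<phi> x *s w x) # js)"])
    show "multilin (p - 1) (\<lambda>js. \<theta> x ((\<psi> x *s u x - \<phi> x *s w x) # js))"
     using multilin_Cons[of "p - 1" "\<theta> x"] hom_form_multilin[OF \<theta>(1)] p by simp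
    fix J :: "'n list" assume J: "length J = p - 1"
    interpret L: Vector_Spaces.linear "(*s)" "(*)" "\<lambda>u. \<theta> x (u # map ax J)" by (rule lin\<theta>[OF J])
    have "\<theta> x ((\<psi> x *s u x - \<phi> x *s w x) # map ax J) = \<psi> x * (\<phi> x * e J x) - \<phi> x * (\<psi> x * e J x)"
     by (simp only: L.diff L.scale u(2)[OF J] w(2)[OF J])
    then show "\<theta> x ((\<psi> x *s u x - \<phi> x *s w x) # map ax J) = 0" by simp
   qed (use js in simp)
  qed
  then show ?thesis using gen unfolding kernel_generators_def by blast
 qed
 obtain A where A: "\<And>j. pf (A j)" "\<And>x. g x *s uf x - f x *s ug x = (\<Sum>j<r. A j x *s X j x)"
  using pair[OF uf ug f.pf g.pf] by blast
 obtain B where B: "\<And>j. pf (B j)" "\<And>x. h x *s ug x - g x *s uh x = (\<Sum>j<r. B j x *s X j x)"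
  using pair[OF ug uh g.pf pfh] by blast
 obtain D where D: "\<And>j. pf (D j)" "\<And>x. f x *s uh x - h x *s uf x = (\<Sum>j<r. D j x *s X j x)"
  using pair[OF uh uf pfh f.pf] by blast
 obtain I0 x0 where I0: "length I0 = p" "?c I0 x0 \<noteq> 0" using hom_form_eq_0[OF \<theta>(1)] \<theta>(2) by blast
 \<comment> \<open>Weighted by \<open>h\<close>, \<open>f\<close>, \<open>g\<close>, the three cross
   differences sum to zero. Where \<theta> does not vanish the generators are independent, so there
   the coefficients can be compared.\<close>
 have cocycle: "h * A j + f * B j + g * D j = 0" if j: "j < r" for j
 proof -
  have "(h x * A j x + f x * B j x + g x * D j x) * ?c I0 x = 0" for x
  proof (cases "?c I0 x = 0")
   case False
   have "(\<Sum>j<r. (h x * A j x + f x * B j x + g x * D j x) *s X j x) =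
    h x *s (\<Sum>j<r. A j x *s X j x) + f x *s (\<Sum>j<r. B j x *s X j x) + g x *s (\<Sum>j<r. D j x *s X j x)"
    by (simp add: vec_eq_iff sum_distrib_left sum.distrib algebra_simps)
   also have "\<dots> = 0" unfolding A(2)[symmetric] B(2)[symmetric] D(2)[symmetric]
    by (simp add: vec_eq_iff algebra_simps)
   finally have "h x * A j x + f x * B j x + g x * D j x = 0"
    by (rule kernel_independent[OF \<theta>(1,3) p gen r False I0(1) _ j])
   then show ?thesis by simp
  qed simp
  then have "(h * A j + f * B j + g * D j) * ?c I0 = 0" by (simp add: fun_eq_iff)
  moreover have "pf (h * A j + f * B j + g * D j)" by (intro pf_add pf_mult A(1) B(1) D(1) pfh f.pf g.pf)
  moreover have "pf (?c I0)" using hp_imp_pf[OF hom_form_hp[OF \<theta>(1)]] I0(1) by simp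
  moreover have "?c I0 \<noteq> 0" using I0(2) by (auto simp: fun_eq_iff)
  ultimately show ?thesis using pf_no_zero_divisors by blast
 qed
 have "\<exists>\<alpha> \<beta>. pf \<alpha> \<and> pf \<beta> \<and> A j = f * \<alpha> + g * \<beta>" if j: "j < r" for j
 proof -
  have "h * A j = f * (- B j) + g * (- D j)" using cocycle[OF j] by (simp add: algebra_simps eq_neg_iff_add_eq_0)
  from f.ideal_cancel[OF gv h A(1) pf_uminus[OF B(1)] pf_uminus[OF D(1)] this] show ?thesis by blast
 qed
 then obtain \<alpha> \<beta> where ab: "\<And>j. j < r ==> pf (\<alpha> j) \<and> pf (\<beta> j) \<and> A j = f * \<alpha> j + g * \<beta> j" by metis
 have pfX: "pvf (X j)" and Xker: "\<theta> x (X j x # js) = 0" if "j < r" "Suc (length js) = p" for j x js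
  using gen that unfolding kernel_generators_def kernel_field_def by blast+
 have pX: "pvf (X j)" if "j < r" for j using gen that unfolding kernel_generators_def kernel_field_def by blast
 \<comment> \<open>The corrections by kernel fields do not change the contractions, and they achieve
   that \<open>g\<close> times \<open>u1\<close> equals \<open>f\<close> times
   \<open>u2\<close>.\<close>
 define u1 where "u1 x = uf x - (\<Sum>j<r. \<beta> j x *s X j x)" for x
 define u2 where "u2 x = ug x + (\<Sum>j<r. \<alpha> j x *s X j x)" for x
 have pu: "pvf u1" "pvf u2" unfolding u1_def u2_def
  using uf(1) ug(1) pX ab by (auto intro!: pvf_diff pvf_add pvf_sum pvf_scale)
 have "g x *s u1 x = f x *s u2 x" for x
 proof -
  have "g x *s uf x - f x *s ug x = (\<Sum>j<r. (f x * \<alpha> j x + g x * \<beta> j x) *s X j x)"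
   unfolding A(2) using ab by (intro sum.cong refl) simp
  also have "\<dots> = f x *s (\<Sum>j<r. \<alpha> j x *s X j x) + g x *s (\<Sum>j<r. \<beta> j x *s X j x)"
   by (simp add: vec_eq_iff sum_distrib_left sum.distrib algebra_simps)
  finally show ?thesis unfolding u1_def u2_def by (simp add: vec_eq_iff algebra_simps)
 qed
 then have gu: "g * (\<lambda>x. u1 x $ i) = f * (\<lambda>x. u2 x $ i)" for i
  by (auto simp: fun_eq_iff vec_eq_iff)
 have "\<exists>c. pf c \<and> (\<lambda>x. u1 x $ i) = f * c" for i
 proof -
  have "g \<noteq> 0" using g.fv by auto
  moreover have "pf (\<lambda>x. u1 x $ i)" "pf (\<lambda>x. u2 x $ i)" using pu by (auto simp: pvf_def)
  ultimately obtain c where "pf c" "(\<lambda>x. u1 x $ i) = f * c" using f.dvd_cancel[OF gv(2) _ _ _ gu] by metis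
  then show ?thesis by blast
 qed
 then obtain c where c: "\<And>i. pf (c i)" "\<And>i. (\<lambda>x. u1 x $ i) = f * c i" by metis
 define w where "w x = (\<chi> i. c i x)" for x
 have "pvf w" using c(1) by (simp add: pvf_def w_def)
 moreover have "e J x = \<theta> x (w x # map ax J)" if J: "length J = p - 1" for J x
 proof -
  have fe: "f y * e J y = f y * \<theta> y (w y # map ax J)" for y
  proof -
   interpret L: Vector_Spaces.linear "(*s)" "(*)" "\<lambda>u. \<theta> y (u # map ax J)" by (rule lin\<theta>[OF J])
   have "f y *s w y = u1 y" using c(2) by (simp add: vec_eq_iff w_def fun_eq_iff)
   then have "f y * \<theta> y (w y # map ax J) = \<theta> y (u1 y # map ax J)" by (metis L.scale)
   also have "\<dots> = \<theta> y (uf y # map ax J) - (\<Sum>j<r. \<beta> j y * \<theta> y (X j y # map ax J))"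
    by (simp only: u1_def L.diff L.sum L.scale)
   also have "\<dots> = f y * e J y" using uf(2)[OF J] Xker J p by simp
   finally show ?thesis ..
  qed
  have "e J = (\<lambda>x. \<theta> x (w x # map ax J))"
  proof (rule pf_mult_cancel[OF f.pf e[OF J]])
   show "pf (\<lambda>x. \<theta> x (w x # map ax J))" using pf_multilin[OF \<theta>(1) \<open>pvf w\<close>] J p by simp
   show "f \<noteq> 0" using f.fv by auto
   show "f * e J = f * (\<lambda>x. \<theta> x (w x # map ax J))" using fe by (simp add: fun_eq_iff)
  qed
  then show ?thesis by (rule fun_cong)
 qed
 ultimately show thesis by (rule that)
qed

section \<open>Regular functions on the punctured cone\<close>

text \<open>Regularity at \<open>x\<close> with a denominator that works on the whole punctured
  space, not only near \<open>x\<close>. A local fraction is brought into this form by a factor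
  vanishing off its neighbourhood, see \<open>open_witness\<close>.\<close>

definition reg :: "(complex^'n => complex) => complex^'n => bool" where
 "reg F x \<longleftrightarrow> (\<exists>s A. pf s \<and> pf A \<and> s x \<noteq> 0 \<and> (\<forall>y. y \<noteq> 0 --> s y * F y = A y))"

lemma pf_eq_off_0:
 fixes p q :: "complex^'n => complex"
 assumes "pf p" "pf q" "\<And>x. x \<noteq> 0 ==> p x = q x" shows "p = q"
proof -
 obtain i :: 'n where True by blast
 have nz: "(\<lambda>x::complex^'n. x $ i) \<noteq> 0" by (auto simp: fun_eq_iff intro!: exI[of _ "ax i"])
 show ?thesis
 proof (rule pf_mult_cancel[OF pf_component assms(1,2) nz])
  show "(\<lambda>x. x $ i) * p = (\<lambda>x. x $ i) * q"
  proof
   fix x show "((\<lambda>x. x $ i) * p) x = ((\<lambda>x. x $ i) * q) x" using assms(3)[of x] by (cases "x = 0") auto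
  qed
 qed
qed

lemma monic_component: "monic_along (\<lambda>x. x $ i) (ax i) 1 (\<lambda>x. x $ i)"
 by (rule monic_along.intro[OF hp_component _ lin_component]) (simp_all add: axis_def)

lemma monic_component_power: "monic_along ((\<lambda>x. x $ i) ^ s) (ax i) s (\<lambda>x. x $ i)"
 using hp_power[OF hp_component[of i], of s]
 by (intro monic_along.intro) (simp_all add: lin_component axis_def fun_power_apply)

lemma component_inv_dir: "i \<noteq> j ==> (\<lambda>x. x $ j) \<in> inv_dir (ax i)"
 by (simp add: inv_dir_def axis_def)

lemma inv_dir_power: "p \<in> inv_dir v ==> p ^ n \<in> inv_dir v"
 by (induction n) (simp_all only: power_0 power_Suc inv_dir_1 inv_dir_mult)

lemma component_nonzero: "(\<lambda>x::complex^'n. x $ i) \<noteq> 0"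
 by (auto simp: fun_eq_iff intro!: exI[of _ "ax i"])

text \<open>The Hartogs phenomenon. The admissible denominators form an ideal whose zeros can only
  be the origin, so it contains powers of two different coordinates. These are coprime, and a
  function with both as denominators is a polynomial.\<close>

lemma regular_polynomial:
 fixes F :: "complex^'n => complex"
 assumes card: "CARD('n) \<ge> 2" and F: "\<And>x. x \<noteq> 0 ==> reg F x"
 shows "\<exists>P. pf P \<and> (\<forall>x. x \<noteq> 0 --> F x = P x)"
proof -
 obtain i j :: 'n where ij: "i \<noteq> j" using card by (metis card_2_iff' ex_card subset_UNIV UNIV_I)
 let ?J = "{b. pf b \<and> (\<exists>A. pf A \<and> (\<forall>y. y \<noteq> 0 --> b y * F y = A y))}"
 have J: "pideal ?J" unfolding pideal_def
 proof (intro conjI ballI allI impI)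
  show "0 \<in> ?J" by (intro CollectI conjI pf_0 exI[of _ 0]) simp_all
 next
  fix a b assume "a \<in> ?J" "b \<in> ?J"
  then obtain A B where "pf a" "pf b" "pf A" "pf B" "\<forall>y. y \<noteq> 0 --> a y * F y = A y" "\<forall>y. y \<noteq> 0 --> b y * F y = B y" by blast
  then show "a + b \<in> ?J" by (intro CollectI conjI pf_add exI[of _ "A + B"]) (simp_all add: distrib_right)
 next
  fix a b :: "complex^'n => complex" assume "a \<in> ?J" "pf b"
  then obtain A where "pf a" "pf A" "\<forall>y. y \<noteq> 0 --> a y * F y = A y" by blast
  then show "b * a \<in> ?J" using \<open>pf b\<close> by (intro CollectI conjI pf_mult exI[of _ "b * A"]) (simp_all add: mult.assoc)
 qed simp
 have cz: "x = 0" if "x \<in> common_zeros ?J" for x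
 proof (rule ccontr)
  assume "x \<noteq> 0"
  then obtain s A where "pf s" "pf A" "s x \<noteq> 0" "\<forall>y. y \<noteq> 0 --> s y * F y = A y" using F unfolding reg_def by blast
  then show False using that unfolding common_zeros_def by blast
 qed
 have ex: "\<exists>s. (\<lambda>x. x $ m) ^ s \<in> ?J" for m
 proof -
  have v: "x $ m = 0" if "x \<in> common_zeros ?J" for x using cz[OF that] by simp
  show ?thesis by (rule nullstellensatz[OF J pf_component[of m]]; (erule v | erule exI))
 qed
 obtain s where s: "(\<lambda>x. x $ i) ^ s \<in> ?J" using ex[of i] by (elim exE) (rule that)
 obtain t where t: "(\<lambda>x. x $ j) ^ t \<in> ?J" using ex[of j] by (elim exE) (rule that)
 let ?f = "(\<lambda>x::complex^'n. x $ i) ^ s" and ?g = "(\<lambda>x::complex^'n. x $ j) ^ t"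
 obtain A where A: "pf A" "\<And>y. y \<noteq> 0 ==> ?f y * F y = A y" using s by blast
 obtain B where B: "pf B" "\<And>y. y \<noteq> 0 ==> ?g y * F y = B y" using t by blast
 interpret f: monic_along ?f "ax i" s "\<lambda>x. x $ i" by (rule monic_component_power)
 have pfg: "pf ?g" by (rule pf_power) simp
 have "?g * A = ?f * B"
 proof (rule pf_eq_off_0)
  fix x :: "complex^'n" assume "x \<noteq> 0"
  then show "(?g * A) x = (?f * B) x" using A(2)[of x] B(2)[of x] by (metis times_fun_apply mult.left_commute)
 qed (use A B pfg f.pf in auto)
 then obtain C where C: "pf C" "A = ?f * C"
  using f.dvd_cancel[OF inv_dir_power[OF component_inv_dir[OF ij]] pf_power_nonzero[OF pf_component component_nonzero] A(1) B(1)] by metis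
 have "F x = C x" if x: "x \<noteq> 0" for x
 proof -
  obtain b D where b: "pf b" "pf D" "b x \<noteq> 0" "\<And>y. y \<noteq> 0 ==> b y * F y = D y" using F[OF x] unfolding reg_def by blast
  have "?f * D = ?f * (b * C)"
  proof (rule pf_eq_off_0)
   fix y :: "complex^'n" assume "y \<noteq> 0"
   then have "?f y * D y = b y * A y" using A(2)[of y] b(4)[of y] by (metis mult.left_commute)
   then show "(?f * D) y = (?f * (b * C)) y" using C(2) by (simp add: mult.left_commute)
  qed (use b C f.pf in auto)
  then have "D = b * C"
   using pf_mult_cancel[OF f.pf b(2) pf_mult[OF b(1) C(1)]] pf_power_nonzero[OF pf_component component_nonzero] by blast
  then have "b x * F x = b x * C x" using b(4)[OF x] by simp
  then show ?thesis using b(3) by simp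
 qed
 then show ?thesis using C(1) by blast
qed

lemma reg_pf: "pf p ==> reg p x"
 unfolding reg_def by (intro exI[of _ 1] exI[of _ p]) auto

lemma reg_add: assumes "reg F x" "reg G x" shows "reg (\<lambda>y. F y + G y) x"
proof -
 obtain s A t B where "pf s" "pf A" "s x \<noteq> 0" "\<forall>y. y \<noteq> 0 --> s y * F y = A y"
  "pf t" "pf B" "t x \<noteq> 0" "\<forall>y. y \<noteq> 0 --> t y * G y = B y" using assms unfolding reg_def by blast
 then show ?thesis unfolding reg_def
  by (intro exI[of _ "\<lambda>y. s y * t y"] exI[of _ "\<lambda>y. t y * A y + s y * B y"] conjI pf_pointwise)
   (auto simp: algebra_simps)
qed

lemma reg_mult: assumes "reg F x" "reg G x" shows "reg (\<lambda>y. F y * G y) x"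
proof -
 obtain s A t B where *: "pf s" "pf A" "s x \<noteq> 0" "\<forall>y. y \<noteq> 0 --> s y * F y = A y"
  "pf t" "pf B" "t x \<noteq> 0" "\<forall>y. y \<noteq> 0 --> t y * G y = B y" using assms unfolding reg_def by blast
 have "s y * t y * (F y * G y) = A y * B y" if "y \<noteq> 0" for y
 proof -
  have "s y * t y * (F y * G y) = (s y * F y) * (t y * G y)" by (simp add: mult_ac)
  then show ?thesis using *(4,8) that by simp
 qed
 moreover have "pf (\<lambda>y. s y * t y)" "pf (\<lambda>y. A y * B y)" "s x * t x \<noteq> 0" using * by (auto intro: pf_pointwise)
 ultimately show ?thesis unfolding reg_def by blast
qed

lemma reg_diff: "reg F x ==> reg G x ==> reg (\<lambda>y. F y - G y) x"
 using reg_add[of F x "\<lambda>y. (-1) * G y"] reg_mult[OF reg_pf[OF pf_const[of "-1"]], where G=G and x=x] by simp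

lemma reg_cong:
 assumes "reg F x" "pf p" "p x \<noteq> 0" "\<And>y. y \<noteq> 0 ==> p y \<noteq> 0 ==> F y = G y"
 shows "reg G x"
proof -
 obtain s A where *: "pf s" "pf A" "s x \<noteq> 0" "\<forall>y. y \<noteq> 0 --> s y * F y = A y" using assms(1) unfolding reg_def by blast
 have "p y * s y * G y = p y * A y" if "y \<noteq> 0" for y
  using * assms(4)[OF that] that by (cases "p y = 0") auto
 then show ?thesis unfolding reg_def using * assms(2,3)
  by (intro exI[of _ "\<lambda>y. p y * s y"] exI[of _ "\<lambda>y. p y * A y"] conjI pf_pointwise) auto
qed

lemma reg_powi: "x $ i \<noteq> 0 ==> reg (\<lambda>y. y $ i powi e) x"
proof (cases "e \<ge> 0")
 case True
 then have "(\<lambda>y::complex^'a. y $ i powi e) = (\<lambda>y. (y $ i) ^ nat e)" by (simp add: power_int_def)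
 then show ?thesis by (simp add: reg_pf pf_pointwise)
next
 case False
 assume x: "x $ i \<noteq> 0"
 \<comment> \<open>The exponent is one larger than the pole, so that the identity also holds where
   \<open>y $ i = 0\<close>, whatever the integer power is there.\<close>
 have "(y $ i) ^ Suc (nat (- e)) * (y $ i powi e) = y $ i" for y :: "complex^'a"
  using False by (cases "y $ i = 0") (auto simp: power_int_def field_simps)
 moreover have "pf (\<lambda>y::complex^'a. (y $ i) ^ Suc (nat (- e)))" by (intro pf_pointwise) auto
 ultimately show ?thesis unfolding reg_def using x
  by (intro exI[of _ "\<lambda>y. (y $ i) ^ Suc (nat (- e))"] exI[of _ "\<lambda>y. y $ i"]) auto
qed

section \<open>Open sets and sections\<close>

lemma open_subset_PP: "zopen V ==> V \<subseteq> PP"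
 unfolding openin_proj_zariski by blast

lemma Union_open_iff:
 assumes "V \<subseteq> PP" shows "x \<in> \<Union>V \<longleftrightarrow> x \<noteq> 0 \<and> proj_point (*s) x \<in> V"
 using assms PP_rep[of _ x] PP_mem_nonzero[of _ x] proj_point_self[of x] by (metis Union_iff subsetD)

text \<open>Since \<open>p\<close> vanishes on the punctured space off the open cone, multiplying by
  it extends identities from a neighbourhood to all non-zero vectors.\<close>

lemma open_witness:
 assumes "zopen V" "x \<in> \<Union>V"
 obtains p where "pf p" "p x \<noteq> 0" "\<forall>y. y \<noteq> 0 --> y \<notin> \<Union>V --> p y = 0"
proof -
 have V: "V \<subseteq> PP" by (rule open_subset_PP[OF assms(1)])
 obtain S where S: "\<forall>p\<in>S. \<exists>k. hp k p" "PP - V = {g \<in> PP. \<forall>p\<in>S. \<forall>x\<in>g. p x = 0}"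
  using assms(1) unfolding openin_proj_zariski by blast
 have x: "x \<noteq> 0" "proj_point (*s) x \<in> V" using assms(2) Union_open_iff[OF V] by auto
 then have "proj_point (*s) x \<notin> PP - V" "proj_point (*s) x \<in> PP" using V by auto
 then obtain p y where p: "p \<in> S" "y \<in> proj_point (*s) x" "p y \<noteq> 0" unfolding S(2) by blast
 obtain k where k: "hp k p" using S(1) p(1) by blast
 have "p x \<noteq> 0" using hp_zero_line[OF k \<open>proj_point (*s) x \<in> PP\<close> proj_point_self _ p(2)] p(3) by blast
 moreover have "p y = 0" if "y \<noteq> 0" "y \<notin> \<Union>V" for y
 proof -
  have "proj_point (*s) y \<in> PP - V" using that proj_point_PP Union_open_iff[OF V] by blast
  then show ?thesis using p(1) proj_point_self[of y] unfolding S(2) by blast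
 qed
 ultimately show thesis using that hp_imp_pf[OF k] by blast
qed

definition twist_germ :: "int => (complex^'n::finite) set set => (complex^'n => complex) => (complex^'n) set => bool" where
 "twist_germ e U f g \<longleftrightarrow> (\<exists>V a b F G. zopen V \<and> g \<in> V \<and> V \<subseteq> U \<and>
    hom_poly (*s) a F \<and> hom_poly (*s) b G \<and> int a - int b = e \<and>
    (\<forall>x\<in>\<Union>V. G x \<noteq> 0 \<and> f x = F x / G x))"

lemma twist_sections_iff:
 "f \<in> twist_sections e U \<longleftrightarrow> (\<forall>x. x \<notin> \<Union>U --> f x = 0) \<and> (\<forall>g\<in>U. twist_germ e U f g)"
 unfolding twist_sections_def twist_germ_def by simp

lemma twist_germI:
 assumes "zopen V" "g \<in> V" "V \<subseteq> U" "hp a F" "hp b G" "int a - int b = e"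
  "\<And>x. x \<in> \<Union>V ==> G x \<noteq> 0" "\<And>x. x \<in> \<Union>V ==> f x = F x / G x"
 shows "twist_germ e U f g"
 unfolding twist_germ_def using assms
 by (intro exI[of _ V] exI[of _ a] exI[of _ b] exI[of _ F] exI[of _ G] conjI ballI) simp_all

lemma twist_germE:
 assumes "f \<in> twist_sections e U" "g \<in> U"
 obtains V a b F G where "zopen V" "g \<in> V" "V \<subseteq> U" "hp a F" "hp b G" "int a - int b = e"
  "\<forall>x\<in>\<Union>V. G x \<noteq> 0" "\<forall>x\<in>\<Union>V. f x = F x / G x"
proof -
 have "twist_germ e U f g" using assms by (simp add: twist_sections_iff)
 then obtain V a b F G where "zopen V \<and> g \<in> V \<and> V \<subseteq> U \<and>
    hom_poly (*s) a F \<and> hom_poly (*s) b G \<and> int a - int b = e \<and> (\<forall>x\<in>\<Union>V. G x \<noteq> 0 \<and> f x = F x / G x)"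
  unfolding twist_germ_def by (elim exE) (rule that)
 then show thesis by (intro that[of V a F b G]) simp_all
qed

lemma reg_twist:
 assumes f: "f \<in> twist_sections e V" and V: "zopen V" "x \<in> \<Union>V"
 shows "reg f x"
proof -
 obtain g where g: "g \<in> V" "x \<in> g" using V(2) by blast
 obtain W a b F G where W: "zopen W" "g \<in> W" "W \<subseteq> V" "hp a F" "hp b G"
  "\<forall>x\<in>\<Union>W. G x \<noteq> 0" "\<forall>x\<in>\<Union>W. f x = F x / G x" by (rule twist_germE[OF f g(1)]) (rule that)
 have xW: "x \<in> \<Union>W" using g W(2) by blast
 obtain p where p: "pf p" "p x \<noteq> 0" "\<forall>y. y \<noteq> 0 --> y \<notin> \<Union>W --> p y = 0" using open_witness[OF W(1) xW] .
 have "p y * G y * f y = p y * F y" if "y \<noteq> 0" for y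
  using p(3) W(6,7) that by (cases "y \<in> \<Union>W") auto
 moreover have "pf (\<lambda>y. p y * G y)" "pf (\<lambda>y. p y * F y)"
  using p(1) hp_imp_pf[OF W(4)] hp_imp_pf[OF W(5)] by (auto intro: pf_pointwise)
 moreover have "p x * G x \<noteq> 0" using p(2) bspec[OF W(6) xW] by simp
 ultimately show ?thesis unfolding reg_def by blast
qed

lemma twist_mult:
 assumes f: "f \<in> twist_sections e U" and g: "g \<in> twist_sections e' U"
 shows "(\<lambda>x. f x * g x) \<in> twist_sections (e + e') U"
 unfolding twist_sections_iff
proof (intro conjI allI impI ballI)
 fix l assume l: "l \<in> U"
 obtain V a b F G where V: "zopen V" "l \<in> V" "V \<subseteq> U" "hp a F" "hp b G" "int a - int b = e"
  "\<forall>x\<in>\<Union>V. G x \<noteq> 0" "\<forall>x\<in>\<Union>V. f x = F x / G x" by (rule twist_germE[OF f l]) (rule that)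
 obtain W c d H K where W: "zopen W" "l \<in> W" "W \<subseteq> U" "hp c H" "hp d K" "int c - int d = e'"
  "\<forall>x\<in>\<Union>W. K x \<noteq> 0" "\<forall>x\<in>\<Union>W. g x = H x / K x" by (rule twist_germE[OF g l]) (rule that)
 have sub: "x \<in> \<Union>V \<and> x \<in> \<Union>W" if "x \<in> \<Union>(V \<inter> W)" for x using that by blast
 show "twist_germ (e + e') U (\<lambda>x. f x * g x) l"
  by (rule twist_germI[OF openin_Int[OF V(1) W(1)] _ _ hom_poly.mult[OF V(4) W(4)] hom_poly.mult[OF V(5) W(5)]])
   (use V(2,3,6-8) W(2,6-8) sub in auto)
qed (use f in \<open>auto simp: twist_sections_iff\<close>)

lemma twist_add:
 assumes f: "f \<in> twist_sections e U" and g: "g \<in> twist_sections e U"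
 shows "(\<lambda>x. f x + g x) \<in> twist_sections e U"
 unfolding twist_sections_iff
proof (intro conjI allI impI ballI)
 fix l assume l: "l \<in> U"
 obtain V a b F G where V: "zopen V" "l \<in> V" "V \<subseteq> U" "hp a F" "hp b G" "int a - int b = e"
  "\<forall>x\<in>\<Union>V. G x \<noteq> 0" "\<forall>x\<in>\<Union>V. f x = F x / G x" by (rule twist_germE[OF f l]) (rule that)
 obtain W c d H K where W: "zopen W" "l \<in> W" "W \<subseteq> U" "hp c H" "hp d K" "int c - int d = e"
  "\<forall>x\<in>\<Union>W. K x \<noteq> 0" "\<forall>x\<in>\<Union>W. g x = H x / K x" by (rule twist_germE[OF g l]) (rule that)
 have "c + b = a + d" using V(6) W(6) by linarith
 then have "hp (a + d) (\<lambda>x. H x * G x)" using hom_poly.mult[OF W(4) V(5)] by simp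
 then have h: "hp (a + d) (\<lambda>x. F x * K x + H x * G x)" using hom_poly.mult[OF V(4) W(5)] by (rule hom_poly.add[rotated])
 have sub: "x \<in> \<Union>V \<and> x \<in> \<Union>W" if "x \<in> \<Union>(V \<inter> W)" for x using that by blast
 show "twist_germ e U (\<lambda>x. f x + g x) l"
  by (rule twist_germI[OF openin_Int[OF V(1) W(1)] _ _ h hom_poly.mult[OF V(5) W(5)]])
   (use V(2,3,6-8) W(2,6-8) sub in \<open>auto simp: add_frac_eq\<close>)
qed (use f g in \<open>auto simp: twist_sections_iff\<close>)

lemma twist_restrict:
 assumes f: "f \<in> twist_sections e U" and V: "zopen V" "V \<subseteq> U"
 shows "(\<lambda>x. if x \<in> \<Union>V then f x else 0) \<in> twist_sections e V"
 unfolding twist_sections_iff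
proof (intro conjI allI impI ballI)
 fix l assume l: "l \<in> V"
 then have "l \<in> U" using V(2) by blast
 obtain W a b F G where W: "zopen W" "l \<in> W" "W \<subseteq> U" "hp a F" "hp b G" "int a - int b = e"
  "\<forall>x\<in>\<Union>W. G x \<noteq> 0" "\<forall>x\<in>\<Union>W. f x = F x / G x" by (rule twist_germE[OF f \<open>l \<in> U\<close>]) (rule that)
 have sub: "x \<in> \<Union>V \<and> x \<in> \<Union>W" if "x \<in> \<Union>(V \<inter> W)" for x using that by blast
 show "twist_germ e V (\<lambda>x. if x \<in> \<Union>V then f x else 0) l"
  by (rule twist_germI[OF openin_Int[OF V(1) W(1)] _ _ W(4,5)]) (use l W(2,6-8) sub in auto)
qed simp

lemma twist_quotient:
 assumes "hp a F" "hp b G" "int a - int b = e" "zopen U" "\<And>x. x \<in> \<Union>U ==> G x \<noteq> 0"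
 shows "(\<lambda>x. if x \<in> \<Union>U then F x / G x else 0) \<in> twist_sections e U"
 unfolding twist_sections_iff
proof (intro conjI allI impI ballI)
 show "twist_germ e U (\<lambda>x. if x \<in> \<Union>U then F x / G x else 0) l" if "l \<in> U" for l
  by (rule twist_germI[OF assms(4) that order_refl assms(1-3)]) (use assms(5) in auto)
qed simp

lemma radial_coset_self: "v \<in> radial_coset x v"
 unfolding radial_coset_def by (intro CollectI exI[of _ 0]) simp

lemma radial_coset_eqI:
 assumes "a = b + t *s x" shows "radial_coset x a = radial_coset x b"
 unfolding radial_coset_def assms
proof (intro set_eqI iffI)
 fix z assume "z \<in> {b + t *s x + u *s x | u. True}"
 then obtain u where "z = b + t *s x + u *s x" by blast
 then have "z = b + (t + u) *s x" by (simp add: vec_eq_iff algebra_simps)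
 then show "z \<in> {b + u *s x | u. True}" by blast
next
 fix z assume "z \<in> {b + u *s x | u. True}"
 then obtain u where "z = b + u *s x" by blast
 then have "z = b + t *s x + (u - t) *s x" by (simp add: vec_eq_iff algebra_simps)
 then show "z \<in> {b + t *s x + u *s x | u. True}" by blast
qed

lemma radial_coset_mem: "w \<in> radial_coset x v \<longleftrightarrow> (\<exists>t. w = v + t *s x)"
 by (simp add: radial_coset_def)

lemma radial_coset_plus: "{v + w | v w. v \<in> radial_coset x a \<and> w \<in> radial_coset x b} = radial_coset x (a + b)"
proof (intro set_eqI iffI)
 fix z assume "z \<in> {v + w | v w. v \<in> radial_coset x a \<and> w \<in> radial_coset x b}"
 then obtain s t where "z = (a + s *s x) + (b + t *s x)" unfolding radial_coset_mem by blast
 then have "z = (a + b) + (s + t) *s x" by (simp add: vec_eq_iff algebra_simps)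
 then show "z \<in> radial_coset x (a + b)" unfolding radial_coset_mem by blast
next
 fix z assume "z \<in> radial_coset x (a + b)"
 then obtain t where "z = (a + t *s x) + (b + 0 *s x)" unfolding radial_coset_mem by (auto simp: algebra_simps)
 then show "z \<in> {v + w | v w. v \<in> radial_coset x a \<and> w \<in> radial_coset x b}" unfolding radial_coset_mem by blast
qed

lemma radial_coset_smult: "{c *s v + t *s x | v t. v \<in> radial_coset x a} = radial_coset x (c *s a)"
proof (intro set_eqI iffI)
 fix z assume "z \<in> {c *s v + t *s x | v t. v \<in> radial_coset x a}"
 then obtain s t where "z = c *s (a + s *s x) + t *s x" unfolding radial_coset_mem by blast
 then have "z = c *s a + (c * s + t) *s x" by (simp add: vec_eq_iff algebra_simps)
 then show "z \<in> radial_coset x (c *s a)" unfolding radial_coset_mem by blast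
next
 fix z assume "z \<in> radial_coset x (c *s a)"
 then obtain t where "z = c *s a + t *s x" unfolding radial_coset_mem by blast
 then show "z \<in> {c *s v + t *s x | v t. v \<in> radial_coset x a}" using radial_coset_self by blast
qed

section \<open>Vector fields modulo the radial field\<close>

definition vf_germ :: "(complex^'n::finite) set set => (complex^'n => (complex^'n) set) => (complex^'n) set => bool" where
 "vf_germ U \<xi> g \<longleftrightarrow> (\<exists>V a. zopen V \<and> g \<in> V \<and> V \<subseteq> U \<and>
    (\<forall>i. a i \<in> twist_sections 1 V) \<and> (\<forall>x\<in>\<Union>V. \<xi> x = radial_coset x (\<chi> i. a i x)))"

lemma vf_sections_iff:
 "\<xi> \<in> vector_field_sections U \<longleftrightarrow> (\<forall>x. x \<notin> \<Union>U --> \<xi> x = {}) \<and> (\<forall>g\<in>U. vf_germ U \<xi> g)"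
 unfolding vector_field_sections_def vf_germ_def by simp

lemma vf_local:
 assumes "\<xi> \<in> vector_field_sections U" "l \<in> U"
 obtains V a where "zopen V" "l \<in> V" "V \<subseteq> U" "\<forall>i. a i \<in> twist_sections 1 V"
  "\<forall>x\<in>\<Union>V. \<xi> x = radial_coset x (\<chi> i. a i x)"
proof -
 have "vf_germ U \<xi> l" using assms by (simp add: vf_sections_iff)
 then show thesis unfolding vf_germ_def by (elim exE conjE) (rule that)
qed

lemma vf_coset:
 assumes "\<xi> \<in> vector_field_sections U" "x \<in> \<Union>U" shows "\<exists>a. \<xi> x = radial_coset x a"
proof -
 obtain l where l: "l \<in> U" "x \<in> l" using assms(2) by blast
 obtain V a where "zopen V" "l \<in> V" "V \<subseteq> U" "\<forall>i. a i \<in> twist_sections 1 V"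
  "\<forall>x\<in>\<Union>V. \<xi> x = radial_coset x (\<chi> i. a i x)" by (rule vf_local[OF assms(1) l(1)]) (rule that)
 then show ?thesis using l by blast
qed

lemma vfI:
 assumes "\<And>x. x \<notin> \<Union>U ==> \<xi> x = {}" "\<And>l. l \<in> U ==> vf_germ U \<xi> l"
 shows "\<xi> \<in> vector_field_sections U"
 using assms by (simp add: vf_sections_iff)

lemma vf_germI:
 assumes "zopen V" "l \<in> V" "V \<subseteq> U" "\<And>i. a i \<in> twist_sections 1 V"
  "\<And>x. x \<in> \<Union>V ==> \<xi> x = radial_coset x (\<chi> i. a i x)"
 shows "vf_germ U \<xi> l"
 unfolding vf_germ_def by (intro exI[of _ V] exI[of _ a] conjI allI ballI assms)

lemma vf_plus:
 assumes \<xi>: "\<xi> \<in> vector_field_sections U" and \<eta>: "\<eta> \<in> vector_field_sections U"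
 shows "(\<lambda>x. {v + w | v w. v \<in> \<xi> x \<and> w \<in> \<eta> x}) \<in> vector_field_sections U"
proof (rule vfI)
 show "{v + w | v w. v \<in> \<xi> x \<and> w \<in> \<eta> x} = {}" if "x \<notin> \<Union>U" for x
  using that \<xi> unfolding vf_sections_iff by blast
 fix l assume l: "l \<in> U"
 obtain V a where V: "zopen V" "l \<in> V" "V \<subseteq> U" "\<forall>i. a i \<in> twist_sections 1 V"
  "\<forall>x\<in>\<Union>V. \<xi> x = radial_coset x (\<chi> i. a i x)" by (rule vf_local[OF \<xi> l]) (rule that)
 obtain W b where W: "zopen W" "l \<in> W" "W \<subseteq> U" "\<forall>i. b i \<in> twist_sections 1 W"
  "\<forall>x\<in>\<Union>W. \<eta> x = radial_coset x (\<chi> i. b i x)" by (rule vf_local[OF \<eta> l]) (rule that)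
 have o: "zopen (V \<inter> W)" using V(1) W(1) by (rule openin_Int)
 define c where "c i = (\<lambda>x. (if x \<in> \<Union>(V \<inter> W) then a i x else 0) + (if x \<in> \<Union>(V \<inter> W) then b i x else 0))" for i
 have "c i \<in> twist_sections 1 (V \<inter> W)" for i
  unfolding c_def by (intro twist_add twist_restrict[OF V(4)[rule_format] o] twist_restrict[OF W(4)[rule_format] o]) auto
 moreover have "{v + w | v w. v \<in> \<xi> x \<and> w \<in> \<eta> x} = radial_coset x (\<chi> i. c i x)" if x: "x \<in> \<Union>(V \<inter> W)" for x
 proof -
  have "x \<in> \<Union>V" "x \<in> \<Union>W" using x by auto
  have "{v + w | v w. v \<in> \<xi> x \<and> w \<in> \<eta> x} = radial_coset x ((\<chi> i. a i x) + (\<chi> i. b i x))"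
   unfolding V(5)[rule_format, OF \<open>x \<in> \<Union>V\<close>] W(5)[rule_format, OF \<open>x \<in> \<Union>W\<close>] by (rule radial_coset_plus)
  also have "(\<chi> i. a i x) + (\<chi> i. b i x) = (\<chi> i. c i x)" unfolding c_def using x by (simp only: if_True vec_eq_iff vector_add_component vec_lambda_beta simp_thms)
  finally show ?thesis .
 qed
 ultimately show "vf_germ U (\<lambda>x. {v + w | v w. v \<in> \<xi> x \<and> w \<in> \<eta> x}) l"
  using V(2,3) W(2) by (intro vf_germI[OF o, of _ _ c]) auto
qed

lemma vf_smult:
 assumes \<xi>: "\<xi> \<in> vector_field_sections U" and f: "f \<in> twist_sections 0 U"
 shows "(\<lambda>x. {f x *s v + t *s x | v t. v \<in> \<xi> x}) \<in> vector_field_sections U"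
proof (rule vfI)
 show "{f x *s v + t *s x | v t. v \<in> \<xi> x} = {}" if "x \<notin> \<Union>U" for x
  using that \<xi> unfolding vf_sections_iff by blast
 fix l assume l: "l \<in> U"
 obtain V a where V: "zopen V" "l \<in> V" "V \<subseteq> U" "\<forall>i. a i \<in> twist_sections 1 V"
  "\<forall>x\<in>\<Union>V. \<xi> x = radial_coset x (\<chi> i. a i x)" by (rule vf_local[OF \<xi> l]) (rule that)
 define c where "c i = (\<lambda>x. (if x \<in> \<Union>V then f x else 0) * a i x)" for i
 have "c i \<in> twist_sections 1 V" for i
  using twist_mult[OF twist_restrict[OF f V(1,3)] V(4)[rule_format]] unfolding c_def by simp
 moreover have "{f x *s v + t *s x | v t. v \<in> \<xi> x} = radial_coset x (\<chi> i. c i x)" if x: "x \<in> \<Union>V" for x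
 proof -
  have "f x *s (\<chi> i. a i x) = (\<chi> i. c i x)" unfolding c_def using x by (simp only: if_True vec_eq_iff vector_smult_component vec_lambda_beta simp_thms)
  then show ?thesis unfolding V(5)[rule_format, OF x] radial_coset_smult by simp
 qed
 ultimately show "vf_germ U (\<lambda>x. {f x *s v + t *s x | v t. v \<in> \<xi> x}) l"
  by (intro vf_germI[OF V(1-3), of c]) blast+
qed

lemma vf_restrict:
 assumes \<xi>: "\<xi> \<in> vector_field_sections U" and W: "zopen W" "W \<subseteq> U"
 shows "(\<lambda>x. if x \<in> \<Union>W then \<xi> x else {}) \<in> vector_field_sections W"
proof (rule vfI)
 fix l assume l: "l \<in> W"
 then have lU: "l \<in> U" using W(2) by blast
 obtain V a where V: "zopen V" "l \<in> V" "V \<subseteq> U" "\<forall>i. a i \<in> twist_sections 1 V"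
  "\<forall>x\<in>\<Union>V. \<xi> x = radial_coset x (\<chi> i. a i x)" by (rule vf_local[OF \<xi> lU]) (rule that)
 have o: "zopen (V \<inter> W)" using V(1) W(1) by (rule openin_Int)
 define c where "c i = (\<lambda>x. if x \<in> \<Union>(V \<inter> W) then a i x else 0)" for i
 have "c i \<in> twist_sections 1 (V \<inter> W)" for i unfolding c_def by (intro twist_restrict[OF V(4)[rule_format] o]) auto
 moreover have "(if x \<in> \<Union>W then \<xi> x else {}) = radial_coset x (\<chi> i. c i x)" if x: "x \<in> \<Union>(V \<inter> W)" for x
 proof -
  have "x \<in> \<Union>V" "x \<in> \<Union>W" using x by auto
  moreover have "(\<chi> i. a i x) = (\<chi> i. c i x)" unfolding c_def using x by (simp only: if_True)
  ultimately show ?thesis using V(5)[rule_format, OF \<open>x \<in> \<Union>V\<close>] by simp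
 qed
 ultimately show "vf_germ W (\<lambda>x. if x \<in> \<Union>W then \<xi> x else {}) l"
  using V(2) l by (intro vf_germI[OF o, of _ _ c]) auto
qed simp

section \<open>Lifting a bivector divisible by the radial field\<close>

text \<open>Exactness of the Koszul complex of the coordinates at bivectors, from the regular
  sequence of three coordinates. It recovers a vector field from its wedge with the position vector,
  which is all that a class modulo the radial field determines.\<close>

lemma koszul_lift:
 fixes p :: "'n::finite => 'n => complex^'n => complex"
 assumes card: "CARD('n) \<ge> 3" and pf: "\<And>a b. pf (p a b)" and anti: "\<And>a b x. p a b x = - p b a x"
  and cyc: "\<And>a b c x. x $ c * p a b x + x $ a * p b c x + x $ b * p c a x = 0"
 obtains Y where "pvf Y" "\<And>a b x. p a b x = x $ a * Y x $ b - x $ b * Y x $ a"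
proof -
 obtain S :: "'n set" where "card S = 3" using ex_card[of 3 UNIV] card by auto
 then obtain i j k :: 'n where ijk: "i \<noteq> j" "i \<noteq> k" "j \<noteq> k" by (auto simp: card_3_iff)
 let ?x = "\<lambda>i x::complex^'n. x $ i"
 interpret f: monic_along "?x i" "ax i" 1 "?x i" by (rule monic_component)
 have "?x k * p i j = ?x i * (- p j k) + ?x j * (- p k i)"
 proof
  fix x
  show "(?x k * p i j) x = (?x i * (- p j k) + ?x j * (- p k i)) x"
   using cyc[of x k i j] by (simp only: plus_fun_apply times_fun_apply fun_Compl_def) algebra
 qed
 then obtain \<alpha> \<beta> where ab: "pf \<alpha>" "pf \<beta>" "p i j = ?x i * \<alpha> + ?x j * \<beta>"
  using f.ideal_cancel[OF monic_component[of j] component_inv_dir[OF ijk(1)] component_inv_dir[OF ijk(2)]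
    component_inv_dir[OF ijk(3)] component_nonzero pf pf_uminus[OF pf] pf_uminus[OF pf]] by metis
 have "\<exists>c. pf c \<and> p i b - ?x b * \<beta> = ?x i * c" for b
 proof -
  have "?x j * (p i b - ?x b * \<beta>) = ?x i * (p j b + ?x b * \<alpha>)"
  proof
   fix x
   have "p b i x = - p i b x" by (rule anti)
   then have "x $ b * p i j x + x $ i * p j b x = x $ j * p i b x" using cyc[of x b i j] by (simp add: add_eq_0_iff2)
   then show "(?x j * (p i b - ?x b * \<beta>)) x = (?x i * (p j b + ?x b * \<alpha>)) x"
    using fun_cong[OF ab(3), of x] by (simp add: algebra_simps)
  qed
  moreover have "pf (p i b - ?x b * \<beta>)" "pf (p j b + ?x b * \<alpha>)" using pf ab by auto
  ultimately show ?thesis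
   using f.dvd_cancel[OF component_inv_dir[OF ijk(1)] component_nonzero] by metis
 qed
 \<comment> \<open>The components of the field are read off from row \<open>i\<close>:
   \<open>c b\<close> is the component \<open>b\<close>, and \<beta> is minus the component
   \<open>i\<close>.\<close>
 then obtain c where c: "\<And>b. pf (c b)" "\<And>b. p i b - ?x b * \<beta> = ?x i * c b" by metis
 define Y where "Y x = (\<chi> b. c b x)" for x
 have "p a b x = x $ a * Y x $ b - x $ b * Y x $ a" for a b x
 proof -
  have "p a b = ?x a * c b - ?x b * c a"
  proof (rule pf_mult_cancel[OF pf_component pf _ component_nonzero])
   show "pf (?x a * c b - ?x b * c a)" using c(1) by auto
   show "?x i * p a b = ?x i * (?x a * c b - ?x b * c a)"
   proof
    fix x
    have 1: "x $ i * p a b x + x $ a * p b i x + x $ b * p i a x = 0" by (rule cyc)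
    have 2: "p b i x = - p i b x" by (rule anti)
    have 3: "p i b x = x $ b * \<beta> x + x $ i * c b x" "p i a x = x $ a * \<beta> x + x $ i * c a x"
     using fun_cong[OF c(2)[of b], of x] fun_cong[OF c(2)[of a], of x] by (simp_all add: algebra_simps)
    show "(?x i * p a b) x = (?x i * (?x a * c b - ?x b * c a)) x"
     using 1 unfolding 2 3 by (simp add: algebra_simps)
   qed
  qed
  then show ?thesis by (simp add: Y_def)
 qed
 moreover have "pvf Y" using c(1) by (simp add: pvf_def Y_def)
 ultimately show thesis using that by blast
qed

text \<open>Koszul exactness one step lower, from the coprimality of two coordinates.\<close>

lemma radial_multiple:
 fixes Z :: "complex^'n => complex^'n"
 assumes card: "CARD('n) \<ge> 2" and Z: "pvf Z" and par: "\<And>x a b. x $ a * Z x $ b = x $ b * Z x $ a"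
 obtains g where "pf g" "\<And>x. Z x = g x *s x"
proof -
 obtain i j :: 'n where ij: "i \<noteq> j" using card by (metis card_2_iff' ex_card subset_UNIV UNIV_I)
 let ?x = "\<lambda>i x::complex^'n. x $ i"
 interpret f: monic_along "?x i" "ax i" 1 "?x i" by (rule monic_component)
 have pfZ: "pf (\<lambda>x. Z x $ a)" for a using Z by (simp add: pvf_def)
 have "?x j * (\<lambda>x. Z x $ i) = ?x i * (\<lambda>x. Z x $ j)" using par by (simp add: fun_eq_iff)
 then obtain g where g: "pf g" "(\<lambda>x. Z x $ i) = ?x i * g"
  using f.dvd_cancel[OF component_inv_dir[OF ij] component_nonzero pfZ pfZ] by metis
 have "(\<lambda>x. Z x $ b) = ?x b * g" for b
 proof (rule pf_mult_cancel[OF pf_component pfZ pf_mult[OF pf_component g(1)] component_nonzero])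
  show "?x i * (\<lambda>x. Z x $ b) = ?x i * (?x b * g)"
   using par[of _ i b] g(2) by (auto simp: fun_eq_iff mult.left_commute)
 qed
 then have "Z x = g x *s x" for x by (auto simp: vec_eq_iff fun_eq_iff mult.commute)
 then show thesis using that g(1) by blast
qed

section \<open>Generators of a split tangent sheaf\<close>

definition chart :: "'n::finite => (complex^'n) set set" where
 "chart i = {g \<in> PP. \<forall>x\<in>g. x $ i \<noteq> 0}"

lemma Union_chart: "x \<in> \<Union>(chart i) \<longleftrightarrow> x $ i \<noteq> 0"
proof
 assume "x $ i \<noteq> 0"
 then have "x \<noteq> 0" by auto
 then have "proj_point (*s) x \<in> chart i" using \<open>x $ i \<noteq> 0\<close> proj_point_PP
  by (auto simp: chart_def proj_point_def)
 then show "x \<in> \<Union>(chart i)" using proj_point_self by blast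
qed (auto simp: chart_def)

lemma openin_chart: "zopen (chart i)"
proof -
 have "PP - chart i = {g \<in> PP. \<forall>p\<in>{\<lambda>x. x $ i}. \<forall>x\<in>g. p x = 0}" (is "?A = ?B")
 proof (intro set_eqI iffI)
  fix g assume "g \<in> ?A"
  then have g: "g \<in> PP" "\<exists>x\<in>g. x $ i = 0" by (auto simp: chart_def)
  then obtain x where x: "x \<in> g" "x $ i = 0" by blast
  have "\<forall>y\<in>g. y $ i = 0" using hp_zero_line[OF hp_component g(1) x(1) x(2)] by blast
  then show "g \<in> ?B" using g(1) by simp
 next
  fix g assume "g \<in> ?B"
  then have g: "g \<in> PP" "\<forall>x\<in>g. x $ i = 0" by auto
  have "g \<noteq> {}" using g(1) proj_point_self unfolding proj_space_def by auto
  then show "g \<in> ?A" using g by (auto simp: chart_def)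
 qed
 moreover have "\<forall>p\<in>{\<lambda>x::complex^'a. x $ i}. \<exists>k. hp k p" using hp_component by blast
 moreover have "chart i \<subseteq> PP" by (auto simp: chart_def)
 ultimately show ?thesis unfolding openin_proj_zariski by blast
qed

text \<open>The power of \<open>x $ i\<close>, a unit on the chart, corrects the degree from
  \<open>D\<close> to \<open>e\<close>.\<close>

lemma twist_chart:
 assumes "hp D p"
 shows "(\<lambda>x. if x $ i \<noteq> 0 then x $ i powi (e - int D) * p x else 0) \<in> twist_sections e (chart i)"
proof -
 let ?a = "nat (e - int D)" and ?b = "nat (int D - e)"
 have "(\<lambda>x. if x \<in> \<Union>(chart i) then (x $ i) ^ ?a * p x / (x $ i) ^ ?b else 0) \<in> twist_sections e (chart i)"
 proof (rule twist_quotient[OF hom_poly.mult[OF _ assms] _ _ openin_chart])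
  show "hp ?a (\<lambda>x. (x $ i) ^ ?a)" "hp ?b (\<lambda>x. (x $ i) ^ ?b)"
   using hp_power[OF hp_component[of i], of ?a] hp_power[OF hp_component[of i], of ?b] by (simp_all add: fun_power_apply[abs_def])
  show "int (?a + D) - int ?b = e" by linarith
  fix x :: "complex^'a" assume "x \<in> \<Union>(chart i)"
  then have "x $ i \<noteq> 0" using Union_chart by blast
  then show "(x $ i) ^ ?b \<noteq> 0" by simp
 qed
 moreover have "(if x \<in> \<Union>(chart i) then (x $ i) ^ ?a * p x / (x $ i) ^ ?b else 0) =
  (if x $ i \<noteq> 0 then x $ i powi (e - int D) * p x else 0)" for x :: "complex^'a"
  unfolding Union_chart by (cases "e \<ge> int D") (simp_all add: power_int_def divide_simps)
 ultimately show ?thesis by simp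
qed

text \<open>Stated for a relation because the local values come from a choice of chart and of a
  representative of a coset; the local hypothesis includes that these choices do not matter.\<close>

lemma regular_relation:
 fixes Q :: "complex^'n => complex => bool"
 assumes card: "CARD('n) \<ge> 2" and ex: "\<And>x. x \<noteq> 0 ==> \<exists>z. Q x z"
  and loc: "\<And>x. x \<noteq> 0 ==> \<exists>p G. pf p \<and> p x \<noteq> 0 \<and> reg G x \<and> (\<forall>y z. y \<noteq> 0 --> p y \<noteq> 0 --> Q y z --> z = G y)"
 shows "\<exists>P. pf P \<and> (\<forall>x z. x \<noteq> 0 --> Q x z --> z = P x)"
proof -
 define F where "F x = (SOME z. Q x z)" for x
 have F: "Q x (F x)" if "x \<noteq> 0" for x unfolding F_def using ex[OF that] by (rule someI_ex)
 have "reg F x" if x: "x \<noteq> 0" for x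
 proof -
  obtain p G where p: "pf p" "p x \<noteq> 0" "reg G x" "\<forall>y z. y \<noteq> 0 --> p y \<noteq> 0 --> Q y z --> z = G y" using loc[OF x] by blast
  show ?thesis by (rule reg_cong[OF p(3,1,2)]) (use p(4) F in metis)
 qed
 from regular_polynomial[OF card this] obtain P where P: "pf P" "\<forall>x. x \<noteq> 0 --> F x = P x" by blast
 have "z = P x" if "x \<noteq> 0" "Q x z" for x z
  using loc[OF that(1)] F[OF that(1)] that P(2) by metis
 then show ?thesis using P(1) by blast
qed

text \<open>The isomorphism of sheaves unpacked, with the operations on sections written out. On the
  cone the kernel is generated by \<open>r\<close> lifted fields and the radial field,
  \<open>r + 1\<close> in all.\<close>

locale split_kernel =
 fixes q k r :: nat and \<omega> :: "'n::finite form" and e :: "nat => int"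
  and \<phi> :: "(complex^'n) set set => (complex^'n => (complex^'n) set) => nat => complex^'n => complex"
 assumes card: "CARD('n) \<ge> 3" and q: "q \<ge> 1" and hom: "hom_form q k \<omega>" and rad: "\<And>x ws. \<omega> x (x # ws) = 0"
  and bij: "\<And>U. zopen U ==>
   bij_betw (\<phi> U) (sections (tangent_sheaf \<omega>) U) (sections (split_sheaf r e) U)"
  and phi_plus: "\<And>U \<xi> \<eta>. zopen U ==> \<xi> \<in> sections (tangent_sheaf \<omega>) U ==>
   \<eta> \<in> sections (tangent_sheaf \<omega>) U ==>
   \<phi> U (\<lambda>x. {v + w | v w. v \<in> \<xi> x \<and> w \<in> \<eta> x}) = (\<lambda>j x. \<phi> U \<xi> j x + \<phi> U \<eta> j x)"
  and phi_smult: "\<And>U f \<xi>. zopen U ==> f \<in> twist_sections 0 U ==>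
   \<xi> \<in> sections (tangent_sheaf \<omega>) U ==>
   \<phi> U (\<lambda>x. {f x *s v + t *s x | v t. v \<in> \<xi> x}) = (\<lambda>j x. f x * \<phi> U \<xi> j x)"
  and phi_restrict: "\<And>U V \<xi>. zopen U ==> zopen V ==> V \<subseteq> U ==>
   \<xi> \<in> sections (tangent_sheaf \<omega>) U ==>
   \<phi> V (\<lambda>x. if x \<in> \<Union>V then \<xi> x else {}) = (\<lambda>j x. if x \<in> \<Union>V then \<phi> U \<xi> j x else 0)"
begin

abbreviation "T \<equiv> sections (tangent_sheaf \<omega>)"

lemma T_iff: "\<xi> \<in> T U \<longleftrightarrow> \<xi> \<in> vector_field_sections U \<and> (\<forall>x. \<forall>v\<in>\<xi> x. \<forall>ws. \<omega> x (v # ws) = 0)"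
 by (simp add: tangent_sheaf_def)

lemma S_iff: "h \<in> sections (split_sheaf r e) U \<longleftrightarrow> (\<forall>j<r. h j \<in> twist_sections (e j) U) \<and> (\<forall>j\<ge>r. h j = (\<lambda>_. 0))"
 by (simp add: split_sheaf_def)

lemma kernel_lin:
 assumes *: "\<omega> x (v # ws) = 0" "\<omega> x (w # ws) = 0"
 shows "\<omega> x ((a *s v + b *s w) # ws) = 0"
proof (cases "Suc (length ws) = q")
 case True
 have "multilin (Suc (length ws)) (\<omega> x)" using hom_form_multilin[OF hom] True by simp
 then interpret l: Vector_Spaces.linear "(*s)" "(*)" "\<lambda>u. \<omega> x (u # ws)"
  by (rule multilin_Cons_lin) simp
 show ?thesis using * by (simp add: l.add l.scale)
qed (simp add: hom_form_length[OF hom])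

lemma T_plus: "\<xi> \<in> T U ==> \<eta> \<in> T U ==> (\<lambda>x. {v + w | v w. v \<in> \<xi> x \<and> w \<in> \<eta> x}) \<in> T U"
 unfolding T_iff using kernel_lin[of _ _ _ _ 1 1] by (auto intro: vf_plus)

lemma T_smult: "\<xi> \<in> T U ==> f \<in> twist_sections 0 U ==> (\<lambda>x. {f x *s v + t *s x | v t. v \<in> \<xi> x}) \<in> T U"
 unfolding T_iff
proof (intro conjI allI ballI)
 assume *: "\<xi> \<in> vector_field_sections U \<and> (\<forall>x. \<forall>v\<in>\<xi> x. \<forall>ws. \<omega> x (v # ws) = 0)" "f \<in> twist_sections 0 U"
 show "(\<lambda>x. {f x *s v + t *s x | v t. v \<in> \<xi> x}) \<in> vector_field_sections U" using * by (intro vf_smult) blast+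
 fix x w ws assume "w \<in> {f x *s v + t *s x | v t. v \<in> \<xi> x}"
 then obtain v t where v: "w = f x *s v + t *s x" "v \<in> \<xi> x" by blast
 have "\<omega> x (v # ws) = 0" using * v(2) by blast
 then show "\<omega> x (w # ws) = 0" unfolding v(1) by (rule kernel_lin[OF _ rad])
qed

lemma T_restrict: "\<xi> \<in> T U ==> zopen W ==> W \<subseteq> U ==> (\<lambda>x. if x \<in> \<Union>W then \<xi> x else {}) \<in> T W"
 unfolding T_iff using vf_restrict[of \<xi> U W] by (auto split: if_splits)

lemma phi_inj: "zopen U ==> \<xi> \<in> T U ==> \<eta> \<in> T U ==> \<phi> U \<xi> = \<phi> U \<eta> ==> \<xi> = \<eta>"
 using bij unfolding bij_betw_def inj_on_def by blast

lemma T_coset: "\<xi> \<in> T U ==> x \<in> \<Union>U ==> \<exists>a. \<xi> x = radial_coset x a"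
 unfolding T_iff using vf_coset by blast

lemma overlap:
 shows "zopen (chart i \<inter> chart l)" "x \<in> \<Union>(chart i \<inter> chart l) \<longleftrightarrow> x $ i \<noteq> 0 \<and> x $ l \<noteq> 0"
proof -
 show o: "zopen (chart i \<inter> chart l)" by (intro openin_Int openin_chart)
 show "x \<in> \<Union>(chart i \<inter> chart l) \<longleftrightarrow> x $ i \<noteq> 0 \<and> x $ l \<noteq> 0"
  using Union_open_iff[OF open_subset_PP[OF o], of x] Union_open_iff[OF open_subset_PP[OF openin_chart], of x i]
   Union_open_iff[OF open_subset_PP[OF openin_chart], of x l] Union_chart[of x i] Union_chart[of x l] by blast
qed

text \<open>A unit of degree zero on the overlap of two charts; it compares local data normalised by
  powers of \<open>x $ i\<close> and of \<open>x $ l\<close>.\<close>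

definition trans :: "'n => 'n => int => complex^'n => complex" where
 "trans i l c = (\<lambda>x. if x $ i \<noteq> 0 \<and> x $ l \<noteq> 0 then (x $ l / x $ i) powi c else 0)"

lemma trans_twist: "trans i l c \<in> twist_sections 0 (chart i \<inter> chart l)"
proof -
 have h: "hp (nat c + nat (- c)) (\<lambda>x. (x $ a) ^ nat c * (x $ b) ^ nat (- c))" for a b :: 'n
  using hom_poly.mult[OF hp_power[OF hp_component[of a], of "nat c"] hp_power[OF hp_component[of b], of "nat (-c)"]]
  by (simp add: fun_power_apply)
 have "(\<lambda>x. if x \<in> \<Union>(chart i \<inter> chart l) then ((x $ l) ^ nat c * (x $ i) ^ nat (- c)) / ((x $ i) ^ nat c * (x $ l) ^ nat (- c)) else 0)
  \<in> twist_sections 0 (chart i \<inter> chart l)"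
  by (rule twist_quotient[OF h h _ overlap(1)]) (simp_all only: overlap(2), simp_all)
 moreover have "(if x \<in> \<Union>(chart i \<inter> chart l) then ((x $ l) ^ nat c * (x $ i) ^ nat (- c)) / ((x $ i) ^ nat c * (x $ l) ^ nat (- c)) else 0)
  = trans i l c x" for x
  unfolding overlap(2) trans_def by (auto simp: power_int_def field_simps)
 ultimately show ?thesis by simp
qed

text \<open>Linearity of \<phi> over functions of degree zero and its injectivity on the overlap
  carry the transition rule from the coordinates to the vector fields; \<open>trans_phi\<close> goes
  the other way.\<close>

lemma trans_section:
 assumes "\<xi> \<in> T (chart i)" "\<eta> \<in> T (chart l)"
  "\<And>j x. x $ i \<noteq> 0 ==> x $ l \<noteq> 0 ==> \<phi> (chart l) \<eta> j x = (x $ l / x $ i) powi c * \<phi> (chart i) \<xi> j x"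
  and x: "x $ i \<noteq> 0" "x $ l \<noteq> 0" "v \<in> \<xi> x"
 shows "(x $ l / x $ i) powi c *s v \<in> \<eta> x"
proof -
 let ?W = "chart i \<inter> chart l"
 let ?a = "\<lambda>x. if x \<in> \<Union>?W then \<xi> x else {}" and ?b = "\<lambda>x. if x \<in> \<Union>?W then \<eta> x else {}"
 let ?c = "\<lambda>x. {trans i l c x *s v + t *s x | v t. v \<in> ?a x}"
 have a: "?a \<in> T ?W" by (rule T_restrict[OF assms(1) overlap(1)]) blast
 have b: "?b \<in> T ?W" by (rule T_restrict[OF assms(2) overlap(1)]) blast
 have c: "?c \<in> T ?W" by (rule T_smult[OF a trans_twist])
 have "\<phi> ?W ?b = \<phi> ?W ?c"
 proof (intro ext)
  fix j x
  have "\<phi> ?W ?b j x = (if x \<in> \<Union>?W then \<phi> (chart l) \<eta> j x else 0)"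
   by (subst phi_restrict[OF openin_chart overlap(1) _ assms(2)]) auto
  also have "\<dots> = trans i l c x * (if x \<in> \<Union>?W then \<phi> (chart i) \<xi> j x else 0)"
   using assms(3)[of x j] unfolding overlap(2) by (auto simp: trans_def)
  also have "\<dots> = trans i l c x * \<phi> ?W ?a j x"
   by (subst phi_restrict[OF openin_chart overlap(1) _ assms(1)]) auto
  also have "\<dots> = \<phi> ?W ?c j x" by (subst phi_smult[OF overlap(1) trans_twist a]) simp
  finally show "\<phi> ?W ?b j x = \<phi> ?W ?c j x" .
 qed
 then have eq: "?b = ?c" by (rule phi_inj[OF overlap(1) b c])
 have xW: "x \<in> \<Union>?W" using x by (simp only: overlap(2) simp_thms not_False_eq_True)
 have "v \<in> ?a x" using x(3) xW by (simp only: if_True)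
 then have "trans i l c x *s v + 0 *s x \<in> ?c x" by blast
 moreover have "?b x = ?c x" using eq by (rule fun_cong)
 ultimately have "trans i l c x *s v + 0 *s x \<in> ?b x" by (simp only:)
 then have "trans i l c x *s v + 0 *s x \<in> \<eta> x" using xW by (simp only: if_True)
 then show ?thesis using x by (simp add: trans_def)
qed

lemma trans_phi:
 assumes "\<xi> \<in> T (chart i)" "\<eta> \<in> T (chart l)"
  "\<And>x. x $ i \<noteq> 0 ==> x $ l \<noteq> 0 ==> \<eta> x = {(x $ l / x $ i) powi c *s v + t *s x | v t. v \<in> \<xi> x}"
  and x: "x $ i \<noteq> 0" "x $ l \<noteq> 0"
 shows "\<phi> (chart l) \<eta> j x = (x $ l / x $ i) powi c * \<phi> (chart i) \<xi> j x"
proof -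
 let ?W = "chart i \<inter> chart l"
 let ?a = "\<lambda>x. if x \<in> \<Union>?W then \<xi> x else {}" and ?b = "\<lambda>x. if x \<in> \<Union>?W then \<eta> x else {}"
 have a: "?a \<in> T ?W" by (rule T_restrict[OF assms(1) overlap(1)]) blast
 have eq: "?b = (\<lambda>x. {trans i l c x *s v + t *s x | v t. v \<in> ?a x})"
  using assms(3) by (intro ext) (simp only: overlap(2) trans_def, simp)
 have xW: "x \<in> \<Union>?W" using x overlap(2) by blast
 have "\<phi> (chart l) \<eta> j x = \<phi> ?W ?b j x"
  by (subst phi_restrict[OF openin_chart overlap(1) _ assms(2)]) (use xW in auto)
 also have "\<dots> = trans i l c x * \<phi> ?W ?a j x" unfolding eq by (subst phi_smult[OF overlap(1) trans_twist a]) simp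
 also have "\<phi> ?W ?a j x = \<phi> (chart i) \<xi> j x"
  by (subst phi_restrict[OF openin_chart overlap(1) _ assms(1)]) (use xW in auto)
 finally show ?thesis using x by (simp add: trans_def)
qed

lemma basis_section:
 assumes "j < r"
 shows "\<exists>\<xi>\<in>T (chart i). \<phi> (chart i) \<xi> = (\<lambda>j' x. if j' = j \<and> x $ i \<noteq> 0 then x $ i powi e j else 0)"
proof -
 have "(\<lambda>j' x. if j' = j \<and> x $ i \<noteq> 0 then x $ i powi e j else 0) \<in> sections (split_sheaf r e) (chart i)"
  unfolding S_iff
 proof (intro conjI allI impI)
  fix j' assume "j' < r"
  have "hp 0 (\<lambda>_::complex^'n. 1)" "hp 0 (\<lambda>_::complex^'n. 0)" by (rule hom_poly.const)+
  from twist_chart[OF this(1), of i "e j"] twist_chart[OF this(2), of i "e j'"]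
  show "(\<lambda>x. if j' = j \<and> x $ i \<noteq> 0 then x $ i powi e j else 0) \<in> twist_sections (e j') (chart i)"
   by (cases "j' = j") (simp_all add: if_distrib cong: if_cong)
 qed (use assms in auto)
 then have "(\<lambda>j' x. if j' = j \<and> x $ i \<noteq> 0 then x $ i powi e j else 0) \<in> \<phi> (chart i) ` T (chart i)"
  by (simp only: bij_betw_imp_surj_on[OF bij[OF openin_chart]])
 then show ?thesis by (elim imageE) (rule bexI, erule sym, assumption)
qed

text \<open>The local frame of the tangent sheaf: the preimage of the generator
  \<open>x $ i powi e j\<close> of the \<open>j\<close>-th summand on the chart.\<close>

definition \<xi> :: "'n => nat => complex^'n => (complex^'n) set" where
 "\<xi> i j = (SOME \<xi>. \<xi> \<in> T (chart i) \<and> \<phi> (chart i) \<xi> = (\<lambda>j' x. if j' = j \<and> x $ i \<noteq> 0 then x $ i powi e j else 0))"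

lemma \<xi>: assumes "j < r"
 shows "\<xi> i j \<in> T (chart i)" "\<phi> (chart i) (\<xi> i j) = (\<lambda>j' x. if j' = j \<and> x $ i \<noteq> 0 then x $ i powi e j else 0)"
 using someI_ex[OF basis_section[OF assms, of i, unfolded Bex_def]] unfolding \<xi>_def by blast+

lemma \<xi>_trans:
 assumes j: "j < r" and x: "x $ i \<noteq> 0" "x $ l \<noteq> 0" "v \<in> \<xi> i j x"
 shows "(x $ l / x $ i) powi e j *s v \<in> \<xi> l j x"
 by (rule trans_section[OF \<xi>(1)[OF j] \<xi>(1)[OF j] _ x]) (simp add: \<xi>(2)[OF j] power_int_divide_distrib)

lemma \<xi>_ne: assumes j: "j < r" and x: "x $ i \<noteq> 0" shows "\<exists>v. \<xi> i j x = radial_coset x v"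
 using T_coset[OF \<xi>(1)[OF j], of x i] x Union_chart by blast

text \<open>Scaled by \<open>x $ i powi (- e j)\<close>, the local frames agree on overlaps modulo
  the radial field. Their wedge with the position vector is therefore globally regular, hence
  polynomial, and \<open>koszul_lift\<close> turns it into a global field.\<close>

lemma generator:
 assumes j: "j < r"
 shows "\<exists>X. kernel_field q \<omega> X \<and>
  (\<forall>i x v. x $ i \<noteq> 0 --> v \<in> \<xi> i j x --> (\<exists>t. X x = x $ i powi (- e j) *s v + t *s x))"
proof -
 have card2: "CARD('n) \<ge> 2" using card by simp
 \<comment> \<open>The component \<open>(a, b)\<close> of the position vector wedge the scaled
   frame; it does not see multiples of the radial field.\<close>
 define Q where "Q a b x z \<longleftrightarrow> (\<exists>i v. x $ i \<noteq> 0 \<and> v \<in> \<xi> i j x \<and> z = x $ i powi (- e j) * (x $ a * v $ b - x $ b * v $ a))"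
  for a b :: 'n and x z
 have ind: "x $ l powi (- e j) * (x $ a * w $ b - x $ b * w $ a) = x $ i powi (- e j) * (x $ a * v $ b - x $ b * v $ a)"
  if x: "x $ i \<noteq> 0" "x $ l \<noteq> 0" "v \<in> \<xi> i j x" "w \<in> \<xi> l j x" for i l a b x v w
 proof -
  let ?c = "(x $ l / x $ i) powi e j"
  obtain u where u: "\<xi> l j x = radial_coset x u" using \<xi>_ne[OF j x(2)] by blast
  obtain s t where "?c *s v = u + s *s x" "w = u + t *s x"
   using \<xi>_trans[OF j x(1-3)] x(4) unfolding u radial_coset_mem by blast
  then have "?c * v $ b = u $ b + s * x $ b" "w $ b = u $ b + t * x $ b" for b by (simp_all add: vec_eq_iff)
  then have w: "w $ b = ?c * v $ b + (t - s) * x $ b" for b by (simp add: algebra_simps)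
  have "x $ a * w $ b - x $ b * w $ a = ?c * (x $ a * v $ b - x $ b * v $ a)" unfolding w by (simp add: algebra_simps)
  moreover have "x $ l powi (- e j) * ?c = x $ i powi (- e j)"
   using x(1,2) by (simp add: power_int_divide_distrib power_int_minus field_simps)
  ultimately show ?thesis by (metis mult.assoc)
 qed
 have nz: "\<exists>i. x $ i \<noteq> 0" if "x \<noteq> 0" for x :: "complex^'n" using that by (auto simp: vec_eq_iff)
 have "\<exists>P. pf P \<and> (\<forall>x z. x \<noteq> 0 --> Q a b x z --> z = P x)" for a b
 proof (rule regular_relation[OF card2])
  fix x :: "complex^'n" assume "x \<noteq> 0"
  then obtain i where i: "x $ i \<noteq> 0" using nz by blast
  then obtain v where v: "\<xi> i j x = radial_coset x v" using \<xi>_ne[OF j] by blast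
  then show "\<exists>z. Q a b x z" unfolding Q_def using i radial_coset_self by blast
  obtain g where g: "g \<in> chart i" "x \<in> g" using i Union_chart by blast
  have "\<xi> i j \<in> vector_field_sections (chart i)" using \<xi>(1)[OF j] T_iff by blast
  then obtain V c where V: "zopen V" "g \<in> V" "V \<subseteq> chart i" "\<forall>i. c i \<in> twist_sections 1 V"
   "\<forall>x\<in>\<Union>V. \<xi> i j x = radial_coset x (\<chi> i. c i x)" by (rule vf_local[OF _ g(1)]) (rule that)
  have xV: "x \<in> \<Union>V" using g V by blast
  obtain p where p: "pf p" "p x \<noteq> 0" "\<forall>y. y \<noteq> 0 --> y \<notin> \<Union>V --> p y = 0" using open_witness[OF V(1) xV] .
  let ?G = "\<lambda>y. y $ i powi (- e j) * (y $ a * c b y - y $ b * c a y)"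
  have rc: "reg (c b) x" for b by (rule reg_twist[OF V(4)[rule_format] V(1) xV])
  then have "reg ?G x" by (intro reg_mult reg_diff reg_powi[OF i] reg_pf[OF pf_component] rc)
  moreover have "z = ?G y" if y: "y \<noteq> 0" "p y \<noteq> 0" "Q a b y z" for y z
  proof -
   have yV: "y \<in> \<Union>V" using p(3) y by blast
   then have yi: "y $ i \<noteq> 0" using V(3) Union_chart by blast
   have "(\<chi> i. c i y) \<in> \<xi> i j y" using V(5) yV radial_coset_self by metis
   then show ?thesis using y(3) ind[OF yi _ \<open>(\<chi> i. c i y) \<in> \<xi> i j y\<close>] unfolding Q_def by auto
  qed
  ultimately show "\<exists>p G. pf p \<and> p x \<noteq> 0 \<and> reg G x \<and> (\<forall>y z. y \<noteq> 0 --> p y \<noteq> 0 --> Q a b y z --> z = G y)"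
   using p(1,2) by blast
 qed
 then obtain P where P: "\<And>a b. pf (P a b)" "\<And>a b x z. x \<noteq> 0 ==> Q a b x z ==> z = P a b x" by metis
 have PX: "P a b x = x $ i powi (- e j) * (x $ a * v $ b - x $ b * v $ a)" if "x $ i \<noteq> 0" "v \<in> \<xi> i j x" for a b x i v
 proof -
  have "x \<noteq> 0" using that(1) by auto
  moreover have "Q a b x (x $ i powi (- e j) * (x $ a * v $ b - x $ b * v $ a))" unfolding Q_def using that by blast
  ultimately show ?thesis using P(2) by metis
 qed
 have ex: "\<exists>i v. x $ i \<noteq> 0 \<and> v \<in> \<xi> i j x" if x: "x \<noteq> 0" for x
  using nz[OF x] \<xi>_ne[OF j] radial_coset_self by metis
 have anti: "P a b x = - P b a x" for a b x
 proof -
  have "P a b = - P b a"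
  proof (rule pf_eq_off_0[OF P(1) pf_uminus[OF P(1)]])
   fix x :: "complex^'n" assume "x \<noteq> 0"
   then obtain i v where "x $ i \<noteq> 0" "v \<in> \<xi> i j x" using ex by blast
   then show "P a b x = (- P b a) x" by (simp add: PX algebra_simps)
  qed
  then show ?thesis by simp
 qed
 have cyc: "x $ c * P a b x + x $ a * P b c x + x $ b * P c a x = 0" for a b c x
 proof (cases "x = 0")
  case False
  then obtain i v where "x $ i \<noteq> 0" "v \<in> \<xi> i j x" using ex by blast
  then show ?thesis by (simp add: PX algebra_simps)
 qed simp
 obtain Y where Y: "pvf Y" "\<And>a b x. P a b x = x $ a * Y x $ b - x $ b * Y x $ a"
  using koszul_lift[OF card P(1) anti cyc] by metis
 have YX: "\<exists>t. Y x = x $ i powi (- e j) *s v + t *s x" if i: "x $ i \<noteq> 0" "v \<in> \<xi> i j x" for i x v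
 proof (intro exI)
  let ?c = "x $ i powi (- e j)"
  show "Y x = ?c *s v + ((Y x $ i - ?c * v $ i) / x $ i) *s x"
  proof (subst vec_eq_iff, intro allI)
   fix b
   have "x $ i * Y x $ b - x $ b * Y x $ i = ?c * (x $ i * v $ b - x $ b * v $ i)" using PX[OF i] Y(2) by metis
   then show "Y x $ b = (?c *s v + ((Y x $ i - ?c * v $ i) / x $ i) *s x) $ b"
    using i(1) by (simp add: field_simps)
  qed
 qed
 have "kernel_field q \<omega> Y" unfolding kernel_field_def
 proof (intro conjI allI impI Y(1))
  fix x and js :: "(complex^'n) list" assume js: "Suc (length js) = q"
  have "(\<lambda>x. \<omega> x (Y x # js)) = (\<lambda>_. 0)"
  proof (rule pf_eq_off_0[OF pf_multilin[OF hom Y(1) js] pf_const])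
   fix x :: "complex^'n" assume "x \<noteq> 0"
   then obtain i v where i: "x $ i \<noteq> 0" "v \<in> \<xi> i j x" using ex by blast
   then have "\<omega> x (v # js) = 0" using \<xi>(1)[OF j, of i] T_iff by blast
   then show "\<omega> x (Y x # js) = 0" using YX[OF i] kernel_lin[OF _ rad] by metis
  qed
  then show "\<omega> x (Y x # js) = 0" by (rule fun_cong)
 qed
 then show ?thesis using YX by blast
qed

text \<open>A homogeneous kernel field gives a section on each chart, whose coordinates under \<phi>
  rescale to functions that agree on overlaps and are therefore polynomials \<open>G j\<close>.
  Subtracting the combination of the \<open>X j\<close> leaves a field with zero class, a multiple
  of the radial field.\<close>

lemma homogeneous_generation:
 assumes Y: "kernel_field q \<omega> Y" and hY: "\<And>b. hp D (\<lambda>x. Y x $ b)"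
  and X: "\<And>j. j < r ==> kernel_field q \<omega> (X j)"
  and X\<xi>: "\<And>j i x v. j < r ==> x $ i \<noteq> 0 ==> v \<in> \<xi> i j x ==> \<exists>t. X j x = x $ i powi (- e j) *s v + t *s x"
 shows "\<exists>G g. (\<forall>j. pf (G j)) \<and> pf g \<and> (\<forall>x. Y x = (\<Sum>j<r. G j x *s X j x) + g x *s x)"
proof -
 have card2: "CARD('n) \<ge> 2" using card by simp
 \<comment> \<open>A vector field on projective space has coefficients of degree one, so a field of
   degree \<open>D\<close> is scaled by \<open>x $ i powi (1 - int D)\<close>.\<close>
 define \<sigma> where "\<sigma> i x = (if x $ i \<noteq> 0 then radial_coset x (x $ i powi (1 - int D) *s Y x) else {})" for i x
 have \<sigma>T: "\<sigma> i \<in> T (chart i)" for i unfolding T_iff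
 proof (intro conjI vfI allI ballI)
  show "\<sigma> i x = {}" if "x \<notin> \<Union>(chart i)" for x using that unfolding Union_chart by (simp add: \<sigma>_def)
  fix l assume l: "l \<in> chart i"
  show "vf_germ (chart i) (\<sigma> i) l"
  proof (rule vf_germI[OF openin_chart l order_refl twist_chart[OF hY]])
   fix x assume "x \<in> \<Union>(chart i)"
   then show "\<sigma> i x = radial_coset x (\<chi> b. if x $ i \<noteq> 0 then x $ i powi (1 - int D) * Y x $ b else 0)"
    unfolding Union_chart by (simp add: \<sigma>_def vector_scalar_mult_def)
  qed
 next
  fix x v ws assume v: "v \<in> \<sigma> i x"
  then obtain t where t: "v = x $ i powi (1 - int D) *s Y x + t *s x"
   by (auto simp: \<sigma>_def radial_coset_mem split: if_splits)
  have "\<omega> x (Y x # ws) = 0"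
   using Y hom_form_length[OF hom, of "Y x # ws" x] unfolding kernel_field_def by (cases "Suc (length ws) = q") auto
  then show "\<omega> x (v # ws) = 0" unfolding t by (rule kernel_lin[OF _ rad])
 qed
 define h where "h i = \<phi> (chart i) (\<sigma> i)" for i
 have hS: "\<forall>j<r. h i j \<in> twist_sections (e j) (chart i)" "\<forall>j\<ge>r. h i j = (\<lambda>_. 0)" for i
  using bij_betwE[OF bij[OF openin_chart], rule_format, OF \<sigma>T] unfolding h_def S_iff by blast+
 have h_trans: "x $ l powi (int D - 1) * h l j x = x $ i powi (int D - 1) * h i j x"
  if x: "x $ i \<noteq> 0" "x $ l \<noteq> 0" for i l j x
 proof -
  have "h l j x = (x $ l / x $ i) powi (1 - int D) * h i j x" unfolding h_def
  proof (rule trans_phi[OF \<sigma>T \<sigma>T _ x])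
   fix x :: "complex^'n" assume x: "x $ i \<noteq> 0" "x $ l \<noteq> 0"
   have eq: "(x $ l / x $ i) powi (1 - int D) * x $ i powi (1 - int D) = x $ l powi (1 - int D)"
    using x by (simp add: power_int_divide_distrib)
   have s: "\<sigma> a x = radial_coset x (x $ a powi (1 - int D) *s Y x)" if "x $ a \<noteq> 0" for a
    using that by (simp add: \<sigma>_def)
   show "\<sigma> l x = {(x $ l / x $ i) powi (1 - int D) *s v + t *s x |v t. v \<in> \<sigma> i x}"
   proof -
    have "(x $ l / x $ i) powi (1 - int D) *s (x $ i powi (1 - int D) *s Y x) = x $ l powi (1 - int D) *s Y x"
     using eq by (simp add: vector_smult_assoc)
    then show ?thesis by (simp only: s[OF x(1)] s[OF x(2)] radial_coset_smult)
   qed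
  qed
  moreover have "x $ l powi (int D - 1) * (x $ l / x $ i) powi (1 - int D) = x $ i powi (int D - 1)"
  proof -
   have *: "1 - int D = - (int D - 1)" by simp
   show ?thesis unfolding * using x by (simp only: power_int_divide_distrib power_int_minus) (simp add: field_simps)
  qed
  ultimately show ?thesis by (metis mult.assoc)
 qed
 have "\<exists>P. pf P \<and> (\<forall>x z. x \<noteq> 0 --> (\<exists>i. x $ i \<noteq> 0 \<and> z = x $ i powi (int D - 1) * h i j x) --> z = P x)" if j: "j < r" for j
 proof (rule regular_relation[OF card2])
  fix x :: "complex^'n" assume "x \<noteq> 0"
  then obtain i where i: "x $ i \<noteq> 0" by (auto simp: vec_eq_iff)
  then show "\<exists>z i. x $ i \<noteq> 0 \<and> z = x $ i powi (int D - 1) * h i j x" by blast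
  have "x \<in> \<Union>(chart i)" using i by (simp only: Union_chart not_False_eq_True)
  then have "reg (h i j) x" using reg_twist[OF _ openin_chart] hS(1) j by blast
  then have "reg (\<lambda>y. y $ i powi (int D - 1) * h i j y) x" by (intro reg_mult reg_powi[OF i])
  moreover have "\<forall>y z. y \<noteq> 0 --> y $ i \<noteq> 0 --> (\<exists>l. y $ l \<noteq> 0 \<and> z = y $ l powi (int D - 1) * h l j y) -->
    z = y $ i powi (int D - 1) * h i j y" using h_trans by blast
  ultimately show "\<exists>p G. pf p \<and> p x \<noteq> 0 \<and> reg G x \<and>
    (\<forall>y z. y \<noteq> 0 --> p y \<noteq> 0 --> (\<exists>i. y $ i \<noteq> 0 \<and> z = y $ i powi (int D - 1) * h i j y) --> z = G y)"
   using i pf_component[of i] by (intro exI[of _ "\<lambda>y. y $ i"] exI[of _ "\<lambda>y. y $ i powi (int D - 1) * h i j y"] conjI)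
 qed
 then have "\<forall>j. \<exists>P. pf P \<and> (j < r --> (\<forall>x i. x $ i \<noteq> 0 --> x $ i powi (int D - 1) * h i j x = P x))"
  using pf_const[of 0] by (metis zero_index)
 then obtain G where G: "\<And>j. pf (G j)" "\<And>j i x. j < r ==> x $ i \<noteq> 0 ==> G j x = x $ i powi (int D - 1) * h i j x" by metis
 define Z where "Z x = Y x - (\<Sum>j<r. G j x *s X j x)" for x
 \<comment> \<open>The section with coordinates \<open>h i j\<close> is built up one index at a
   time, by compatibility of \<phi> with the sum of two sections; its values are tracked as cosets
   alongside.\<close>
 have "\<exists>\<tau>\<in>T (chart i). \<phi> (chart i) \<tau> = (\<lambda>j x. if j < m then h i j x else 0) \<and>
  (\<forall>x. x $ i \<noteq> 0 --> \<tau> x = radial_coset x (x $ i powi (1 - int D) *s (\<Sum>j<m. G j x *s X j x)))" if "m \<le> r" for i m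
  using that
 proof (induction m)
  case 0
  \<comment> \<open>The zero section arises as 0 times \<sigma>, so that \<open>phi_smult\<close>
    computes its coordinates.\<close>
  let ?\<tau> = "\<lambda>x. {0 *s v + t *s x | v t. v \<in> \<sigma> i x}"
  have z: "(\<lambda>_. 0) \<in> twist_sections 0 (chart i)" using twist_chart[OF hom_poly.const[of _ 0], of i 0] by (simp cong: if_cong)
  have "?\<tau> \<in> T (chart i)" using T_smult[OF \<sigma>T z] .
  moreover have "\<phi> (chart i) ?\<tau> = (\<lambda>j x. 0 * \<phi> (chart i) (\<sigma> i) j x)" by (rule phi_smult[OF openin_chart z \<sigma>T])
  moreover have "?\<tau> x = radial_coset x (x $ i powi (1 - int D) *s (\<Sum>j<0. G j x *s X j x))" if "x $ i \<noteq> 0" for x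
  proof -
   have "\<sigma> i x = radial_coset x (x $ i powi (1 - int D) *s Y x)" using that by (simp add: \<sigma>_def)
   then show ?thesis by (simp only: radial_coset_smult) simp
  qed
  ultimately show ?case by (intro bexI[of _ ?\<tau>]) simp_all
 next
  case (Suc m)
  then have m: "m < r" by simp
  from Suc obtain \<tau> where \<tau>: "\<tau> \<in> T (chart i)" "\<phi> (chart i) \<tau> = (\<lambda>j x. if j < m then h i j x else 0)"
   "\<forall>x. x $ i \<noteq> 0 --> \<tau> x = radial_coset x (x $ i powi (1 - int D) *s (\<Sum>j<m. G j x *s X j x))" by auto
  let ?p = "\<lambda>x. if x $ i \<noteq> 0 then x $ i powi (- e m) else 0"
  have "?p \<in> twist_sections (- e m) (chart i)" using twist_chart[OF hom_poly.const[of _ 1], of i "- e m"] by (simp cong: if_cong)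
  then have "(\<lambda>x. ?p x * h i m x) \<in> twist_sections (- e m + e m) (chart i)" using hS(1) m by (intro twist_mult) auto
  then have f: "(\<lambda>x. ?p x * h i m x) \<in> twist_sections 0 (chart i)" by simp
  let ?\<rho> = "\<lambda>x. {(?p x * h i m x) *s v + t *s x | v t. v \<in> \<xi> i m x}"
  have \<rho>: "?\<rho> \<in> T (chart i)" by (rule T_smult[OF \<xi>(1)[OF m] f])
  have \<rho>\<phi>: "\<phi> (chart i) ?\<rho> = (\<lambda>j x. (?p x * h i m x) * \<phi> (chart i) (\<xi> i m) j x)"
   by (rule phi_smult[OF openin_chart f \<xi>(1)[OF m]])
  let ?\<tau>' = "\<lambda>x. {v + w | v w. v \<in> \<tau> x \<and> w \<in> ?\<rho> x}"
  have 1: "?\<tau>' \<in> T (chart i)" by (rule T_plus[OF \<tau>(1) \<rho>])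
  have "\<phi> (chart i) ?\<tau>' = (\<lambda>j x. \<phi> (chart i) \<tau> j x + \<phi> (chart i) ?\<rho> j x)"
   by (rule phi_plus[OF openin_chart \<tau>(1) \<rho>])
  also have "\<dots> = (\<lambda>j x. if j < Suc m then h i j x else 0)"
  proof (intro ext)
   fix j x
   have "x $ i = 0 ==> h i m x = 0" using hS(1)[rule_format, OF m, of i] Union_chart[of x i]
    unfolding twist_sections_iff by blast
   then show "\<phi> (chart i) \<tau> j x + \<phi> (chart i) ?\<rho> j x = (if j < Suc m then h i j x else 0)"
    unfolding \<tau>(2) \<rho>\<phi> \<xi>(2)[OF m] by (auto simp: less_Suc_eq power_int_minus)
  qed
  finally have 2: "\<phi> (chart i) ?\<tau>' = (\<lambda>j x. if j < Suc m then h i j x else 0)" .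
  have 3: "?\<tau>' x = radial_coset x (x $ i powi (1 - int D) *s (\<Sum>j<Suc m. G j x *s X j x))" if x: "x $ i \<noteq> 0" for x
  proof -
   obtain a where a: "\<xi> i m x = radial_coset x a" using \<xi>_ne[OF m x] by blast
   then obtain t where t: "X m x = x $ i powi (- e m) *s a + t *s x" using X\<xi>[OF m x] radial_coset_self by blast
   have c: "x $ i powi (1 - int D) * G m x = h i m x"
   proof -
    have "x $ i powi (1 - int D) * x $ i powi (int D - 1) = 1"
     using x power_int_add[of "x $ i" "1 - int D" "int D - 1"] by simp
    then show ?thesis using G(2)[OF m x] by (simp add: mult.assoc[symmetric])
   qed
   have px: "?p x = x $ i powi (- e m)" using x by simp
   have \<rho>x: "?\<rho> x = radial_coset x ((?p x * h i m x) *s a)" unfolding a by (rule radial_coset_smult)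
   have \<tau>x: "\<tau> x = radial_coset x (x $ i powi (1 - int D) *s (\<Sum>j<m. G j x *s X j x))" using \<tau>(3) x by blast
   have "?\<tau>' x = radial_coset x (x $ i powi (1 - int D) *s (\<Sum>j<m. G j x *s X j x) + (?p x * h i m x) *s a)"
    unfolding \<rho>x \<tau>x by (rule radial_coset_plus)
   also have "\<dots> = radial_coset x (x $ i powi (1 - int D) *s (\<Sum>j<Suc m. G j x *s X j x))"
    by (rule radial_coset_eqI[where t = "- h i m x * t"]; unfold px c[symmetric]; simp add: t vec_eq_iff algebra_simps)
   finally show ?thesis .
  qed
  show ?case by (intro bexI[OF _ 1] conjI 2 allI impI 3)
 qed
 note partial = this[OF order_refl]
 have rad_Z: "\<exists>t. Z x = t *s x" if x: "x $ i \<noteq> 0" for i x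
 proof -
  obtain \<tau> where \<tau>: "\<tau> \<in> T (chart i)" "\<phi> (chart i) \<tau> = (\<lambda>j x. if j < r then h i j x else 0)"
   "\<forall>x. x $ i \<noteq> 0 --> \<tau> x = radial_coset x (x $ i powi (1 - int D) *s (\<Sum>j<r. G j x *s X j x))" using partial[of i] by blast
  have "\<phi> (chart i) \<tau> = \<phi> (chart i) (\<sigma> i)" unfolding \<tau>(2) h_def[symmetric] using hS(2)[of i] by (auto simp: fun_eq_iff)
  then have "\<tau> = \<sigma> i" by (rule phi_inj[OF openin_chart \<tau>(1) \<sigma>T])
  then have eq: "radial_coset x (x $ i powi (1 - int D) *s Y x) = radial_coset x (x $ i powi (1 - int D) *s (\<Sum>j<r. G j x *s X j x))"
   using \<tau>(3) x by (auto simp: \<sigma>_def)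
  have "x $ i powi (1 - int D) *s Y x \<in> radial_coset x (x $ i powi (1 - int D) *s Y x)" by (rule radial_coset_self)
  then obtain t where t: "x $ i powi (1 - int D) *s Y x = x $ i powi (1 - int D) *s (\<Sum>j<r. G j x *s X j x) + t *s x"
   unfolding eq radial_coset_mem by blast
  have "Z x $ b = (inverse (x $ i powi (1 - int D)) * t) * x $ b" for b
   using arg_cong[OF t, of "\<lambda>v. v $ b"] x unfolding Z_def by (simp add: field_simps)
  then show ?thesis by (intro exI[of _ "inverse (x $ i powi (1 - int D)) * t"]) (simp add: vec_eq_iff)
 qed
 have par: "x $ a * Z x $ b = x $ b * Z x $ a" for x a b
 proof (cases "x = 0")
  case False
  then obtain i where "x $ i \<noteq> 0" by (auto simp: vec_eq_iff)
  then obtain t where "Z x = t *s x" using rad_Z by blast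
  then show ?thesis by simp
 qed simp
 have "pvf Z" unfolding Z_def using Y X G(1) unfolding kernel_field_def by (intro pvf_diff pvf_sum pvf_scale) auto
 then obtain g where "pf g" "\<And>x. Z x = g x *s x" using radial_multiple[OF card2 _ par] by metis
 then show ?thesis using G(1) unfolding Z_def by (intro exI[of _ G] exI[of _ g]) (simp add: algebra_simps)
qed

lemma pvf_components:
 assumes "pvf Y"
 obtains m Z where "\<And>D b. hp D (\<lambda>x::complex^'n. Z D x $ b)" "\<And>x::complex^'n. Y x = (\<Sum>D\<le>m. Z D x)"
proof -
 have "\<exists>n P. (\<forall>i. hp i (P i)) \<and> (\<forall>x. Y x $ b = (\<Sum>i\<le>n. P i x))" for b
 proof -
  have "pf (\<lambda>x. Y x $ b)" using assms by (simp add: pvf_def)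
  from hom_components[OF this] show ?thesis by metis
 qed
 then obtain n P where P: "\<And>b i. hp i (P b i)" "\<And>b x. Y x $ b = (\<Sum>i\<le>n b. P b i x)" by metis
 define m where "m = Max (range n)"
 have m: "n b \<le> m" for b unfolding m_def by (rule Max_ge) auto
 define Z where "Z D x = (\<chi> b. if D \<le> n b then P b D x else 0)" for D x
 have 1: "hp D (\<lambda>x. Z D x $ b)" for D b unfolding Z_def using P(1) hp_zero by (cases "D \<le> n b") auto
 have "Y x $ b = (\<Sum>D\<le>m. Z D x) $ b" for x b
 proof -
  have "(\<Sum>D\<le>m. Z D x) $ b = (\<Sum>D\<le>m. if D \<le> n b then P b D x else 0)" by (simp add: Z_def)
  also have "\<dots> = (\<Sum>D\<le>n b. P b D x)" using m[of b] by (intro sum.mono_neutral_cong_right) auto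
  finally show ?thesis by (simp add: P(2))
 qed
 then have 2: "Y x = (\<Sum>D\<le>m. Z D x)" for x unfolding vec_eq_iff by blast
 show thesis by (rule that[OF 1 2])
qed

lemma kernel_field_components:
 assumes Y: "kernel_field q \<omega> Y" and Z: "\<And>D b. hp D (\<lambda>x::complex^'n. Z D x $ b)" "\<And>x::complex^'n. Y x = (\<Sum>D\<le>m. Z D x)"
  and D: "D \<le> m"
 shows "kernel_field q \<omega> (Z D)"
 unfolding kernel_field_def
proof (intro conjI allI impI)
 show "pvf (Z D)" using Z(1) hp_imp_pf unfolding pvf_def by blast
 fix x and js :: "(complex^'n) list" assume js: "Suc (length js) = q"
 have lin: "lin (\<lambda>u. \<omega> x (u # js))" for x
 proof -
  have "multilin (Suc (length js)) (\<omega> x)" using hom_form_multilin[OF hom] js by simp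
  then show ?thesis by (rule multilin_Cons_lin) simp
 qed
 have hZ: "hp (D + k) (\<lambda>x. \<omega> x (Z D x # js))" for D
 proof -
  have "\<omega> x (Z D x # js) = (\<Sum>i\<in>UNIV. Z D x $ i * \<omega> x (ax i # js))" for x
   by (rule lin_expand[OF lin])
  moreover have "hp (D + k) (\<lambda>x. \<Sum>i\<in>UNIV. Z D x $ i * \<omega> x (ax i # js))"
   using js by (intro hp_sum hom_poly.mult Z(1) hom_form_hp[OF hom]) auto
  ultimately show ?thesis by simp
 qed
 \<comment> \<open>The contraction of the component of degree \<open>D\<close> has degree
   \<open>D + k\<close>, so nothing occurs below degree \<open>k\<close>.\<close>
 let ?P = "\<lambda>i x. if k \<le> i then \<omega> x (Z (i - k) x # js) else 0"
 have "hp i (?P i)" for i using hZ[of "i - k"] hp_zero by (cases "k \<le> i") auto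
 moreover have "\<omega> y (Y y # js) = (\<Sum>i\<le>m + k. ?P i y)" for y
 proof -
  interpret l: Vector_Spaces.linear "(*s)" "(*)" "\<lambda>u. \<omega> y (u # js)" by (rule lin)
  have "\<omega> y (Y y # js) = (\<Sum>D\<le>m. \<omega> y (Z D y # js))" by (simp add: Z(2) l.sum)
  also have "\<dots> = (\<Sum>i\<in>{k..m + k}. \<omega> y (Z (i - k) y # js))"
   using sum.shift_bounds_cl_nat_ivl[of "\<lambda>i. \<omega> y (Z (i - k) y # js)" 0 k m] by (simp add: atLeast0AtMost)
  also have "\<dots> = (\<Sum>i\<le>m + k. ?P i y)" by (intro sum.mono_neutral_cong_left) auto
  finally show ?thesis .
 qed
 moreover have "\<omega> y (Y y # js) = 0" for y using Y js unfolding kernel_field_def by blast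
 ultimately have "?P (D + k) x = 0" using D
  by (intro component_zero[OF _ _ infinite_nonzero, of ?P "\<lambda>y. \<omega> y (Y y # js)" "m + k" x "D + k"]) simp_all
 then show "\<omega> x (Z D x # js) = 0" by simp
qed

text \<open>The radial field, which \<omega> kills, is the generator on the cone that is invisible
  on projective space.\<close>

theorem kernel_generators_exist: "\<exists>X. kernel_generators q \<omega> (Suc r) X \<and> (\<forall>x. X r x = x)"
proof -
 have "\<forall>j. \<exists>X. j < r --> kernel_field q \<omega> X \<and>
  (\<forall>i x v. x $ i \<noteq> 0 --> v \<in> \<xi> i j x --> (\<exists>t. X x = x $ i powi (- e j) *s v + t *s x))" using generator by blast
 then obtain X where X: "\<And>j. j < r ==> kernel_field q \<omega> (X j)"
  "\<And>j i x v. j < r ==> x $ i \<noteq> 0 ==> v \<in> \<xi> i j x ==> \<exists>t. X j x = x $ i powi (- e j) *s v + t *s x" by metis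
 define X' where "X' j x = (if j < r then X j x else x)" for j x
 have "kernel_field q \<omega> (\<lambda>x. x)" unfolding kernel_field_def using pvf_ident rad by blast
 then have 1: "kernel_field q \<omega> (X' j)" for j unfolding X'_def using X(1)[of j] by (cases "j < r") auto
 have "\<exists>G. (\<forall>j. pf (G j)) \<and> (\<forall>x. Y x = (\<Sum>j<Suc r. G j x *s X' j x))" if Y: "kernel_field q \<omega> Y" for Y
 proof -
  have "pvf Y" using Y unfolding kernel_field_def by blast
  from pvf_components[OF this] obtain m Z where Z: "\<And>D b. hp D (\<lambda>x::complex^'n. Z D x $ b)" "\<And>x::complex^'n. Y x = (\<Sum>D\<le>m. Z D x)"
   by metis
  have "\<exists>G g. (\<forall>j. pf (G j)) \<and> pf g \<and> (\<forall>x. Z D x = (\<Sum>j<r. G j x *s X j x) + g x *s x)" if "D \<le> m" for D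
   by (rule homogeneous_generation[OF kernel_field_components[OF Y Z that] Z(1) X])
  then have "\<forall>D. \<exists>G. \<exists>g. D \<le> m --> (\<forall>j. pf (G j)) \<and> pf g \<and> (\<forall>x. Z D x = (\<Sum>j<r. G j x *s X j x) + g x *s x)" by blast
  from choice[OF this] obtain G where "\<forall>D. \<exists>g. D \<le> m --> (\<forall>j. pf (G D j)) \<and> pf g \<and> (\<forall>x. Z D x = (\<Sum>j<r. G D j x *s X j x) + g x *s x)" by blast
  from choice[OF this] obtain g where "\<forall>D. D \<le> m --> (\<forall>j. pf (G D j)) \<and> pf (g D) \<and> (\<forall>x. Z D x = (\<Sum>j<r. G D j x *s X j x) + g D x *s x)" by blast
  then have G: "\<And>D j. D \<le> m ==> pf (G D j)" "\<And>D. D \<le> m ==> pf (g D)"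
   "\<And>D x. D \<le> m ==> Z D x = (\<Sum>j<r. G D j x *s X j x) + g D x *s x" by blast+
  define H where "H j x = (\<Sum>D\<le>m. if j < r then G D j x else g D x)" for j x
  have "pf (H j)" for j unfolding H_def using G(1,2) by (cases "j < r") (auto intro!: pf_sum')
  moreover have "Y x = (\<Sum>j<Suc r. H j x *s X' j x)" for x
  proof -
   have "Y x = (\<Sum>D\<le>m. (\<Sum>j<r. G D j x *s X j x) + g D x *s x)" unfolding Z(2) using G(3) by simp
   also have "\<dots> = (\<Sum>j<r. \<Sum>D\<le>m. G D j x *s X j x) + (\<Sum>D\<le>m. g D x *s x)"
    by (simp add: sum.distrib sum.swap[of _ "{..m}"])
   also have "\<dots> = (\<Sum>j<r. H j x *s X' j x) + H r x *s X' r x"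
    by (simp add: H_def X'_def vec.scale_sum_left)
   finally show ?thesis by simp
  qed
  ultimately show ?thesis by blast
 qed
 then show ?thesis using 1 unfolding kernel_generators_def by (intro exI[of _ X']) (simp add: X'_def)
qed

end

lemma split_tangent_generators:
 fixes \<omega> :: "'n::finite form"
 assumes \<omega>: "folform q d \<omega>" and q: "1 \<le> q" "q < CARD('n)" and card: "CARD('n) \<ge> 3"
  and split: "split_tangent_sheaf q \<omega>"
 shows "\<exists>X. kernel_generators q \<omega> (CARD('n) - q) X \<and> (\<forall>x. X (CARD('n) - 1 - q) x = x)"
proof -
 let ?r = "CARD('n) - 1 - q"
 obtain e where "sheaf_iso (tangent_sheaf \<omega>) (split_sheaf ?r e)" using split unfolding split_tangent_sheaf_def by blast
 then obtain \<phi> where \<phi>: "\<forall>U. zopen U -->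
    bij_betw (\<phi> U) (sections (tangent_sheaf \<omega>) U) (sections (split_sheaf ?r e) U) \<and>
    (\<forall>\<xi>\<in>sections (tangent_sheaf \<omega>) U. \<forall>\<eta>\<in>sections (tangent_sheaf \<omega>) U.
     \<phi> U (plus_section (tangent_sheaf \<omega>) \<xi> \<eta>) = plus_section (split_sheaf ?r e) (\<phi> U \<xi>) (\<phi> U \<eta>)) \<and>
    (\<forall>f\<in>twist_sections 0 U. \<forall>\<xi>\<in>sections (tangent_sheaf \<omega>) U.
     \<phi> U (smult_section (tangent_sheaf \<omega>) f \<xi>) = smult_section (split_sheaf ?r e) f (\<phi> U \<xi>)) \<and>
    (\<forall>V. zopen V \<and> V \<subseteq> U --> (\<forall>\<xi>\<in>sections (tangent_sheaf \<omega>) U.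
     \<phi> V (restrict_section (tangent_sheaf \<omega>) V \<xi>) = restrict_section (split_sheaf ?r e) V (\<phi> U \<xi>)))"
  unfolding sheaf_iso_def by (elim exE) (rule that)
 have ops: "plus_section (tangent_sheaf \<omega>) = (\<lambda>\<xi> \<eta> x. {v + w | v w. v \<in> \<xi> x \<and> w \<in> \<eta> x})"
  "plus_section (split_sheaf ?r e) = (\<lambda>h k j x. h j x + k j x)"
  "smult_section (tangent_sheaf \<omega>) = (\<lambda>f \<xi> x. {f x *s v + t *s x | v t. v \<in> \<xi> x})"
  "smult_section (split_sheaf ?r e) = (\<lambda>f h j x. f x * h j x)"
  "restrict_section (tangent_sheaf \<omega>) = (\<lambda>V \<xi> x. if x \<in> \<Union>V then \<xi> x else {})"
  "restrict_section (split_sheaf ?r e) = (\<lambda>V h j x. if x \<in> \<Union>V then h j x else 0)"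
  by (simp_all only: tangent_sheaf_def split_sheaf_def module_sheaf.simps)
 have tw: "\<omega> \<in> twisted_forms q d" using \<omega> by (simp add: folform_def)
 interpret split_kernel q "Suc d" ?r \<omega> e \<phi>
 proof
  show "hom_form q (Suc d) \<omega>" by (rule twisted_hom_form[OF tw])
  show "\<omega> x (x # ws) = 0" for x ws using tw by (simp add: twisted_forms_def)
  fix U :: "(complex^'n) set set" assume U: "zopen U"
  note * = mp[OF spec[OF \<phi>[unfolded ops], of U] U]
  show "bij_betw (\<phi> U) (sections (tangent_sheaf \<omega>) U) (sections (split_sheaf ?r e) U)" by (rule conjunct1[OF *])
  fix \<xi> assume \<xi>: "\<xi> \<in> sections (tangent_sheaf \<omega>) U"
  show "\<phi> U (\<lambda>x. {v + w | v w. v \<in> \<xi> x \<and> w \<in> \<eta> x}) = (\<lambda>j x. \<phi> U \<xi> j x + \<phi> U \<eta> j x)"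
   if "\<eta> \<in> sections (tangent_sheaf \<omega>) U" for \<eta>
   by (rule bspec[OF bspec[OF conjunct1[OF conjunct2[OF *]] \<xi>] that])
  show "\<phi> U (\<lambda>x. {f x *s v + t *s x | v t. v \<in> \<xi> x}) = (\<lambda>j x. f x * \<phi> U \<xi> j x)" if "f \<in> twist_sections 0 U" for f
   by (rule bspec[OF bspec[OF conjunct1[OF conjunct2[OF conjunct2[OF *]]] that] \<xi>])
  show "\<phi> V (\<lambda>x. if x \<in> \<Union>V then \<xi> x else {}) = (\<lambda>j x. if x \<in> \<Union>V then \<phi> U \<xi> j x else 0)"
   if "zopen V" "V \<subseteq> U" for V
   by (rule bspec[OF mp[OF spec[OF conjunct2[OF conjunct2[OF conjunct2[OF *]]]] conjI[OF that]] \<xi>])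
 qed (use card q in simp_all)
 have "Suc ?r = CARD('n) - q" using assms(2,3) by linarith
 then show ?thesis using kernel_generators_exist by metis
qed

text \<open>Contracting \<omega> wedge d\<omega> = 0 with a kernel field shows that i_X d\<omega> is
  proportional to \<omega>; the factor is a polynomial since the coefficients of \<omega> have no
  common divisor.\<close>

lemma ext_deriv_multiple:
 fixes \<omega> :: "'n::finite form"
 assumes \<omega>: "folform 1 d \<omega>" and X: "kernel_field 1 \<omega> X"
 shows "\<exists>h. pf h \<and> (\<forall>x u. ext_deriv \<omega> x [X x, u] = h x * \<omega> x [u])"
proof -
 have tw: "\<omega> \<in> twisted_forms 1 d" and ex: "exchange 1 2 \<omega> (ext_deriv \<omega>)" and nz: "\<omega> \<noteq> 0"
  and ncd: "no_common_divisor (affine_sing \<omega>)" using \<omega> by (simp_all add: folform_def numeral_2_eq_2)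
 have hom: "hom_form 1 (Suc d) \<omega>" by (rule twisted_hom_form[OF tw])
 have hom2: "hom_form 2 d (ext_deriv \<omega>)" using hom_form_ext_deriv[OF hom] by (simp add: numeral_2_eq_2)
 have lin1: "lin (\<lambda>u. \<omega> x [u])" for x
  using multilin_Cons_lin[of 0 "\<omega> x" "[]"] hom_form_multilin[OF hom, of x] by simp
 have lin2: "lin (\<lambda>u. ext_deriv \<omega> x [v, u])" for x v
  using multilin_lin[OF hom_form_multilin[OF hom2], of "[v, 0]" 1 x] by simp
 let ?c = "\<lambda>i x. \<omega> x [ax i]" and ?a = "\<lambda>i x. ext_deriv \<omega> x [X x, ax i]"
 have c: "hp (Suc d) (?c i)" for i by (rule hom_form_hp[OF hom]) simp
 have Xp: "pvf X" using X unfolding kernel_field_def by blast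
 have a: "pf (?a i)" for i by (rule pf_multilin[OF hom2 Xp]) simp
 have cross: "?c i * ?a j = ?a i * ?c j" for i j
 proof
  fix x
  have "\<omega> x (X x # []) * ext_deriv \<omega> x [ax i, ax j] = (\<Sum>a<2. ext_deriv \<omega> x ([ax i, ax j][a := X x]) * \<omega> x ([ax i, ax j] ! a # []))"
   by (rule exchangeD[OF ex]) simp_all
  moreover have "\<omega> x [X x] = 0" using X unfolding kernel_field_def by simp
  moreover have "ext_deriv \<omega> x [ax i, X x] = - ext_deriv \<omega> x [X x, ax i]" by (simp add: ext_deriv_2)
  ultimately show "(?c i * ?a j) x = (?a i * ?c j) x"
   by (simp add: numeral_2_eq_2 mult.commute)
 qed
 obtain i0 where i0: "?c i0 \<noteq> 0" using hom_form_1_nonzero[OF hom nz] by blast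
 have sub: "{x. \<forall>i\<in>UNIV. ?c i x = 0} = affine_sing \<omega>"
 proof (intro set_eqI iffI)
  fix x assume x: "x \<in> {x. \<forall>i\<in>UNIV. ?c i x = 0}"
  have "\<omega> x vs = 0" for vs
  proof (cases "length vs = 1")
   case True
   then obtain v where v: "vs = [v]" by (metis One_nat_def Suc_length_conv length_0_conv)
   show ?thesis unfolding v by (subst lin_expand[OF lin1]) (use x in simp)
  qed (simp add: hom_form_length[OF hom])
  then show "x \<in> affine_sing \<omega>" by (simp add: affine_sing_def)
 qed (simp add: affine_sing_def)
 have "\<exists>h. pf h \<and> (\<forall>i. ?a i = h * ?c i)"
 proof (rule proportional_division[OF finite[of UNIV] c a cross UNIV_I i0 ncd[folded sub]])
  fix h assume "pf h" "\<And>i. i \<in> UNIV ==> ?a i = h * ?c i"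
  then show ?thesis by blast
 qed
 then obtain h where h: "pf h" "\<And>i. ?a i = h * ?c i" by blast
 have hx: "ext_deriv \<omega> x [X x, ax i] = h x * \<omega> x [ax i]" for x i using fun_cong[OF h(2)[of i], of x] by simp
 have "ext_deriv \<omega> x [X x, u] = h x * \<omega> x [u]" for x u
  unfolding lin_expand[OF lin1, of x u] lin_expand[OF lin2, of x "X x" u] sum_distrib_left
  using hx by (intro sum.cong) (simp_all add: mult.left_commute)
 then show ?thesis using h(1) by blast
qed

text \<open>As i_R d\<omega> = (d + 2) \<omega> for the radial field R, subtracting
  \<open>h j / (d + 2)\<close> times R makes \<open>X j\<close> a kernel field of d\<omega>.
  Conversely a kernel field of d\<omega> is one of \<omega> and has no radial part, so the radial
  generator drops out of the count.\<close>

lemma ext_deriv_generators: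
 fixes \<omega> :: "'n::finite form"
 assumes \<omega>: "folform 1 d \<omega>" and gen: "kernel_generators 1 \<omega> (Suc r) X" and Xr: "\<And>x. X r x = x"
 shows "\<exists>X. kernel_generators 2 (ext_deriv \<omega>) r X"
proof -
 have tw: "\<omega> \<in> twisted_forms 1 d" and nz: "\<omega> \<noteq> 0" using \<omega> by (simp_all add: folform_def)
 have hom: "hom_form 1 (Suc d) \<omega>" by (rule twisted_hom_form[OF tw])
 have R: "\<omega> x (x # ws) = 0" for x ws using tw by (simp add: twisted_forms_def)
 have hom2: "hom_form 2 d (ext_deriv \<omega>)" using hom_form_ext_deriv[OF hom] by (simp add: numeral_2_eq_2)
 have lin2: "lin (\<lambda>v. ext_deriv \<omega> x [v, u])" for x u
  using multilin_lin[OF hom_form_multilin[OF hom2], of "[0, u]" 0 x] by simp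
 have rad: "ext_deriv \<omega> x [x, u] = of_nat (d + 2) * \<omega> x [u]" for x u by (rule ext_deriv_radial[OF hom R])
 have KX: "kernel_field 1 \<omega> (X j)" if "j < r" for j using gen that unfolding kernel_generators_def by simp
 have "\<forall>j. \<exists>h. j < r --> pf h \<and> (\<forall>x u. ext_deriv \<omega> x [X j x, u] = h x * \<omega> x [u])"
  using ext_deriv_multiple[OF \<omega> KX] by blast
 from choice[OF this] obtain h where h: "\<And>j. j < r ==> pf (h j)" "\<And>j x u. j < r ==> ext_deriv \<omega> x [X j x, u] = h j x * \<omega> x [u]" by blast
 define Z where "Z j x = X j x - (h j x * inverse (of_nat (d + 2))) *s x" for j x
 have d2: "(of_nat (d + 2) :: complex) \<noteq> 0" by (metis of_nat_eq_0_iff add_is_0 zero_neq_numeral)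
 have Z0: "ext_deriv \<omega> x [Z j x, u] = 0" if "j < r" for j x u
 proof -
  interpret l: Vector_Spaces.linear "(*s)" "(*)" "\<lambda>v. ext_deriv \<omega> x [v, u]" by (rule lin2)
  show ?thesis unfolding Z_def l.diff l.scale h(2)[OF that] rad using d2 by (simp add: field_simps)
 qed
 have KZ: "kernel_field 2 (ext_deriv \<omega>) (Z j)" if j: "j < r" for j
  unfolding kernel_field_def
 proof (intro conjI allI impI)
  have "pvf (X j)" using KX[OF j] unfolding kernel_field_def by blast
  then show "pvf (Z j)" unfolding Z_def
   using h(1)[OF j] by (intro pvf_diff pvf_scale pvf_ident pf_pointwise pf_const)
  fix x and js :: "(complex^'n) list" assume "Suc (length js) = 2"
  then obtain u where "js = [u]" by (cases js) auto
  then show "ext_deriv \<omega> x (Z j x # js) = 0" using Z0[OF j] by simp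
 qed
 have "\<exists>G. (\<forall>j. pf (G j)) \<and> (\<forall>x. Y x = (\<Sum>j<r. G j x *s Z j x))" if Y: "kernel_field 2 (ext_deriv \<omega>) Y" for Y
 proof -
  have Y0: "ext_deriv \<omega> x [Y x, u] = 0" for x u using Y unfolding kernel_field_def by simp
  have pY: "pvf Y" using Y unfolding kernel_field_def by blast
  have "\<omega> x [Y x] = 0" for x
  proof -
   have "ext_deriv \<omega> x [x, Y x] = - ext_deriv \<omega> x [Y x, x]" by (simp add: ext_deriv_2)
   then show ?thesis using d2 by (simp only: rad Y0) simp
  qed
  then have "kernel_field 1 \<omega> Y" using pY unfolding kernel_field_def by simp
  then obtain G where G: "\<forall>j. pf (G j)" "\<forall>x. Y x = (\<Sum>j<Suc r. G j x *s X j x)"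
   using gen unfolding kernel_generators_def by blast
  \<comment> \<open>The total coefficient of the radial field once every \<open>X j\<close> is
    rewritten through \<open>Z j\<close>; contraction with d\<omega> forces it to be zero.\<close>
  define g where "g x = G r x + (\<Sum>j<r. G j x * (h j x * inverse (of_nat (d + 2))))" for x
  have Yx: "Y x = (\<Sum>j<r. G j x *s Z j x) + g x *s x" for x
  proof -
   have "(\<Sum>j<r. G j x *s Z j x) = (\<Sum>j<r. G j x *s X j x) - (\<Sum>j<r. G j x * (h j x * inverse (of_nat (d + 2)))) *s x"
    unfolding Z_def by (simp add: vec.scale_right_diff_distrib sum_subtractf vec.scale_sum_left)
   then show ?thesis using G(2) by (simp add: g_def Xr vec.scale_left_distrib)
  qed
  have pg: "pf g" unfolding g_def using G(1) h(1) by (intro pf_pointwise pf_sum' pf_const) auto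
  have go: "g x * \<omega> x [u] = 0" for x u
  proof -
   interpret l: Vector_Spaces.linear "(*s)" "(*)" "\<lambda>v. ext_deriv \<omega> x [v, u]" by (rule lin2)
   have "0 = ext_deriv \<omega> x [Y x, u]" using Y0 by simp
   also have "\<dots> = g x * (of_nat (d + 2) * \<omega> x [u])"
    unfolding Yx l.add l.scale l.sum rad using Z0 by simp
   finally show ?thesis using d2 by simp
  qed
  obtain i where i: "(\<lambda>x. \<omega> x [ax i]) \<noteq> 0" using hom_form_1_nonzero[OF hom nz] by blast
  have "pf (\<lambda>x. \<omega> x [ax i])" by (rule hp_imp_pf[OF hom_form_hp[OF hom]]) simp
  moreover have "g * (\<lambda>x. \<omega> x [ax i]) = 0" using go by (simp add: fun_eq_iff)
  ultimately have "g = 0" using pf_no_zero_divisors pg i by metis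
  then show ?thesis using Yx G(1) by (intro exI[of _ G]) simp
 qed
 then show ?thesis using KZ unfolding kernel_generators_def by blast
qed

section \<open>The form whose kernel is lifted\<close>

text \<open>For \<open>q = 1\<close> the codimension hypothesis is on \<open>d\<omega>\<close>, otherwise on \<open>\<omega>\<close>.\<close>

definition dform :: "nat => 'n::finite form => 'n form" where
 "dform q \<omega> = (if q = 1 then ext_deriv \<omega> else \<omega>)"

definition dlen :: "nat => nat" where "dlen q = (if q = 1 then 2 else q)"

definition ddeg :: "nat => nat => nat" where "ddeg q d = (if q = 1 then d else Suc d)"

lemma dlen_ge: "1 \<le> q ==> 2 \<le> dlen q" by (simp add: dlen_def)

lemma hom_form_dform: "hom_form q (Suc d) \<omega> ==> hom_form (dlen q) (ddeg q d) (dform q \<omega>)"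
 using hom_form_ext_deriv[of q d \<omega>] by (auto simp: dform_def dlen_def ddeg_def numeral_2_eq_2)

lemma folform_dform:
 fixes \<omega> :: "'n::finite form"
 assumes \<omega>: "folform q d \<omega>"
 shows "hom_form (dlen q) (ddeg q d) (dform q \<omega>)" "dform q \<omega> \<noteq> 0"
  "exchange (dlen q) (dlen q) (dform q \<omega>) (dform q \<omega>)"
proof -
 have tw: "\<omega> \<in> twisted_forms q d" and nz: "\<omega> \<noteq> 0" and ex: "exchange q q \<omega> \<omega>" "exchange q (Suc q) \<omega> (ext_deriv \<omega>)"
  using \<omega> by (simp_all add: folform_def)
 have hom: "hom_form q (Suc d) \<omega>" by (rule twisted_hom_form[OF tw])
 have R: "\<omega> x (x # ws) = 0" for x ws using tw by (simp add: twisted_forms_def)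
 show "hom_form (dlen q) (ddeg q d) (dform q \<omega>)" by (rule hom_form_dform[OF hom])
 show "exchange (dlen q) (dlen q) (dform q \<omega>) (dform q \<omega>)"
  using ex hom pluecker_ext_deriv[of d \<omega>] nz by (auto simp: dform_def dlen_def numeral_2_eq_2)
 show "dform q \<omega> \<noteq> 0"
 proof (cases "q = 1")
  case True
  have h1: "hom_form 1 (Suc d) \<omega>" using hom True by simp
  show ?thesis
  proof
   assume "dform q \<omega> = 0"
   then have "ext_deriv \<omega> = 0" using True by (simp add: dform_def)
   then have "of_nat (d + 2) * \<omega> x [v] = 0" for x v using ext_deriv_radial[OF h1 R, of x v] by simp
   then have "\<omega> x [v] = 0" for x v by (metis mult_eq_0_iff of_nat_eq_0_iff add_is_0 zero_neq_numeral)
   then show False using hom_form_1_nonzero[OF h1 nz] by (simp add: fun_eq_iff)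
  qed
 qed (use nz in \<open>simp add: dform_def\<close>)
qed

lemma dform_generators:
 fixes \<omega> :: "'n::finite form"
 assumes \<omega>: "folform q d \<omega>" and q: "1 \<le> q" "q < CARD('n)" and card: "CARD('n) \<ge> 3"
  and split: "split_tangent_sheaf q \<omega>"
  and c: "if q = 1 then codim (affine_zariski (*s)) (affine_sing (ext_deriv \<omega>)) \<ge> 3
      else codim projective_zariski (proj_sing \<omega>) \<ge> 3"
 shows "codim3 (affine_sing (dform q \<omega>))" "\<exists>X. kernel_generators (dlen q) (dform q \<omega>) (CARD('n) - dlen q) X"
proof -
 have hom: "hom_form q (Suc d) \<omega>" using \<omega> twisted_hom_form by (auto simp: folform_def)
 show "codim3 (affine_sing (dform q \<omega>))"
  using c codim3_affine[OF folform_dform(1)[OF \<omega>]] codim3_proj[OF hom card] by (auto simp: dform_def)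
 from split_tangent_generators[OF \<omega> q card split] obtain X where
  X: "kernel_generators q \<omega> (CARD('n) - q) X" "\<forall>x. X (CARD('n) - 1 - q) x = x" by blast
 show "\<exists>X. kernel_generators (dlen q) (dform q \<omega>) (CARD('n) - dlen q) X"
 proof (cases "q = 1")
  case True
  have "CARD('n) - 1 = Suc (CARD('n) - 2)" "CARD('n) - 1 - 1 = CARD('n) - 2" using card by simp_all
  then have "kernel_generators 1 \<omega> (Suc (CARD('n) - 2)) X" "\<And>x. X (CARD('n) - 2) x = x"
   using X True by simp_all
  from ext_deriv_generators[OF \<omega>[unfolded True] this] show ?thesis by (simp add: True dform_def dlen_def)
 qed (use X in \<open>auto simp: dform_def dlen_def\<close>)
qed

section \<open>Linear pull-backs and polynomials on spaces of forms\<close>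

abbreviation lmap :: "(complex^'k::finite => complex^'n::finite) => bool" where
 "lmap \<equiv> Vector_Spaces.linear (*s) (*s)"

lemma lmap_simps:
 assumes "lmap \<pi>"
 shows "\<pi> (x + y) = \<pi> x + \<pi> y" "\<pi> (c *s x) = c *s \<pi> x" "\<pi> 0 = 0" "\<pi> (x - y) = \<pi> x - \<pi> y" "\<pi> (sum f A) = (\<Sum>a\<in>A. \<pi> (f a))"
proof -
 interpret Vector_Spaces.linear "(*s)" "(*s)" \<pi> by fact
 show "\<pi> (x + y) = \<pi> x + \<pi> y" "\<pi> (c *s x) = c *s \<pi> x" "\<pi> 0 = 0" "\<pi> (x - y) = \<pi> x - \<pi> y" "\<pi> (sum f A) = (\<Sum>a\<in>A. \<pi> (f a))"
  by (simp_all add: add scale zero diff sum)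
qed

lemma lmapI: "(\<And>x y. \<pi> (x + y) = \<pi> x + \<pi> y) ==> (\<And>c x. \<pi> (c *s x) = c *s \<pi> x) ==> lmap \<pi>"
 by unfold_locales (simp_all add: vec_eq_iff algebra_simps)

lemma lin_simps:
 assumes "lin l" shows "l (x + y) = l x + l y" "l (c *s x) = c * l x" "l 0 = 0" "l (x - y) = l x - l y"
proof -
 interpret Vector_Spaces.linear "(*s)" "(*)" l by fact
 show "l (x + y) = l x + l y" "l (c *s x) = c * l x" "l 0 = 0" "l (x - y) = l x - l y" by (simp_all add: add scale zero diff)
qed

lemma lin_comp: "lmap \<pi> ==> lin l ==> lin (\<lambda>x. l (\<pi> x))"
 by (rule linI) (simp_all add: lmap_simps lin_simps)

lemma hom_poly_compose:
 "hom_poly s' k p ==> Vector_Spaces.linear s s' f ==> hom_poly s k (\<lambda>x. p (f x))"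
proof (induction rule: hom_poly.induct)
 case (linear l)
 have "Vector_Spaces.linear s (*) (l \<circ> f)" by (rule Vector_Spaces.linear_compose[OF linear(2,1)])
 then show ?case using hom_poly.linear[of s "l \<circ> f"] by (simp add: o_def)
next
 case (add k p q)
 then show ?case using hom_poly.add[of s k "\<lambda>x. p (f x)" "\<lambda>x. q (f x)"] by blast
next
 case (mult j p k q)
 then show ?case using hom_poly.mult[of s j "\<lambda>x. p (f x)" k "\<lambda>x. q (f x)"] by blast
qed (rule hom_poly.const)

lemma hp_comp: "hp k p ==> lmap \<pi> ==> hp k (\<lambda>x. p (\<pi> x))"
 by (rule hom_poly_compose)

lemma pf_affine: "pf p ==> lmap \<pi> ==> pf (\<lambda>x. p (\<pi> x + y))"
proof (induction rule: poly_fun.induct)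
 case (linear l)
 have "pf (\<lambda>z. l (\<pi> z))" by (rule poly_fun.linear[OF lin_comp[OF linear(2,1)]])
 then show ?case unfolding lin_simps(1)[OF linear(1)] by (intro poly_fun.add poly_fun.const)
next
 case (add p q)
 then show ?case using poly_fun.add[of "(*s)" "\<lambda>x. p (\<pi> x + y)" "\<lambda>x. q (\<pi> x + y)"] by blast
next
 case (mult p q)
 then show ?case using poly_fun.mult[of "(*s)" "\<lambda>x. p (\<pi> x + y)" "\<lambda>x. q (\<pi> x + y)"] by blast
qed (rule poly_fun.const)

lemma pf_comp: "pf p ==> lmap \<pi> ==> pf (\<lambda>x. p (\<pi> x))"
 using pf_affine[of p \<pi> 0] by simp

lemma alt_comp:
 fixes \<pi> :: "complex^'k::finite => complex^'n::finite"
 assumes "alt q F" "lmap \<pi>"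
 shows "alt q (\<lambda>vs. F (map \<pi> vs))"
 unfolding alt_def multilin_def
proof (intro conjI allI impI)
 fix vs :: "(complex^'k) list" and i assume i: "length vs = q \<and> i < q"
 then have "lin (\<lambda>v. F ((map \<pi> vs)[i := v]))" using multilin_lin[OF alt_multilin[OF assms(1)], of "map \<pi> vs" i] by simp
 from lin_comp[OF assms(2) this] show "lin (\<lambda>v. F (map \<pi> (vs[i := v])))" by (simp add: map_update)
next
 fix vs :: "(complex^'k) list" and i j assume *: "length vs = q \<and> i < j \<and> j < q \<and> vs ! i = vs ! j"
 then show "F (map \<pi> vs) = 0" by (intro alt_equal[OF assms(1), of "map \<pi> vs" i j]) auto
qed

lemma hom_form_pullback:
 assumes "hom_form q k \<omega>" "lmap \<pi>" shows "hom_form q k (pullback \<pi> \<omega>)"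
 unfolding pullback_def
proof (rule hom_formI)
 show "alt q (\<lambda>vs. \<omega> (\<pi> x) (map \<pi> vs))" for x by (rule alt_comp[OF hom_form_alt[OF assms(1)] assms(2)])
 show "\<omega> (\<pi> x) (map \<pi> vs) = 0" if "length vs \<noteq> q" for x vs using that by (simp add: hom_form_length[OF assms(1)])
 show "hp k (\<lambda>x. \<omega> (\<pi> x) (map \<pi> vs))" if "length vs = q" for vs
  using that by (intro hp_comp[OF hom_form_hp[OF assms(1)] assms(2)]) simp
qed

lemma twisted_pullback: "\<omega> \<in> twisted_forms q d ==> lmap \<pi> ==> pullback \<pi> \<omega> \<in> twisted_forms q d"
 unfolding twisted_forms_def using hom_form_pullback[of q "d + 1" \<omega> \<pi>] by (simp add: pullback_def)

lemma ext_deriv_pullback: "lmap \<pi> ==> ext_deriv (pullback \<pi> \<omega>) = pullback \<pi> (ext_deriv \<omega>)"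
 by (intro ext) (simp add: ext_deriv_def pullback_def lmap_simps take_map drop_map)

lemma dform_pullback: "lmap \<pi> ==> dform q (pullback \<pi> \<omega>) = pullback \<pi> (dform q \<omega>)"
 by (simp add: dform_def ext_deriv_pullback)

lemma exchange_pullback: "exchange q p \<omega> \<eta> ==> exchange q p (pullback \<pi> \<omega>) (pullback \<pi> \<eta>)"
 unfolding exchange_def pullback_def by (auto simp: map_update intro!: sum.cong)

interpretation fm: vector_space form_scale by (rule vector_space_form_scale)

interpretation fmp: vector_space_pair form_scale "(*) :: complex => complex => complex"
 by unfold_locales (auto simp: algebra_simps)

text \<open>Forms live in the space of all functions, and differentiation is linear on polynomial
  forms only. A map that is linear on \<open>W\<close> is therefore replaced by a linear functional
  of the ambient space.\<close>

lemma functional_extend: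
 fixes f :: "'n::finite form => complex"
 assumes W: "fm.subspace W" and add: "\<And>a b. a \<in> W ==> b \<in> W ==> f (a + b) = f a + f b"
  and scale: "\<And>c a. a \<in> W ==> f (form_scale c a) = c * f a"
 shows "\<exists>l. Vector_Spaces.linear form_scale (*) l \<and> (\<forall>\<omega>\<in>W. f \<omega> = l \<omega>)"
proof -
 obtain B where B: "B \<subseteq> W" "fm.independent B" "W \<subseteq> fm.span B" using fm.maximal_independent_subset by blast
 obtain l where l: "Vector_Spaces.linear form_scale (*) l" "\<forall>x\<in>B. l x = f x"
  using fmp.linear_independent_extend[OF B(2), of f] by blast
 interpret l: Vector_Spaces.linear form_scale "(*)" l by fact
 have "fm.span B \<subseteq> {\<omega> \<in> W. f \<omega> = l \<omega>}"
 proof (rule fm.span_minimal)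
  have "f (form_scale 0 0) = 0 * f 0" by (rule scale[OF fm.subspace_0[OF W]])
  then have f0: "f 0 = 0" by simp
  show "fm.subspace {\<omega> \<in> W. f \<omega> = l \<omega>}" unfolding fm.subspace_def
   using f0 fm.subspace_0[OF W] fm.subspace_add[OF W] fm.subspace_scale[OF W]
   by (auto simp: add scale l.zero l.add l.scale)
 qed (use B(1) l(2) in auto)
 then show ?thesis using B(3) l(1) by blast
qed

definition hp_on :: "'n::finite form set => nat => ('n form => complex) => bool" where
 "hp_on W k F \<longleftrightarrow> (\<exists>p. hom_poly form_scale k p \<and> (\<forall>\<omega>\<in>W. F \<omega> = p \<omega>))"

lemma hp_onE: assumes "hp_on W k F" obtains p where "hom_poly form_scale k p" "\<forall>\<omega>\<in>W. F \<omega> = p \<omega>"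
 using assms unfolding hp_on_def by blast

lemma hp_on_const: "hp_on W 0 (\<lambda>_. c)"
 unfolding hp_on_def using hom_poly.const by blast

lemma hp_on_mult: assumes "hp_on W k F" "hp_on W l G" shows "hp_on W (k + l) (\<lambda>\<omega>. F \<omega> * G \<omega>)"
proof -
 obtain p q where "hom_poly form_scale k p" "\<forall>\<omega>\<in>W. F \<omega> = p \<omega>" "hom_poly form_scale l q" "\<forall>\<omega>\<in>W. G \<omega> = q \<omega>"
  using assms hp_onE by metis
 then show ?thesis unfolding hp_on_def by (intro exI[of _ "\<lambda>\<omega>. p \<omega> * q \<omega>"]) (auto intro: hom_poly.mult)
qed

lemma hp_on_add: assumes "hp_on W k F" "hp_on W k G" shows "hp_on W k (\<lambda>\<omega>. F \<omega> + G \<omega>)"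
proof -
 obtain p q where "hom_poly form_scale k p" "\<forall>\<omega>\<in>W. F \<omega> = p \<omega>" "hom_poly form_scale k q" "\<forall>\<omega>\<in>W. G \<omega> = q \<omega>"
  using assms hp_onE by metis
 then show ?thesis unfolding hp_on_def by (intro exI[of _ "\<lambda>\<omega>. p \<omega> + q \<omega>"]) (auto intro: hom_poly.add)
qed

lemma hp_on_scale: "hp_on W k F ==> hp_on W k (\<lambda>\<omega>. c * F \<omega>)"
 using hp_on_mult[OF hp_on_const, of W k F c] by simp

lemma hp_on_diff: "hp_on W k F ==> hp_on W k G ==> hp_on W k (\<lambda>\<omega>. F \<omega> - G \<omega>)"
 using hp_on_add[OF _ hp_on_scale[of W k G "-1"], of F] by simp

lemma hp_on_linear:
 assumes "fm.subspace W" "\<And>a b. a \<in> W ==> b \<in> W ==> f (a + b) = f a + f b"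
  "\<And>c a. a \<in> W ==> f (form_scale c a) = c * f a"
 shows "hp_on W 1 f"
 using functional_extend[OF assms] unfolding hp_on_def by (blast intro: hom_poly.linear)

lemma hp_on_zero: "hp_on W k (\<lambda>_. 0)"
proof (induction k)
 case 0 show ?case by (rule hp_on_const)
next
 case (Suc k)
 have "Vector_Spaces.linear form_scale (*) (\<lambda>_ :: 'a form. 0 :: complex)" by unfold_locales (auto simp: algebra_simps)
 then have "hom_poly form_scale 1 (\<lambda>_ :: 'a form. 0 :: complex)" by (rule hom_poly.linear)
 then have "hp_on W 1 (\<lambda>_. 0)" unfolding hp_on_def by blast
 from hp_on_mult[OF this Suc] show ?case by simp
qed

lemma hp_on_sum: "(\<And>i. i \<in> A ==> hp_on W k (F i)) ==> hp_on W k (\<lambda>\<omega>. \<Sum>i\<in>A. F i \<omega>)"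
 by (induction A rule: infinite_finite_induct) (auto intro: hp_on_zero hp_on_add)

lemma hp_on_prod: "finite A ==> (\<And>i. i \<in> A ==> hp_on W k (F i)) ==> hp_on W (card A * k) (\<lambda>\<omega>. \<Prod>i\<in>A. F i \<omega>)"
 by (induction A rule: finite_induct) (auto intro: hp_on_const[of W 1, simplified] hp_on_mult)

lemma hp_on_det:
 fixes M :: "'i::finite => 'i => 'n::finite form => complex"
 assumes "\<And>i j. hp_on W k (M i j)" shows "hp_on W (CARD('i) * k) (\<lambda>\<omega>. det (\<chi> i j. M i j \<omega>))"
 unfolding det_def vec_lambda_beta by (intro hp_on_sum hp_on_scale hp_on_prod assms finite)

lemma alt_add:
 fixes F G :: "(complex^'n) list => complex"
 assumes "alt q F" "alt q G" shows "alt q (\<lambda>vs. F vs + G vs)"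
 unfolding alt_def multilin_def
proof (intro conjI allI impI)
 fix vs :: "(complex^'n) list" and i assume i: "length vs = q \<and> i < q"
 have l: "lin (\<lambda>v. F (vs[i := v]))" "lin (\<lambda>v. G (vs[i := v]))"
  using i multilin_lin[OF alt_multilin[OF assms(1)]] multilin_lin[OF alt_multilin[OF assms(2)]] by blast+
 show "lin (\<lambda>v. F (vs[i := v]) + G (vs[i := v]))"
  by (intro linI) (simp_all add: lin_simps[OF l(1)] lin_simps[OF l(2)] algebra_simps)
next
 fix vs :: "(complex^'n) list" and i j assume *: "length vs = q \<and> i < j \<and> j < q \<and> vs ! i = vs ! j"
 then have "F vs = 0" "G vs = 0" using alt_equal[OF assms(1), of vs i j] alt_equal[OF assms(2), of vs i j] by auto
 then show "F vs + G vs = 0" by simp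
qed

lemma alt_scale:
 fixes F :: "(complex^'n) list => complex"
 assumes "alt q F" shows "alt q (\<lambda>vs. c * F vs)"
 unfolding alt_def multilin_def
proof (intro conjI allI impI)
 fix vs :: "(complex^'n) list" and i assume i: "length vs = q \<and> i < q"
 have l: "lin (\<lambda>v. F (vs[i := v]))" using i multilin_lin[OF alt_multilin[OF assms(1)]] by blast
 show "lin (\<lambda>v. c * F (vs[i := v]))" by (intro linI) (simp_all add: lin_simps[OF l] algebra_simps)
next
 fix vs :: "(complex^'n) list" and i j assume *: "length vs = q \<and> i < j \<and> j < q \<and> vs ! i = vs ! j"
 then have "F vs = 0" using alt_equal[OF assms(1), of vs i j] by auto
 then show "c * F vs = 0" by simp
qed

lemma hom_form_add:
 fixes \<omega> :: "'n::finite form"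
 assumes "hom_form q k \<omega>" "hom_form q k \<eta>" shows "hom_form q k (\<omega> + \<eta>)"
 unfolding plus_fun_def
 by (rule hom_formI) (simp_all add: alt_add hom_formD[OF assms(1)] hom_formD[OF assms(2)] hom_poly.add)

lemma hom_form_scale:
 fixes \<omega> :: "'n::finite form"
 assumes "hom_form q k \<omega>" shows "hom_form q k (form_scale c \<omega>)"
 unfolding form_scale_def
 by (rule hom_formI) (simp_all add: alt_scale hom_formD[OF assms(1)] hp_scale)

lemma subspace_twisted: "fm.subspace (twisted_forms q d :: 'n::finite form set)"
proof -
 have "hom_form q (d + 1) (0 :: 'n form)" by (rule hom_formI) (auto simp: alt_def multilin_def hp_zero intro!: linI)
 then show ?thesis unfolding fm.subspace_def twisted_forms_def
  by (auto simp: form_scale_def intro!: hom_form_add hom_form_scale[unfolded form_scale_def])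
qed

lemma dform_add:
 assumes \<omega>: "\<omega> \<in> twisted_forms q d" and \<eta>: "\<eta> \<in> twisted_forms q d"
 shows "dform q (\<omega> + \<eta>) x vs = dform q \<omega> x vs + dform q \<eta> x vs"
proof (cases "q = 1")
 case True
 have hom: "hom_form q (Suc d) \<omega>" "hom_form q (Suc d) \<eta>" using assms twisted_hom_form by auto
 have *: "dird u (\<lambda>x. \<omega> x ws + \<eta> x ws) x = dird u (\<lambda>x. \<omega> x ws) x + dird u (\<lambda>x. \<eta> x ws) x" for u ws
 proof (cases "length ws = q")
  case True show ?thesis by (rule dird_add[OF hom_form_hp[OF hom(1) True] hom_form_hp[OF hom(2) True]])
 qed (simp add: hom_form_length[OF hom(1)] hom_form_length[OF hom(2)] dird_zero)
 show ?thesis using True by (simp only: dform_def if_True simp_thms ext_deriv_eq plus_fun_apply * distrib_left sum.distrib)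
qed (simp add: dform_def)

lemma dform_scale:
 assumes \<omega>: "\<omega> \<in> twisted_forms q d"
 shows "dform q (form_scale c \<omega>) x vs = c * dform q \<omega> x vs"
proof (cases "q = 1")
 case True
 have hom: "hom_form q (Suc d) \<omega>" using assms twisted_hom_form by auto
 have *: "dird u (\<lambda>x. c * \<omega> x ws) x = c * dird u (\<lambda>x. \<omega> x ws) x" for u ws
 proof (cases "length ws = q")
  case True show ?thesis by (rule dird_scale[OF hom_form_hp[OF hom True]])
 qed (simp add: hom_form_length[OF hom] dird_zero)
 show ?thesis using True by (simp add: dform_def ext_deriv_eq form_scale_def * sum_distrib_left mult_ac)
qed (simp add: dform_def form_scale_def)

lemma hp_on_dform: "hp_on (twisted_forms q d) 1 (\<lambda>\<omega>. dform q \<omega> x vs)"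
 by (rule hp_on_linear[OF subspace_twisted dform_add dform_scale])

section \<open>Linear independence is an open condition\<close>

text \<open>Gaussian elimination with polynomial entries.\<close>

lemma independence_open:
 fixes G :: "'b => 'n::finite form => 'z => complex"
 assumes "finite A" and "\<And>b z. b \<in> A ==> hp_on W m (\<lambda>\<omega>. G b \<omega> z)"
  and "\<And>a. (\<forall>z. (\<Sum>b\<in>A. a b * G b \<omega>\<^sub>0 z) = 0) ==> (\<forall>b\<in>A. a b = 0)"
 shows "\<exists>D k. hp_on W k D \<and> D \<omega>\<^sub>0 \<noteq> 0 \<and>
  (\<forall>\<omega> a. D \<omega> \<noteq> 0 --> (\<forall>z. (\<Sum>b\<in>A. a b * G b \<omega> z) = 0) --> (\<forall>b\<in>A. a b = 0))"
 using assms
proof (induction A arbitrary: G m rule: finite_induct)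
 case empty
 show ?case by (intro exI[of _ "\<lambda>_. 1"] exI[of _ 0] conjI) (auto intro: hp_on_const)
next
 case (insert c A)
 have "\<exists>z. G c \<omega>\<^sub>0 z \<noteq> 0"
 proof (rule ccontr)
  assume "\<not> ?thesis"
  then have "\<forall>z. (\<Sum>b\<in>insert c A. (if b = c then 1 else 0) * G b \<omega>\<^sub>0 z) = 0"
   using insert.hyps by (auto intro!: sum.neutral)
  from insert.prems(2)[OF this] show False by simp
 qed
 then obtain z0 where z0: "G c \<omega>\<^sub>0 z0 \<noteq> 0" by blast
 \<comment> \<open>Fraction-free elimination with pivot \<open>G c \<omega> z0\<close>: the degree
   in \<omega> doubles, but the entries stay polynomial.\<close>
 define G' where "G' b \<omega> z = G c \<omega> z0 * G b \<omega> z - G b \<omega> z0 * G c \<omega> z" for b \<omega> z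
 have expand: "(\<Sum>b\<in>A. a b * G' b \<omega> z) = G c \<omega> z0 * (\<Sum>b\<in>A. a b * G b \<omega> z) - (\<Sum>b\<in>A. a b * G b \<omega> z0) * G c \<omega> z" for a \<omega> z
  by (simp add: G'_def sum_subtractf sum_distrib_left sum_distrib_right algebra_simps)
 have "\<exists>D k. hp_on W k D \<and> D \<omega>\<^sub>0 \<noteq> 0 \<and>
  (\<forall>\<omega> a. D \<omega> \<noteq> 0 --> (\<forall>z. (\<Sum>b\<in>A. a b * G' b \<omega> z) = 0) --> (\<forall>b\<in>A. a b = 0))"
 proof (rule insert.IH)
  show "hp_on W (m + m) (\<lambda>\<omega>. G' b \<omega> z)" if "b \<in> A" for b z
   unfolding G'_def using that by (intro hp_on_diff hp_on_mult insert.prems) auto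
  fix a assume a: "\<forall>z. (\<Sum>b\<in>A. a b * G' b \<omega>\<^sub>0 z) = 0"
  let ?a = "\<lambda>b. if b = c then - (\<Sum>b\<in>A. a b * G b \<omega>\<^sub>0 z0) else G c \<omega>\<^sub>0 z0 * a b"
  have "(\<Sum>b\<in>insert c A. ?a b * G b \<omega>\<^sub>0 z) = 0" for z
  proof -
   have "(\<Sum>b\<in>A. ?a b * G b \<omega>\<^sub>0 z) = G c \<omega>\<^sub>0 z0 * (\<Sum>b\<in>A. a b * G b \<omega>\<^sub>0 z)"
    using insert.hyps by (auto simp: sum_distrib_left mult.assoc intro!: sum.cong)
   then show ?thesis using insert.hyps spec[OF a, of z] unfolding expand by simp
  qed
  then have "\<forall>b\<in>insert c A. ?a b = 0" by (intro insert.prems(2)) blast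
  then have "?a b = 0" if "b \<in> A" for b using that by blast
  moreover have "b \<noteq> c" if "b \<in> A" for b using that insert.hyps by blast
  ultimately show "\<forall>b\<in>A. a b = 0" using z0 by simp
 qed
 then obtain D k where D: "hp_on W k D" "D \<omega>\<^sub>0 \<noteq> 0"
  "\<forall>\<omega> a. D \<omega> \<noteq> 0 --> (\<forall>z. (\<Sum>b\<in>A. a b * G' b \<omega> z) = 0) --> (\<forall>b\<in>A. a b = 0)" by blast
 show ?case
 proof (intro exI[of _ "\<lambda>\<omega>. D \<omega> * G c \<omega> z0"] exI[of _ "k + m"] conjI allI impI)
  show "hp_on W (k + m) (\<lambda>\<omega>. D \<omega> * G c \<omega> z0)" by (intro hp_on_mult D insert.prems) simp
  show "D \<omega>\<^sub>0 * G c \<omega>\<^sub>0 z0 \<noteq> 0" using D z0 by simp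
  fix \<omega> a assume nz: "D \<omega> * G c \<omega> z0 \<noteq> 0" and a: "\<forall>z. (\<Sum>b\<in>insert c A. a b * G b \<omega> z) = 0"
  have a': "(\<Sum>b\<in>A. a b * G b \<omega> z) = - (a c * G c \<omega> z)" for z
   using spec[OF a, of z] insert.hyps by (simp add: add_eq_0_iff2)
  have "\<forall>z. (\<Sum>b\<in>A. a b * G' b \<omega> z) = 0" unfolding expand a' by simp
  then have A: "\<forall>b\<in>A. a b = 0" using D(3) nz by (metis mult_zero_left)
  then have "a c * G c \<omega> z0 = 0" using a'[of z0] by simp
  then show "\<forall>b\<in>insert c A. a b = 0" using A nz by auto
 qed
qed

lemma hp_pdeg: "hp k p ==> pdeg k p"
proof (induction rule: hom_poly.induct)
 case (const c)
 have "(\<lambda>_::complex^'a. c) = fsc c 1" by (simp add: fun_eq_iff)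
 then show ?case using pdeg_fsc[OF pdeg_1] by metis
next
 case (linear l)
 have eq: "l = (\<Sum>i\<in>UNIV. fsc (l (ax i)) (\<lambda>x. x $ i))"
 proof
  fix x
  show "l x = (\<Sum>i\<in>UNIV. fsc (l (ax i)) (\<lambda>x. x $ i)) x"
   by (subst lin_expand[OF linear, of x]) (simp add: fun_sum_apply mult.commute)
 qed
 show ?case by (rule ssubst[OF eq, of "pdeg 1"]) (rule pdeg_sum[OF pdeg_fsc[OF pdeg_component]])
next
 case (add k p q)
 then show ?case using pdeg_add[of k p q] by (simp add: plus_fun_def)
next
 case (mult j p k q)
 then show ?case using pdeg_mult[of j p k q] by (simp add: times_fun_def)
qed

section \<open>Constant vector fields in the kernel\<close>

text \<open>It suffices that \<open>v\<close> kills the faces of one list \<open>us\<close> on which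
  \<theta> is not identically zero: the exchange relation writes the contraction with
  \<open>v\<close>, times \<theta> at \<open>us\<close>, in terms of these faces.\<close>

lemma exchange_kernel:
 fixes \<theta> :: "'n::finite form"
 assumes \<theta>: "hom_form p k \<theta>" "exchange p p \<theta> \<theta>" and us: "length us = p" "\<theta> x0 us \<noteq> 0"
  and v: "\<And>x a. a < p ==> \<theta> x (v # take a us @ drop (Suc a) us) = 0"
 shows "\<theta> x (v # js) = 0"
proof (cases "Suc (length js) = p")
 case True
 have "(\<lambda>x. \<theta> x (v # js)) * (\<lambda>x. \<theta> x us) = 0"
 proof
  fix x
  have "\<theta> x (v # js) * \<theta> x us = (\<Sum>a<p. \<theta> x (us[a := v]) * \<theta> x (us ! a # js))" by (rule exchangeD[OF \<theta>(2) us(1) True])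
  also have "\<dots> = 0" using v by (intro sum.neutral) (simp add: alt_head[OF hom_form_alt[OF \<theta>(1)] us(1)])
  finally show "((\<lambda>x. \<theta> x (v # js)) * (\<lambda>x. \<theta> x us)) x = 0 x" by simp
 qed
 moreover have "pf (\<lambda>x. \<theta> x (v # js))" "pf (\<lambda>x. \<theta> x us)" using True us(1) by (auto intro!: hp_imp_pf[OF hom_form_hp[OF \<theta>(1)]])
 moreover have "(\<lambda>x. \<theta> x us) \<noteq> 0" using us(2) by (auto simp: fun_eq_iff)
 ultimately have "(\<lambda>x. \<theta> x (v # js)) = 0" using pf_no_zero_divisors by blast
 then show ?thesis by (simp add: fun_eq_iff)
qed (simp add: hom_form_length[OF \<theta>(1)])

text \<open>For \<open>q = 1\<close>, contract with the radial field: (d + 2) \<omega>(v) =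
  d\<omega>(x, v) = 0.\<close>

lemma dform_kernel:
 fixes \<omega> :: "'n::finite form"
 assumes \<omega>: "folform q d \<omega>" and v: "\<And>x js. dform q \<omega> x (v # js) = 0"
 shows "\<omega> x (v # js) = 0"
proof (cases "q = 1")
 case True
 have tw: "\<omega> \<in> twisted_forms 1 d" using \<omega> True by (simp add: folform_def)
 have hom: "hom_form 1 (Suc d) \<omega>" by (rule twisted_hom_form[OF tw])
 have R: "\<omega> x (x # ws) = 0" for x ws using tw by (simp add: twisted_forms_def)
 have "ext_deriv \<omega> x [x, v] = - ext_deriv \<omega> x [v, x]" by (simp add: ext_deriv_2)
 then have "of_nat (d + 2) * \<omega> x [v] = 0" using v[of x "[x]"] True ext_deriv_radial[OF hom R, of x v] by (simp add: dform_def)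
 then have "\<omega> x [v] = 0" by (metis mult_eq_0_iff of_nat_eq_0_iff add_is_0 zero_neq_numeral)
 then show ?thesis using hom_form_length[OF hom, of "v # js" x] by (cases js) auto
qed (use v in \<open>simp add: dform_def\<close>)

text \<open>For a constant field \<open>v\<close> in the kernel, i_v d\<omega> is the derivative of
  \<omega> along \<open>v\<close>. Integrability makes it a polynomial multiple of \<omega>; its
  coefficients have degree \<open>d\<close>, one less than those of \<omega>, so it
  vanishes.\<close>

lemma kernel_invariant:
 fixes \<omega> :: "'n::finite form"
 assumes \<omega>: "folform q d \<omega>" and q: "q \<ge> 1" and v: "\<And>x js. \<omega> x (v # js) = 0"
 shows "\<omega> (x + t *s v) ws = \<omega> x ws"
proof (cases "length ws = q")
 case len: True
 have tw: "\<omega> \<in> twisted_forms q d" and nz: "\<omega> \<noteq> 0" and ex: "exchange q q \<omega> \<omega>" "exchange q (Suc q) \<omega> (ext_deriv \<omega>)"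
  and ncd: "no_common_divisor (affine_sing \<omega>)" using \<omega> by (simp_all add: folform_def)
 have hom: "hom_form q (Suc d) \<omega>" by (rule twisted_hom_form[OF tw])
 have hom2: "hom_form (Suc q) d (ext_deriv \<omega>)" by (rule hom_form_ext_deriv[OF hom])
 define \<eta> where "\<eta> x vs = ext_deriv \<omega> x (v # vs)" for x vs
 have \<eta>_dird: "\<eta> x vs = dird v (\<lambda>x. \<omega> x vs) x" for x vs
 proof -
  have "\<eta> x vs = (\<Sum>i<Suc (length vs). (-1) ^ i * dird ((v # vs) ! i) (\<lambda>x. \<omega> x (take i (v # vs) @ drop (Suc i) (v # vs))) x)"
   unfolding \<eta>_def ext_deriv_eq by simp
  also have "\<dots> = dird v (\<lambda>x. \<omega> x vs) x" unfolding sum.lessThan_Suc_shift by (simp add: v dird_zero)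
  finally show ?thesis .
 qed
 have \<eta>_alt: "alt q (\<eta> x)" for x
 proof -
  have a: "alt (Suc q) (ext_deriv \<omega> x)" by (rule hom_form_alt[OF hom2])
  show ?thesis unfolding alt_def
  proof (intro conjI allI impI)
   show "multilin q (\<eta> x)" unfolding \<eta>_def by (rule multilin_Cons[OF alt_multilin[OF a]])
   fix vs :: "(complex^'n) list" and i j assume "length vs = q \<and> i < j \<and> j < q \<and> vs ! i = vs ! j"
   then show "\<eta> x vs = 0" unfolding \<eta>_def by (intro alt_equal[OF a, of "v # vs" "Suc i" "Suc j"]) auto
  qed
 qed
 have pr: "\<omega> x U * \<eta> x us = \<eta> x U * \<omega> x us" if len: "length U = q" "length us = q" for x U us
 proof (rule exchange_proportional[OF \<eta>_alt hom_form_alt[OF hom] _ _ len])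
  fix u :: "complex^'n" and us js :: "(complex^'n) list" assume l: "length us = q" "Suc (length js) = q"
  show "\<omega> x (u # js) * \<omega> x us = (\<Sum>a<q. \<omega> x (us[a := u]) * \<omega> x (us ! a # js))" by (rule exchangeD[OF ex(1) l])
  have "\<omega> x (u # js) * ext_deriv \<omega> x (v # us) = (\<Sum>a<Suc q. ext_deriv \<omega> x ((v # us)[a := u]) * \<omega> x ((v # us) ! a # js))"
   by (rule exchangeD[OF ex(2) _ l(2)]) (simp add: l)
  then show "\<omega> x (u # js) * \<eta> x us = (\<Sum>a<q. \<eta> x (us[a := u]) * \<omega> x (us ! a # js))"
   unfolding sum.lessThan_Suc_shift \<eta>_def by (simp add: v)
 qed
 let ?c = "\<lambda>I x. \<omega> x (map ax I)" and ?a = "\<lambda>I x. \<eta> x (map ax I)" and ?T = "{I :: 'n list. length I = q}"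
 have c: "hp (Suc d) (?c I)" if "I \<in> ?T" for I using that by (intro hom_form_hp[OF hom]) simp
 have a: "hp d (?a I)" if "I \<in> ?T" for I using that unfolding \<eta>_def by (intro hom_form_hp[OF hom2]) simp
 obtain I0 where I0: "I0 \<in> ?T" "?c I0 \<noteq> 0" using hom_form_nonzero[OF hom nz] by blast
 have sub: "{x. \<forall>I\<in>?T. ?c I x = 0} = affine_sing \<omega>"
  unfolding affine_sing_form_coeffs[OF hom] common_zeros_def form_coeffs_def by simp
 have "\<exists>h. pf h \<and> (\<forall>I\<in>?T. ?a I = h * ?c I)"
 proof (rule proportional_division[OF finite_index_lists c hp_imp_pf[OF a] _ I0 ncd[folded sub]])
  show "?c I * ?a J = ?a I * ?c J" if "I \<in> ?T" "J \<in> ?T" for I J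
   using pr[of "map ax I" "map ax J"] that by (simp add: fun_eq_iff)
  fix h assume "pf h" "\<And>I. I \<in> ?T ==> ?a I = h * ?c I"
  then show ?thesis by blast
 qed
 then obtain h where h: "pf h" "\<forall>I\<in>?T. ?a I = h * ?c I" by blast
 have \<eta>0: "\<eta> x (map ax I) = 0" if "length I = q" for I x
  using degree_drop_zero[OF a c h(1) h(2)[rule_format], of I x] that by simp
 have "\<eta> x vs = 0" if "length vs = q" for vs x
  by (rule multilin_zero_basis[OF alt_multilin[OF \<eta>_alt] \<eta>0 that])
 then have "dird v (\<lambda>x. \<omega> x ws) x = 0" for x using \<eta>_dird len by metis
 then show ?thesis by (rule dird_zero_const[OF hom_form_hp[OF hom len]])
qed (use twisted_hom_form[of \<omega> q d] \<omega> in \<open>simp add: folform_def hom_form_length\<close>)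

section \<open>Lifting along a linear projection\<close>

text \<open>Multiplying by a power of \<open>s\<close> gives an identity of polynomials, and the
  degree of the reflected polynomial is too small unless \<open>P\<close> is constant.\<close>

lemma poly_inverse_const:
 fixes P Q :: "complex poly"
 assumes "\<And>s. s \<noteq> 0 ==> poly P s = poly Q (inverse s)"
 shows "poly P s = coeff P 0"
proof -
 have *: "poly (P * monom 1 (degree Q)) s = poly (reflect_poly Q) s" if "s \<in> - {0}" for s
  using that assms[of s] by (simp add: poly_reflect_poly_nz poly_monom mult.commute)
 have eq: "P * monom 1 (degree Q) = reflect_poly Q"
 proof (rule ccontr)
  assume "P * monom 1 (degree Q) \<noteq> reflect_poly Q"
  then have "finite {s. poly (P * monom 1 (degree Q) - reflect_poly Q) s = 0}" by (intro poly_roots_finite) simp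
  moreover have "- {0} \<subseteq> {s. poly (P * monom 1 (degree Q) - reflect_poly Q) s = 0}" using * by (simp add: subset_iff)
  ultimately show False using infinite_nonzero finite_subset by blast
 qed
 have "degree P = 0"
 proof (cases "P = 0")
  case False
  have "degree P + degree Q = degree (reflect_poly Q)" unfolding eq[symmetric] using False by (simp add: degree_mult_eq degree_monom_eq)
  also have "\<dots> \<le> degree Q" by (rule degree_reflect_poly_le)
  finally show ?thesis by simp
 qed simp
 then show ?thesis using degree_eq_zeroE by (metis coeff_pCons_0 mult_zero_right poly_pCons add.right_neutral poly_0)
qed

text \<open>A polynomial in \<open>s\<close> and in \<open>1/s\<close> is constant: this forces the lift of a coefficient family of
 minimal degree to be a constant vector.\<close>

lemma projection_lifting:
 fixes \<theta> :: "'n::finite form" and \<pi> :: "complex^'k::finite => complex^'n"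
 assumes \<theta>: "hom_form p k \<theta>" "\<theta> \<noteq> 0" "exchange p p \<theta> \<theta>" and p: "p \<ge> 1" and card: "CARD('n) \<ge> 2"
  and gen: "kernel_generators p \<theta> r X" and r: "r + p = CARD('n)" and c3: "codim3 (affine_sing \<theta>)"
  and \<pi>: "lmap \<pi>" "lmap \<iota>" "\<And>x. \<pi> (\<iota> x) = x"
  and e: "\<And>J. length J = p - 1 ==> hp k (e J)"
  and rel: "\<And>I J x. length I = p ==> length J = p - 1 ==>
   \<theta> (\<pi> x) (map ax I) * e J x = (\<Sum>a<p. (-1) ^ a * e (take a I @ drop (Suc a) I) x * \<theta> (\<pi> x) (ax (I ! a) # map ax J))"
 shows "\<exists>w. \<forall>J x. length J = p - 1 --> e J x = \<theta> (\<pi> x) (w # map ax J)"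
proof -
 \<comment> \<open>On the translate of the section by \<open>y\<close> the relations are those of
   the base, so lifting there gives a field \<open>w y\<close>, which at first depends on the
   translate.\<close>
 have "\<exists>w. pvf w \<and> (\<forall>J z. length J = p - 1 --> e J (\<iota> z + y) = \<theta> z (w z # map ax J))" if y: "\<pi> y = 0" for y
 proof -
  have 1: "pf (\<lambda>z. e J (\<iota> z + y))" if J: "length J = p - 1" for J
   by (rule pf_affine[OF hp_imp_pf[OF e[OF J]] \<pi>(2)])
  have 2: "\<theta> z (map ax I) * e J (\<iota> z + y) =
    (\<Sum>a<p. (-1) ^ a * e (take a I @ drop (Suc a) I) (\<iota> z + y) * \<theta> z (ax (I ! a) # map ax J))"
   if "length I = p" "length J = p - 1" for I J z
   using rel[OF that, of "\<iota> z + y"] by (simp add: lmap_simps[OF \<pi>(1)] \<pi>(3) y)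
  show ?thesis
  proof (rule kernel_lifting[OF \<theta> p card gen r c3, of "\<lambda>J z. e J (\<iota> z + y)"])
   fix w assume "pvf w" "\<And>J z. length J = p - 1 ==> e J (\<iota> z + y) = \<theta> z (w z # map ax J)"
   then show ?thesis by blast
  qed (use 1 2 in auto)
 qed
 then obtain w where w: "\<And>y. \<pi> y = 0 ==> pvf (w y)"
  "\<And>y J z. \<pi> y = 0 ==> length J = p - 1 ==> e J (\<iota> z + y) = \<theta> z (w y z # map ax J)" by metis
 have line: "e J (\<iota> z + s *s y) = e J (\<iota> z) \<and> e J (\<iota> z) = \<theta> z (w 0 0 # map ax J)"
  if y: "\<pi> y = 0" and J: "length J = p - 1" for J y z s
 proof -
  have key: "\<exists>c. (\<forall>s. e J (\<iota> z + s *s y) = c) \<and> \<theta> z (w y 0 # map ax J) = c" if y: "\<pi> y = 0" for y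
  proof -
   obtain P where P: "\<forall>s. e J (\<iota> z + s *s y) = poly P s" using pf_line[OF hp_imp_pf[OF e[OF J]]] by blast
   have l1: "length (map ax J) = p - 1" using J by simp
   have "multilin (Suc (length J)) (\<theta> z)" using hom_form_multilin[OF \<theta>(1)] J p by simp
   then have lin: "lin (\<lambda>u. \<theta> z (u # map ax J))" by (rule multilin_Cons_lin) simp
   have "pf (\<lambda>x. \<theta> z (w y x # map ax J))"
   proof -
    have "\<theta> z (w y x # map ax J) = (\<Sum>i\<in>UNIV. w y x $ i * \<theta> z (ax i # map ax J))" for x by (rule lin_expand[OF lin])
    then show ?thesis using w(1)[OF y] by (simp add: pvf_def pf_sum' pf_pointwise)
   qed
   from pf_line[OF this, of 0 z] obtain Q where Q: "\<forall>t. \<theta> z (w y (t *s z) # map ax J) = poly Q t" by auto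
   \<comment> \<open>Scaling moves \<open>s\<close> from the kernel direction into the base point.
     The family has the same degree \<open>k\<close> as \<theta>, so the powers of \<open>s\<close>
     cancel and survive only in the argument of the field.\<close>
   have PQ: "poly P s = poly Q (inverse s)" if s: "s \<noteq> 0" for s
   proof -
    have "\<iota> z + s *s y = s *s (\<iota> (inverse s *s z) + y)" using s by (simp add: lmap_simps[OF \<pi>(2)] vector_add_ldistrib vector_smult_assoc)
    then have "poly P s = s ^ k * e J (\<iota> (inverse s *s z) + y)" using P hom_poly_scale[OF e[OF J]] by metis
    also have "\<dots> = s ^ k * \<theta> (inverse s *s z) (w y (inverse s *s z) # map ax J)" using w(2)[OF y J] by simp
    also have "\<dots> = s ^ k * (inverse s ^ k * \<theta> z (w y (inverse s *s z) # map ax J))"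
     using hom_poly_scale[OF hom_form_hp[OF \<theta>(1)], of "w y (inverse s *s z) # map ax J" "inverse s" z] J p by simp
    also have "\<dots> = poly Q (inverse s)" using Q s by (simp add: power_inverse)
    finally show ?thesis .
   qed
   have c: "poly P s = coeff P 0" for s by (rule poly_inverse_const[OF PQ])
   have "poly Q s = poly P (inverse s)" if "s \<noteq> 0" for s using PQ[of "inverse s"] that by simp
   from poly_inverse_const[OF this] have "poly Q 0 = poly Q 1" by metis
   also have "\<dots> = coeff P 0" using PQ[of 1] c by simp
   finally have "\<theta> z (w y 0 # map ax J) = coeff P 0" using spec[OF Q, of 0] by simp
   then show ?thesis using P c by auto
  qed
  have 0: "\<pi> 0 = 0" using lmap_simps(3)[OF \<pi>(1)] .
  have "e J (\<iota> z + 0 *s 0) = \<theta> z (w 0 0 # map ax J)" using key[OF 0] by metis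
  moreover have "e J (\<iota> z + s *s y) = e J (\<iota> z + 0 *s y)" using key[OF y] by metis
  ultimately show ?thesis by simp
 qed
 have "e J x = \<theta> (\<pi> x) (w 0 0 # map ax J)" if J: "length J = p - 1" for J x
 proof -
  have "\<pi> (x - \<iota> (\<pi> x)) = 0" by (simp add: lmap_simps[OF \<pi>(1)] \<pi>(3))
  from line[OF this J, of "\<pi> x" 1] show ?thesis by simp
 qed
 then show ?thesis by blast
qed

section \<open>Deformations of linear pull-backs\<close>

interpretation vlp: vector_space_pair "(*s) :: complex => complex^'n => _" "(*) :: complex => complex => complex"
 by unfold_locales (auto simp: algebra_simps)

lemma annihilator:
 fixes R :: "(complex^'n) set"
 assumes "vec.span R \<noteq> UNIV"
 shows "\<exists>u. u \<noteq> 0 \<and> (\<forall>r\<in>R. (\<Sum>j\<in>UNIV. u $ j * r $ j) = 0)"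
proof -
 obtain v where v: "v \<notin> vec.span R" using assms by blast
 obtain B where B: "B \<subseteq> R" "vec.independent B" "R \<subseteq> vec.span B" using vec.maximal_independent_subset by blast
 have "vec.span R \<subseteq> vec.span B" using B(3) by (rule vec.span_minimal[OF _ vec.subspace_span])
 moreover have "vec.span B \<subseteq> vec.span R" using B(1) by (rule vec.span_mono)
 ultimately have sp: "vec.span B = vec.span R" by blast
 then have "vec.independent (insert v B)" using v B(2) by (intro vec.independent_insertI) auto
 then obtain l where l: "lin l" "\<forall>x\<in>insert v B. l x = (if x = v then 1 else 0)"
  using vlp.linear_independent_extend[of "insert v B" "\<lambda>x. if x = v then 1 else 0"] by blast
 have vB: "v \<notin> B" using v sp vec.span_base by blast
 have "vec.span B \<subseteq> {x. l x = 0}"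
  by (rule vec.span_minimal) (use l(2) vB in \<open>auto simp: vec.subspace_def lin_simps[OF l(1)]\<close>)
 then have 0: "l r = 0" if "r \<in> R" for r using that B(3) by blast
 define u where "u = (\<chi> j. l (ax j))"
 have lu: "l r = (\<Sum>j\<in>UNIV. u $ j * r $ j)" for r unfolding u_def by (subst lin_expand[OF l(1)]) (simp add: mult.commute)
 have "l v = 1" using l(2) by simp
 then have "u \<noteq> 0" unfolding lu by auto
 then show ?thesis using 0 lu by metis
qed

text \<open>Functions that are independent over \<open>S\<close> are separated by
  \<open>card S\<close> evaluations: the unit vectors outside \<open>S\<close> extend to a basis by
  evaluation vectors and further unit vectors taken from the spanning set, and all added ones are
  evaluations. The resulting square system is invertible.\<close>

lemma separating_points:
 fixes g :: "'n::finite => 'z => complex"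
 assumes ind: "\<And>u :: complex^'n. (\<forall>z. (\<Sum>j\<in>S. u $ j * g j z) = 0) ==> (\<forall>j\<in>S. u $ j = 0)"
 obtains z where "\<forall>u :: complex^'n. (\<forall>i\<in>S. (\<Sum>j\<in>UNIV. u $ j * g j (z i)) = 0) --> (\<forall>i. i \<notin> S --> u $ i = 0) --> u = 0"
proof -
 let ?\<rho> = "\<lambda>z. (\<chi> j. g j z)" and ?U = "ax ` (- S) :: (complex^'n) set"
 let ?R = "range ?\<rho> \<union> ?U"
 have inj: "inj (ax :: 'n => complex^'n)" by (auto simp: inj_on_def axis_eq_axis)
 have span: "vec.span ?R = UNIV"
 proof (rule ccontr)
  assume "\<not> ?thesis"
  then obtain u where u: "u \<noteq> 0" "\<forall>r\<in>?R. (\<Sum>j\<in>UNIV. u $ j * r $ j) = 0" using annihilator by blast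
  have out: "u $ i = 0" if "i \<notin> S" for i
  proof -
   have "(\<Sum>j\<in>UNIV. u $ j * ax i $ j) = 0" using u(2) that by blast
   then show ?thesis by (simp add: axis_def if_distrib cong: if_cong)
  qed
  have "(\<Sum>j\<in>S. u $ j * g j z) = 0" for z
  proof -
   have "(\<Sum>j\<in>UNIV. u $ j * ?\<rho> z $ j) = 0" using u(2) by blast
   moreover have "(\<Sum>j\<in>UNIV. u $ j * ?\<rho> z $ j) = (\<Sum>j\<in>S. u $ j * g j z)"
    using out by (intro sum.mono_neutral_cong_right) auto
   ultimately show ?thesis by simp
  qed
  then have "\<forall>j\<in>S. u $ j = 0" by (intro ind) blast
  then have "u = 0" using out by (auto simp: vec_eq_iff)
  then show False using u(1) by simp
 qed
 have "vec.independent ?U"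
  by (rule vec.independent_mono[OF independent_cart_basis]) (auto simp: cart_basis_def)
 then obtain B where B: "?U \<subseteq> B" "B \<subseteq> ?R" "vec.independent B" "?R \<subseteq> vec.span B"
  using vec.maximal_independent_subset_extend[of ?U ?R] by blast
 have "vec.span ?R \<subseteq> vec.span B" using B(4) by (rule vec.span_minimal[OF _ vec.subspace_span])
 then have spB: "vec.span B = UNIV" using span by blast
 then have "card B = CARD('n)" using vec.dim_span_eq_card_independent[OF B(3)] vec_dim_card by metis
 moreover have "card ?U = CARD('n) - card S"
  using card_image[OF inj_on_subset[OF inj subset_UNIV], of "- S"] by (simp add: Compl_eq_Diff_UNIV card_Diff_subset[OF finite subset_UNIV])
 moreover have "card (B - ?U) = card B - card ?U" by (rule card_Diff_subset[OF _ B(1)]) simp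
 moreover have "card S \<le> CARD('n)" by (rule card_mono) auto
 ultimately have "card (B - ?U) = card S" by simp
 moreover have "finite B" using vec.finiteI_independent[OF B(3)] .
 ultimately obtain h where h: "bij_betw h S (B - ?U)" using finite_same_card_bij[of S "B - ?U"] by auto
 have "\<forall>i. \<exists>z. i \<in> S --> h i = ?\<rho> z" using bij_betwE[OF h] B(2) by blast
 from choice[OF this] obtain z where z: "\<forall>i. i \<in> S --> h i = ?\<rho> (z i)" by blast
 show thesis
 proof (rule that[of z], intro allI impI)
  fix u :: "complex^'n"
  assume u: "\<forall>i\<in>S. (\<Sum>j\<in>UNIV. u $ j * g j (z i)) = 0" and out: "\<forall>i. i \<notin> S --> u $ i = 0"
  have "vec.span B \<subseteq> {r. (\<Sum>j\<in>UNIV. u $ j * r $ j) = 0}"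
  proof (rule vec.span_minimal)
   show "B \<subseteq> {r. (\<Sum>j\<in>UNIV. u $ j * r $ j) = 0}"
   proof
    fix r assume r: "r \<in> B"
    show "r \<in> {r. (\<Sum>j\<in>UNIV. u $ j * r $ j) = 0}"
    proof (cases "r \<in> ?U")
     case True
     then obtain i where "r = ax i" "i \<notin> S" by blast
     then show ?thesis using out by (simp add: axis_def if_distrib cong: if_cong)
    next
     case False
     then obtain i where "i \<in> S" "r = h i" using r h unfolding bij_betw_def by blast
     then show ?thesis using z u by simp
    qed
   qed
   show "vec.subspace {r. (\<Sum>j\<in>UNIV. u $ j * r $ j) = 0}" unfolding vec.subspace_def
    by (auto simp: distrib_left sum.distrib mult.left_commute[of _ c for c] sum_distrib_left[symmetric])
  qed
  then have all: "(\<Sum>j\<in>UNIV. u $ j * r $ j) = 0" for r using spB by blast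
  have "u $ i = 0" for i using all[of "ax i"] by (simp add: axis_def if_distrib cong: if_cong)
  then show "u = 0" by (simp add: vec_eq_iff)
 qed
qed

text \<open>The arguments are replaced one at a time; each replacement changes the value by a term
  containing a kernel vector.\<close>

lemma alt_map_kernel:
 assumes F: "alt q F" and K: "\<And>v js. F ((v - \<rho> v) # js) = 0" and len: "length vs = q"
 shows "F (map \<rho> vs) = F vs"
proof -
 have "F (map \<rho> (take i vs) @ drop i vs) = F vs" if "i \<le> q" for i
  using that
 proof (induction i)
  case (Suc i)
  then have i: "i < q" by simp
  let ?us = "map \<rho> (take i vs) @ drop i vs"
  have l: "length ?us = q" using len i by simp
  have d: "drop i vs = vs ! i # drop (Suc i) vs" using len i by (simp add: Cons_nth_drop_Suc)
  have t: "take (Suc i) vs = take i vs @ [vs ! i]" using len i by (simp add: take_Suc_conv_app_nth)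
  have "map \<rho> (take (Suc i) vs) @ drop (Suc i) vs = ?us[i := \<rho> (vs ! i)]"
   using len i unfolding d t by (simp add: list_update_append)
  moreover have "?us[i := vs ! i] = ?us" using len i unfolding d by (simp add: list_update_append)
  moreover have "F (?us[i := vs ! i - \<rho> (vs ! i)]) = F (?us[i := vs ! i]) - F (?us[i := \<rho> (vs ! i)])"
   by (rule lin_simps(4)[OF multilin_lin[OF alt_multilin[OF F] l i]])
  moreover have "F (?us[i := vs ! i - \<rho> (vs ! i)]) = 0" by (simp only: alt_head[OF F l i] K mult_zero_right)
  ultimately show ?case using Suc by simp
 qed simp
 from this[of q] show ?thesis using len by simp
qed

text \<open>Bounded degree makes the space of coefficient families finite-dimensional, so that a
  complement of the image of \<open>L\<close> has a finite basis.\<close>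

lemma coeff_families_finite:
 "\<exists>T. finite T \<and> (\<forall>e :: (complex^'k::finite) \<times> 'n::finite list => complex.
  (\<forall>J. hp k (\<lambda>x. e (x, J))) \<and> (\<forall>x J. length J \<noteq> m --> e (x, J) = 0) --> e \<in> fs.span T)"
proof -
 let ?f = "\<lambda>J p. \<lambda>(x, J'). if J' = J then p x else 0 :: complex"
 let ?L = "{J :: 'n list. length J = m}"
 let ?T = "(\<Union>J\<in>?L. ?f J ` (monoms_le k :: (complex^'k => complex) set))"
 have "e \<in> fs.span ?T" if e: "\<forall>J. hp k (\<lambda>x. e (x, J))" "\<forall>x J. length J \<noteq> m --> e (x, J) = 0"
  for e :: "(complex^'k) \<times> 'n list => complex"
 proof -
  have J: "?f J (\<lambda>x. e (x, J)) \<in> fs.span ?T" if "J \<in> ?L" for J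
  proof -
   have "fs.span (monoms_le k) \<subseteq> {p. ?f J p \<in> fs.span ?T}"
   proof (rule fs.span_minimal)
    show "monoms_le k \<subseteq> {p. ?f J p \<in> fs.span ?T}" using that by (auto intro!: fs.span_base)
    have f: "?f J 0 = 0" "?f J (p + q) = ?f J p + ?f J q" "?f J (fsc c p) = fsc c (?f J p)" for p q :: "complex^'k => complex" and c
     by (auto simp: fun_eq_iff)
    show "fs.subspace {p. ?f J p \<in> fs.span ?T}" unfolding fs.subspace_def
    proof (intro conjI ballI allI CollectI)
     show "?f J 0 \<in> fs.span ?T" unfolding f by (rule fs.span_zero)
     show "?f J (p + q) \<in> fs.span ?T" if "p \<in> {p. ?f J p \<in> fs.span ?T}" "q \<in> {p. ?f J p \<in> fs.span ?T}" for p q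
      unfolding f using that[unfolded mem_Collect_eq] by (rule fs.span_add)
     show "?f J (fsc c p) \<in> fs.span ?T" if "p \<in> {p. ?f J p \<in> fs.span ?T}" for p c
      unfolding f using that[unfolded mem_Collect_eq] by (rule fs.span_scale)
    qed
   qed
   then show ?thesis using hp_pdeg[OF e(1)[rule_format, of J]] unfolding pdeg_def by blast
  qed
  have "e = (\<Sum>J\<in>?L. ?f J (\<lambda>x. e (x, J)))"
  proof
   fix y show "e y = (\<Sum>J\<in>?L. ?f J (\<lambda>x. e (x, J))) y"
   proof (cases y)
    case (Pair x J')
    have "(\<Sum>J\<in>?L. ?f J (\<lambda>x. e (x, J))) y = (\<Sum>J\<in>?L. if J' = J then e (x, J) else 0)"
     unfolding Pair by (simp add: fun_sum_apply)
    also have "\<dots> = (if J' \<in> ?L then e (x, J') else 0)" by (rule sum.delta'[OF finite_index_lists])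
    also have "\<dots> = e y" using e(2) Pair by simp
    finally show ?thesis by simp
   qed
  qed
  moreover have "(\<Sum>J\<in>?L. ?f J (\<lambda>x. e (x, J))) \<in> fs.span ?T" by (rule fs.span_sum[OF J])
  ultimately show ?thesis by simp
 qed
 moreover have "finite ?T" by (intro finite_UN_I finite_index_lists finite_imageI finite_monoms_le)
 ultimately show ?thesis by blast
qed

locale rigid =
 fixes q d r :: nat and \<omega>\<^sub>G :: "'n::finite form" and X and \<pi> :: "complex^'k::finite => complex^'n" and \<iota>
 assumes q: "1 \<le> q" and card: "CARD('n) \<ge> 2" and fol: "folform q d \<omega>\<^sub>G"
  and gen: "kernel_generators (dlen q) (dform q \<omega>\<^sub>G) r X" and r: "r + dlen q = CARD('n)"
  and c3: "codim3 (affine_sing (dform q \<omega>\<^sub>G))"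
  and \<pi>: "lmap \<pi>" and \<iota>: "lmap \<iota>" and sect: "\<And>x. \<pi> (\<iota> x) = x"
begin

abbreviation "p \<equiv> dlen q"
abbreviation "k \<equiv> ddeg q d"
abbreviation "W \<equiv> (twisted_forms q d :: 'k form set)"
definition "\<omega>\<^sub>0 = pullback \<pi> \<omega>\<^sub>G"
abbreviation "b \<equiv> \<lambda>i. \<iota> (ax i)"

text \<open>Contraction of \<open>dform\<close> with a constant vector, recorded on the frame of the
  image of \<iota> only.\<close>

definition L :: "'k form => complex^'k => (complex^'k) \<times> 'n list => complex" where
 "L \<omega> v = (\<lambda>(x, J). dform q \<omega> x (v # map b J))"

text \<open>The Pluecker relations with one factor replaced by an unknown family \<open>e\<close>:
  linear in \<open>e\<close>, and satisfied by the contractions of a decomposable form.\<close>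

definition M :: "'k form => ((complex^'k) \<times> 'n list => complex) => (complex^'k) \<times> 'n list \<times> 'n list => complex" where
 "M \<omega> e = (\<lambda>(x, I, J). if length I = p \<and> length J = p - 1 then
  dform q \<omega> x (map b I) * e (x, J)
   - (\<Sum>a<p. (-1) ^ a * e (x, take a I @ drop (Suc a) I) * dform q \<omega> x (b (I ! a) # map b J)) else 0)"

lemma M_apply: "length I = p \<and> length J = p - 1 ==> M \<omega> e (x, I, J) = dform q \<omega> x (map b I) * e (x, J)
   - (\<Sum>a<p. (-1) ^ a * e (x, take a I @ drop (Suc a) I) * dform q \<omega> x (b (I ! a) # map b J))"
 unfolding M_def prod.case by (rule if_P)

lemma M_zero: "\<not> (length I = p \<and> length J = p - 1) ==> M \<omega> e (x, I, J) = 0"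
 unfolding M_def prod.case by (rule if_not_P)

definition E :: "((complex^'k) \<times> 'n list => complex) set" where
 "E = {e. (\<forall>J. hp k (\<lambda>x. e (x, J))) \<and> (\<forall>x J. length J \<noteq> p - 1 --> e (x, J) = 0)}"

lemma p1: "p \<ge> 1" "Suc (p - 1) = p" using dlen_ge[OF q] by simp_all

lemma tw_G: "\<omega>\<^sub>G \<in> twisted_forms q d" using fol by (simp add: folform_def)

lemma \<omega>\<^sub>0W: "\<omega>\<^sub>0 \<in> W" unfolding \<omega>\<^sub>0_def by (rule twisted_pullback[OF tw_G \<pi>])

lemma dform_hom: "\<omega> \<in> W ==> hom_form p k (dform q \<omega>)" by (rule hom_form_dform[OF twisted_hom_form])

lemma dform_0: "dform q \<omega>\<^sub>0 = pullback \<pi> (dform q \<omega>\<^sub>G)" unfolding \<omega>\<^sub>0_def by (rule dform_pullback[OF \<pi>])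

lemma lin_dform: assumes "\<omega> \<in> W" shows "lin (\<lambda>v. dform q \<omega> x (v # js))"
proof (cases "Suc (length js) = p")
 case True
 then have "multilin (Suc (length js)) (dform q \<omega> x)" using hom_form_multilin[OF dform_hom[OF assms]] by simp
 then show ?thesis by (rule multilin_Cons_lin) simp
qed (simp add: hom_form_length[OF dform_hom[OF assms]] linI)

lemma lin_L: "\<omega> \<in> W ==> lin (\<lambda>v. L \<omega> v y)" unfolding L_def by (cases y) (simp add: lin_dform)

lemma L_E: assumes "\<omega> \<in> W" shows "L \<omega> v \<in> E"
proof -
 have h: "hom_form p k (dform q \<omega>)" by (rule dform_hom[OF assms])
 have "hp k (\<lambda>x. dform q \<omega> x (v # map b J))" for J
 proof (cases "Suc (length J) = p")
  case True
  then show ?thesis using hom_form_hp[OF h, of "v # map b J"] by simp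
 qed (simp add: hom_form_length[OF h] hp_zero)
 moreover have "dform q \<omega> x (v # map b J) = 0" if "length J \<noteq> p - 1" for x J
  using that by (intro hom_form_length[OF h]) auto
 ultimately show ?thesis by (simp add: E_def L_def)
qed

lemma M_L: assumes "\<omega> \<in> W" "exchange p p (dform q \<omega>) (dform q \<omega>)" shows "M \<omega> (L \<omega> v) y = 0"
proof -
 obtain x I J where y: "y = (x, I, J)" by (cases y) auto
 show ?thesis
 proof (cases "length I = p \<and> length J = p - 1")
  case True
  then have l: "length (map b I) = p" "Suc (length (map b J)) = p" using p1 by simp_all
  have "dform q \<omega> x (v # map b J) * dform q \<omega> x (map b I) =
   (\<Sum>a<p. dform q \<omega> x ((map b I)[a := v]) * dform q \<omega> x (map b I ! a # map b J))"
   by (rule exchangeD[OF assms(2) l])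
  also have "\<dots> = (\<Sum>a<p. (-1) ^ a * dform q \<omega> x (v # map b (take a I @ drop (Suc a) I)) * dform q \<omega> x (b (I ! a) # map b J))"
   using True by (intro sum.cong) (simp_all add: alt_head[OF hom_form_alt[OF dform_hom[OF assms(1)]] l(1)] take_map drop_map)
  finally show ?thesis unfolding y M_apply[OF True] by (simp add: L_def mult.commute)
 next
  case False
  then show ?thesis unfolding y by (rule M_zero)
 qed
qed

lemma M_sum: "finite A ==> M \<omega> (\<lambda>y. \<Sum>a\<in>A. c a * f a y) z = (\<Sum>a\<in>A. c a * M \<omega> (f a) z)"
proof -
 assume "finite A"
 obtain x I J where z: "z = (x, I, J)" by (cases z) auto
 show ?thesis
 proof (cases "length I = p \<and> length J = p - 1")
  case True
  have "(\<Sum>i<p. (-1) ^ i * (\<Sum>a\<in>A. c a * f a (x, take i I @ drop (Suc i) I)) * dform q \<omega> x (b (I ! i) # map b J))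
   = (\<Sum>a\<in>A. c a * (\<Sum>i<p. (-1) ^ i * f a (x, take i I @ drop (Suc i) I) * dform q \<omega> x (b (I ! i) # map b J)))"
   by (simp add: sum_distrib_left sum_distrib_right sum.swap[of _ A] mult_ac)
  moreover have "dform q \<omega> x (map b I) * (\<Sum>a\<in>A. c a * f a (x, J)) = (\<Sum>a\<in>A. c a * (dform q \<omega> x (map b I) * f a (x, J)))"
   unfolding sum_distrib_left by (intro sum.cong refl) (simp add: mult_ac)
  ultimately show ?thesis unfolding z M_apply[OF True] right_diff_distrib sum_subtractf by simp
 next
  case False
  show ?thesis unfolding z M_zero[OF False] by simp
 qed
qed

lemma hp_on_M: "hp_on W 1 (\<lambda>\<omega>. M \<omega> e z)"
proof -
 obtain x I J where z: "z = (x, I, J)" by (cases z) auto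
 have "hp_on W 1 (\<lambda>\<omega>. e (x, J) * dform q \<omega> x (map b I)
   - (\<Sum>a<p. ((-1) ^ a * e (x, take a I @ drop (Suc a) I)) * dform q \<omega> x (b (I ! a) # map b J)))"
  by (intro hp_on_diff hp_on_sum hp_on_scale hp_on_dform)
 then have "hp_on W 1 (\<lambda>\<omega>. M \<omega> e (x, I, J))" if "length I = p \<and> length J = p - 1"
  unfolding M_apply[OF that] by (simp only: mult.commute[of _ "e (x, J)"])
 moreover have "hp_on W 1 (\<lambda>\<omega>. M \<omega> e (x, I, J))" if "\<not> (length I = p \<and> length J = p - 1)"
  unfolding M_zero[OF that] by (rule hp_on_zero)
 ultimately show ?thesis unfolding z by blast
qed

text \<open>This is \<open>projection_lifting\<close> read in the frame \<open>b\<close>, on which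
  the pull-back takes the values of the form below.\<close>

lemma exact:
 assumes e: "e \<in> E" and Me: "\<And>z. M \<omega>\<^sub>0 e z = 0"
 shows "\<exists>w. \<forall>y. e y = L \<omega>\<^sub>0 (\<iota> w) y"
proof -
 have b\<pi>: "map (\<lambda>x. \<pi> (b x)) I = map ax I" for I by (simp add: sect)
 have "\<exists>w. \<forall>J x. length J = p - 1 --> e (x, J) = dform q \<omega>\<^sub>G (\<pi> x) (w # map ax J)"
 proof (rule projection_lifting[OF folform_dform[OF fol] p1(1) card gen r c3 \<pi> \<iota> sect])
  show "hp k (\<lambda>x. e (x, J))" for J using e by (simp add: E_def)
  fix I J :: "'n list" and x assume l: "length I = p" "length J = p - 1"
  show "dform q \<omega>\<^sub>G (\<pi> x) (map ax I) * e (x, J) =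
   (\<Sum>a<p. (-1) ^ a * e (x, take a I @ drop (Suc a) I) * dform q \<omega>\<^sub>G (\<pi> x) (ax (I ! a) # map ax J))"
   using Me[of "(x, I, J)"] unfolding M_apply[OF conjI[OF l]] by (simp add: dform_0 pullback_def sect o_def)
 qed
 then obtain w where w: "\<forall>J x. length J = p - 1 --> e (x, J) = dform q \<omega>\<^sub>G (\<pi> x) (w # map ax J)" by blast
 have "e (x, J) = L \<omega>\<^sub>0 (\<iota> w) (x, J)" for x J
 proof (cases "length J = p - 1")
  case True
  then show ?thesis using w by (simp add: L_def dform_0 pullback_def sect o_def)
 next
  case False
  then show ?thesis using e L_E[OF \<omega>\<^sub>0W, of "\<iota> w"] by (simp add: E_def)
 qed
 then show ?thesis by (intro exI[of _ w]) auto
qed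

lemma L_0_\<pi>: "L \<omega>\<^sub>0 v = L \<omega>\<^sub>0 (\<iota> (\<pi> v))"
 by (simp add: L_def dform_0 pullback_def sect fun_eq_iff)

lemma \<iota>_expand: "\<iota> u = (\<Sum>j\<in>UNIV. u $ j *s b j)"
 by (subst basis_expansion[symmetric, of u]) (simp only: lmap_simps[OF \<iota>])

lemma lin_sum: "lin l ==> l (\<Sum>j\<in>A. c j *s f j) = (\<Sum>j\<in>A. c j * l (f j))"
proof -
 assume "lin l"
 then interpret l: Vector_Spaces.linear "(*s)" "(*)" l .
 show ?thesis by (simp add: l.sum l.scale)
qed

lemma subspace_E: "fs.subspace E"
 unfolding fs.subspace_def E_def by (auto intro: hp_zero hom_poly.add hp_scale)

lemma nonvanishing: "\<exists>x I. length I = p \<and> dform q \<omega>\<^sub>0 x (map b I) \<noteq> 0"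
proof -
 have "\<exists>x I. length I = p \<and> dform q \<omega>\<^sub>G x (map ax I) \<noteq> 0"
  using hom_form_eq_0[OF folform_dform(1)[OF fol]] folform_dform(2)[OF fol] by blast
 then obtain x I where "length I = p" "dform q \<omega>\<^sub>G x (map ax I) \<noteq> 0" by blast
 then show ?thesis by (intro exI[of _ "\<iota> x"] exI[of _ I]) (simp add: dform_0 pullback_def sect o_def)
qed

text \<open>\<open>S\<close> picks frame vectors whose contractions form a basis of the image of
  \<open>L \<omega>\<^sub>0\<close>, and \<open>A\<close> completes it to a basis of
  \<open>E\<close>; by exactness \<open>M \<omega>\<^sub>0\<close> is then injective on the span of
  \<open>A\<close>.\<close>

lemma basis_data:
 obtains S :: "'n set" and A where "finite A" "A \<subseteq> E" "(\<Union>j\<in>S. {L \<omega>\<^sub>0 (b j)}) \<inter> A = {}"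
  "inj_on (\<lambda>j. L \<omega>\<^sub>0 (b j)) S" "fs.independent ((\<lambda>j. L \<omega>\<^sub>0 (b j)) ` S \<union> A)"
  "E \<subseteq> fs.span ((\<lambda>j. L \<omega>\<^sub>0 (b j)) ` S \<union> A)" "\<forall>j. L \<omega>\<^sub>0 (b j) \<in> fs.span ((\<lambda>j. L \<omega>\<^sub>0 (b j)) ` S)"
proof -
 let ?g = "\<lambda>j. L \<omega>\<^sub>0 (b j)"
 obtain B0 where B0: "B0 \<subseteq> range ?g" "fs.independent B0" "range ?g \<subseteq> fs.span B0"
  using fs.maximal_independent_subset by blast
 obtain S where S: "inj_on ?g S" "B0 = ?g ` S" using B0(1) unfolding subset_image_inj by blast
 have "B0 \<subseteq> E" using B0(1) L_E[OF \<omega>\<^sub>0W] by blast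
 from fs.maximal_independent_subset_extend[OF this B0(2)]
 obtain B where B: "B0 \<subseteq> B" "B \<subseteq> E" "fs.independent B" "E \<subseteq> fs.span B" by blast
 obtain T where T: "finite T" "E \<subseteq> fs.span T"
  using coeff_families_finite[of k "p - 1", where 'k='k and 'n='n] unfolding E_def by blast
 have fin: "finite B" using fs.independent_span_bound[OF T(1) B(3)] B(2) T(2) by blast
 have un: "?g ` S \<union> (B - B0) = B" using S(2) B(1) by blast
 show thesis
  by (rule that[of "B - B0" S]) (use fin B S B0(3) un in auto)
qed

text \<open>Rows of a square system. Indices in \<open>S\<close> evaluate \<open>L \<omega>\<close>;
  the others use the coordinates of \<pi>, multiplied by a coefficient of
  \<open>dform q \<omega>\<close> so that all rows have degree one in \<omega>.\<close>

definition \<mu> :: "'n set => ('n => (complex^'k) \<times> 'n list) => complex^'k => 'n list => 'n => 'k form => complex^'k => complex" where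
 "\<mu> S z x1 I1 i \<omega> v = (if i \<in> S then L \<omega> v (z i) else dform q \<omega> x1 (map b I1) * \<pi> v $ i)"

lemma lin_\<mu>: assumes "\<omega> \<in> W" shows "lin (\<lambda>v. \<mu> S z x1 I1 i \<omega> v)"
proof (cases "i \<in> S")
 case False
 then show ?thesis by (intro linI) (simp_all add: \<mu>_def lmap_simps[OF \<pi>] algebra_simps)
qed (simp add: \<mu>_def lin_L[OF assms])

lemma hp_on_\<mu>: "hp_on W 1 (\<lambda>\<omega>. \<mu> S z x1 I1 i \<omega> v)"
proof (cases "i \<in> S")
 case True
 obtain x J where "z i = (x, J)" by (cases "z i") auto
 then show ?thesis using True hp_on_dform[of q d x "v # map b J"] by (simp add: \<mu>_def L_def)
next
 case False
 then show ?thesis using hp_on_scale[OF hp_on_dform, of q d "\<pi> v $ i" x1 "map b I1"] by (simp add: \<mu>_def mult.commute)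
qed

definition Amat :: "'n set => ('n => (complex^'k) \<times> 'n list) => complex^'k => 'n list => 'k form => complex^'n^'n" where
 "Amat S z x1 I1 \<omega> = (\<chi> i j. \<mu> S z x1 I1 i \<omega> (b j))"

lemma Amat_mult: assumes "\<omega> \<in> W" shows "Amat S z x1 I1 \<omega> *v u = (\<chi> i. \<mu> S z x1 I1 i \<omega> (\<iota> u))"
 unfolding \<iota>_expand[of u] lin_sum[OF lin_\<mu>[OF assms]] Amat_def matrix_vector_mult_def
 by (simp add: mult.commute)

text \<open>If \<open>w\<close> is killed by the selected functionals, then \<open>L \<omega> w\<close> and the members of the two families
 \<open>L \<omega> (b j)\<close> and \<open>A\<close> are one too many to be independent; applying \<open>M \<omega>\<close> removes \<open>A\<close>.\<close>

lemma selected_functionals_suffice: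
 assumes S: "finite A" "A \<subseteq> E" "(\<Union>j\<in>S. {L \<omega>\<^sub>0 (b j)}) \<inter> A = {}"
  "inj_on (\<lambda>j. L \<omega>\<^sub>0 (b j)) S" "E \<subseteq> fs.span ((\<lambda>j. L \<omega>\<^sub>0 (b j)) ` S \<union> A)"
  and \<omega>: "\<omega> \<in> W" "exchange p p (dform q \<omega>) (dform q \<omega>)"
  and indep: "\<And>a. (\<forall>y. (\<Sum>e\<in>A. a e * M \<omega> e y) = 0) ==> (\<forall>e\<in>A. a e = 0)"
  and det: "det (Amat S z x1 I1 \<omega>) \<noteq> 0"
  and w: "\<And>i. \<mu> S z x1 I1 i \<omega> w = 0"
 shows "L \<omega> w y = 0"
proof -
 let ?g = "\<lambda>j. L \<omega>\<^sub>0 (b j)"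
 \<comment> \<open>A sum type as index set keeps the families apart even if some of their members
   coincide.\<close>
 let ?I = "Inl ` S \<union> (Inr ` (Some ` A \<union> {None}) :: ('n + ((complex^'k) \<times> 'n list => complex) option) set)"
 define F where "F i = (case i of Inl j => L \<omega> (b j) | Inr (Some e) => e | Inr None => L \<omega> w)"
  for i :: "'n + ((complex^'k) \<times> 'n list => complex) option"
 have cI: "card ?I = card S + (card A + 1)"
 proof -
  have "card ?I = card (Inl ` S :: ('n + ((complex^'k) \<times> 'n list => complex) option) set)
    + card (Inr ` (Some ` A \<union> {None}) :: ('n + ((complex^'k) \<times> 'n list => complex) option) set)"
   using S(1) by (intro card_Un_disjoint) auto
  also have "\<dots> = card S + card (Some ` A \<union> {None})"
   by (intro arg_cong2[where f = "(+)"] card_image) (simp_all add: inj_on_def)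
  also have "card (Some ` A \<union> {None}) = card A + 1" using S(1) by (simp add: card_image)
  finally show ?thesis .
 qed
 have cB: "card (?g ` S \<union> A) = card S + card A"
  using S(1,3) by (subst card_Un_disjoint) (auto simp: card_image[OF S(4)])
 have FE: "F i \<in> fs.span (?g ` S \<union> A)" if "i \<in> ?I" for i
  using that S(2,5) L_E[OF \<omega>(1)] unfolding F_def by (auto split: sum.splits option.splits)
 have finI: "finite ?I" using S(1) by simp
 have "finite (?g ` S \<union> A)" "card (?g ` S \<union> A) < card ?I" using S(1) cI cB by simp_all
 then have "\<exists>c. (\<exists>i\<in>?I. c i \<noteq> 0) \<and> (\<Sum>i\<in>?I. fsc (c i) (F i)) = 0"
  by (rule fs.family_dependent[where F = F, OF finI _ _ FE]) (assumption, intro exI conjI)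
 then obtain c where c: "\<exists>i\<in>?I. c i \<noteq> 0" "(\<Sum>i\<in>?I. fsc (c i) (F i)) = 0" by (elim exE conjE) (rule that)
 define u' where "u' = (\<Sum>j\<in>S. c (Inl j) *s b j) + c (Inr None) *s w"
 have rel: "L \<omega> u' y + (\<Sum>e\<in>A. c (Inr (Some e)) * e y) = 0" for y
 proof -
  have "0 = (\<Sum>i\<in>?I. fsc (c i) (F i)) y" unfolding c(2) by simp
  also have "\<dots> = (\<Sum>i\<in>?I. c i * F i y)" by (simp add: fun_sum_apply)
  also have "\<dots> = (\<Sum>j\<in>S. c (Inl j) * L \<omega> (b j) y) + ((\<Sum>e\<in>A. c (Inr (Some e)) * e y) + c (Inr None) * L \<omega> w y)"
  proof -
   have "(\<Sum>i\<in>?I. c i * F i y) = (\<Sum>i\<in>Inl ` S. c i * F i y) + (\<Sum>i\<in>Inr ` (Some ` A \<union> {None}). c i * F i y)"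
    using S(1) by (intro sum.union_disjoint) auto
   also have "(\<Sum>i\<in>Inl ` S. c i * F i y) = (\<Sum>j\<in>S. c (Inl j) * L \<omega> (b j) y)"
    by (subst sum.reindex) (simp_all add: F_def o_def)
   also have "(\<Sum>i\<in>Inr ` (Some ` A \<union> {None}). c i * F i y) = (\<Sum>i\<in>Some ` A \<union> {None}. c (Inr i) * F (Inr i) y)"
    unfolding sum.reindex[OF inj_Inr] o_def ..
   also have "\<dots> = (\<Sum>i\<in>Some ` A. c (Inr i) * F (Inr i) y) + c (Inr None) * L \<omega> w y"
    using S(1) by (simp add: F_def add.commute)
   also have "(\<Sum>i\<in>Some ` A. c (Inr i) * F (Inr i) y) = (\<Sum>e\<in>A. c (Inr (Some e)) * e y)"
    by (subst sum.reindex) (simp_all add: F_def o_def)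
   finally show ?thesis .
  qed
  also have "\<dots> = L \<omega> u' y + (\<Sum>e\<in>A. c (Inr (Some e)) * e y)"
   unfolding u'_def lin_simps(1)[OF lin_L[OF \<omega>(1)]] lin_simps(2)[OF lin_L[OF \<omega>(1)]] lin_sum[OF lin_L[OF \<omega>(1)]] by simp
  finally show ?thesis by simp
 qed
 have "(\<Sum>e\<in>A. c (Inr (Some e)) * M \<omega> e y) = 0" for y
 proof -
  \<comment> \<open>Written as a sum with one term, so that \<open>M_sum\<close> also covers the
    negation.\<close>
  have eq: "(\<lambda>y. \<Sum>e\<in>A. c (Inr (Some e)) * e y) = (\<lambda>y. \<Sum>t\<in>{()}. (-1) * L \<omega> u' y)"
   using rel by (auto simp: fun_eq_iff eq_neg_iff_add_eq_0 add.commute)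
  have "(\<Sum>e\<in>A. c (Inr (Some e)) * M \<omega> e y) = M \<omega> (\<lambda>y. \<Sum>e\<in>A. c (Inr (Some e)) * e y) y" by (rule M_sum[OF S(1), symmetric])
  also have "\<dots> = (\<Sum>t\<in>{()}. (-1) * M \<omega> (L \<omega> u') y)" unfolding eq by (rule M_sum) simp
  also have "\<dots> = 0" by (simp add: M_L[OF \<omega>])
  finally show ?thesis .
 qed
 then have cA: "\<forall>e\<in>A. c (Inr (Some e)) = 0" by (intro indep) blast
 then have L0: "L \<omega> u' y = 0" for y using rel[of y] by simp
 \<comment> \<open>The coefficients over \<open>S\<close> as a vector of the base. All rows vanish
   on it, since they vanish on \<open>w\<close> and \<open>L \<omega> u'\<close> is zero; hence it
   is zero and only the multiple of \<open>w\<close> remains.\<close>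
 define u where "u = (\<chi> j. if j \<in> S then c (Inl j) else 0)"
 have \<iota>u: "\<iota> u = (\<Sum>j\<in>S. c (Inl j) *s b j)"
  by (subst \<iota>_expand) (unfold u_def, rule sum.mono_neutral_cong_right, auto)
 have "\<mu> S z x1 I1 i \<omega> (\<iota> u) = 0" for i
 proof (cases "i \<in> S")
  case True
  have "u' = \<iota> u + c (Inr None) *s w" unfolding u'_def \<iota>u ..
  then have "\<mu> S z x1 I1 i \<omega> u' = \<mu> S z x1 I1 i \<omega> (\<iota> u) + c (Inr None) * \<mu> S z x1 I1 i \<omega> w"
   by (simp only: lin_simps(1)[OF lin_\<mu>[OF \<omega>(1)]] lin_simps(2)[OF lin_\<mu>[OF \<omega>(1)]])
  moreover have "\<mu> S z x1 I1 i \<omega> u' = 0" using True L0 by (simp add: \<mu>_def)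
  ultimately show ?thesis using w by simp
 qed (simp add: \<mu>_def sect u_def)
 then have "Amat S z x1 I1 \<omega> *v u = 0" unfolding Amat_mult[OF \<omega>(1)] by (simp add: vec_eq_iff)
 then have "Amat S z x1 I1 \<omega> *v u = Amat S z x1 I1 \<omega> *v 0" by simp
 then have "u = 0"
  by (rule trans[OF iffD1[OF cramer[OF det]] iffD1[OF cramer[OF det] refl, symmetric]])
 then have cS: "c (Inl j) = 0" if "j \<in> S" for j using that unfolding u_def by (auto simp: vec_eq_iff split: if_splits)
 then have cn: "c (Inr None) \<noteq> 0" using c(1) cA by auto
 have "u' = c (Inr None) *s w" unfolding u'_def using cS by simp
 then have "c (Inr None) * L \<omega> w y = 0" using L0[of y] lin_simps(2)[OF lin_L[OF \<omega>(1)]] by metis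
 then show ?thesis using cn by simp
qed

text \<open>Where \<Delta> is non-zero, \<open>\<rho> \<omega> v\<close> is the base vector whose
  image under \<iota> has the same values as \<open>v\<close> under the selected functionals. The
  difference lies in the kernel of \<omega>, so \<omega> is the pull-back of its restriction. The
  last clause turns open conditions on projections into open conditions on forms.\<close>

lemma rigid_neighbourhood:
 "\<exists>\<Delta> m \<rho>. hp_on W m \<Delta> \<and> \<Delta> \<omega>\<^sub>0 \<noteq> 0 \<and> \<rho> \<omega>\<^sub>0 = \<pi> \<and>
  (\<forall>\<omega>\<in>W. \<Delta> \<omega> \<noteq> 0 --> lmap (\<rho> \<omega>) \<and> (\<forall>u. \<rho> \<omega> (\<iota> u) = u)) \<and>
  (\<forall>\<omega>. folform q d \<omega> --> \<Delta> \<omega> \<noteq> 0 --> \<omega> = pullback (\<rho> \<omega>) (pullback \<iota> \<omega>)) \<and>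
  (\<forall>j P. hom_poly map_scale j P --> (\<exists>F m. hp_on W m F \<and> (\<forall>\<omega>\<in>W. \<Delta> \<omega> \<noteq> 0 --> (F \<omega> = 0 \<longleftrightarrow> P (\<rho> \<omega>) = 0))))"
proof (rule basis_data)
 fix S :: "'n set" and A
 assume S: "finite A" "A \<subseteq> E" "(\<Union>j\<in>S. {L \<omega>\<^sub>0 (b j)}) \<inter> A = {}"
  "inj_on (\<lambda>j. L \<omega>\<^sub>0 (b j)) S" "fs.independent ((\<lambda>j. L \<omega>\<^sub>0 (b j)) ` S \<union> A)"
  "E \<subseteq> fs.span ((\<lambda>j. L \<omega>\<^sub>0 (b j)) ` S \<union> A)" "\<forall>j. L \<omega>\<^sub>0 (b j) \<in> fs.span ((\<lambda>j. L \<omega>\<^sub>0 (b j)) ` S)"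
 let ?g = "\<lambda>j. L \<omega>\<^sub>0 (b j)"
 have finB: "finite (?g ` S \<union> A)" using S(1) by simp
 have ind0: "\<forall>j\<in>S. u $ j = 0" if u: "\<forall>y. (\<Sum>j\<in>S. u $ j * ?g j y) = 0" for u :: "complex^'n"
 proof
  fix j assume j: "j \<in> S"
  have "fs.independent (?g ` S)" using S(5) by (rule fs.independent_mono) blast
  moreover have "(\<Sum>e\<in>?g ` S. fsc (u $ the_inv_into S ?g e) e) = (\<Sum>j\<in>S. fsc (u $ j) (?g j))"
   by (subst sum.reindex[OF S(4)]) (simp add: the_inv_into_f_f[OF S(4)])
  moreover have "(\<Sum>j\<in>S. fsc (u $ j) (?g j)) = 0" using u by (simp add: fun_eq_iff fun_sum_apply)
  ultimately have "u $ the_inv_into S ?g (?g j) = 0"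
   using fs.independentD[of "?g ` S" "?g ` S" "\<lambda>e. u $ the_inv_into S ?g e" "?g j"] j by simp
  then show "u $ j = 0" using the_inv_into_f_f[OF S(4) j] by simp
 qed
 obtain z where z: "\<forall>u :: complex^'n. (\<forall>i\<in>S. (\<Sum>j\<in>UNIV. u $ j * ?g j (z i)) = 0) --> (\<forall>i. i \<notin> S --> u $ i = 0) --> u = 0"
  by (rule separating_points[where g = ?g and S = S]) (erule ind0, rule that)
 obtain x1 I1 where I1: "length I1 = p" "dform q \<omega>\<^sub>0 x1 (map b I1) \<noteq> 0" using nonvanishing by blast
 let ?A = "Amat S z x1 I1" and ?\<mu> = "\<mu> S z x1 I1"
 have "?A \<omega>\<^sub>0 *v u = 0 ==> u = 0" for u
 proof -
  assume "?A \<omega>\<^sub>0 *v u = 0"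
  then have u: "?\<mu> i \<omega>\<^sub>0 (\<iota> u) = 0" for i unfolding Amat_mult[OF \<omega>\<^sub>0W] by (simp add: vec_eq_iff)
  have "(\<Sum>j\<in>UNIV. u $ j * ?g j (z i)) = 0" if "i \<in> S" for i
   using u[of i] that lin_sum[OF lin_L[OF \<omega>\<^sub>0W], of "\<lambda>j. u $ j" b UNIV "z i"] \<iota>_expand[of u] by (simp add: \<mu>_def)
  moreover have "u $ i = 0" if "i \<notin> S" for i using u[of i] that I1(2) by (simp add: \<mu>_def sect)
  ultimately show "u = 0" using z by blast
 qed
 then have det0: "det (?A \<omega>\<^sub>0) \<noteq> 0"
  using matrix_left_invertible_ker[of "?A \<omega>\<^sub>0"] invertible_left_inverse[of "?A \<omega>\<^sub>0"] invertible_det_nz[of "?A \<omega>\<^sub>0"] by blast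
 have "\<exists>D k. hp_on W k D \<and> D \<omega>\<^sub>0 \<noteq> 0 \<and>
  (\<forall>\<omega> a. D \<omega> \<noteq> 0 --> (\<forall>y. (\<Sum>e\<in>A. a e * M \<omega> e y) = 0) --> (\<forall>e\<in>A. a e = 0))"
 proof (rule independence_open[OF S(1) hp_on_M])
  fix a assume a: "\<forall>y. (\<Sum>e\<in>A. a e * M \<omega>\<^sub>0 e y) = 0"
  let ?e = "\<lambda>y. \<Sum>e\<in>A. a e * e y"
  have eq: "?e = (\<Sum>e\<in>A. fsc (a e) e)" by (simp add: fun_eq_iff fun_sum_apply)
  have "?e \<in> E" unfolding eq using S(2) by (intro fs.subspace_sum[OF subspace_E] fs.subspace_scale[OF subspace_E]) blast
  moreover have "M \<omega>\<^sub>0 ?e y = 0" for y unfolding M_sum[OF S(1)] using a by blast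
  ultimately obtain w where w: "\<forall>y. ?e y = L \<omega>\<^sub>0 (\<iota> w) y" using exact by blast
  have "L \<omega>\<^sub>0 (\<iota> w) = (\<Sum>j\<in>UNIV. fsc (w $ j) (?g j))"
   by (rule ext) (simp add: \<iota>_expand[of w] lin_sum[OF lin_L[OF \<omega>\<^sub>0W]] fun_sum_apply del: vec_lambda_beta)
  also have "\<dots> \<in> fs.span (?g ` S)" using S(7) by (intro fs.span_sum fs.span_scale) blast
  finally have *: "L \<omega>\<^sub>0 (\<iota> w) \<in> fs.span (?g ` S)" .
  have **: "?e = L \<omega>\<^sub>0 (\<iota> w)" using w by (intro ext) blast
  have "?e \<in> fs.span (?g ` S)" by (rule ssubst[OF **, of "\<lambda>e. e \<in> fs.span (?g ` S)"]) (rule *)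
  then obtain c where c: "?e = (\<Sum>v\<in>?g ` S. fsc (c v) v)" using fs.span_finite[of "?g ` S"] by auto
  have dis: "?g ` S \<inter> A = {}" using S(3) by blast
  let ?c = "\<lambda>v. if v \<in> A then a v else - c v"
  have "(\<Sum>v\<in>?g ` S \<union> A. fsc (?c v) v) = (\<Sum>v\<in>?g ` S. fsc (?c v) v) + (\<Sum>v\<in>A. fsc (?c v) v)"
   using S(1) dis by (intro sum.union_disjoint) auto
  also have "(\<Sum>v\<in>A. fsc (?c v) v) = ?e" unfolding eq by simp
  also have "(\<Sum>v\<in>?g ` S. fsc (?c v) v) = - (\<Sum>v\<in>?g ` S. fsc (c v) v)"
   unfolding sum_negf[symmetric] using dis by (intro sum.cong) (auto simp: fun_eq_iff)
  also have "- (\<Sum>v\<in>?g ` S. fsc (c v) v) + ?e = 0" unfolding c by (rule left_minus)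
  finally have "(\<Sum>v\<in>?g ` S \<union> A. fsc (?c v) v) = 0" .
  then have "?c v = 0" if "v \<in> A" for v
   using fs.independentD[OF S(5) finB subset_refl, of ?c v] that by blast
  then show "\<forall>e\<in>A. a e = 0" by simp
 qed
 then obtain D m where D: "hp_on W m D" "D \<omega>\<^sub>0 \<noteq> 0"
  "\<forall>\<omega> a. D \<omega> \<noteq> 0 --> (\<forall>y. (\<Sum>e\<in>A. a e * M \<omega> e y) = 0) --> (\<forall>e\<in>A. a e = 0)" by blast
 \<comment> \<open>Three open conditions: \<open>D\<close> keeps \<open>M \<omega>\<close> injective
   on the span of \<open>A\<close>, the determinant allows solving for \<rho>, and the last factor
   provides a list on which \<open>dform q \<omega>\<close> is non-zero.\<close>
 define \<Delta> where "\<Delta> \<omega> = D \<omega> * det (?A \<omega>) * dform q \<omega> x1 (map b I1)" for \<omega>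
 define num where "num \<omega> v j = det (\<chi> i l. if l = j then ?\<mu> i \<omega> v else ?A \<omega> $ i $ l)" for \<omega> v j
 define \<rho> where "\<rho> \<omega> v = (\<chi> j. num \<omega> v j / det (?A \<omega>))" for \<omega> v
 have hdet: "hp_on W (CARD('n) * 1) (\<lambda>\<omega>. det (?A \<omega>))" unfolding Amat_def by (rule hp_on_det[OF hp_on_\<mu>])
 have hnum: "hp_on W (CARD('n) * 1) (\<lambda>\<omega>. num \<omega> v j)" for v j
 proof -
  have "hp_on W 1 (\<lambda>\<omega>. if l = j then ?\<mu> i \<omega> v else ?A \<omega> $ i $ l)" for i l
   unfolding Amat_def using hp_on_\<mu>[of S z x1 I1 i v] hp_on_\<mu>[of S z x1 I1 i "b l"] by (cases "l = j") simp_all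
  then show ?thesis unfolding num_def by (rule hp_on_det)
 qed
 have \<Delta>: "hp_on W (m + CARD('n) * 1 + 1) \<Delta>" unfolding \<Delta>_def[abs_def] by (intro hp_on_mult D hdet hp_on_dform)
 have \<Delta>0: "\<Delta> \<omega>\<^sub>0 \<noteq> 0" using D(2) det0 I1 by (simp add: \<Delta>_def)
 have nz: "D \<omega> \<noteq> 0" "det (?A \<omega>) \<noteq> 0" "dform q \<omega> x1 (map b I1) \<noteq> 0" if "\<Delta> \<omega> \<noteq> 0" for \<omega>
  using that by (auto simp: \<Delta>_def)
 have A\<rho>: "?A \<omega> *v \<rho> \<omega> v = (\<chi> i. ?\<mu> i \<omega> v)" if "det (?A \<omega>) \<noteq> 0" for \<omega> v
 proof -
  have "\<rho> \<omega> v = (\<chi> j. det (\<chi> i l. if l = j then (\<chi> i. ?\<mu> i \<omega> v) $ i else ?A \<omega> $ i $ l) / det (?A \<omega>))"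
   unfolding \<rho>_def num_def vec_lambda_beta ..
  then show ?thesis by (rule iffD2[OF cramer[OF that]])
 qed
 have A_inj: "u = v" if "det (?A \<omega>) \<noteq> 0" "?A \<omega> *v u = ?A \<omega> *v v" for \<omega> u v
  by (rule trans[OF iffD1[OF cramer[OF that(1)] that(2)] iffD1[OF cramer[OF that(1)] refl, symmetric]])
 have \<rho>_lmap: "lmap (\<rho> \<omega>)" if \<omega>: "\<omega> \<in> W" "det (?A \<omega>) \<noteq> 0" for \<omega>
 proof (rule lmapI)
  fix x y and c :: complex
  show "\<rho> \<omega> (x + y) = \<rho> \<omega> x + \<rho> \<omega> y"
   by (rule A_inj[OF \<omega>(2)])
    (simp add: A\<rho>[OF \<omega>(2)] matrix_vector_right_distrib lin_simps[OF lin_\<mu>[OF \<omega>(1)]] vec_eq_iff)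
  show "\<rho> \<omega> (c *s x) = c *s \<rho> \<omega> x"
   by (rule A_inj[OF \<omega>(2)])
    (simp add: A\<rho>[OF \<omega>(2)] vec.scale lin_simps[OF lin_\<mu>[OF \<omega>(1)]] vec_eq_iff)
 qed
 have \<rho>_\<iota>: "\<rho> \<omega> (\<iota> u) = u" if \<omega>: "\<omega> \<in> W" "det (?A \<omega>) \<noteq> 0" for \<omega> u
  by (rule A_inj[OF \<omega>(2)]) (simp only: A\<rho>[OF \<omega>(2)], simp only: Amat_mult[OF \<omega>(1)])
 have \<rho>0: "\<rho> \<omega>\<^sub>0 = \<pi>"
 proof
  fix v
  have *: "?\<mu> i \<omega>\<^sub>0 (\<iota> (\<pi> v)) = ?\<mu> i \<omega>\<^sub>0 v" for i by (simp add: \<mu>_def sect L_0_\<pi>[symmetric])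
  show "\<rho> \<omega>\<^sub>0 v = \<pi> v"
   by (rule A_inj[OF det0]) (simp only: A\<rho>[OF det0], simp only: Amat_mult[OF \<omega>\<^sub>0W] *)
 qed
 have pull: "\<omega> = pullback (\<rho> \<omega>) (pullback \<iota> \<omega>)" if \<omega>: "folform q d \<omega>" "\<Delta> \<omega> \<noteq> 0" for \<omega>
 proof -
  have \<omega>W: "\<omega> \<in> W" using \<omega>(1) by (simp add: folform_def)
  have hom: "hom_form p k (dform q \<omega>)" by (rule dform_hom[OF \<omega>W])
  have ex: "exchange p p (dform q \<omega>) (dform q \<omega>)" by (rule folform_dform(3)[OF \<omega>(1)])
  have K: "\<omega> x ((v - \<iota> (\<rho> \<omega> v)) # js) = 0" for x v js
  proof (rule dform_kernel[OF \<omega>(1)])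
   fix x and js :: "(complex^'k) list"
   let ?w = "v - \<iota> (\<rho> \<omega> v)"
   have "?\<mu> i \<omega> (\<iota> (\<rho> \<omega> v)) = ?\<mu> i \<omega> v" for i
    using A\<rho>[OF nz(2)[OF \<omega>(2)], of v] unfolding Amat_mult[OF \<omega>W] by (simp add: vec_eq_iff)
   then have w: "?\<mu> i \<omega> ?w = 0" for i by (simp add: lin_simps(4)[OF lin_\<mu>[OF \<omega>W]])
   have L0: "L \<omega> ?w y = 0" for y
    by (rule selected_functionals_suffice[OF S(1-4,6) \<omega>W ex _ nz(2)[OF \<omega>(2)] w]) (use D(3) nz(1)[OF \<omega>(2)] in blast)
   show "dform q \<omega> x (?w # js) = 0"
   proof (rule exchange_kernel[OF hom ex _ nz(3)[OF \<omega>(2)]])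
    show "length (map b I1) = p" using I1(1) by simp
    show "dform q \<omega> x (?w # take a (map b I1) @ drop (Suc a) (map b I1)) = 0" for x a
     using L0[of "(x, take a I1 @ drop (Suc a) I1)"] by (simp add: L_def take_map drop_map)
   qed
  qed
  have inv: "\<omega> (\<iota> (\<rho> \<omega> x)) ws = \<omega> x ws" for x ws
   using kernel_invariant[OF \<omega>(1) q K, of "\<iota> (\<rho> \<omega> x)" 1 x ws] by simp
  have "\<omega> x (map (\<lambda>v. \<iota> (\<rho> \<omega> v)) vs) = \<omega> x vs" for x vs
  proof (cases "length vs = q")
   case True
   show ?thesis by (rule alt_map_kernel[OF hom_form_alt[OF twisted_hom_form[OF \<omega>W]] K True])
  qed (simp add: hom_form_length[OF twisted_hom_form[OF \<omega>W]])
  then show ?thesis using inv by (simp add: pullback_def fun_eq_iff o_def)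
 qed
 \<comment> \<open>A polynomial of degree \<open>j\<close> in the entries of
   \<open>\<rho> \<omega>\<close> has the power \<open>j\<close> of the determinant as denominator;
   clearing it leaves degree \<open>j * CARD('n)\<close> in \<omega>.\<close>
 have poly: "\<exists>F. hp_on W (j * CARD('n)) F \<and> (\<forall>\<omega>\<in>W. \<Delta> \<omega> \<noteq> 0 --> F \<omega> = det (?A \<omega>) ^ j * P (\<rho> \<omega>))"
  if "hom_poly map_scale j P" for j P
  using that
 proof (induction rule: hom_poly.induct)
  case (const c)
  show ?case by (intro exI[of _ "\<lambda>_. c"] conjI) (simp_all add: hp_on_const)
 next
  case (linear l)
  interpret l: Vector_Spaces.linear map_scale "(*)" l by fact
  let ?E = "\<lambda>a j v. v $ a *s ax j :: complex^'n"
  let ?F = "\<lambda>\<omega>. \<Sum>a\<in>UNIV. \<Sum>j\<in>UNIV. l (?E a j) * num \<omega> (ax a) j"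
  have "hp_on W (1 * CARD('n)) ?F" using hnum by (intro hp_on_sum hp_on_scale) simp
  moreover have "?F \<omega> = det (?A \<omega>) ^ 1 * l (\<rho> \<omega>)" if \<omega>: "\<omega> \<in> W" "\<Delta> \<omega> \<noteq> 0" for \<omega>
  proof -
   have num: "num \<omega> v j = det (?A \<omega>) * \<rho> \<omega> v $ j" for v j using nz(2)[OF \<omega>(2)] by (simp add: \<rho>_def)
   have "\<rho> \<omega> = (\<Sum>a\<in>UNIV. \<Sum>j\<in>UNIV. map_scale (\<rho> \<omega> (ax a) $ j) (?E a j))"
   proof (intro ext)
    fix v
    have "\<rho> \<omega> v = (\<Sum>a\<in>UNIV. v $ a *s \<rho> \<omega> (ax a))"
     by (subst basis_expansion[symmetric, of v]) (simp only: lmap_simps[OF \<rho>_lmap[OF \<omega>(1) nz(2)[OF \<omega>(2)]]])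
    also have "\<dots> = (\<Sum>a\<in>UNIV. \<Sum>j\<in>UNIV. map_scale (\<rho> \<omega> (ax a) $ j) (?E a j)) v"
    proof -
     have "v $ a *s \<rho> \<omega> (ax a) = (\<Sum>j\<in>UNIV. \<rho> \<omega> (ax a) $ j *s ?E a j v)" for a
      by (subst basis_expansion[symmetric, of "\<rho> \<omega> (ax a)"])
       (simp add: vec.scale_sum_right vector_smult_assoc mult.commute del: vec_lambda_beta)
     then show ?thesis by (simp add: fun_sum_apply map_scale_def)
    qed
    finally show "\<rho> \<omega> v = (\<Sum>a\<in>UNIV. \<Sum>j\<in>UNIV. map_scale (\<rho> \<omega> (ax a) $ j) (?E a j)) v" .
   qed
   then have "l (\<rho> \<omega>) = l (\<Sum>a\<in>UNIV. \<Sum>j\<in>UNIV. map_scale (\<rho> \<omega> (ax a) $ j) (?E a j))" by (rule arg_cong)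
   also have "\<dots> = (\<Sum>a\<in>UNIV. \<Sum>j\<in>UNIV. \<rho> \<omega> (ax a) $ j * l (?E a j))" by (simp only: l.sum l.scale)
   finally show ?thesis unfolding num by (simp add: sum_distrib_left mult_ac)
  qed
  ultimately show ?case by blast
 next
  case (add j P Q)
  then obtain F G where "hp_on W (j * CARD('n)) F" "hp_on W (j * CARD('n)) G"
   "\<forall>\<omega>\<in>W. \<Delta> \<omega> \<noteq> 0 --> F \<omega> = det (?A \<omega>) ^ j * P (\<rho> \<omega>)" "\<forall>\<omega>\<in>W. \<Delta> \<omega> \<noteq> 0 --> G \<omega> = det (?A \<omega>) ^ j * Q (\<rho> \<omega>)" by blast
  then show ?case by (intro exI[of _ "\<lambda>\<omega>. F \<omega> + G \<omega>"]) (simp add: hp_on_add distrib_left)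
 next
  case (mult j P l Q)
  then obtain F G where "hp_on W (j * CARD('n)) F" "hp_on W (l * CARD('n)) G"
   "\<forall>\<omega>\<in>W. \<Delta> \<omega> \<noteq> 0 --> F \<omega> = det (?A \<omega>) ^ j * P (\<rho> \<omega>)" "\<forall>\<omega>\<in>W. \<Delta> \<omega> \<noteq> 0 --> G \<omega> = det (?A \<omega>) ^ l * Q (\<rho> \<omega>)" by blast
  then show ?case using hp_on_mult[of W "j * CARD('n)" F "l * CARD('n)" G]
   by (intro exI[of _ "\<lambda>\<omega>. F \<omega> * G \<omega>"] conjI ballI impI) (simp_all add: add_mult_distrib power_add)
 qed
 have 4: "\<exists>F m. hp_on W m F \<and> (\<forall>\<omega>\<in>W. \<Delta> \<omega> \<noteq> 0 --> (F \<omega> = 0 \<longleftrightarrow> P (\<rho> \<omega>) = 0))" if "hom_poly map_scale j P" for j P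
  using poly[OF that] nz(2) by (metis mult_eq_0_iff power_not_zero)
 show ?thesis
  by (intro exI[of _ \<Delta>] exI[of _ "m + CARD('n) * 1 + 1"] exI[of _ \<rho>] conjI \<Delta> \<Delta>0 \<rho>0)
   (use \<rho>_lmap \<rho>_\<iota> nz(2) pull 4 in blast)+
qed

end

section \<open>Polynomial criteria for irreducibility\<close>

abbreviation fpt :: "'n::finite form => 'n form set" where "fpt \<equiv> proj_point form_scale"

lemma fpt_self: "\<omega> \<in> fpt \<omega>"
 unfolding proj_point_def by (intro CollectI exI[of _ 1]) (simp add: form_scale_def)

lemma proj_open_nbhd:
 assumes "vector_space s" "openin (proj_zariski s W) V" "proj_point s x \<in> V"
 shows "\<exists>k p. hom_poly s k p \<and> p x \<noteq> 0 \<and> (\<forall>y\<in>W. y \<noteq> 0 --> p y \<noteq> 0 --> proj_point s y \<in> V)"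
proof -
 interpret vector_space s by fact
 obtain S where S: "V \<subseteq> proj_space s W" "\<forall>p\<in>S. \<exists>k. hom_poly s k p"
  "proj_space s W - V = {g \<in> proj_space s W. \<forall>p\<in>S. \<forall>x\<in>g. p x = 0}"
  using assms(2) unfolding openin_proj_zariski by blast
 have "proj_point s x \<notin> {g \<in> proj_space s W. \<forall>p\<in>S. \<forall>x\<in>g. p x = 0}" using assms(3) S(3) by blast
 then obtain p z where p: "p \<in> S" "z \<in> proj_point s x" "p z \<noteq> 0" using assms(3) S(1) by blast
 obtain k where k: "hom_poly s k p" using S(2) p(1) by blast
 obtain c where "z = s c x" using p(2) unfolding proj_point_def by blast
 then have "p x \<noteq> 0" using p(3) hom_poly_scale[OF k] by auto
 moreover have "proj_point s y \<in> V" if y: "y \<in> W" "y \<noteq> 0" "p y \<noteq> 0" for y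
 proof (rule ccontr)
  assume n: "proj_point s y \<notin> V"
  have "proj_point s y \<in> proj_space s W" using y unfolding proj_space_def by blast
  then have "proj_point s y \<in> {g \<in> proj_space s W. \<forall>p\<in>S. \<forall>x\<in>g. p x = 0}" using n S(3) by blast
  moreover have "y \<in> proj_point s y" unfolding proj_point_def by (intro CollectI exI[of _ 1]) simp
  ultimately show False using p(1) y(3) by blast
 qed
 ultimately show ?thesis using k by blast
qed

lemma hom_poly_fpt: "hom_poly form_scale k p ==> \<eta> \<in> fpt \<omega> ==> p \<eta> = 0 \<longleftrightarrow> p \<omega> = 0"
 unfolding proj_point_def by (auto simp: hom_poly_scale)

lemma folform_pos: "folform q d \<omega> ==> \<omega> \<in> twisted_forms q d - {0}"
 by (simp add: folform_def)

context
 fixes q d :: nat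
 assumes q: "1 \<le> q"
begin

abbreviation "folspace \<equiv> foliation_space q d"

lemma fol_iff:
 assumes "CARD('n::finite) \<ge> 2"
 shows "g \<in> foliations q d \<longleftrightarrow> (\<exists>\<omega>::'n form. folform q d \<omega> \<and> g = fpt \<omega>)"
 unfolding foliations_folform[OF q assms] by blast

lemma topspace_fol:
 assumes "CARD('n::finite) \<ge> 2"
 shows "topspace folspace = (foliations q d :: 'n form set set)"
proof -
 have "openin (proj_zariski form_scale (twisted_forms q d :: 'n form set)) (proj_space form_scale (twisted_forms q d))"
  unfolding openin_proj_zariski
 proof (intro conjI exI[of _ "{\<lambda>_. 1}"])
  show "\<forall>p\<in>{\<lambda>_ :: 'n form. 1}. \<exists>k. hom_poly form_scale k p" using hom_poly.const by blast
  have "\<exists>x. x \<in> g" if "g \<in> proj_space form_scale (twisted_forms q d :: 'n form set)" for g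
   using that fpt_self unfolding proj_space_def by blast
  then show "proj_space form_scale (twisted_forms q d :: 'n form set) - proj_space form_scale (twisted_forms q d) =
    {g \<in> proj_space form_scale (twisted_forms q d). \<forall>p\<in>{\<lambda>_. 1}. \<forall>x\<in>g. p x = (0 :: complex)}" by auto
 qed simp
 then have "proj_space form_scale (twisted_forms q d :: 'n form set) \<subseteq> topspace (proj_zariski form_scale (twisted_forms q d))"
  by (rule openin_subset)
 moreover have "foliations q d \<subseteq> proj_space form_scale (twisted_forms q d :: 'n form set)"
  unfolding foliations_folform[OF q assms] proj_space_def using folform_pos by blast
 ultimately show ?thesis unfolding foliation_space_def by auto
qed

lemma open_nbhd:
 fixes \<omega> :: "'n::finite form"
 assumes card: "CARD('n) \<ge> 2" and U: "openin folspace U" "fpt \<omega> \<in> U"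
 shows "\<exists>k p. hom_poly form_scale k p \<and> p \<omega> \<noteq> 0 \<and> (\<forall>\<eta>. folform q d \<eta> --> p \<eta> \<noteq> 0 --> fpt \<eta> \<in> U)"
proof -
 obtain V where V: "openin (proj_zariski form_scale (twisted_forms q d :: 'n form set)) V" "U = V \<inter> foliations q d"
  using U(1) unfolding foliation_space_def openin_subtopology by blast
 have "fpt \<omega> \<in> V" using U(2) V(2) by blast
 from proj_open_nbhd[OF vector_space_form_scale V(1) this] obtain k p where
  p: "hom_poly form_scale k p" "p \<omega> \<noteq> 0" "\<forall>y\<in>twisted_forms q d. y \<noteq> 0 --> p y \<noteq> 0 --> fpt y \<in> V" by blast
 have "fpt \<eta> \<in> U" if "folform q d \<eta>" "p \<eta> \<noteq> 0" for \<eta>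
  using that p(3) folform_pos[OF that(1)] fol_iff[OF card] unfolding V(2) by blast
 then show ?thesis using p(1,2) by blast
qed

lemma open_poly:
 fixes F :: "'n::finite form => complex"
 assumes card: "CARD('n) \<ge> 2" and F: "hp_on (twisted_forms q d) k F"
 shows "openin folspace {fpt \<omega> | \<omega>. folform q d \<omega> \<and> F \<omega> \<noteq> 0}"
proof -
 obtain p where p: "hom_poly form_scale k p" "\<forall>\<omega>\<in>twisted_forms q d. F \<omega> = p \<omega>" using hp_onE[OF F] .
 let ?P = "proj_space form_scale (twisted_forms q d :: 'n form set)"
 let ?V = "{g \<in> ?P. \<exists>x\<in>g. p x \<noteq> 0}"
 have "openin (proj_zariski form_scale (twisted_forms q d)) ?V"
  unfolding openin_proj_zariski by (intro conjI exI[of _ "{p}"]) (use p(1) in auto)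
 moreover have "{fpt \<omega> | \<omega>. folform q d \<omega> \<and> F \<omega> \<noteq> 0} = ?V \<inter> foliations q d"
 proof (intro set_eqI iffI)
  fix g assume "g \<in> {fpt \<omega> | \<omega>. folform q d \<omega> \<and> F \<omega> \<noteq> 0}"
  then obtain \<omega> where \<omega>: "g = fpt \<omega>" "folform q d \<omega>" "F \<omega> \<noteq> 0" by blast
  have "p \<omega> \<noteq> 0" using \<omega>(3) p(2) folform_pos[OF \<omega>(2)] by auto
  moreover have "g \<in> ?P" using \<omega>(1) folform_pos[OF \<omega>(2)] unfolding proj_space_def by blast
  ultimately show "g \<in> ?V \<inter> foliations q d" using fpt_self[of \<omega>] fol_iff[OF card, of g] \<omega>(1,2) by blast
 next
  fix g assume g: "g \<in> ?V \<inter> foliations q d"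
  then obtain \<omega> where \<omega>: "folform q d \<omega>" "g = fpt \<omega>" using fol_iff[OF card, of g] by blast
  obtain x where "x \<in> g" "p x \<noteq> 0" using g by blast
  then have "p \<omega> \<noteq> 0" using hom_poly_fpt[OF p(1)] \<omega>(2) by blast
  then have "F \<omega> \<noteq> 0" using p(2) folform_pos[OF \<omega>(1)] by auto
  then show "g \<in> {fpt \<omega> | \<omega>. folform q d \<omega> \<and> F \<omega> \<noteq> 0}" using \<omega> by blast
 qed
 ultimately show ?thesis unfolding foliation_space_def openin_subtopology by blast
qed

text \<open>Irreducibility as the meeting of non-empty open subsets, tested on the sets where a
  homogeneous polynomial on the space of forms is non-zero.\<close>

lemma irreducible_setI_poly:
 fixes C :: "'n::finite form set set"
 assumes card: "CARD('n) \<ge> 2" and C: "C \<subseteq> foliations q d" "C \<noteq> {}"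
  and meet: "\<And>k l p p' \<omega> \<omega>'. hom_poly form_scale k p ==> hom_poly form_scale l p' ==> folform q d \<omega> ==> folform q d \<omega>' ==>
   fpt \<omega> \<in> C ==> fpt \<omega>' \<in> C ==> p \<omega> \<noteq> 0 ==> p' \<omega>' \<noteq> 0 ==> \<exists>\<eta>. folform q d \<eta> \<and> fpt \<eta> \<in> C \<and> p \<eta> \<noteq> 0 \<and> p' \<eta> \<noteq> 0"
 shows "irreducible_set folspace C"
 unfolding irreducible_set_def
proof (intro conjI allI impI)
 show "C \<subseteq> topspace folspace" using C(1) topspace_fol[OF card] by simp
 fix A B assume AB: "closedin folspace A \<and> closedin folspace B \<and> C \<subseteq> A \<union> B"
 show "C \<subseteq> A \<or> C \<subseteq> B"
 proof (rule ccontr)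
  assume "\<not> ?thesis"
  then obtain g g' where g: "g \<in> C" "g \<notin> A" "g' \<in> C" "g' \<notin> B" by blast
  obtain \<omega> where \<omega>: "folform q d \<omega>" "g = fpt \<omega>" using g(1) C(1) fol_iff[OF card, of g] by blast
  obtain \<omega>' where \<omega>': "folform q d \<omega>'" "g' = fpt \<omega>'" using g(3) C(1) fol_iff[OF card, of g'] by blast
  have o: "openin folspace (topspace folspace - A)" "openin folspace (topspace folspace - B)" using AB by auto
  have m: "fpt \<omega> \<in> topspace folspace - A" "fpt \<omega>' \<in> topspace folspace - B" using g C(1) topspace_fol[OF card] \<omega>(2) \<omega>'(2) by auto
  obtain k p where p: "hom_poly form_scale k p" "p \<omega> \<noteq> 0" "\<forall>\<eta>. folform q d \<eta> --> p \<eta> \<noteq> 0 --> fpt \<eta> \<in> topspace folspace - A"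
   using open_nbhd[OF card o(1) m(1)] by blast
  obtain l p' where p': "hom_poly form_scale l p'" "p' \<omega>' \<noteq> 0" "\<forall>\<eta>. folform q d \<eta> --> p' \<eta> \<noteq> 0 --> fpt \<eta> \<in> topspace folspace - B"
   using open_nbhd[OF card o(2) m(2)] by blast
  obtain \<eta> where "folform q d \<eta>" "fpt \<eta> \<in> C" "p \<eta> \<noteq> 0" "p' \<eta> \<noteq> 0"
   using meet[OF p(1) p'(1) \<omega>(1) \<omega>'(1) _ _ p(2) p'(2)] g(1,3) \<omega>(2) \<omega>'(2) by blast
  then show False using p(3) p'(3) AB by blast
 qed
qed (use C(2) in simp)

lemma irreducible_meet:
 fixes C :: "'n::finite form set set"
 assumes card: "CARD('n) \<ge> 2" and C: "irreducible_set folspace C"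
  and F: "hp_on (twisted_forms q d) k F" "hp_on (twisted_forms q d) l G"
  and \<omega>: "folform q d \<omega>" "fpt \<omega> \<in> C" "F \<omega> \<noteq> 0" and \<omega>': "folform q d \<omega>'" "fpt \<omega>' \<in> C" "G \<omega>' \<noteq> 0"
 shows "\<exists>\<eta>. folform q d \<eta> \<and> fpt \<eta> \<in> C \<and> F \<eta> \<noteq> 0 \<and> G \<eta> \<noteq> 0"
proof (rule ccontr)
 assume n: "\<not> ?thesis"
 let ?O = "\<lambda>F. {fpt \<omega> | \<omega>. folform q d \<omega> \<and> F \<omega> \<noteq> (0::complex)}"
 have cl: "closedin folspace (topspace folspace - ?O F)" "closedin folspace (topspace folspace - ?O G)"
  using open_poly[OF card F(1)] open_poly[OF card F(2)] by (auto intro: closedin_diff)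
 have CX: "C \<subseteq> topspace folspace" using C unfolding irreducible_set_def by blast
 have "C \<subseteq> (topspace folspace - ?O F) \<union> (topspace folspace - ?O G)"
 proof
  fix g assume g: "g \<in> C"
  have "\<not> (g \<in> ?O F \<and> g \<in> ?O G)"
  proof
   assume "g \<in> ?O F \<and> g \<in> ?O G"
   then obtain \<eta> \<eta>' where \<eta>: "g = fpt \<eta>" "folform q d \<eta>" "F \<eta> \<noteq> 0" "g = fpt \<eta>'" "folform q d \<eta>'" "G \<eta>' \<noteq> 0" by blast
   obtain p where p: "hom_poly form_scale l p" "\<forall>\<omega>\<in>twisted_forms q d. G \<omega> = p \<omega>" using hp_onE[OF F(2)] .
   have "\<eta> \<in> fpt \<eta>'" using \<eta>(1,4) fpt_self by blast
   then have "G \<eta> \<noteq> 0" using hom_poly_fpt[OF p(1), of \<eta> \<eta>'] p(2) \<eta>(6) folform_pos[OF \<eta>(2)] folform_pos[OF \<eta>(5)] by auto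
   then show False using n \<eta>(1-3) g by blast
  qed
  then show "g \<in> (topspace folspace - ?O F) \<union> (topspace folspace - ?O G)" using g CX by blast
 qed
 then have "C \<subseteq> topspace folspace - ?O F \<or> C \<subseteq> topspace folspace - ?O G" using C cl unfolding irreducible_set_def by blast
 then show False using \<omega> \<omega>' by blast
qed

end

text \<open>Zorn's lemma applies because in a chain a member outside \<open>A\<close> and a member
  outside \<open>B\<close> lie in a common member, so the union is irreducible.\<close>

lemma irreducible_component_exists:
 assumes S: "irreducible_set T S"
 shows "\<exists>C. irreducible_component T C \<and> S \<subseteq> C"
proof -
 let ?A = "{D. irreducible_set T D \<and> S \<subseteq> D}"
 have "\<exists>M\<in>?A. \<forall>Y\<in>?A. M \<subseteq> Y --> Y = M"
 proof (rule subset_Zorn_nonempty)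
  show "?A \<noteq> {}" using S by blast
  fix K assume K: "K \<noteq> {}" "subset.chain ?A K"
  have KA: "K \<subseteq> ?A" using K(2) unfolding subset.chain_def by blast
  have cmp: "D \<subseteq> D' \<or> D' \<subseteq> D" if "D \<in> K" "D' \<in> K" for D D' using K(2) that unfolding subset_chain_def by blast
  have "irreducible_set T (\<Union>K)" unfolding irreducible_set_def
  proof (intro conjI allI impI)
   show "\<Union>K \<subseteq> topspace T" using KA unfolding irreducible_set_def by blast
   show "\<Union>K \<noteq> {}" using K(1) KA unfolding irreducible_set_def by blast
   fix A B assume AB: "closedin T A \<and> closedin T B \<and> \<Union>K \<subseteq> A \<union> B"
   show "\<Union>K \<subseteq> A \<or> \<Union>K \<subseteq> B"
   proof (rule ccontr)
    assume "\<not> ?thesis"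
    then obtain D D' where D: "D \<in> K" "\<not> D \<subseteq> A" "D' \<in> K" "\<not> D' \<subseteq> B" by blast
    then obtain D'' where D'': "D'' \<in> K" "\<not> D'' \<subseteq> A" "\<not> D'' \<subseteq> B" using cmp[of D D'] by blast
    then have "irreducible_set T D''" "D'' \<subseteq> A \<union> B" using KA AB by blast+
    then show False using D'' AB unfolding irreducible_set_def by blast
   qed
  qed
  then show "\<Union>K \<in> ?A" using K(1) KA by blast
 qed
 then obtain M where M: "M \<in> ?A" "\<forall>Y\<in>?A. M \<subseteq> Y --> Y = M" by blast
 have "irreducible_component T M" unfolding irreducible_component_def
 proof (intro conjI allI impI)
  show "irreducible_set T M" using M(1) by blast
  fix D assume "irreducible_set T D \<and> M \<subseteq> D"
  then show "D = M" using M by blast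
 qed
 then show ?thesis using M(1) by blast
qed

section \<open>Pull-back and restriction of foliations\<close>

lemma affine_sing_pullback:
 fixes \<pi> :: "complex^'k::finite => complex^'n::finite"
 assumes "\<And>x. \<pi> (\<iota> x) = x"
 shows "x \<in> affine_sing (pullback \<pi> \<omega>) \<longleftrightarrow> \<pi> x \<in> affine_sing \<omega>"
proof
 assume "x \<in> affine_sing (pullback \<pi> \<omega>)"
 then have "\<omega> (\<pi> x) (map \<pi> (map \<iota> vs)) = 0" for vs unfolding affine_sing_def pullback_def by blast
 then show "\<pi> x \<in> affine_sing \<omega>" by (simp add: affine_sing_def assms o_def)
qed (simp add: affine_sing_def pullback_def)

lemma pullback_0: "pullback \<pi> (0 :: 'n::finite form) = 0"
 by (simp add: pullback_def fun_eq_iff)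

lemma folform_pullback:
 fixes \<pi> :: "complex^'k::finite => complex^'n::finite"
 assumes \<omega>: "folform q d \<omega>" and \<pi>: "lmap \<pi>" and sect: "\<And>x. \<pi> (\<iota> x) = x"
 shows "folform q d (pullback \<pi> \<omega>)"
 unfolding folform_def
proof (intro conjI)
 have ncd: "no_common_divisor (affine_sing \<omega>)" using \<omega> by (simp add: folform_def)
 show "pullback \<pi> \<omega> \<in> twisted_forms q d" using \<omega> by (intro twisted_pullback \<pi>) (simp add: folform_def)
 show "exchange q q (pullback \<pi> \<omega>) (pullback \<pi> \<omega>)" using \<omega> by (intro exchange_pullback) (simp add: folform_def)
 show "exchange q (Suc q) (pullback \<pi> \<omega>) (ext_deriv (pullback \<pi> \<omega>))"
  unfolding ext_deriv_pullback[OF \<pi>] using \<omega> by (intro exchange_pullback) (simp add: folform_def)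
 show "pullback \<pi> \<omega> \<noteq> 0"
 proof
  assume "pullback \<pi> \<omega> = 0"
  then have "pullback \<iota> (pullback \<pi> \<omega>) = 0" by (simp add: pullback_0)
  then have "\<omega> = 0" by (simp add: pullback_def sect o_def)
  then show False using \<omega> by (simp add: folform_def)
 qed
 show "no_common_divisor (affine_sing (pullback \<pi> \<omega>))" unfolding no_common_divisor_def
 proof (intro allI impI)
  fix v :: "complex^'k" assume "v \<noteq> 0"
  obtain i :: 'n where True by blast
  \<comment> \<open>If \<pi> collapses \<open>v\<close>, every pulled back polynomial is invariant
    along \<open>v\<close>, and any direction of the base will do.\<close>
  define u where "u = (if \<pi> v = 0 then ax i else \<pi> v)"
  have "u \<noteq> 0" by (simp add: u_def axis_eq_0_iff)
  then obtain g where g: "g \<in> inv_dir u" "g \<noteq> 0" "\<forall>x\<in>affine_sing \<omega>. g x = 0" using ncd unfolding no_common_divisor_def by blast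
  have gp: "pf g" "g (x + t *s u) = g x" for x t using g(1) by (simp_all add: inv_dir_def)
  have "g (\<pi> (x + t *s v)) = g (\<pi> x)" for x t
   using gp(2)[of "\<pi> x" t] by (cases "\<pi> v = 0") (simp_all add: lmap_simps[OF \<pi>] u_def)
  then have "(\<lambda>x. g (\<pi> x)) \<in> inv_dir v" using pf_comp[OF gp(1) \<pi>] by (simp add: inv_dir_def)
  moreover have "(\<lambda>x. g (\<pi> x)) \<noteq> 0"
  proof
   assume *: "(\<lambda>x. g (\<pi> x)) = 0"
   have "g y = 0" for y using fun_cong[OF *, of "\<iota> y"] by (simp add: sect)
   then show False using g(2) by (simp add: fun_eq_iff)
  qed
  moreover have "\<forall>x\<in>affine_sing (pullback \<pi> \<omega>). g (\<pi> x) = 0" using g(3) affine_sing_pullback[of \<pi> \<iota>, OF sect] by blast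
  ultimately show "\<exists>g\<in>inv_dir v. g \<noteq> 0 \<and> (\<forall>x\<in>affine_sing (pullback \<pi> \<omega>). g x = 0)" by blast
 qed
qed

text \<open>An arbitrary restriction may acquire zeros along a divisor. Here the form is the
  pull-back of its restriction, so its singular set is invariant along the kernel of \<rho>, and a
  polynomial vanishing on that set may be restricted to a translate of the section.\<close>

lemma folform_restrict:
 fixes \<rho> :: "complex^'k::finite => complex^'n::finite"
 assumes \<omega>: "folform q d \<omega>" and \<rho>: "lmap \<rho>" and \<iota>: "lmap \<iota>" and sect: "\<And>x. \<rho> (\<iota> x) = x"
  and eq: "\<omega> = pullback \<rho> (pullback \<iota> \<omega>)"
 shows "folform q d (pullback \<iota> \<omega>)"
 unfolding folform_def
proof (intro conjI)
 have ncd: "no_common_divisor (affine_sing \<omega>)" using \<omega> by (simp add: folform_def)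
 show "pullback \<iota> \<omega> \<in> twisted_forms q d" using \<omega> by (intro twisted_pullback \<iota>) (simp add: folform_def)
 show "exchange q q (pullback \<iota> \<omega>) (pullback \<iota> \<omega>)" using \<omega> by (intro exchange_pullback) (simp add: folform_def)
 show "exchange q (Suc q) (pullback \<iota> \<omega>) (ext_deriv (pullback \<iota> \<omega>))"
  unfolding ext_deriv_pullback[OF \<iota>] using \<omega> by (intro exchange_pullback) (simp add: folform_def)
 show "pullback \<iota> \<omega> \<noteq> 0"
 proof
  assume "pullback \<iota> \<omega> = 0"
  then have "\<omega> = 0" using eq pullback_0 by metis
  then show False using \<omega> by (simp add: folform_def)
 qed
 have Z: "x \<in> affine_sing \<omega> \<longleftrightarrow> \<rho> x \<in> affine_sing (pullback \<iota> \<omega>)" for x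
  by (subst eq) (rule affine_sing_pullback[of \<rho> \<iota>, OF sect])
 show "no_common_divisor (affine_sing (pullback \<iota> \<omega>))" unfolding no_common_divisor_def
 proof (intro allI impI)
  fix u :: "complex^'n" assume "u \<noteq> 0"
  then have "\<iota> u \<noteq> 0" using sect[of u] lmap_simps(3)[OF \<rho>] by auto
  then obtain g where g: "g \<in> inv_dir (\<iota> u)" "g \<noteq> 0" "\<forall>x\<in>affine_sing \<omega>. g x = 0" using ncd unfolding no_common_divisor_def by blast
  have gp: "pf g" "g (x + t *s \<iota> u) = g x" for x t using g(1) by (simp_all add: inv_dir_def)
  obtain y where y: "g y \<noteq> 0" using g(2) by (auto simp: fun_eq_iff)
  \<comment> \<open>A translation in the kernel of \<rho> that makes the section pass through
    \<open>y\<close>, where \<open>g\<close> is non-zero.\<close>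
  let ?k = "y - \<iota> (\<rho> y)"
  let ?g = "\<lambda>x. g (\<iota> x + ?k)"
  have "?g (x + t *s u) = ?g x" for x t
   using gp(2)[of "\<iota> x + ?k" t] by (simp add: lmap_simps[OF \<iota>] algebra_simps)
  then have "?g \<in> inv_dir u" using pf_affine[OF gp(1) \<iota>] by (simp add: inv_dir_def)
  moreover have "?g \<noteq> 0"
  proof
   assume "?g = 0"
   from fun_cong[OF this, of "\<rho> y"] show False using y by simp
  qed
  moreover have "\<forall>x\<in>affine_sing (pullback \<iota> \<omega>). ?g x = 0"
  proof
   fix x assume "x \<in> affine_sing (pullback \<iota> \<omega>)"
   then have "\<iota> x + ?k \<in> affine_sing \<omega>" unfolding Z by (simp add: lmap_simps[OF \<rho>] sect)
   then show "?g x = 0" using g(3) by blast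
  qed
  ultimately show "\<exists>g\<in>inv_dir u. g \<noteq> 0 \<and> (\<forall>x\<in>affine_sing (pullback \<iota> \<omega>). g x = 0)" by blast
 qed
qed

lemma linear_section:
 fixes \<pi> :: "complex^'k::finite => complex^'n::finite"
 assumes "lmap \<pi>" "surj \<pi>"
 obtains \<iota> where "lmap \<iota>" "\<forall>x. \<pi> (\<iota> x) = x"
proof -
 have "\<forall>j. \<exists>v. \<pi> v = ax j" using assms(2) by (metis surjD)
 from choice[OF this] obtain f where f: "\<forall>j. \<pi> (f j) = ax j" ..
 define \<iota> where "\<iota> u = (\<Sum>j\<in>UNIV. u $ j *s f j)" for u :: "complex^'n"
 have "lmap \<iota>" by (rule lmapI) (simp_all add: \<iota>_def vec.scale_left_distrib sum.distrib vec.scale_sum_right vector_smult_assoc)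
 moreover have "\<pi> (\<iota> u) = u" for u unfolding \<iota>_def lmap_simps[OF assms(1)] using f by (simp add: basis_expansion)
 ultimately show thesis using that by blast
qed

section \<open>Lines of linear projections\<close>

definition bpoly :: "nat => (complex => complex) => bool" where
 "bpoly m f \<longleftrightarrow> (\<exists>P. degree P \<le> m \<and> (\<forall>t. f t = poly P t))"

lemma bpoly_const: "bpoly m (\<lambda>_. c)"
 unfolding bpoly_def by (rule exI[of _ "[:c:]"]) simp

lemma bpoly_affine: "bpoly 1 (\<lambda>t. a + t * b)"
 unfolding bpoly_def by (rule exI[of _ "[:a, b:]"]) simp

lemma bpoly_add: assumes "bpoly m f" "bpoly m g" shows "bpoly m (\<lambda>t. f t + g t)"
proof -
 obtain P Q where "degree P \<le> m" "\<forall>t. f t = poly P t" "degree Q \<le> m" "\<forall>t. g t = poly Q t"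
  using assms unfolding bpoly_def by blast
 then show ?thesis unfolding bpoly_def by (intro exI[of _ "P + Q"]) (simp add: degree_add_le)
qed

lemma bpoly_mult: assumes "bpoly m f" "bpoly n g" shows "bpoly (m + n) (\<lambda>t. f t * g t)"
proof -
 obtain P Q where *: "degree P \<le> m" "\<forall>t. f t = poly P t" "degree Q \<le> n" "\<forall>t. g t = poly Q t"
  using assms unfolding bpoly_def by blast
 have "degree (P * Q) \<le> m + n" using degree_mult_le[of P Q] *(1,3) by linarith
 then show ?thesis unfolding bpoly_def using * by (intro exI[of _ "P * Q"]) simp
qed

lemma bpoly_sum: "(\<And>i. i \<in> A ==> bpoly m (f i)) ==> bpoly m (\<lambda>t. \<Sum>i\<in>A. f i t)"
 by (induction A rule: infinite_finite_induct) (simp_all add: bpoly_const bpoly_add)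

lemma bpoly_prod: "finite A ==> (\<And>i. i \<in> A ==> bpoly m (f i)) ==> bpoly (card A * m) (\<lambda>t. \<Prod>i\<in>A. f i t)"
 by (induction A rule: finite_induct) (simp_all add: bpoly_const bpoly_mult)

lemma bpoly_det:
 fixes B :: "complex => complex^'n^'n"
 assumes "\<And>i j. bpoly m (\<lambda>t. B t $ i $ j)" shows "\<exists>k. bpoly k (\<lambda>t. det (B t))"
proof -
 have "bpoly (0 + CARD('n) * m) (\<lambda>t. det (B t))"
  unfolding det_def by (intro bpoly_sum bpoly_mult bpoly_const bpoly_prod assms finite)
 then show ?thesis by blast
qed

lemma bpoly_hp: "hp k p ==> bpoly k (\<lambda>t. p (x + t *s v))"
proof (induction rule: hom_poly.induct)
 case (linear l)
 show ?case using bpoly_affine[of "l x" "l v"] by (simp add: lin_simps[OF linear])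
qed (simp_all add: bpoly_const bpoly_add bpoly_mult)

lemma bpoly_coord_prod: "bpoly (length vs) (\<lambda>t. coord_prod (map (\<lambda>v. \<pi> v + t *s \<delta> v) vs) I)"
proof (induction vs arbitrary: I)
 case (Cons v vs)
 show ?case
 proof (cases I)
  case Nil
  then show ?thesis by (simp add: bpoly_const)
 next
  case (Cons i J)
  then show ?thesis using bpoly_mult[OF bpoly_affine[of "\<pi> v $ i" "\<delta> v $ i"] Cons.IH[of J]] by simp
 qed
qed (simp add: bpoly_const)

text \<open>Along a line of projections the pull-back is a polynomial curve in the space of forms.
  The bound \<open>q + k\<close>, from \<open>q\<close> vector arguments and coefficients of degree
  \<open>k\<close>, is uniform in the arguments, so finitely many \<open>F i\<close>
  suffice.\<close>

lemma pullback_line: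
 fixes \<eta> :: "'n::finite form" and \<pi> \<delta> :: "complex^'k::finite => complex^'n"
 assumes \<eta>: "hom_form q k \<eta>"
 shows "\<exists>F. \<forall>t. pullback (\<lambda>x. \<pi> x + t *s \<delta> x) \<eta> = (\<Sum>i\<le>q + k. form_scale (t ^ i) (F i))"
proof -
 have "bpoly (q + k) (\<lambda>t. pullback (\<lambda>x. \<pi> x + t *s \<delta> x) \<eta> x vs)" for x vs
 proof (cases "length vs = q")
  case True
  have "bpoly (q + k) (\<lambda>t. \<Sum>I | length I = q. coord_prod (map (\<lambda>v. \<pi> v + t *s \<delta> v) vs) I * \<eta> (\<pi> x + t *s \<delta> x) (map ax I))"
   using bpoly_coord_prod[of vs \<pi> \<delta>] True by (intro bpoly_sum bpoly_mult bpoly_hp hom_form_hp[OF \<eta>]) simp_all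
  moreover have "pullback (\<lambda>x. \<pi> x + t *s \<delta> x) \<eta> x vs =
    (\<Sum>I | length I = q. coord_prod (map (\<lambda>v. \<pi> v + t *s \<delta> v) vs) I * \<eta> (\<pi> x + t *s \<delta> x) (map ax I))" for t
   unfolding pullback_def using True by (intro multilin_expand hom_form_multilin[OF \<eta>]) simp
  ultimately show ?thesis by simp
 qed (simp add: pullback_def hom_form_length[OF \<eta>] bpoly_const)
 then have "\<forall>x vs. \<exists>P. degree P \<le> q + k \<and> (\<forall>t. pullback (\<lambda>x. \<pi> x + t *s \<delta> x) \<eta> x vs = poly P t)" unfolding bpoly_def by blast
 then obtain P where P: "\<And>x vs. degree (P x vs) \<le> q + k" "\<And>x vs t. pullback (\<lambda>x. \<pi> x + t *s \<delta> x) \<eta> x vs = poly (P x vs) t" by metis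
 have "poly (P x vs) t = (\<Sum>i\<le>q + k. t ^ i * coeff (P x vs) i)" for x vs t
  unfolding poly_altdef using P(1)[of x vs] by (intro sum.mono_neutral_cong_left) (auto simp: coeff_eq_0)
 then have "pullback (\<lambda>x. \<pi> x + t *s \<delta> x) \<eta> = (\<Sum>i\<le>q + k. form_scale (t ^ i) (\<lambda>x vs. coeff (P x vs) i))" for t
  by (intro ext) (simp add: P(2) fun_sum_apply form_scale_def)
 then show ?thesis by (intro exI[of _ "\<lambda>i x vs. coeff (P x vs) i"]) blast
qed

lemma hom_poly_curve:
 assumes "hom_poly form_scale k p"
 shows "\<exists>P. \<forall>t. p (\<Sum>i\<le>m. form_scale (t ^ i) (F i)) = poly P t"
 using assms
proof (induction rule: hom_poly.induct)
 case (const c) show ?case by (rule exI[of _ "[:c:]"]) simp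
next
 case (linear l)
 interpret l: Vector_Spaces.linear form_scale "(*)" l by fact
 show ?case by (rule exI[of _ "\<Sum>i\<le>m. monom (l (F i)) i"]) (simp add: l.sum l.scale poly_sum poly_monom mult.commute)
next
 case (add k p q)
 then obtain P Q where "\<forall>t. p (\<Sum>i\<le>m. form_scale (t ^ i) (F i)) = poly P t" "\<forall>t. q (\<Sum>i\<le>m. form_scale (t ^ i) (F i)) = poly Q t" by blast
 then show ?case by (intro exI[of _ "P + Q"]) simp
next
 case (mult j p k q)
 then obtain P Q where "\<forall>t. p (\<Sum>i\<le>m. form_scale (t ^ i) (F i)) = poly P t" "\<forall>t. q (\<Sum>i\<le>m. form_scale (t ^ i) (F i)) = poly Q t" by blast
 then show ?case by (intro exI[of _ "P * Q"]) simp
qed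

lemma pullback_linear: "Vector_Spaces.linear form_scale form_scale (pullback \<pi>)"
 by unfold_locales (auto simp: pullback_def form_scale_def fun_eq_iff algebra_simps)

lemma hp_on_pullback: "hom_poly form_scale k p ==> hp_on W k (\<lambda>\<eta>. p (pullback \<pi> \<eta>))"
 using hom_poly_compose[OF _ pullback_linear, of k p \<pi>] unfolding hp_on_def by blast

definition pullbacks :: "nat => nat => 'n::finite form set set => 'k::finite form set set" where
 "pullbacks q d C = {fpt (pullback \<pi> \<eta>) | \<pi> \<eta>. lmap \<pi> \<and> surj \<pi> \<and> folform q d \<eta> \<and> fpt \<eta> \<in> C}"

text \<open>Irreducibility of \<open>C\<close> first gives one member \<zeta> good for both
  projections; then the line joining the projections is left with all but finitely many parameters
  at which surjectivity and both polynomial conditions hold.\<close>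

lemma pullbacks_irreducible:
 fixes C :: "'n::finite form set set"
 assumes q: "1 \<le> q" and card: "CARD('n) \<ge> 2" "CARD('k::finite) \<ge> 2"
  and C: "irreducible_set (foliation_space q d) C" and ex: "\<exists>\<pi> :: complex^'k => complex^'n. lmap \<pi> \<and> surj \<pi>"
 shows "irreducible_set (foliation_space q d) (pullbacks q d C :: 'k form set set)"
proof (rule irreducible_setI_poly[OF q card(2)])
 have CX: "C \<subseteq> foliations q d" using C topspace_fol[OF q card(1)] unfolding irreducible_set_def by blast
 have fp: "folform q d (pullback \<pi> \<eta>)" if *: "lmap \<pi>" "surj \<pi>" "folform q d \<eta>" for \<pi> :: "complex^'k => complex^'n" and \<eta>
 proof -
  obtain \<iota> where "lmap \<iota>" "\<forall>x. \<pi> (\<iota> x) = x" using linear_section[OF *(1,2)] .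
  then show ?thesis using folform_pullback[OF *(3,1), of \<iota>] by blast
 qed
 show "(pullbacks q d C :: 'k form set set) \<subseteq> foliations q d"
  unfolding pullbacks_def using fp fol_iff[OF q card(2)] by blast
 obtain g where "g \<in> C" using C unfolding irreducible_set_def by blast
 then obtain \<eta> where "folform q d \<eta>" "fpt \<eta> \<in> C" using CX fol_iff[OF q card(1), of g] by blast
 then show "(pullbacks q d C :: 'k form set set) \<noteq> {}" unfolding pullbacks_def using ex by blast
 fix k l and p p' :: "'k form => complex" and \<omega> \<omega>'
 assume p: "hom_poly form_scale k p" "hom_poly form_scale l p'" and \<omega>: "folform q d \<omega>" "folform q d \<omega>'"
  "fpt \<omega> \<in> pullbacks q d C" "fpt \<omega>' \<in> pullbacks q d C" "p \<omega> \<noteq> 0" "p' \<omega>' \<noteq> 0"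
 obtain \<pi> \<eta> where \<pi>: "fpt \<omega> = fpt (pullback \<pi> \<eta>)" "lmap \<pi>" "surj \<pi>" "folform q d \<eta>" "fpt \<eta> \<in> C"
  using \<omega>(3) unfolding pullbacks_def by blast
 obtain \<pi>' \<eta>' where \<pi>': "fpt \<omega>' = fpt (pullback \<pi>' \<eta>')" "lmap \<pi>'" "surj \<pi>'" "folform q d \<eta>'" "fpt \<eta>' \<in> C"
  using \<omega>(4) unfolding pullbacks_def by blast
 have "p (pullback \<pi> \<eta>) \<noteq> 0" using hom_poly_fpt[OF p(1), of \<omega> "pullback \<pi> \<eta>"] fpt_self[of \<omega>] \<pi>(1) \<omega>(5) by blast
 moreover have "p' (pullback \<pi>' \<eta>') \<noteq> 0" using hom_poly_fpt[OF p(2), of \<omega>' "pullback \<pi>' \<eta>'"] fpt_self[of \<omega>'] \<pi>'(1) \<omega>(6) by blast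
 ultimately obtain \<zeta> where \<zeta>: "folform q d \<zeta>" "fpt \<zeta> \<in> C" "p (pullback \<pi> \<zeta>) \<noteq> 0" "p' (pullback \<pi>' \<zeta>) \<noteq> 0"
  using irreducible_meet[OF q card(1) C hp_on_pullback[OF p(1)] hp_on_pullback[OF p(2)] \<pi>(4,5) _ \<pi>'(4,5)] by blast
 let ?\<delta> = "\<lambda>x. \<pi>' x - \<pi> x" and ?\<pi> = "\<lambda>t x. \<pi> x + t *s (\<pi>' x - \<pi> x)"
 have hom: "hom_form q (Suc d) \<zeta>" using \<zeta>(1) by (intro twisted_hom_form) (simp add: folform_def)
 obtain F where F: "\<forall>t. pullback (?\<pi> t) \<zeta> = (\<Sum>i\<le>q + Suc d. form_scale (t ^ i) (F i))"
  using pullback_line[OF hom, of \<pi> ?\<delta>] by blast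
 obtain P where P: "\<forall>t. p (\<Sum>i\<le>q + Suc d. form_scale (t ^ i) (F i)) = poly P t" using hom_poly_curve[OF p(1)] by blast
 obtain P' where P': "\<forall>t. p' (\<Sum>i\<le>q + Suc d. form_scale (t ^ i) (F i)) = poly P' t" using hom_poly_curve[OF p(2)] by blast
 obtain \<iota> where \<iota>: "lmap \<iota>" "\<forall>x. \<pi> (\<iota> x) = x" using linear_section[OF \<pi>(2,3)] .
 \<comment> \<open>Surjectivity along the line is controlled by the matrix on a section of \<pi>,
   which is the identity at \<open>t = 0\<close>.\<close>
 define B where "B t = (\<chi> i j. ?\<pi> t (\<iota> (ax j)) $ i)" for t
 have "bpoly 1 (\<lambda>t. B t $ i $ j)" for i j
  unfolding B_def vec_lambda_beta vector_add_component vector_smult_component by (rule bpoly_affine)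
 from bpoly_det[of _ B, OF this] obtain R where R: "\<forall>t. det (B t) = poly R t" unfolding bpoly_def by blast
 have "B 0 = mat 1" using \<iota>(2) by (simp add: B_def vec_eq_iff mat_def axis_def)
 then have "poly R 0 \<noteq> 0" using R by (metis det_I zero_neq_one)
 moreover have "poly P 0 \<noteq> 0"
 proof -
  have "?\<pi> 0 = \<pi>" by simp
  then show ?thesis using \<zeta>(3) spec[OF P, of 0] spec[OF F, of 0] by simp
 qed
 moreover have "poly P' 1 \<noteq> 0"
 proof -
  have "?\<pi> 1 = \<pi>'" by simp
  then show ?thesis using \<zeta>(4) spec[OF P', of 1] spec[OF F, of 1] by simp
 qed
 ultimately have "R * P * P' \<noteq> 0" by auto
 then obtain t where "poly (R * P * P') t \<noteq> 0" using poly_all_0_iff_0 by blast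
 then have t: "poly R t \<noteq> 0" "poly P t \<noteq> 0" "poly P' t \<noteq> 0" by auto
 define \<rho> where "\<rho> = ?\<pi> t"
 have lm: "lmap \<rho>" unfolding \<rho>_def
  by (rule lmapI) (simp_all add: lmap_simps[OF \<pi>(2)] lmap_simps[OF \<pi>'(2)] vec_eq_iff algebra_simps)
 have sj: "surj \<rho>"
 proof -
  have Bt: "B t = (\<chi> i j. \<rho> (\<iota> (ax j)) $ i)" unfolding B_def \<rho>_def ..
  have Bv: "B t *v u = \<rho> (\<iota> u)" for u
  proof -
   have e: "\<rho> (\<iota> u) = (\<Sum>j\<in>UNIV. u $ j *s \<rho> (\<iota> (ax j)))"
    by (subst basis_expansion[symmetric, of u]) (simp only: lmap_simps[OF \<iota>(1)] lmap_simps[OF lm])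
   show ?thesis unfolding e Bt by (simp add: vec_eq_iff matrix_vector_mult_def mult.commute)
  qed
  have "invertible (B t)" using R t(1) invertible_det_nz by metis
  then obtain A where A: "B t ** A = mat 1" unfolding invertible_def by blast
  have "\<rho> (\<iota> (A *v u)) = u" for u unfolding Bv[symmetric] by (simp add: matrix_vector_mul_assoc A)
  then show ?thesis by (rule surjI)
 qed
 have "p (pullback \<rho> \<zeta>) \<noteq> 0" "p' (pullback \<rho> \<zeta>) \<noteq> 0" using F P P' t unfolding \<rho>_def by simp_all
 moreover have "fpt (pullback \<rho> \<zeta>) \<in> (pullbacks q d C :: 'k form set set)" unfolding pullbacks_def using lm sj \<zeta>(1,2) by blast
 ultimately show "\<exists>\<eta>. folform q d \<eta> \<and> fpt \<eta> \<in> pullbacks q d C \<and> p \<eta> \<noteq> 0 \<and> p' \<eta> \<noteq> 0"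
  using fp[OF lm sj \<zeta>(1)] by blast
qed

section \<open>Stability of linear pull-backs\<close>

lemma projection_open_nbhd:
 assumes P: "openin (linear_projections :: (complex^'k::finite => complex^'n::finite) set topology) P" "P \<noteq> {}"
 obtains \<pi> j p where "lmap \<pi>" "surj \<pi>" "hom_poly map_scale j p" "p \<pi> \<noteq> 0"
  "\<forall>\<rho>. lmap \<rho> --> surj \<rho> --> p \<rho> \<noteq> 0 --> proj_point map_scale \<rho> \<in> P"
proof -
 let ?S = "proj_point map_scale ` {\<pi> :: complex^'k => complex^'n. lmap \<pi> \<and> surj \<pi>}"
 obtain V where V: "openin (proj_zariski map_scale {\<pi> :: complex^'k => complex^'n. lmap \<pi>}) V" "P = V \<inter> ?S"
  using P(1) unfolding linear_projections_def openin_subtopology by blast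
 obtain \<pi> where \<pi>: "lmap \<pi>" "surj \<pi>" "proj_point map_scale \<pi> \<in> V" using P(2) V(2) by blast
 obtain j p where p: "hom_poly map_scale j p" "p \<pi> \<noteq> 0"
  "\<forall>\<rho>\<in>{\<pi>. lmap \<pi>}. \<rho> \<noteq> 0 --> p \<rho> \<noteq> 0 --> proj_point map_scale \<rho> \<in> V"
  using proj_open_nbhd[OF vector_space_map_scale V(1) \<pi>(3)] by blast
 have "proj_point map_scale \<rho> \<in> P" if \<rho>: "lmap \<rho>" "surj \<rho>" "p \<rho> \<noteq> 0" for \<rho> :: "complex^'k => complex^'n"
 proof -
  obtain i :: 'n where True by blast
  obtain x where "\<rho> x = ax i" using \<rho>(2) by (metis surjD)
  then have "\<rho> \<noteq> 0" by (auto simp: axis_eq_0_iff)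
  then show ?thesis using p(3) \<rho> unfolding V(2) by blast
 qed
 then show thesis using that[OF \<pi>(1,2) p(1,2)] by blast
qed

text \<open>One section \<iota> serves all members of \<open>C'\<close>: where \<Delta> is non-zero,
  restriction along \<iota> inverts pull-back. As \<pi> is taken from \<open>P\<close>, the
  condition that puts \<open>\<rho> \<omega>\<close> into \<open>P\<close> holds at
  \<open>\<omega>\<^sub>0\<close>, so it cuts out a non-empty open subset of
  \<open>C'\<close>.\<close>

theorem stable_pullback:
 fixes C :: "'n::finite form set set"
 assumes q: "1 \<le> q" "q < CARD('n)" and dl: "dlen q \<le> CARD('n)" and card: "CARD('n) \<ge> 3" "CARD('k::finite) \<ge> 2"
  and C: "irreducible_component (foliation_space q d) C"
  and C': "irreducible_component (foliation_space q d) (C' :: 'k form set set)" "pullbacks q d C \<subseteq> C'"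
  and gen: "generic_in (foliation_space q d) C (\<lambda>g. \<forall>\<omega>\<in>g.
     split_tangent_sheaf q \<omega> \<and>
     (if q = 1 then codim (affine_zariski (*s)) (affine_sing (ext_deriv \<omega>)) \<ge> 3
      else codim projective_zariski (proj_sing \<omega>) \<ge> 3))"
  and V: "openin (subtopology (foliation_space q d) C) V" "V \<noteq> {}"
  and P: "openin linear_projections P" "P \<noteq> {}"
 shows "generic_in (foliation_space q d) C' (\<lambda>g. \<exists>\<omega> \<pi>.
        proj_point form_scale \<omega> \<in> V \<and> proj_point map_scale \<pi> \<in> P \<and>
        g = proj_point form_scale (pullback \<pi> \<omega>))"
proof -
 have card2: "CARD('n) \<ge> 2" using card(1) by simp
 let ?W = "twisted_forms q d :: 'k form set"
 have Cirr: "irreducible_set (foliation_space q d) C" and C'irr: "irreducible_set (foliation_space q d) C'"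
  using C C'(1) unfolding irreducible_component_def by blast+
 have CX: "C \<subseteq> foliations q d" using Cirr topspace_fol[OF q(1) card2] unfolding irreducible_set_def by blast
 have C'X: "C' \<subseteq> foliations q d" using C'irr topspace_fol[OF q(1) card(2)] unfolding irreducible_set_def by blast
 obtain U where U: "openin (subtopology (foliation_space q d) C) U" "U \<noteq> {}" "\<forall>g\<in>U. \<forall>\<omega>\<in>g.
     split_tangent_sheaf q \<omega> \<and>
     (if q = 1 then codim (affine_zariski (*s)) (affine_sing (ext_deriv \<omega>)) \<ge> 3
      else codim projective_zariski (proj_sing \<omega>) \<ge> 3)" using gen unfolding generic_in_def by blast
 obtain g where g: "g \<in> U" "g \<in> C" using U(1,2) openin_subset[OF U(1)] by auto
 obtain \<omega>\<^sub>G where G: "folform q d \<omega>\<^sub>G" "g = fpt \<omega>\<^sub>G" using g(2) CX fol_iff[OF q(1) card2, of g] by blast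
 have Gp: "split_tangent_sheaf q \<omega>\<^sub>G" "if q = 1 then codim (affine_zariski (*s)) (affine_sing (ext_deriv \<omega>\<^sub>G)) \<ge> 3
      else codim projective_zariski (proj_sing \<omega>\<^sub>G) \<ge> 3" using U(3) g(1) G(2) fpt_self[of \<omega>\<^sub>G] by blast+
 obtain X where X: "kernel_generators (dlen q) (dform q \<omega>\<^sub>G) (CARD('n) - dlen q) X"
  using dform_generators(2)[OF G(1) q card(1) Gp] by blast
 obtain \<pi> j p where \<pi>: "lmap \<pi>" "surj \<pi>" and p: "hom_poly map_scale j p" "p \<pi> \<noteq> 0"
  "\<forall>\<rho>. lmap \<rho> --> surj \<rho> --> p \<rho> \<noteq> 0 --> proj_point map_scale \<rho> \<in> P"
  by (rule projection_open_nbhd[OF P]) (rule that)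
 obtain \<iota> where \<iota>: "lmap \<iota>" "\<forall>x. \<pi> (\<iota> x) = x" using linear_section[OF \<pi>] .
 interpret R: rigid q d "CARD('n) - dlen q" \<omega>\<^sub>G X \<pi> \<iota>
  by (rule rigid.intro[OF q(1) card2 G(1) X _ dform_generators(1)[OF G(1) q card(1) Gp] \<pi>(1) \<iota>(1)]) (use dl \<iota>(2) in simp_all)
 obtain \<Delta> m \<rho> where \<Delta>: "hp_on ?W m \<Delta>" "\<Delta> R.\<omega>\<^sub>0 \<noteq> 0" "\<rho> R.\<omega>\<^sub>0 = \<pi>"
  "\<forall>\<omega>\<in>?W. \<Delta> \<omega> \<noteq> 0 --> lmap (\<rho> \<omega>) \<and> (\<forall>u. \<rho> \<omega> (\<iota> u) = u)"
  "\<forall>\<omega>. folform q d \<omega> --> \<Delta> \<omega> \<noteq> 0 --> \<omega> = pullback (\<rho> \<omega>) (pullback \<iota> \<omega>)"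
  "\<forall>j P. hom_poly map_scale j P --> (\<exists>F m. hp_on ?W m F \<and> (\<forall>\<omega>\<in>?W. \<Delta> \<omega> \<noteq> 0 --> (F \<omega> = 0 \<longleftrightarrow> P (\<rho> \<omega>) = 0)))"
  using R.rigid_neighbourhood by (elim exE conjE) (rule that)
 obtain F l where F: "hp_on ?W l F" "\<forall>\<omega>\<in>?W. \<Delta> \<omega> \<noteq> 0 --> (F \<omega> = 0 \<longleftrightarrow> p (\<rho> \<omega>) = 0)" using \<Delta>(6) p(1) by blast
 have fW: "folform q d \<omega> ==> \<omega> \<in> ?W" for \<omega> :: "'k form" by (simp add: folform_def)
 have pb: "folform q d (pullback \<pi> \<eta>)" if "folform q d \<eta>" for \<eta>
  using folform_pullback[OF that \<pi>(1), of \<iota>] \<iota>(2) by blast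
 have pbC': "fpt (pullback \<pi> \<eta>) \<in> C'" if "folform q d \<eta>" "fpt \<eta> \<in> C" for \<eta>
  using that \<pi> C'(2) unfolding pullbacks_def by blast
 have \<iota>\<pi>: "pullback \<iota> (pullback \<pi> \<eta>) = \<eta>" for \<eta> :: "'n form" using \<iota>(2) by (simp add: pullback_def o_def)
 have res: "folform q d (pullback \<iota> \<omega>)" if "folform q d \<omega>" "\<Delta> \<omega> \<noteq> 0" for \<omega>
  using folform_restrict[OF that(1) _ \<iota>(1), of "\<rho> \<omega>"] \<Delta>(4,5) that fW[OF that(1)] by blast
 have \<omega>\<^sub>0: "R.\<omega>\<^sub>0 = pullback \<pi> \<omega>\<^sub>G" by (rule R.\<omega>\<^sub>0_def)

 \<comment> \<open>The restrictions of the members of \<open>C'\<close> with \<Delta> non-zero. They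
   lie in \<open>C\<close> because the union with \<open>C\<close> is irreducible and
   \<open>C\<close> is maximal.\<close>
 let ?T = "{fpt (pullback \<iota> \<omega>) | \<omega>. folform q d \<omega> \<and> fpt \<omega> \<in> C' \<and> \<Delta> \<omega> \<noteq> 0}"
 \<comment> \<open>For a member of \<open>C\<close>, irreducibility of \<open>C\<close> passes to
   one whose pull-back by \<pi> has \<Delta> non-zero; that pull-back lies in \<open>C'\<close> and
   restricts to the given member of \<open>C\<close>.\<close>
 have meetT: "\<exists>\<omega>. folform q d \<omega> \<and> fpt \<omega> \<in> C' \<and> \<Delta> \<omega> \<noteq> 0 \<and> f (pullback \<iota> \<omega>) \<noteq> 0"
  if f: "hom_poly form_scale a f" "folform q d \<eta>" "fpt \<eta> \<in> C \<union> ?T" "f \<eta> \<noteq> 0" for a f \<eta>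
 proof (cases "fpt \<eta> \<in> C")
  case True
  have "\<Delta> (pullback \<pi> \<omega>\<^sub>G) \<noteq> 0" using \<Delta>(2) \<omega>\<^sub>0 by simp
  from hp_onE[OF \<Delta>(1)] obtain \<Delta>' where \<Delta>': "hom_poly form_scale m \<Delta>'" "\<forall>\<omega>\<in>?W. \<Delta> \<omega> = \<Delta>' \<omega>" .
  have 1: "hp_on (twisted_forms q d) a f" unfolding hp_on_def using f(1) by blast
  have 2: "\<Delta>' (pullback \<pi> \<omega>\<^sub>G) \<noteq> 0" using \<Delta>(2) \<omega>\<^sub>0 \<Delta>'(2) fW[OF pb[OF G(1)]] by simp
  have "fpt \<omega>\<^sub>G \<in> C" using g(2) G(2) by simp
  then obtain \<zeta> where \<zeta>: "folform q d \<zeta>" "fpt \<zeta> \<in> C" "f \<zeta> \<noteq> 0" "\<Delta>' (pullback \<pi> \<zeta>) \<noteq> 0"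
   using irreducible_meet[OF q(1) card2 Cirr 1 hp_on_pullback[OF \<Delta>'(1)] f(2) True f(4) G(1) _ 2] by blast
  have "\<Delta> (pullback \<pi> \<zeta>) \<noteq> 0" using \<zeta>(4) \<Delta>'(2) fW[OF pb[OF \<zeta>(1)]] by simp
  then show ?thesis using pb[OF \<zeta>(1)] pbC'[OF \<zeta>(1,2)] \<zeta>(3) \<iota>\<pi> by metis
 next
  case False
  then obtain \<omega> where \<omega>: "fpt \<eta> = fpt (pullback \<iota> \<omega>)" "folform q d \<omega>" "fpt \<omega> \<in> C'" "\<Delta> \<omega> \<noteq> 0" using f(3) by blast
  have "f (pullback \<iota> \<omega>) \<noteq> 0" using hom_poly_fpt[OF f(1), of \<eta> "pullback \<iota> \<omega>"] fpt_self[of \<eta>] \<omega>(1) f(4) by blast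
  then show ?thesis using \<omega> by blast
 qed
 have "irreducible_set (foliation_space q d) (C \<union> ?T)"
 proof (rule irreducible_setI_poly[OF q(1) card2])
  show "C \<union> ?T \<subseteq> foliations q d" using CX res fol_iff[OF q(1) card2] by blast
  show "C \<union> ?T \<noteq> {}" using g(2) by blast
  fix a b and f f' :: "'n form => complex" and \<eta> \<eta>'
  assume f: "hom_poly form_scale a f" "hom_poly form_scale b f'" and \<eta>: "folform q d \<eta>" "folform q d \<eta>'"
   "fpt \<eta> \<in> C \<union> ?T" "fpt \<eta>' \<in> C \<union> ?T" "f \<eta> \<noteq> 0" "f' \<eta>' \<noteq> 0"
  obtain \<omega> where \<omega>: "folform q d \<omega>" "fpt \<omega> \<in> C'" "\<Delta> \<omega> \<noteq> 0" "f (pullback \<iota> \<omega>) \<noteq> 0"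
   using meetT[OF f(1) \<eta>(1,3,5)] by blast
  obtain \<omega>' where \<omega>': "folform q d \<omega>'" "fpt \<omega>' \<in> C'" "\<Delta> \<omega>' \<noteq> 0" "f' (pullback \<iota> \<omega>') \<noteq> 0"
   using meetT[OF f(2) \<eta>(2,4,6)] by blast
  have nz: "\<Delta> \<omega> * f (pullback \<iota> \<omega>) \<noteq> 0" "f' (pullback \<iota> \<omega>') \<noteq> 0" using \<omega>(3,4) \<omega>'(4) by simp_all
  obtain \<zeta> where \<zeta>: "folform q d \<zeta>" "fpt \<zeta> \<in> C'" "\<Delta> \<zeta> * f (pullback \<iota> \<zeta>) \<noteq> 0" "f' (pullback \<iota> \<zeta>) \<noteq> 0"
   using irreducible_meet[OF q(1) card(2) C'irr hp_on_mult[OF \<Delta>(1) hp_on_pullback[OF f(1)]] hp_on_pullback[OF f(2)]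
     \<omega>(1,2) nz(1) \<omega>'(1,2) nz(2)] by blast
  have "\<Delta> \<zeta> \<noteq> 0" "f (pullback \<iota> \<zeta>) \<noteq> 0" using \<zeta>(3) by auto
  then show "\<exists>\<eta>. folform q d \<eta> \<and> fpt \<eta> \<in> C \<union> ?T \<and> f \<eta> \<noteq> 0 \<and> f' \<eta> \<noteq> 0"
   using \<zeta>(1,2,4) res[OF \<zeta>(1)] by (intro exI[of _ "pullback \<iota> \<zeta>"]) blast
 qed
 then have "C \<union> ?T = C" using C unfolding irreducible_component_def by blast
 then have resC: "fpt (pullback \<iota> \<omega>) \<in> C" if "folform q d \<omega>" "fpt \<omega> \<in> C'" "\<Delta> \<omega> \<noteq> 0" for \<omega> using that by blast

 obtain V' where V': "openin (foliation_space q d) V'" "V = V' \<inter> C" using V(1) unfolding openin_subtopology by blast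
 obtain h where h: "h \<in> V'" "h \<in> C" using V(2) V'(2) by blast
 obtain \<eta>\<^sub>1 where \<eta>\<^sub>1: "folform q d \<eta>\<^sub>1" "h = fpt \<eta>\<^sub>1" using h(2) CX fol_iff[OF q(1) card2, of h] by blast
 have "fpt \<eta>\<^sub>1 \<in> V'" using h(1) \<eta>\<^sub>1(2) by simp
 then obtain b f where f: "hom_poly form_scale b f" "f \<eta>\<^sub>1 \<noteq> 0" "\<forall>\<eta>. folform q d \<eta> --> f \<eta> \<noteq> 0 --> fpt \<eta> \<in> V'"
  using open_nbhd[OF q(1) card2 V'(1)] by blast
 \<comment> \<open>The three factors secure in turn the neighbourhood, a projection in
   \<open>P\<close> and a restriction in \<open>V\<close>.\<close>
 let ?F = "\<lambda>\<omega>. \<Delta> \<omega> * F \<omega> * f (pullback \<iota> \<omega>)"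
 have hF: "hp_on ?W (m + l + b) ?F" by (intro hp_on_mult \<Delta>(1) F(1) hp_on_pullback f(1))
 let ?O = "{fpt \<omega> | \<omega>. folform q d \<omega> \<and> ?F \<omega> \<noteq> 0}"
 have "F R.\<omega>\<^sub>0 \<noteq> 0" using F(2) \<Delta>(2,3) p(2) R.\<omega>\<^sub>0W by simp
 then have nz: "\<Delta> (pullback \<pi> \<omega>\<^sub>G) * F (pullback \<pi> \<omega>\<^sub>G) \<noteq> 0" using \<Delta>(2) \<omega>\<^sub>0 by simp
 have "f (pullback \<iota> (pullback \<pi> \<eta>\<^sub>1)) \<noteq> 0" using f(2) \<iota>\<pi> by simp
 moreover have "fpt \<omega>\<^sub>G \<in> C" "fpt \<eta>\<^sub>1 \<in> C" using g(2) G(2) h(2) \<eta>\<^sub>1(2) by simp_all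
 ultimately have "\<exists>\<omega>. folform q d \<omega> \<and> fpt \<omega> \<in> C' \<and> \<Delta> \<omega> * F \<omega> \<noteq> 0 \<and> f (pullback \<iota> \<omega>) \<noteq> 0"
  using irreducible_meet[OF q(1) card(2) C'irr hp_on_mult[OF \<Delta>(1) F(1)] hp_on_pullback[OF f(1), of _ \<iota>]
    pb[OF G(1)] pbC'[OF G(1)] nz pb[OF \<eta>\<^sub>1(1)] pbC'[OF \<eta>\<^sub>1(1)]] by blast
 then have ne: "?O \<inter> C' \<noteq> {}" by auto
 have "openin (subtopology (foliation_space q d) C') (?O \<inter> C')"
  using open_poly[OF q(1) card(2) hF] unfolding openin_subtopology by blast
 moreover have "\<exists>\<omega> \<pi>. fpt \<omega> \<in> V \<and> proj_point map_scale \<pi> \<in> P \<and> u = fpt (pullback \<pi> \<omega>)" if u: "u \<in> ?O \<inter> C'" for u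
 proof -
  from u obtain \<omega> where \<omega>: "u = fpt \<omega>" "folform q d \<omega>" "?F \<omega> \<noteq> 0" by blast
  then have nz: "\<Delta> \<omega> \<noteq> 0" "F \<omega> \<noteq> 0" "f (pullback \<iota> \<omega>) \<noteq> 0" by auto
  have \<rho>: "lmap (\<rho> \<omega>)" "\<forall>u. \<rho> \<omega> (\<iota> u) = u" using \<Delta>(4) fW[OF \<omega>(2)] nz(1) by blast+
  have "surj (\<rho> \<omega>)" using \<rho>(2) by (intro surjI) blast
  moreover have "p (\<rho> \<omega>) \<noteq> 0" using F(2) fW[OF \<omega>(2)] nz(1,2) by blast
  ultimately have 1: "proj_point map_scale (\<rho> \<omega>) \<in> P" using p(3) \<rho>(1) by blast
  have "fpt \<omega> \<in> C'" using u unfolding \<omega>(1) by (rule IntD2)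
  then have "fpt (pullback \<iota> \<omega>) \<in> C" using resC \<omega>(2) nz(1) by blast
  moreover have "fpt (pullback \<iota> \<omega>) \<in> V'" using f(3) res[OF \<omega>(2) nz(1)] nz(3) by blast
  ultimately have 2: "fpt (pullback \<iota> \<omega>) \<in> V" using V'(2) by blast
  have eq: "\<omega> = pullback (\<rho> \<omega>) (pullback \<iota> \<omega>)" using \<Delta>(5) \<omega>(2) nz(1) by blast
  have "u = fpt (pullback (\<rho> \<omega>) (pullback \<iota> \<omega>))" unfolding \<omega>(1) by (rule arg_cong[OF eq, of fpt])
  then show ?thesis using 1 2 by blast
 qed
 ultimately show ?thesis using ne unfolding generic_in_def by blast
qed

lemma coordinate_projection:
 assumes "CARD('n::finite) \<le> CARD('k::finite)"
 shows "\<exists>\<pi> :: complex^'k => complex^'n. lmap \<pi> \<and> surj \<pi>"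
proof -
 obtain f :: "'n => 'k" where f: "inj f" using card_le_inj[of "UNIV :: 'n set" "UNIV :: 'k set"] assms by auto
 let ?\<pi> = "\<lambda>x :: complex^'k. \<chi> i. x $ f i"
 have "lmap ?\<pi>" by (rule lmapI) (simp_all add: vec_eq_iff)
 have "?\<pi> (\<chi> j. y $ inv f j) = y" for y :: "complex^'n" using f by (simp add: vec_eq_iff)
 then have "surj ?\<pi>" by (rule surjI[of ?\<pi> "\<lambda>y. \<chi> j. y $ inv f j"])
 with \<open>lmap ?\<pi>\<close> show ?thesis by blast
qed

theorem corollary5p1:
  fixes n q d m :: nat
    and C :: "'n::finite form set set"
  assumes "CARD('n) = n + 1"
    and "CARD('k::finite) = n + m + 1"
    and "1 \<le> q" and "q \<le> n - 1"
    and "q = 1 \<Longrightarrow> n \<ge> 3" and "q \<ge> 2 \<Longrightarrow> n \<ge> 4"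
    and "m \<ge> 1"
    and "irreducible_component (foliation_space q d) C"
    and "generic_in (foliation_space q d) C (\<lambda>g. \<forall>\<omega>\<in>g.
           split_tangent_sheaf q \<omega> \<and>
           (if q = 1 then codim (affine_zariski (*s)) (affine_sing (ext_deriv \<omega>)) \<ge> 3
            else codim projective_zariski (proj_sing \<omega>) \<ge> 3))"
  shows "\<exists>C' :: 'k form set set. irreducible_component (foliation_space q d) C' \<and>
           (\<forall>V P. openin (subtopology (foliation_space q d) C) V \<and> V \<noteq> {} \<and>
                  openin linear_projections P \<and> P \<noteq> {} \<longrightarrow>
              generic_in (foliation_space q d) C' (\<lambda>g. \<exists>\<omega> \<pi>.
                proj_point form_scale \<omega> \<in> V \<and> proj_point map_scale \<pi> \<in> P \<and>
                g = proj_point form_scale (pullback \<pi> \<omega>)))"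
proof -
  have n: "n \<ge> 2" using assms(3-6) by linarith
  have card: "CARD('n) \<ge> 3" "CARD('k) \<ge> 2" "CARD('n) \<ge> 2" "q < CARD('n)" "dlen q \<le> CARD('n)" "CARD('n) \<le> CARD('k)"
    using n assms(1-4) by (auto simp: dlen_def)
  have "irreducible_set (foliation_space q d) C" using assms(8) unfolding irreducible_component_def by blast
  then have "irreducible_set (foliation_space q d) (pullbacks q d C :: 'k form set set)"
    by (rule pullbacks_irreducible[OF assms(3) card(3,2) _ coordinate_projection[OF card(6)]])
  \<comment> \<open>The component is fixed before \<open>V\<close> and \<open>P\<close>, so the same
    one serves all open sets.\<close>
  then obtain C' :: "'k form set set" where C': "irreducible_component (foliation_space q d) C'" "pullbacks q d C \<subseteq> C'"
    using irreducible_component_exists by blast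
  show ?thesis
    using stable_pullback[OF assms(3) card(4,5,1,2) assms(8) C' assms(9)] C'(1) by blast
qed

end
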